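(* Assume that the Cartan superdatum satisfies the following parity condition: for every $i\in I$, the integer $d_i$ is odd if and only if $i\in I_{\rm odd}$. Set $v=q\sqrt\pi$. Then there are equivalences of categories $$\mathrm{Mod}^{\mathrm P}\bigl(\mathbb Q[\sqrt\pi]\otimes_{\mathbb Q[\pi]}\mathcal U(\mathfrak g)\bigr)\simeq\mathrm{Mod}^{\mathrm P}(\mathbf U(\mathfrak g))\simeq\mathrm{Mod}^{\mathrm P}\bigl(\mathbb Q[\sqrt\pi]\otimes_{\mathbb Q}\mathsf U_v(\mathfrak g)\bigr),$$ $$\mathcal O^{\mathrm P}_{\rm int}\bigl(\mathbb Q[\sqrt\pi]\otimes_{\mathbb Q[\pi]}\mathcal U(\mathfrak g)\bigr)\simeq\mathcal O^{\mathrm P}_{\rm int}(\mathbf U(\mathfrak g))\simeq\mathcal O^{\mathrm P}_{\rm int}\bigl(\mathbb Q[\sqrt\pi]\otimes_{\mathbb Q}\mathsf U_v(\mathfrak g)\bigr),$$ where $\mathsf U_v(\mathfrak g)$ is the usual quantum Kac–Moody algebra with parameter $v$.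
   Context: **Cartan superdatum.** $I$ is an index set; $\mathsf A=(a_{ij})_{i,j\in I}$ is a symmetrizable Cartan matrix: integers with $a_{ii}=2$, $a_{ij}\le0$ for $i\ne j$, $a_{ij}=0$ if $a_{ji}=0$, and fixed positive integers $d_i$ with $d_ia_{ij}=d_ja_{ji}$. $\mathrm P$ is a free abelian group, $\{\alpha_i\}\subset\mathrm P$ is linearly independent, $\{h_i\}\subset\mathrm{Hom}(\mathrm P,\mathbb Z)$, $\langle h_i,\alpha_j\rangle=a_{ij}$; $\mathrm Q^+=\sum\mathbb Z_{\ge0}\alpha_i$. $I=I_{\rm even}\sqcup I_{\rm odd}$ with $a_{ij}\in2\mathbb Z$ for $i\in I_{\rm odd}$, $j\in I$; $\mathrm p(i)=0$ for $i$ even, $1$ for $i$ odd. **Scalars.** $\pi$ is an indeterminate with $\pi^2=1$, $\sqrt\pi$ one with $(\sqrt\pi)^2=\pi$; $\mathbb Q(q)^\pi=\mathbb Q(q)\otimes\mathbb Z[\pi]$, $\mathbb Q(q)^{\sqrt\pi}=\mathbb Q(q)\otimes\mathbb Z[\sqrt\pi]$. $q_i=q^{d_i}$, $\pi_i=\pi^{\mathrm p(i)}$; fix $\sqrt{\pi_i}\in\mathbb Z[\sqrt\pi]$ with $(\sqrt{\pi_i})^2=\pi_i$. With $v=q\sqrt\pi$ one has $\mathbb Q[\sqrt\pi]\otimes_{\mathbb Q}\mathbb Q(v)=\mathbb Q(q)^{\sqrt\pi}$, so all three algebras in the claim are $\mathbb Q(q)^{\sqrt\pi}$-algebras. **$\mathcal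 U(\mathfrak g)$.** The $\mathbb Q(q)^\pi$-algebra generated by $e_i,f_i,\tilde K_i^{\pm1}$ with relations $\tilde K_i\tilde K_j=\tilde K_j\tilde K_i$, $\tilde K_ie_j\tilde K_i^{-1}=q_i^{2a_{ij}}e_j$, $\tilde K_if_j\tilde K_i^{-1}=q_i^{-2a_{ij}}f_j$, $e_if_j-\pi^{\mathrm p(i)\mathrm p(j)}q_i^{-a_{ij}}f_je_i=\delta_{ij}\frac{1-\tilde K_i}{1-q_i^2\pi_i}$, and for $i\ne j$: $\sum_{k=0}^{1-a_{ij}}(-\pi^{\mathrm p(i)\mathrm p(j)})^k\pi_i^{k(k-1)/2}f_i^{\{1-a_{ij}-k\}}f_jf_i^{\{k\}}=0$ and the same with all $f$ replaced by $e$, where $x^{\{n\}}=x^n/\prod_{k=1}^n\frac{(\pi_iq_i)^k-q_i^{-k}}{\pi_iq_i-q_i^{-1}}$ for $x=e_i,f_i$. **$\mathbf U(\mathfrak g)$.** Put $p_i=q_i\sqrt{\pi_i}$, $\theta_{ij}=\sqrt{\pi_j}^{\,a_{ji}}$ ($i\ne j$), $\theta_{ii}=1$. $\mathbf U(\mathfrak g)$ is the $\mathbb Q(q)^{\sqrt\pi}$-algebra generated by $e_i,f_i,K_i^{\pm1}$ with relations $K_iK_j=K_jK_i$, $K_ie_jK_i^{-1}=p_i^{a_{ij}}e_j$, $K_if_jK_i^{-1}=p_i^{-a_{ij}}f_j$, $e_if_j-\theta_{ji}f_je_i=\delta_{ij}\frac{K_i-K_i^{-1}}{p_i-p_i^{-1}}$,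 and for $i\ne j$: $\sum_{k=0}^{1-a_{ij}}(-\theta_{ji})^kf_i^{(1-a_{ij}-k)}f_jf_i^{(k)}=0$, $\sum_{k=0}^{1-a_{ij}}(-\theta_{ij})^ke_i^{(1-a_{ij}-k)}e_je_i^{(k)}=0$, with $x^{(n)}=x^n/\prod_{k=1}^n\frac{p_i^k-p_i^{-k}}{p_i-p_i^{-1}}$. **$\mathsf U_v(\mathfrak g)$.** The $\mathbb Q(v)$-algebra generated by $e_i,f_i,K_i^{\pm1}$ with relations $K_iK_j=K_jK_i$, $K_ie_jK_i^{-1}=v^{d_ia_{ij}}e_j$, $K_if_jK_i^{-1}=v^{-d_ia_{ij}}f_j$, $e_if_j-f_je_i=\delta_{ij}\frac{K_i-K_i^{-1}}{v^{d_i}-v^{-d_i}}$ and, for $i\neq j$, the usual quantum Serre relations $\sum_{k=0}^{1-a_{ij}}(-1)^k\genfrac{[}{]}{0pt}{}{1-a_{ij}}{k}_{v^{d_i}}x_i^{1-a_{ij}-k}x_jx_i^k=0$ for $x=e$ and $x=f$ (symmetric quantum binomials in $v^{d_i}$). **Categories.** Each algebra $\mathcal A$ is $\mathrm Q$-graded ($\mathrm Q=\bigoplus\mathbb Z\alpha_i$; $e_i,f_i$ of degree $\pm\alpha_i$). $\mathrm{Mod}^{\mathrm P}(\mathcal A)$: $\mathcal A$-modules $V=\bigoplus_{\mu\in\mathrm P}V_\mu$ with $\mathcal A_\alpha V_\mu\subset V_{\mu+\alpha}$ and with $\tilde K_i$, resp. $K_i$, resp. $K_i$ acting on $V_\mu$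 as $(q_i^2\pi_i)^{\langle h_i,\mu\rangle}$, resp. $p_i^{\langle h_i,\mu\rangle}$, resp. $v^{d_i\langle h_i,\mu\rangle}$. $\mathcal O^{\mathrm P}_{\rm int}(\mathcal A)$: the full subcategory of $V$ with finite-dimensional weight spaces, weights in a finite union of sets $\lambda_s-\mathrm Q^+$, and all $e_i,f_i$ locally nilpotent. *)

theory Defs
  imports
    "HOL-Algebra.QuotRing"
    "HOL-Algebra.Generated_Groups"
    "HOL-Algebra.Module"
    "HOL-Algebra.Algebraic_Closure_Type"
    "HOL-Computational_Algebra.Computational_Algebra"
    "HOL-Library.Poly_Mapping"
    "HOL-Library.Numeral_Type"
begin

section \<open>Categories and equivalences\<close>

record ('o, 'm) cat =
  Ob :: "'o set"
  Hom :: "'o \<Rightarrow> 'o \<Rightarrow> 'm set"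
  Idt :: "'o \<Rightarrow> 'm"
  Cmp :: "'o \<Rightarrow> 'o \<Rightarrow> 'o \<Rightarrow> 'm \<Rightarrow> 'm \<Rightarrow> 'm"

text \<open>\<open>Cmp C x y z g f\<close> is the composite \<open>g \<circ> f\<close> of \<open>f : x \<rightarrow> y\<close> and \<open>g : y \<rightarrow> z\<close>.\<close>

locale is_category =
  fixes C :: "('o, 'm) cat"
  assumes Idt_in: "x \<in> Ob C \<Longrightarrow> Idt C x \<in> Hom C x x"
    and Cmp_in: "\<lbrakk>x \<in> Ob C; y \<in> Ob C; z \<in> Ob C; f \<in> Hom C x y; g \<in> Hom C y z\<rbrakk>
      \<Longrightarrow> Cmp C x y z g f \<in> Hom C x z"
    and Cmp_Idt_right: "\<lbrakk>x \<in> Ob C; y \<in> Ob C; f \<in> Hom C x y\<rbrakk> \<Longrightarrow> Cmp C x x y f (Idt C x) = f"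
    and Cmp_Idt_left: "\<lbrakk>x \<in> Ob C; y \<in> Ob C; f \<in> Hom C x y\<rbrakk> \<Longrightarrow> Cmp C x y y (Idt C y) f = f"
    and Cmp_assoc: "\<lbrakk>w \<in> Ob C; x \<in> Ob C; y \<in> Ob C; z \<in> Ob C;
        f \<in> Hom C w x; g \<in> Hom C x y; h \<in> Hom C y z\<rbrakk>
      \<Longrightarrow> Cmp C w y z h (Cmp C w x y g f) = Cmp C w x z (Cmp C x y z h g) f"

locale cat_functor =
  fixes C :: "('o1, 'm1) cat" and D :: "('o2, 'm2) cat"
    and Fo :: "'o1 \<Rightarrow> 'o2" and Fm :: "'o1 \<Rightarrow> 'o1 \<Rightarrow> 'm1 \<Rightarrow> 'm2"
  assumes Fo_in: "x \<in> Ob C \<Longrightarrow> Fo x \<in> Ob D"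
    and Fm_in: "\<lbrakk>x \<in> Ob C; y \<in> Ob C; f \<in> Hom C x y\<rbrakk> \<Longrightarrow> Fm x y f \<in> Hom D (Fo x) (Fo y)"
    and Fm_Idt: "x \<in> Ob C \<Longrightarrow> Fm x x (Idt C x) = Idt D (Fo x)"
    and Fm_Cmp: "\<lbrakk>x \<in> Ob C; y \<in> Ob C; z \<in> Ob C; f \<in> Hom C x y; g \<in> Hom C y z\<rbrakk>
      \<Longrightarrow> Fm x z (Cmp C x y z g f) = Cmp D (Fo x) (Fo y) (Fo z) (Fm y z g) (Fm x y f)"

definition cat_isos :: "('o, 'm) cat \<Rightarrow> 'o \<Rightarrow> 'o \<Rightarrow> 'm set" where
  "cat_isos C x y = {f \<in> Hom C x y. \<exists>g \<in> Hom C y x.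
     Cmp C x y x g f = Idt C x \<and> Cmp C y x y f g = Idt C y}"

definition naturally_isomorphic ::
  "('o1, 'm1) cat \<Rightarrow> ('o2, 'm2) cat \<Rightarrow>
   ('o1 \<Rightarrow> 'o2) \<Rightarrow> ('o1 \<Rightarrow> 'o1 \<Rightarrow> 'm1 \<Rightarrow> 'm2) \<Rightarrow>
   ('o1 \<Rightarrow> 'o2) \<Rightarrow> ('o1 \<Rightarrow> 'o1 \<Rightarrow> 'm1 \<Rightarrow> 'm2) \<Rightarrow> bool" where
  "naturally_isomorphic C D Fo Fm Go Gm \<longleftrightarrow> (\<exists>\<eta>.
     (\<forall>x \<in> Ob C. \<eta> x \<in> cat_isos D (Fo x) (Go x)) \<and>
     (\<forall>x \<in> Ob C. \<forall>y \<in> Ob C. \<forall>f \<in> Hom C x y.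
        Cmp D (Fo x) (Fo y) (Go y) (\<eta> y) (Fm x y f) =
        Cmp D (Fo x) (Go x) (Go y) (Gm x y f) (\<eta> x)))"

definition equivalent_cats :: "('o1, 'm1) cat \<Rightarrow> ('o2, 'm2) cat \<Rightarrow> bool" where
  "equivalent_cats C D \<longleftrightarrow> is_category C \<and> is_category D \<and>
     (\<exists>Fo Fm Go Gm. cat_functor C D Fo Fm \<and> cat_functor D C Go Gm \<and>
        naturally_isomorphic C C (\<lambda>x. Go (Fo x)) (\<lambda>x y f. Gm (Fo x) (Fo y) (Fm x y f))
          (\<lambda>x. x) (\<lambda>x y f. f) \<and>
        naturally_isomorphic D D (\<lambda>x. Fo (Go x)) (\<lambda>x y f. Fm (Go x) (Go y) (Gm x y f))
          (\<lambda>x. x) (\<lambda>x y f. f))"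

definition full_subcat :: "('o, 'm) cat \<Rightarrow> ('o \<Rightarrow> bool) \<Rightarrow> ('o, 'm) cat" where
  "full_subcat C P = C\<lparr>Ob := {x \<in> Ob C. P x}\<rparr>"


section \<open>Monoid algebras, free algebras, tensor products\<close>

definition monoid_algebra ::
  "('m, 'x) monoid_scheme \<Rightarrow> ('m \<Rightarrow>\<^sub>0 'k::comm_ring_1) ring" where
  "monoid_algebra M = \<lparr>
     carrier = {f. Poly_Mapping.keys f \<subseteq> carrier M},
     monoid.mult = (\<lambda>f g. \<Sum>x\<in>Poly_Mapping.keys f. \<Sum>y\<in>Poly_Mapping.keys g.
        Poly_Mapping.single (x \<otimes>\<^bsub>M\<^esub> y) (Poly_Mapping.lookup f x * Poly_Mapping.lookup g y)),
     one = Poly_Mapping.single \<one>\<^bsub>M\<^esub> 1,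
     zero = 0,
     add = (+)\<rparr>"

context
  fixes M :: "('m, 'x) monoid_scheme"
begin

lemma monoid_algebra_mult_superset:
  fixes f g :: "'m \<Rightarrow>\<^sub>0 'k::comm_ring_1"
  assumes "finite S" "Poly_Mapping.keys f \<subseteq> S" "finite T" "Poly_Mapping.keys g \<subseteq> T"
  shows "f \<otimes>\<^bsub>monoid_algebra M\<^esub> g = (\<Sum>x\<in>S. \<Sum>y\<in>T.
    Poly_Mapping.single (x \<otimes>\<^bsub>M\<^esub> y) (Poly_Mapping.lookup f x * Poly_Mapping.lookup g y))"
proof -
  have "f \<otimes>\<^bsub>monoid_algebra M\<^esub> g = (\<Sum>x\<in>Poly_Mapping.keys f. \<Sum>y\<in>T.
    Poly_Mapping.single (x \<otimes>\<^bsub>M\<^esub> y) (Poly_Mapping.lookup f x * Poly_Mapping.lookup g y))"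
    unfolding monoid_algebra_def monoid.simps
    by (intro sum.cong refl sum.mono_neutral_left) (use assms in \<open>auto simp: in_keys_iff\<close>)
  also have "\<dots> = (\<Sum>x\<in>S. \<Sum>y\<in>T.
    Poly_Mapping.single (x \<otimes>\<^bsub>M\<^esub> y) (Poly_Mapping.lookup f x * Poly_Mapping.lookup g y))"
    by (intro sum.mono_neutral_left) (use assms in \<open>auto simp: in_keys_iff\<close>)
  finally show ?thesis .
qed

lemma monoid_algebra_mult_single:
  "Poly_Mapping.single x a \<otimes>\<^bsub>monoid_algebra M\<^esub> Poly_Mapping.single y b =
   Poly_Mapping.single (x \<otimes>\<^bsub>M\<^esub> y) (a * b :: 'k::comm_ring_1)"
  by (subst monoid_algebra_mult_superset[of "{x}" _ "{y}"]) auto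

lemma monoid_algebra_distrib_right:
  fixes f g h :: "'m \<Rightarrow>\<^sub>0 'k::comm_ring_1"
  shows "(f + g) \<otimes>\<^bsub>monoid_algebra M\<^esub> h =
    f \<otimes>\<^bsub>monoid_algebra M\<^esub> h + g \<otimes>\<^bsub>monoid_algebra M\<^esub> h"
proof -
  let ?S = "Poly_Mapping.keys f \<union> Poly_Mapping.keys g"
  have "Poly_Mapping.keys (f + g) \<subseteq> ?S" by (rule Poly_Mapping.keys_add)
  then show ?thesis
    by (subst (1 2 3) monoid_algebra_mult_superset[of ?S _ "Poly_Mapping.keys h"])
      (auto simp: lookup_add distrib_right single_add sum.distrib)
qed

lemma monoid_algebra_distrib_left:
  fixes f g h :: "'m \<Rightarrow>\<^sub>0 'k::comm_ring_1"
  shows "h \<otimes>\<^bsub>monoid_algebra M\<^esub> (f + g) =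
    h \<otimes>\<^bsub>monoid_algebra M\<^esub> f + h \<otimes>\<^bsub>monoid_algebra M\<^esub> g"
proof -
  let ?S = "Poly_Mapping.keys f \<union> Poly_Mapping.keys g"
  have "Poly_Mapping.keys (f + g) \<subseteq> ?S" by (rule Poly_Mapping.keys_add)
  then show ?thesis
    by (subst (1 2 3) monoid_algebra_mult_superset[of "Poly_Mapping.keys h" _ ?S])
      (auto simp: lookup_add distrib_left single_add sum.distrib)
qed

lemma monoid_algebra_zero_mult:
  "(0 :: 'm \<Rightarrow>\<^sub>0 'k::comm_ring_1) \<otimes>\<^bsub>monoid_algebra M\<^esub> f = 0"
  "f \<otimes>\<^bsub>monoid_algebra M\<^esub> (0 :: 'm \<Rightarrow>\<^sub>0 'k) = 0"
  by (simp_all add: monoid_algebra_def)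

lemma monoid_algebra_induct [consumes 1, case_names zero single add]:
  fixes f :: "'m \<Rightarrow>\<^sub>0 'k::comm_ring_1"
  assumes "f \<in> carrier (monoid_algebra M)" "P 0"
    and "\<And>x a. x \<in> carrier M \<Longrightarrow> P (Poly_Mapping.single x a)"
    and "\<And>f g. P f \<Longrightarrow> P g \<Longrightarrow> P (f + g)"
  shows "P f"
proof -
  have sub: "P (\<Sum>x\<in>S. Poly_Mapping.single x (Poly_Mapping.lookup f x))"
    if "S \<subseteq> Poly_Mapping.keys f" for S
    using finite_subset[OF that finite_keys] that
  proof (induction S rule: finite_induct)
    case empty
    then show ?case using assms by simp
  next
    case (insert x S)
    then have "x \<in> carrier M" using assms(1) by (auto simp: monoid_algebra_def)
    then show ?case using insert assms(3,4) by simp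
  qed
  have eq: "(\<Sum>x\<in>Poly_Mapping.keys f. Poly_Mapping.single x (Poly_Mapping.lookup f x)) = f"
    by (rule poly_mapping_eqI) (auto simp: lookup_sum lookup_single when_def sum.delta in_keys_iff)
  show ?thesis using sub[OF order_refl] unfolding eq .
qed

lemma ring_monoid_algebra:
  assumes "monoid M"
  shows "ring (monoid_algebra M :: ('m \<Rightarrow>\<^sub>0 'k::comm_ring_1) ring)"
proof -
  interpret M: monoid M by fact
  let ?R = "monoid_algebra M :: ('m \<Rightarrow>\<^sub>0 'k) ring"
  have add: "(\<oplus>\<^bsub>?R\<^esub>) = (+)" and zero: "\<zero>\<^bsub>?R\<^esub> = 0"
    and one: "\<one>\<^bsub>?R\<^esub> = Poly_Mapping.single \<one>\<^bsub>M\<^esub> 1"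
    and car: "carrier ?R = {f. Poly_Mapping.keys f \<subseteq> carrier M}"
    by (simp_all add: monoid_algebra_def)
  note dist = monoid_algebra_distrib_left monoid_algebra_distrib_right
  have add_closed: "f + g \<in> carrier ?R" if "f \<in> carrier ?R" "g \<in> carrier ?R" for f g
    using that Poly_Mapping.keys_add[of f g] by (auto simp: car)
  have closed: "f \<otimes>\<^bsub>?R\<^esub> g \<in> carrier ?R" if "f \<in> carrier ?R" "g \<in> carrier ?R" for f g
    using that(1)
  proof (induction f rule: monoid_algebra_induct)
    case zero
    then show ?case by (simp add: monoid_algebra_zero_mult car)
  next
    case (single x a)
    show ?case using that(2)
    proof (induction g rule: monoid_algebra_induct)
      case zero
      then show ?case by (simp add: monoid_algebra_zero_mult car)
    next
      case (single y b)
      then show ?case using \<open>x \<in> carrier M\<close> by (simp add: monoid_algebra_mult_single car)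
    qed (simp add: dist add_closed)
  qed (simp add: dist add_closed)
  have assoc: "(f \<otimes>\<^bsub>?R\<^esub> g) \<otimes>\<^bsub>?R\<^esub> h = f \<otimes>\<^bsub>?R\<^esub> (g \<otimes>\<^bsub>?R\<^esub> h)"
    if "f \<in> carrier ?R" "g \<in> carrier ?R" "h \<in> carrier ?R" for f g h
    using that(1)
  proof (induction f rule: monoid_algebra_induct)
    case (single x a)
    show ?case using that(2)
    proof (induction g rule: monoid_algebra_induct)
      case (single y b)
      show ?case using that(3)
      proof (induction h rule: monoid_algebra_induct)
        case (single z c)
        then show ?case using \<open>x \<in> carrier M\<close> \<open>y \<in> carrier M\<close>
          by (simp add: monoid_algebra_mult_single M.m_assoc mult.assoc)
      qed (simp_all add: dist monoid_algebra_zero_mult)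
    qed (simp_all add: dist monoid_algebra_zero_mult)
  qed (simp_all add: dist monoid_algebra_zero_mult)
  have one_l: "\<one>\<^bsub>?R\<^esub> \<otimes>\<^bsub>?R\<^esub> f = f" and one_r: "f \<otimes>\<^bsub>?R\<^esub> \<one>\<^bsub>?R\<^esub> = f"
    if "f \<in> carrier ?R" for f
    using that
    by (induction f rule: monoid_algebra_induct)
      (simp_all add: dist monoid_algebra_zero_mult monoid_algebra_mult_single one)
  show ?thesis
  proof (rule ringI)
    show "abelian_group ?R"
    proof (rule abelian_groupI)
      fix f assume "f \<in> carrier ?R"
      then show "\<exists>g\<in>carrier ?R. g \<oplus>\<^bsub>?R\<^esub> f = \<zero>\<^bsub>?R\<^esub>"
        by (intro bexI[of _ "- f"]) (auto simp: add zero car keys_def)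
    qed (auto simp: add zero add_closed add.assoc add.commute, auto simp: car)
    show "monoid ?R"
      by (rule monoidI) (auto simp: closed assoc one_l one_r, auto simp: one car)
  qed (auto simp: add dist)
qed

end

definition word_monoid :: "'g list monoid" where
  "word_monoid = \<lparr>carrier = UNIV, monoid.mult = (@), one = []\<rparr>"

abbreviation free_algebra :: "('g list \<Rightarrow>\<^sub>0 'k::comm_ring_1) ring" where
  "free_algebra \<equiv> monoid_algebra word_monoid"

lemma ring_free_algebra: "ring (free_algebra :: ('g list \<Rightarrow>\<^sub>0 'k::comm_ring_1) ring)"
  by (rule ring_monoid_algebra) (auto simp: word_monoid_def intro: monoidI)

text \<open>
  The tensor product \<open>S \<otimes>\<^sub>R A\<close> of two \<open>R\<close>-algebras with structure maps \<open>\<phi> : R \<rightarrow> S\<close> and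
  \<open>\<psi> : R \<rightarrow> A\<close>. The group underlying \<open>monoid_algebra (S \<times>\<times> A)\<close> is the free abelian group on
  \<open>S \<times> A\<close>; it is divided by the \<open>R\<close>-bilinearity relations, and the multiplication is the one
  induced by \<open>(s, a) (s', a') = (s s', a a')\<close>.
\<close>

definition tensor_ideal ::
  "('s, 'x) ring_scheme \<Rightarrow> ('a, 'y) ring_scheme \<Rightarrow> ('r \<Rightarrow> 's) \<Rightarrow> ('r \<Rightarrow> 'a) \<Rightarrow> (('s \<times> 'a) \<Rightarrow>\<^sub>0 int) set"
where
  "tensor_ideal S A \<phi> \<psi> = (let \<delta> = (\<lambda>s a. Poly_Mapping.single (s, a) 1) in
     Idl\<^bsub>monoid_algebra (S \<times>\<times> A)\<^esub>
      ({\<delta> (s \<oplus>\<^bsub>S\<^esub> t) a - \<delta> s a - \<delta> t a | s t a.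
          s \<in> carrier S \<and> t \<in> carrier S \<and> a \<in> carrier A} \<union>
       {\<delta> s (a \<oplus>\<^bsub>A\<^esub> b) - \<delta> s a - \<delta> s b | s a b.
          s \<in> carrier S \<and> a \<in> carrier A \<and> b \<in> carrier A} \<union>
       {\<delta> (s \<otimes>\<^bsub>S\<^esub> \<phi> r) a - \<delta> s (\<psi> r \<otimes>\<^bsub>A\<^esub> a) | s r a.
          s \<in> carrier S \<and> a \<in> carrier A}))"

definition tensor_ring ::
  "('s, 'x) ring_scheme \<Rightarrow> ('a, 'y) ring_scheme \<Rightarrow> ('r \<Rightarrow> 's) \<Rightarrow> ('r \<Rightarrow> 'a) \<Rightarrow>
   (('s \<times> 'a) \<Rightarrow>\<^sub>0 int) set ring" where
  "tensor_ring S A \<phi> \<psi> = monoid_algebra (S \<times>\<times> A) Quot tensor_ideal S A \<phi> \<psi>"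

definition pure_tensor ::
  "('s, 'x) ring_scheme \<Rightarrow> ('a, 'y) ring_scheme \<Rightarrow> ('r \<Rightarrow> 's) \<Rightarrow> ('r \<Rightarrow> 'a) \<Rightarrow> 's \<Rightarrow> 'a \<Rightarrow>
   (('s \<times> 'a) \<Rightarrow>\<^sub>0 int) set" where
  "pure_tensor S A \<phi> \<psi> s a =
     tensor_ideal S A \<phi> \<psi> +>\<^bsub>monoid_algebra (S \<times>\<times> A)\<^esub> Poly_Mapping.single (s, a) 1"

lemma ring_tensor_ring:
  assumes "ring S" "ring A" "\<And>r. \<phi> r \<in> carrier S" "\<And>r. \<psi> r \<in> carrier A"
  shows "ring (tensor_ring S A \<phi> \<psi>)"
proof -
  interpret S: ring S by fact
  interpret A: ring A by fact
  interpret T: ring "monoid_algebra (S \<times>\<times> A) :: (_ \<Rightarrow>\<^sub>0 int) ring"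
    by (intro ring_monoid_algebra DirProd_monoid S.monoid_axioms A.monoid_axioms)
  have diff: "f - g \<in> carrier (monoid_algebra (S \<times>\<times> A))"
    if "f \<in> carrier (monoid_algebra (S \<times>\<times> A))" "g \<in> carrier (monoid_algebra (S \<times>\<times> A))"
    for f g :: "_ \<Rightarrow>\<^sub>0 int"
    using that keys_diff[of f g] by (auto simp: monoid_algebra_def)
  have single: "Poly_Mapping.single (s, a) (1::int) \<in> carrier (monoid_algebra (S \<times>\<times> A))"
    if "s \<in> carrier S" "a \<in> carrier A" for s a
    using that by (simp add: monoid_algebra_def)
  show ?thesis
    unfolding tensor_ring_def tensor_ideal_def Let_def
    by (intro ideal.quotient_is_ring T.genideal_ideal)
      (auto intro!: diff single simp: assms)
qed


section \<open>Scalars\<close>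

text \<open>\<open>\<rat>(x)\<close>; the indeterminate is called \<open>q\<close> or \<open>v\<close> according to the algebra.\<close>

type_synonym rfun = "rat poly fract"

definition xvar :: rfun where
  "xvar = Fraction_Field.Fract [:0, 1:] 1"

definition rfun_of_rat :: "rat \<Rightarrow> rfun" where
  "rfun_of_rat c = Fraction_Field.Fract [:c:] 1"

text \<open>
  With the convolution product, \<open>2 \<Rightarrow>\<^sub>0 k\<close> is the group ring \<open>k[\<int>/2] = k[\<pi>]/(\<pi>\<^sup>2 - 1)\<close> and
  \<open>4 \<Rightarrow>\<^sub>0 k\<close> is \<open>k[\<int>/4] = k[\<surd>\<pi>]/(\<surd>\<pi>\<^sup>4 - 1)\<close>.
\<close>

type_synonym 'k pi_ext = "2 \<Rightarrow>\<^sub>0 'k"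
type_synonym 'k sqrtpi_ext = "4 \<Rightarrow>\<^sub>0 'k"

abbreviation scalar_const :: "'k \<Rightarrow> ('n::zero \<Rightarrow>\<^sub>0 'k::zero)" where
  "scalar_const c \<equiv> Poly_Mapping.single 0 c"

definition pi2 :: "'k::comm_ring_1 pi_ext" where
  "pi2 = Poly_Mapping.single 1 1"

definition sqrtpi :: "'k::comm_ring_1 sqrtpi_ext" where
  "sqrtpi = Poly_Mapping.single 1 1"

abbreviation pi4 :: "'k::comm_ring_1 sqrtpi_ext" where
  "pi4 \<equiv> sqrtpi ^ 2"

definition pi_incl :: "'k::comm_ring_1 pi_ext \<Rightarrow> 'k sqrtpi_ext" where
  "pi_incl f = scalar_const (Poly_Mapping.lookup f 0) + scalar_const (Poly_Mapping.lookup f 1) * pi4"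

lemma pi2_square: "(pi2 :: 'k::comm_ring_1 pi_ext) ^ 2 = 1"
proof -
  have eq: "(1 :: 2) + 1 = 0" by simp
  show ?thesis unfolding pi2_def power2_eq_square mult_single eq by simp
qed

lemma sqrtpi_pow4: "(sqrtpi :: 'k::comm_ring_1 sqrtpi_ext) ^ 4 = 1"
proof -
  have eq: "(1 :: 4) + 1 + 1 + 1 = 0" by simp
  show ?thesis unfolding sqrtpi_def power4_eq_xxxx mult_single eq by simp
qed

text \<open>Inverses and integer powers of units; both are only applied to units below.\<close>

definition uinv :: "'k::comm_ring_1 \<Rightarrow> 'k" where
  "uinv x = (THE y. x * y = 1)"

definition zpow :: "'k::comm_ring_1 \<Rightarrow> int \<Rightarrow> 'k" where
  "zpow x n = (if 0 \<le> n then x ^ nat n else uinv x ^ nat (- n))"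

definition v_elt :: "rfun sqrtpi_ext" where
  "v_elt = scalar_const xvar * sqrtpi"

text \<open>The embedding \<open>\<rat>(v) \<rightarrow> \<rat>(q)[\<surd>\<pi>]\<close> sending \<open>v\<close> to \<open>q \<surd>\<pi>\<close>.\<close>

definition v_embed :: "rfun \<Rightarrow> rfun sqrtpi_ext" where
  "v_embed f = (let ev = (\<lambda>a. poly (map_poly (\<lambda>c. scalar_const (rfun_of_rat c)) a) v_elt) in
     ev (fst (quot_of_fract f)) * uinv (ev (snd (quot_of_fract f))))"

text \<open>The identification of \<open>\<rat>[\<surd>\<pi>] \<otimes>\<^sub>\<rat> \<rat>(v) = \<rat>(v)[\<surd>\<pi>]\<close> with \<open>\<rat>(q)[\<surd>\<pi>]\<close>.\<close>

definition v_ident :: "rfun sqrtpi_ext \<Rightarrow> rfun sqrtpi_ext" where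
  "v_ident x = (\<Sum>k\<in>UNIV. v_embed (Poly_Mapping.lookup x k) * Poly_Mapping.single k 1)"


section \<open>Cartan superdata\<close>

record ('i, 'p) superdatum =
  cm :: "'i \<Rightarrow> 'i \<Rightarrow> int"
  dd :: "'i \<Rightarrow> nat"
  rt :: "'i \<Rightarrow> 'p"
  crt :: "'i \<Rightarrow> 'p \<Rightarrow> int"
  odds :: "'i set"

definition par :: "('i, 'p) superdatum \<Rightarrow> 'i \<Rightarrow> nat" where
  "par C i = (if i \<in> odds C then 1 else 0)"

definition zscale :: "int \<Rightarrow> 'p::ab_group_add \<Rightarrow> 'p" where
  "zscale n x = (if 0 \<le> n then (\<Sum>_<nat n. x) else - (\<Sum>_<nat (- n). x))"

lemma module_zscale: "Modules.module (zscale :: int \<Rightarrow> 'p::ab_group_add \<Rightarrow> 'p)"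
proof -
  have nat: "zscale (int n) x = (\<Sum>_<n. x)" for n and x :: 'p
    by (simp add: zscale_def)
  have zero: "zscale 0 x = 0" for x :: 'p by (simp add: zscale_def)
  have uminus_scale: "zscale (- n) x = - zscale n x" for n and x :: 'p
    by (simp add: zscale_def)
  have suc: "zscale (n + 1) x = zscale n x + x" for n and x :: 'p
  proof (cases n)
    case (nonneg k)
    have "zscale (int (Suc k)) x = zscale (int k) x + x" by (simp only: nat sum.lessThan_Suc)
    then show ?thesis using nonneg by (simp add: add.commute)
  next
    case (neg k)
    have "zscale (int (Suc k)) x = zscale (int k) x + x" by (simp only: nat sum.lessThan_Suc)
    moreover have "n + 1 = - int k" using neg by simp
    ultimately show ?thesis using neg by (simp only: uminus_scale) simp
  qed
  have pred: "zscale (n - 1) x = zscale n x - x" for n and x :: 'p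
    using suc[of "n - 1" x] by simp
  have addl: "zscale (m + n) x = zscale m x + zscale n x" for m n and x :: 'p
  proof (induction m rule: int_induct[where k = 0])
    case base then show ?case by (simp add: zero)
  next
    case (step1 i)
    have "zscale (i + 1 + n) x = zscale (i + n) x + x"
      using suc[of "i + n" x] by (simp only: ac_simps)
    then show ?case unfolding step1 suc[of i x] by (simp only: ac_simps)
  next
    case (step2 i)
    have "zscale (i - 1 + n) x = zscale (i + n) x - x"
      using pred[of "i + n" x] by (simp only: diff_add_eq)
    then show ?case unfolding step2 pred[of i x] by (simp only: diff_add_eq)
  qed
  have addr: "zscale n (x + y) = zscale n x + zscale n y" for n and x y :: 'p
    by (simp add: zscale_def sum.distrib)
  have mul: "zscale m (zscale n x) = zscale (m * n) x" for m n and x :: 'p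
  proof (induction m rule: int_induct[where k = 0])
    case base then show ?case by (simp add: zero)
  next
    case (step1 i) show ?case unfolding suc[of i] step1(2) distrib_right mult_1 by (simp only: addl)
  next
    case (step2 i)
    have "i * n = (i - 1) * n + n" by (simp add: left_diff_distrib)
    then have "zscale (i * n) x = zscale ((i - 1) * n) x + zscale n x" by (simp only: addl)
    then show ?case by (simp only: pred[of i] step2) simp
  qed
  show ?thesis
    by (rule Modules.module.intro) (simp_all add: addl addr mul, simp add: zscale_def)
qed

locale cartan_superdatum =
  fixes C :: "('i, 'p::ab_group_add) superdatum"
  assumes cm_diag: "cm C i i = 2"
    and cm_offdiag: "i \<noteq> j \<Longrightarrow> cm C i j \<le> 0"
    and cm_zero: "cm C j i = 0 \<Longrightarrow> cm C i j = 0"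
    and dd_pos: "0 < dd C i"
    and symmetrizable: "int (dd C i) * cm C i j = int (dd C j) * cm C j i"
    and P_free: "\<exists>B :: 'p set. \<not> Modules.module.dependent zscale B \<and> Modules.module.span zscale B = UNIV"
    and rt_inj: "inj (rt C)"
    and rt_independent: "\<not> Modules.module.dependent zscale (range (rt C))"
    and crt_hom: "crt C i (x + y) = crt C i x + crt C i y"
    and crt_rt: "crt C i (rt C j) = cm C i j"
    and odd_even: "i \<in> odds C \<Longrightarrow> even (cm C i j)"

definition Qplus :: "('i, 'p::ab_group_add) superdatum \<Rightarrow> 'p set" where
  "Qplus C = {\<Sum>i\<in>J. zscale (int (n i)) (rt C i) | J n. finite J}"


section \<open>Presented algebras\<close>

datatype 'i gen = gE 'i | gF 'i | gK 'i | gKinv 'i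

fun gen_deg :: "('i, 'p::ab_group_add) superdatum \<Rightarrow> 'i gen \<Rightarrow> 'p" where
  "gen_deg C (gE i) = rt C i"
| "gen_deg C (gF i) = - rt C i"
| "gen_deg C (gK i) = 0"
| "gen_deg C (gKinv i) = 0"

definition word_deg :: "('i, 'p::ab_group_add) superdatum \<Rightarrow> 'i gen list \<Rightarrow> 'p" where
  "word_deg C w = sum_list (map (gen_deg C) w)"

text \<open>
  A \<open>'k\<close>-algebra with structure map \<open>scl\<close>, homogeneous components \<open>hcomp\<close> (indexed by all of
  \<open>P \<supseteq> Q\<close>, and zero outside \<open>Q\<close>), and distinguished elements.
\<close>

record ('i, 'p, 'k, 'a) gr_algebra = "'a ring" +
  scl :: "'k \<Rightarrow> 'a"
  hcomp :: "'p \<Rightarrow> 'a set"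
  eel :: "'i \<Rightarrow> 'a"
  fel :: "'i \<Rightarrow> 'a"
  Kel :: "'i \<Rightarrow> 'a"

definition presented_algebra ::
  "('i, 'p::ab_group_add) superdatum \<Rightarrow> ('i gen list \<Rightarrow>\<^sub>0 'k) set \<Rightarrow>
   ('i, 'p, 'k::comm_ring_1, ('i gen list \<Rightarrow>\<^sub>0 'k) set) gr_algebra" where
  "presented_algebra C rels = (let I = Idl\<^bsub>free_algebra\<^esub> rels; cl = (\<lambda>f. I +>\<^bsub>free_algebra\<^esub> f) in
     ring.extend (free_algebra Quot I)
      \<lparr>scl = (\<lambda>c. cl (Poly_Mapping.single [] c)),
       hcomp = (\<lambda>\<beta>. cl ` {f. \<forall>w \<in> Poly_Mapping.keys f. word_deg C w = \<beta>}),
       eel = (\<lambda>i. cl (Poly_Mapping.single [gE i] 1)),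
       fel = (\<lambda>i. cl (Poly_Mapping.single [gF i] 1)),
       Kel = (\<lambda>i. cl (Poly_Mapping.single [gK i] 1))\<rparr>)"

abbreviation mon :: "'k \<Rightarrow> 'i gen list \<Rightarrow> ('i gen list \<Rightarrow>\<^sub>0 'k::comm_ring_1)" where
  "mon c w \<equiv> Poly_Mapping.single w c"

definition serre_len :: "('i, 'p) superdatum \<Rightarrow> 'i \<Rightarrow> 'i \<Rightarrow> nat" where
  "serre_len C i j = nat (1 - cm C i j)"

text \<open>
  The relations common to the three presentations. In the order of the arguments, the relations are
  \<open>K\<^sub>i e\<^sub>j K\<^sub>i\<^sup>-\<^sup>1 = \<kappa> i j e\<^sub>j\<close>, \<open>K\<^sub>i f\<^sub>j K\<^sub>i\<^sup>-\<^sup>1 = \<kappa>' i j f\<^sub>j\<close>,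
  \<open>e\<^sub>i f\<^sub>j - t i j f\<^sub>j e\<^sub>i = \<delta>\<^sub>i\<^sub>j h i\<close>, and for \<open>i \<noteq> j\<close>, with \<open>m = 1 - a\<^sub>i\<^sub>j\<close>,
  \<open>\<Sum>k\<le>m. se i j k e\<^sub>i\<^sup>m\<^sup>-\<^sup>k e\<^sub>j e\<^sub>i\<^sup>k = 0\<close>, \<open>\<Sum>k\<le>m. sf i j k f\<^sub>i\<^sup>m\<^sup>-\<^sup>k f\<^sub>j f\<^sub>i\<^sup>k = 0\<close>.
\<close>

definition qgroup_rels ::
  "('i, 'p) superdatum \<Rightarrow> ('i \<Rightarrow> 'i \<Rightarrow> 'k::comm_ring_1) \<Rightarrow> ('i \<Rightarrow> 'i \<Rightarrow> 'k) \<Rightarrow> ('i \<Rightarrow> 'i \<Rightarrow> 'k) \<Rightarrow>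
   ('i \<Rightarrow> 'i gen list \<Rightarrow>\<^sub>0 'k) \<Rightarrow> ('i \<Rightarrow> 'i \<Rightarrow> nat \<Rightarrow> 'k) \<Rightarrow> ('i \<Rightarrow> 'i \<Rightarrow> nat \<Rightarrow> 'k) \<Rightarrow>
   ('i gen list \<Rightarrow>\<^sub>0 'k) set" where
  "qgroup_rels C \<kappa> \<kappa>' t h se sf =
     (\<Union>i. {mon 1 [gK i, gKinv i] - mon 1 [], mon 1 [gKinv i, gK i] - mon 1 []}) \<union>
     (\<Union>i j. {mon 1 [gK i, gK j] - mon 1 [gK j, gK i],
              mon 1 [gK i, gE j, gKinv i] - mon (\<kappa> i j) [gE j],
              mon 1 [gK i, gF j, gKinv i] - mon (\<kappa>' i j) [gF j],
              mon 1 [gE i, gF j] - mon (t i j) [gF j, gE i] - (if i = j then h i else 0)}) \<union>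
     (\<Union>i. \<Union>j \<in> {j. j \<noteq> i}.
        {\<Sum>k\<le>serre_len C i j. mon (se i j k)
           (replicate (serre_len C i j - k) (gE i) @ [gE j] @ replicate k (gE i)),
         \<Sum>k\<le>serre_len C i j. mon (sf i j k)
           (replicate (serre_len C i j - k) (gF i) @ [gF j] @ replicate k (gF i))})"


subsection \<open>The quantum Kac--Moody superalgebra with \<open>\<pi>\<close>\<close>

definition q_sub :: "('i, 'p) superdatum \<Rightarrow> 'i \<Rightarrow> rfun" where
  "q_sub C i = xvar ^ dd C i"

abbreviation q2 :: "('i, 'p) superdatum \<Rightarrow> 'i \<Rightarrow> rfun pi_ext" where
  "q2 C i \<equiv> scalar_const (q_sub C i)"

definition pi2_sub :: "('i, 'p) superdatum \<Rightarrow> 'i \<Rightarrow> rfun pi_ext" where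
  "pi2_sub C i = pi2 ^ par C i"

definition super_fact :: "('i, 'p) superdatum \<Rightarrow> 'i \<Rightarrow> nat \<Rightarrow> rfun pi_ext" where
  "super_fact C i n = (\<Prod>k=1..n.
     ((pi2_sub C i * q2 C i) ^ k - zpow (q2 C i) (- int k)) *
     uinv (pi2_sub C i * q2 C i - zpow (q2 C i) (- 1)))"

definition super_serre :: "('i, 'p) superdatum \<Rightarrow> 'i \<Rightarrow> 'i \<Rightarrow> nat \<Rightarrow> rfun pi_ext" where
  "super_serre C i j k =
     (- (pi2 ^ (par C i * par C j))) ^ k * pi2_sub C i ^ (k * (k - 1) div 2) *
     uinv (super_fact C i (serre_len C i j - k)) * uinv (super_fact C i k)"

definition U_super ::
  "('i, 'p::ab_group_add) superdatum \<Rightarrow>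
   ('i, 'p, rfun pi_ext, ('i gen list \<Rightarrow>\<^sub>0 rfun pi_ext) set) gr_algebra" where
  "U_super C = presented_algebra C (qgroup_rels C
     (\<lambda>i j. zpow (q2 C i) (2 * cm C i j))
     (\<lambda>i j. zpow (q2 C i) (- 2 * cm C i j))
     (\<lambda>i j. pi2 ^ (par C i * par C j) * zpow (q2 C i) (- cm C i j))
     (\<lambda>i. let c = uinv (1 - q2 C i ^ 2 * pi2_sub C i) in mon c [] - mon c [gK i])
     (super_serre C) (super_serre C))"


subsection \<open>The quantum Kac--Moody superalgebra with \<open>\<surd>\<pi>\<close>\<close>

text \<open>
  \<open>r i\<close> is the chosen square root of \<open>\<pi>\<^sub>i\<close> in \<open>\<int>[\<surd>\<pi>]\<close>.
\<close>

definition sqrt_sub :: "('i \<Rightarrow> int sqrtpi_ext) \<Rightarrow> 'i \<Rightarrow> rfun sqrtpi_ext" where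
  "sqrt_sub r i = Poly_Mapping.map of_int (r i)"

definition p_sub :: "('i, 'p) superdatum \<Rightarrow> ('i \<Rightarrow> int sqrtpi_ext) \<Rightarrow> 'i \<Rightarrow> rfun sqrtpi_ext" where
  "p_sub C r i = scalar_const (q_sub C i) * sqrt_sub r i"

definition theta ::
  "('i, 'p) superdatum \<Rightarrow> ('i \<Rightarrow> int sqrtpi_ext) \<Rightarrow> 'i \<Rightarrow> 'i \<Rightarrow> rfun sqrtpi_ext" where
  "theta C r i j = (if i = j then 1 else zpow (sqrt_sub r j) (cm C j i))"

definition p_fact ::
  "('i, 'p) superdatum \<Rightarrow> ('i \<Rightarrow> int sqrtpi_ext) \<Rightarrow> 'i \<Rightarrow> nat \<Rightarrow> rfun sqrtpi_ext" where
  "p_fact C r i n = (\<Prod>k=1..n.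
     (p_sub C r i ^ k - zpow (p_sub C r i) (- int k)) *
     uinv (p_sub C r i - zpow (p_sub C r i) (- 1)))"

definition U_sqrt ::
  "('i, 'p::ab_group_add) superdatum \<Rightarrow> ('i \<Rightarrow> int sqrtpi_ext) \<Rightarrow>
   ('i, 'p, rfun sqrtpi_ext, ('i gen list \<Rightarrow>\<^sub>0 rfun sqrtpi_ext) set) gr_algebra" where
  "U_sqrt C r = presented_algebra C (qgroup_rels C
     (\<lambda>i j. zpow (p_sub C r i) (cm C i j))
     (\<lambda>i j. zpow (p_sub C r i) (- cm C i j))
     (\<lambda>i j. theta C r j i)
     (\<lambda>i. let c = uinv (p_sub C r i - zpow (p_sub C r i) (- 1)) in mon c [gK i] - mon c [gKinv i])
     (\<lambda>i j k. (- theta C r i j) ^ k *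
        uinv (p_fact C r i (serre_len C i j - k)) * uinv (p_fact C r i k))
     (\<lambda>i j k. (- theta C r j i) ^ k *
        uinv (p_fact C r i (serre_len C i j - k)) * uinv (p_fact C r i k)))"


subsection \<open>The quantum Kac--Moody algebra with parameter \<open>v\<close>\<close>

text \<open>Here \<open>xvar\<close> plays the role of \<open>v\<close>, so that \<open>q_sub C i\<close> is \<open>v ^ d\<^sub>i\<close>.\<close>

definition sym_qfact :: "rfun \<Rightarrow> nat \<Rightarrow> rfun" where
  "sym_qfact x n = (\<Prod>k=1..n. (x ^ k - inverse x ^ k) / (x - inverse x))"

definition sym_qbinom :: "rfun \<Rightarrow> nat \<Rightarrow> nat \<Rightarrow> rfun" where
  "sym_qbinom x n k = sym_qfact x n / (sym_qfact x k * sym_qfact x (n - k))"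

definition v_serre :: "('i, 'p) superdatum \<Rightarrow> 'i \<Rightarrow> 'i \<Rightarrow> nat \<Rightarrow> rfun" where
  "v_serre C i j k = (- 1) ^ k * sym_qbinom (q_sub C i) (serre_len C i j) k"

definition U_v ::
  "('i, 'p::ab_group_add) superdatum \<Rightarrow>
   ('i, 'p, rfun, ('i gen list \<Rightarrow>\<^sub>0 rfun) set) gr_algebra" where
  "U_v C = presented_algebra C (qgroup_rels C
     (\<lambda>i j. xvar powi (int (dd C i) * cm C i j))
     (\<lambda>i j. xvar powi (- int (dd C i) * cm C i j))
     (\<lambda>i j. 1)
     (\<lambda>i. let c = 1 / (q_sub C i - inverse (q_sub C i)) in mon c [gK i] - mon c [gKinv i])
     (v_serre C) (v_serre C))"


subsection \<open>Extension of scalars to \<open>\<rat>[\<surd>\<pi>]\<close>\<close>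

text \<open>
  \<open>\<rat>[\<surd>\<pi>] \<otimes>\<^sub>R B\<close> for a \<open>'k\<close>-algebra \<open>B\<close>, where \<open>\<phi> : R \<rightarrow> \<rat>[\<surd>\<pi>]\<close> and \<open>\<psi> : R \<rightarrow> 'k\<close>. It is made
  into a \<open>\<rat>(q)[\<surd>\<pi>]\<close>-algebra by \<open>x \<mapsto> \<Sum>\<^sub>k \<surd>\<pi>\<^sup>k \<otimes> c\<^sub>k\<close>, where \<open>c\<^sub>k = crd x k \<in> 'k\<close> are
  coefficients of \<open>x\<close> with respect to the powers of \<open>\<surd>\<pi>\<close>.
\<close>

definition sqrtpi_tensor ::
  "('r \<Rightarrow> rat sqrtpi_ext) \<Rightarrow> ('r \<Rightarrow> 'k) \<Rightarrow> (rfun sqrtpi_ext \<Rightarrow> 4 \<Rightarrow> 'k) \<Rightarrow>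
   ('i, 'p, 'k, 'a) gr_algebra \<Rightarrow>
   ('i, 'p, rfun sqrtpi_ext, ((rat sqrtpi_ext \<times> 'a) \<Rightarrow>\<^sub>0 int) set) gr_algebra" where
  "sqrtpi_tensor \<phi> \<psi> crd B = (let S = (ring_of_type_algebra :: rat sqrtpi_ext ring);
       T = tensor_ring S B \<phi> (\<lambda>r. scl B (\<psi> r)); tens = pure_tensor S B \<phi> (\<lambda>r. scl B (\<psi> r)) in
     ring.extend T
      \<lparr>scl = (\<lambda>x. \<Oplus>\<^bsub>T\<^esub>k\<in>UNIV. tens (Poly_Mapping.single k 1) (scl B (crd x k))),
       hcomp = (\<lambda>\<beta>. generate (add_monoid T) {tens s b | s b. b \<in> hcomp B \<beta>}),
       eel = (\<lambda>i. tens 1 (eel B i)),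
       fel = (\<lambda>i. tens 1 (fel B i)),
       Kel = (\<lambda>i. tens 1 (Kel B i))\<rparr>)"

text \<open>\<open>\<rat>[\<surd>\<pi>] \<otimes>\<^bsub>\<rat>[\<pi>]\<^esub> U\<close> for the \<open>\<rat>(q)[\<pi>]\<close>-algebra \<open>U\<close>\<close>

definition U_super_ext ::
  "('i, 'p::ab_group_add) superdatum \<Rightarrow> ('i, 'p, rfun sqrtpi_ext,
     ((rat sqrtpi_ext \<times> ('i gen list \<Rightarrow>\<^sub>0 rfun pi_ext) set) \<Rightarrow>\<^sub>0 int) set) gr_algebra" where
  "U_super_ext C = sqrtpi_tensor (pi_incl :: rat pi_ext \<Rightarrow> _) (Poly_Mapping.map rfun_of_rat)
     (\<lambda>x k. scalar_const (Poly_Mapping.lookup x k)) (U_super C)"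

text \<open>
  \<open>\<rat>[\<surd>\<pi>] \<otimes>\<^sub>\<rat> U\<^sub>v\<close> for the \<open>\<rat>(v)\<close>-algebra \<open>U\<^sub>v\<close>: the coefficients of an element of
  \<open>\<rat>(q)[\<surd>\<pi>]\<close> are those in \<open>\<rat>(v)\<close>, \<open>v = q \<surd>\<pi>\<close>.
\<close>

definition U_v_ext ::
  "('i, 'p::ab_group_add) superdatum \<Rightarrow> ('i, 'p, rfun sqrtpi_ext,
     ((rat sqrtpi_ext \<times> ('i gen list \<Rightarrow>\<^sub>0 rfun) set) \<Rightarrow>\<^sub>0 int) set) gr_algebra" where
  "U_v_ext C = sqrtpi_tensor (scalar_const :: rat \<Rightarrow> _) rfun_of_rat
     (\<lambda>x. Poly_Mapping.lookup (the_inv v_ident x)) (U_v C)"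


section \<open>Weight modules\<close>

text \<open>
  Modules are \<^term>\<open>Module.module\<close> records (whose ring multiplication and unit are not used)
  together with the family of weight spaces, which is part of the structure.
\<close>

record ('a, 'v, 'p) wt_module = "('a, 'v) module" +
  wtsp :: "'p \<Rightarrow> 'v set"

text \<open>The library's module locale requires a commutative base ring.\<close>

locale left_module = R?: ring R + V?: abelian_group V
  for R :: "('a, 'x) ring_scheme" (structure) and V :: "('a, 'v, 'y) module_scheme" (structure) +
  assumes smult_closed: "\<lbrakk>a \<in> carrier R; x \<in> carrier V\<rbrakk> \<Longrightarrow> a \<odot>\<^bsub>V\<^esub> x \<in> carrier V"
    and smult_l_distr: "\<lbrakk>a \<in> carrier R; b \<in> carrier R; x \<in> carrier V\<rbrakk>
      \<Longrightarrow> (a \<oplus>\<^bsub>R\<^esub> b) \<odot>\<^bsub>V\<^esub> x = a \<odot>\<^bsub>V\<^esub> x \<oplus>\<^bsub>V\<^esub> b \<odot>\<^bsub>V\<^esub> x"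
    and smult_r_distr: "\<lbrakk>a \<in> carrier R; x \<in> carrier V; y \<in> carrier V\<rbrakk>
      \<Longrightarrow> a \<odot>\<^bsub>V\<^esub> (x \<oplus>\<^bsub>V\<^esub> y) = a \<odot>\<^bsub>V\<^esub> x \<oplus>\<^bsub>V\<^esub> a \<odot>\<^bsub>V\<^esub> y"
    and smult_assoc: "\<lbrakk>a \<in> carrier R; b \<in> carrier R; x \<in> carrier V\<rbrakk>
      \<Longrightarrow> (a \<otimes>\<^bsub>R\<^esub> b) \<odot>\<^bsub>V\<^esub> x = a \<odot>\<^bsub>V\<^esub> (b \<odot>\<^bsub>V\<^esub> x)"
    and smult_one: "x \<in> carrier V \<Longrightarrow> \<one>\<^bsub>R\<^esub> \<odot>\<^bsub>V\<^esub> x = x"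

definition direct_sum_decomp :: "('v, 'x) ring_scheme \<Rightarrow> ('p \<Rightarrow> 'v set) \<Rightarrow> bool" where
  "direct_sum_decomp V W \<longleftrightarrow> (\<forall>\<mu>. subgroup (W \<mu>) (add_monoid V)) \<and>
     (\<forall>x \<in> carrier V. \<exists>!c. finite {\<mu>. c \<mu> \<noteq> \<zero>\<^bsub>V\<^esub>} \<and> (\<forall>\<mu>. c \<mu> \<in> W \<mu>) \<and>
        x = (\<Oplus>\<^bsub>V\<^esub>\<mu>\<in>{\<mu>. c \<mu> \<noteq> \<zero>\<^bsub>V\<^esub>}. c \<mu>))"

text \<open>\<open>\<kappa> i n\<close> is the scalar by which \<open>K\<^sub>i\<close> acts on \<open>V\<^sub>\<mu>\<close> when \<open>\<langle>h\<^sub>i, \<mu>\<rangle> = n\<close>.\<close>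

definition weight_module ::
  "('i, 'p::ab_group_add) superdatum \<Rightarrow> ('i, 'p, 'k, 'a) gr_algebra \<Rightarrow> ('i \<Rightarrow> int \<Rightarrow> 'k) \<Rightarrow>
   ('a, 'v, 'p) wt_module \<Rightarrow> bool" where
  "weight_module C A \<kappa> V \<longleftrightarrow> left_module A V \<and> direct_sum_decomp V (wtsp V) \<and>
     (\<forall>\<beta> \<mu>. \<forall>a \<in> hcomp A \<beta>. \<forall>x \<in> wtsp V \<mu>. a \<odot>\<^bsub>V\<^esub> x \<in> wtsp V (\<mu> + \<beta>)) \<and>
     (\<forall>i \<mu>. \<forall>x \<in> wtsp V \<mu>. Kel A i \<odot>\<^bsub>V\<^esub> x = scl A (\<kappa> i (crt C i \<mu>)) \<odot>\<^bsub>V\<^esub> x)"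

definition wt_hom ::
  "('i, 'p, 'k, 'a) gr_algebra \<Rightarrow> ('a, 'v, 'p) wt_module \<Rightarrow> ('a, 'v, 'p) wt_module \<Rightarrow> ('v \<Rightarrow> 'v) set"
where
  "wt_hom A V W = {f \<in> carrier V \<rightarrow>\<^sub>E carrier W.
     (\<forall>x \<in> carrier V. \<forall>y \<in> carrier V. f (x \<oplus>\<^bsub>V\<^esub> y) = f x \<oplus>\<^bsub>W\<^esub> f y) \<and>
     (\<forall>a \<in> carrier A. \<forall>x \<in> carrier V. f (a \<odot>\<^bsub>V\<^esub> x) = a \<odot>\<^bsub>W\<^esub> f x) \<and>
     (\<forall>\<mu>. f ` wtsp V \<mu> \<subseteq> wtsp W \<mu>)}"

definition ModP ::
  "('i, 'p::ab_group_add) superdatum \<Rightarrow> ('i, 'p, 'k, 'a) gr_algebra \<Rightarrow> ('i \<Rightarrow> int \<Rightarrow> 'k) \<Rightarrow>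
   (('a, 'v, 'p) wt_module, 'v \<Rightarrow> 'v) cat" where
  "ModP C A \<kappa> = \<lparr>Ob = {V. weight_module C A \<kappa> V}, Hom = wt_hom A,
     Idt = (\<lambda>V. \<lambda>x\<in>carrier V. x), Cmp = (\<lambda>U V W g f. compose (carrier U) g f)\<rparr>"

text \<open>Finite dimension is over the field \<open>\<rat>(q)\<close>.\<close>

definition fin_dim_wtsp ::
  "('i, 'p, rfun sqrtpi_ext, 'a) gr_algebra \<Rightarrow> ('a, 'v, 'p) wt_module \<Rightarrow> 'p \<Rightarrow> bool" where
  "fin_dim_wtsp A V \<mu> \<longleftrightarrow> (\<exists>B. finite B \<and> B \<subseteq> wtsp V \<mu> \<and>
     (\<forall>x \<in> wtsp V \<mu>. \<exists>c. x = (\<Oplus>\<^bsub>V\<^esub>b\<in>B. scl A (scalar_const (c b)) \<odot>\<^bsub>V\<^esub> b)))"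

definition integrable_O ::
  "('i, 'p::ab_group_add) superdatum \<Rightarrow> ('i, 'p, rfun sqrtpi_ext, 'a) gr_algebra \<Rightarrow>
   ('a, 'v, 'p) wt_module \<Rightarrow> bool" where
  "integrable_O C A V \<longleftrightarrow> (\<forall>\<mu>. fin_dim_wtsp A V \<mu>) \<and>
     (\<exists>\<Lambda>. finite \<Lambda> \<and> (\<forall>\<mu>. wtsp V \<mu> \<noteq> {\<zero>\<^bsub>V\<^esub>} \<longrightarrow> (\<exists>\<nu>\<in>\<Lambda>. \<exists>\<beta>\<in>Qplus C. \<mu> = \<nu> - \<beta>))) \<and>
     (\<forall>i. \<forall>x \<in> carrier V. \<exists>n. ((\<lambda>y. eel A i \<odot>\<^bsub>V\<^esub> y) ^^ n) x = \<zero>\<^bsub>V\<^esub>) \<and>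
     (\<forall>i. \<forall>x \<in> carrier V. \<exists>n. ((\<lambda>y. fel A i \<odot>\<^bsub>V\<^esub> y) ^^ n) x = \<zero>\<^bsub>V\<^esub>)"

definition Oint ::
  "('i, 'p::ab_group_add) superdatum \<Rightarrow> ('i, 'p, rfun sqrtpi_ext, 'a) gr_algebra \<Rightarrow>
   ('i \<Rightarrow> int \<Rightarrow> rfun sqrtpi_ext) \<Rightarrow> (('a, 'v, 'p) wt_module, 'v \<Rightarrow> 'v) cat" where
  "Oint C A \<kappa> = full_subcat (ModP C A \<kappa>) (integrable_O C A)"

definition eig_super :: "('i, 'p) superdatum \<Rightarrow> 'i \<Rightarrow> int \<Rightarrow> rfun sqrtpi_ext" where
  "eig_super C i n = zpow (scalar_const (q_sub C i) ^ 2 * pi4 ^ par C i) n"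

definition eig_sqrt ::
  "('i, 'p) superdatum \<Rightarrow> ('i \<Rightarrow> int sqrtpi_ext) \<Rightarrow> 'i \<Rightarrow> int \<Rightarrow> rfun sqrtpi_ext" where
  "eig_sqrt C r i n = zpow (p_sub C r i) n"

definition eig_v :: "('i, 'p) superdatum \<Rightarrow> 'i \<Rightarrow> int \<Rightarrow> rfun sqrtpi_ext" where
  "eig_v C i n = zpow v_elt (int (dd C i) * n)"

end

theory Submission
  imports Defs
begin

text \<open>
  On a weight module the \<open>K\<^sub>i\<close> act by prescribed scalars. Hence a weight module over any of the three
  algebras is the same thing as a \<open>P\<close>-graded module over \<open>\<rat>(q)\<close> extended by \<open>\<surd>\<pi>\<close>, with operators \<open>E\<^sub>i\<close>, \<open>F\<^sub>i\<close> of
  degree \<open>\<plusminus>\<alpha>\<^sub>i\<close> subject to commutation and Serre relations. Replacing \<open>E\<^sub>i\<close>, \<open>F\<^sub>i\<close> on \<open>V\<^sub>\<mu>\<close> by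
  \<open>c\<^sub>i(\<mu>) E\<^sub>i\<close>, \<open>d\<^sub>i(\<mu>) F\<^sub>i\<close> with units \<open>c\<^sub>i(\<mu>)\<close>, \<open>d\<^sub>i(\<mu>)\<close> for which the ratios
  \<open>c\<^sub>i(\<mu> + \<alpha>\<^sub>j) / c\<^sub>i(\<mu>)\<close> do not depend on \<open>\<mu>\<close> only changes the constants in these relations, and it keeps
  the morphisms. Units that turn the constants of one algebra into those of another exist: as the
  \<open>\<alpha>\<^sub>i\<close> are linearly independent, the ratios may be prescribed along each coset of the root lattice, and a
  total order on \<open>I\<close> distributes a symmetric family of constants over the ordered pairs.
  The parity condition gives \<open>(\<surd>\<pi>) ^ (2 d\<^sub>i) = \<pi>\<^sub>i\<close>, so that \<open>p\<^sub>i\<close> and \<open>v ^ d\<^sub>i\<close> differ by an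
  involution, and the symmetry \<open>d\<^sub>i a\<^sub>i\<^sub>j = d\<^sub>j a\<^sub>j\<^sub>i\<close> removes the remaining signs.
\<close>

section \<open>Homomorphisms out of quotient and monoid algebras\<close>

text \<open>No ring map between the algebras is used: the twisting units depend on the weight, so
  they exist only as operators on weight modules. The action of the second algebra is produced
  instead by its universal property, as a ring homomorphism into the additive endomorphisms of the
  same group. Hence quotients, free algebras and tensor products must be mapped into a
  noncommutative target. The algebra with \<surd>\<pi> is the hub: its constants are turned into
  those of the other two, and inverse units lead back. The functors keep sets and maps, but a twist
  followed by its inverse is compared with the original only on generators and weight vectors;
  therefore the identity map appears as a natural isomorphism and not as an equality of modules. The
  scalars Q(q)[\<surd>\<pi>] have zero divisors, so every denominator has to be shown invertible.
  The uniform device is to exhibit a multiple of it that is a nonzero element of Q(q).\<close>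

lemma quotient_ring_hom_ex:
  assumes "ring R" "ring E" "h \<in> ring_hom R E" "ideal I R" "\<And>x. x \<in> I \<Longrightarrow> h x = \<zero>\<^bsub>E\<^esub>"
  shows "\<exists>\<Phi> \<in> ring_hom (R Quot I) E. \<forall>x\<in>carrier R. \<Phi> (I +>\<^bsub>R\<^esub> x) = h x"
proof -
  interpret R: ring R by fact
  interpret E: ring E by fact
  interpret I: ideal I R by fact
  interpret h: ring_hom_ring R E h by (rule ring_hom_ringI2) (use assms in auto)
  have const: "h y = h x" if "x \<in> carrier R" and y: "y \<in> I +>\<^bsub>R\<^esub> x" for x y
  proof -
    obtain a where a: "a \<in> I" "y = a \<oplus>\<^bsub>R\<^esub> x" using y by (auto simp: a_r_coset_def')
    then have "a \<in> carrier R" using I.Icarr by auto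
    then show ?thesis using a that assms(5) by simp
  qed
  have self: "x \<in> I +>\<^bsub>R\<^esub> x" if "x \<in> carrier R" for x
    using that I.a_rcos_self by auto
  \<comment> \<open>Evaluation at a chosen representative; by \<open>const\<close> the choice does
    not matter, since elements of one coset differ by something that \<open>h\<close> kills.\<close>
  define \<Phi> where "\<Phi> Z = h (SOME x. x \<in> Z)" for Z
  have eq: "\<Phi> (I +>\<^bsub>R\<^esub> x) = h x" if "x \<in> carrier R" for x
    unfolding \<Phi>_def using const[OF that] someI[of "\<lambda>y. y \<in> I +>\<^bsub>R\<^esub> x", OF self[OF that]] by blast
  have car: "carrier (R Quot I) = (\<lambda>x. I +>\<^bsub>R\<^esub> x) ` carrier R"
    by (auto simp: FactRing_def A_RCOSETS_def')
  have "\<Phi> \<in> ring_hom (R Quot I) E"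
  proof (rule ring_hom_memI)
    fix Z Y assume "Z \<in> carrier (R Quot I)" "Y \<in> carrier (R Quot I)"
    then obtain x y where xy: "x \<in> carrier R" "Z = I +>\<^bsub>R\<^esub> x" "y \<in> carrier R" "Y = I +>\<^bsub>R\<^esub> y"
      unfolding car by auto
    have m: "Z \<otimes>\<^bsub>R Quot I\<^esub> Y = I +>\<^bsub>R\<^esub> (x \<otimes>\<^bsub>R\<^esub> y)" "Z \<oplus>\<^bsub>R Quot I\<^esub> Y = I +>\<^bsub>R\<^esub> (x \<oplus>\<^bsub>R\<^esub> y)"
      using ring_hom_memE(2,3)[OF I.rcos_ring_hom, of x y] xy by auto
    show "\<Phi> (Z \<otimes>\<^bsub>R Quot I\<^esub> Y) = \<Phi> Z \<otimes>\<^bsub>E\<^esub> \<Phi> Y" "\<Phi> (Z \<oplus>\<^bsub>R Quot I\<^esub> Y) = \<Phi> Z \<oplus>\<^bsub>E\<^esub> \<Phi> Y"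
      unfolding m using xy by (simp_all add: eq)
  next
    fix Z assume "Z \<in> carrier (R Quot I)"
    then show "\<Phi> Z \<in> carrier E" unfolding car by (auto simp: eq)
  next
    have "\<one>\<^bsub>R Quot I\<^esub> = I +>\<^bsub>R\<^esub> \<one>\<^bsub>R\<^esub>" by (simp add: FactRing_def)
    then show "\<Phi> \<one>\<^bsub>R Quot I\<^esub> = \<one>\<^bsub>E\<^esub>" by (simp add: eq)
  qed
  then show ?thesis using eq by auto
qed

section \<open>Universal property of monoid algebras\<close>

definition scalar_hom :: "('k::comm_ring_1 \<Rightarrow> 'e) \<Rightarrow> ('e, 'y) ring_scheme \<Rightarrow> bool" where
  "scalar_hom \<rho> E \<longleftrightarrow> range \<rho> \<subseteq> carrier E \<and> \<rho> 1 = \<one>\<^bsub>E\<^esub> \<and>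
     (\<forall>a b. \<rho> (a + b) = \<rho> a \<oplus>\<^bsub>E\<^esub> \<rho> b) \<and> (\<forall>a b. \<rho> (a * b) = \<rho> a \<otimes>\<^bsub>E\<^esub> \<rho> b)"

lemma scalar_homD:
  assumes "scalar_hom \<rho> E"
  shows "\<rho> a \<in> carrier E" "\<rho> 1 = \<one>\<^bsub>E\<^esub>" "\<rho> (a + b) = \<rho> a \<oplus>\<^bsub>E\<^esub> \<rho> b" "\<rho> (a * b) = \<rho> a \<otimes>\<^bsub>E\<^esub> \<rho> b"
  using assms by (auto simp: scalar_hom_def)

lemma scalar_hom_zero:
  assumes "ring E" "scalar_hom \<rho> E"
  shows "\<rho> 0 = \<zero>\<^bsub>E\<^esub>"
proof -
  interpret ring E by fact
  have "\<rho> 0 \<oplus>\<^bsub>E\<^esub> \<rho> 0 = \<rho> 0" "\<rho> 0 \<in> carrier E"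
    using scalar_homD(1)[OF assms(2), of 0] scalar_homD(3)[OF assms(2), of 0 0] by auto
  then show ?thesis using add.l_cancel_one[of "\<rho> 0" "\<rho> 0"] by simp
qed

lemma monoid_algebra_simps:
  "\<zero>\<^bsub>monoid_algebra M\<^esub> = 0" "f \<oplus>\<^bsub>monoid_algebra M\<^esub> g = f + g"
  "\<one>\<^bsub>monoid_algebra M\<^esub> = Poly_Mapping.single \<one>\<^bsub>M\<^esub> 1"
  "f \<in> carrier (monoid_algebra M) \<longleftrightarrow> Poly_Mapping.keys f \<subseteq> carrier M"
  by (simp_all add: monoid_algebra_def)

lemma monoid_algebra_diff_closed:
  "f \<in> carrier (monoid_algebra M) \<Longrightarrow> g \<in> carrier (monoid_algebra M) \<Longrightarrow>
    f - g \<in> carrier (monoid_algebra M)"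
  using keys_diff[of f g] by (auto simp: monoid_algebra_simps)

lemma monoid_algebra_minus:
  assumes "monoid M" "f \<in> carrier (monoid_algebra M)" "g \<in> carrier (monoid_algebra M)"
  shows "f \<ominus>\<^bsub>monoid_algebra M\<^esub> g = f - g"
proof -
  interpret ring "monoid_algebra M" by (rule ring_monoid_algebra) fact
  have g: "- g \<in> carrier (monoid_algebra M)"
    using assms(3) by (auto simp: monoid_algebra_simps)
  have "- g \<oplus>\<^bsub>monoid_algebra M\<^esub> g = \<zero>\<^bsub>monoid_algebra M\<^esub>"
    by (simp add: monoid_algebra_simps)
  then have "\<ominus>\<^bsub>monoid_algebra M\<^esub> g = - g"
    using minus_equality assms(3) g by blast
  then show ?thesis by (simp add: a_minus_def monoid_algebra_simps)
qed

text \<open>As \<open>E\<close> is not commutative, \<open>comm\<close> is what lets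
  \<open>\<rho> b\<close> pass \<open>m x\<close> in the product of two monomials. The instances are
  words acting on a weight module, and the free abelian group behind a tensor product.\<close>

lemma monoid_algebra_hom_ex:
  fixes \<rho> :: "'k::comm_ring_1 \<Rightarrow> 'e" and M :: "('m, 'x) monoid_scheme"
  assumes "ring E" "monoid M" and \<rho>: "scalar_hom \<rho> E"
    and m: "\<And>x. x \<in> carrier M \<Longrightarrow> m x \<in> carrier E" "m \<one>\<^bsub>M\<^esub> = \<one>\<^bsub>E\<^esub>"
      "\<And>x y. x \<in> carrier M \<Longrightarrow> y \<in> carrier M \<Longrightarrow> m (x \<otimes>\<^bsub>M\<^esub> y) = m x \<otimes>\<^bsub>E\<^esub> m y"
    and comm: "\<And>a x. x \<in> carrier M \<Longrightarrow> m x \<otimes>\<^bsub>E\<^esub> \<rho> a = \<rho> a \<otimes>\<^bsub>E\<^esub> m x"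
  shows "\<exists>\<Phi> \<in> ring_hom (monoid_algebra M) E. \<forall>x\<in>carrier M. \<forall>a.
    \<Phi> (Poly_Mapping.single x a) = \<rho> a \<otimes>\<^bsub>E\<^esub> m x"
proof -
  interpret E: ring E by fact
  interpret M: monoid M by fact
  interpret A: ring "monoid_algebra M :: ('m \<Rightarrow>\<^sub>0 'k) ring" by (rule ring_monoid_algebra) fact
  let ?A = "monoid_algebra M :: ('m \<Rightarrow>\<^sub>0 'k) ring"
  note \<rho>D = scalar_homD[OF \<rho>]
  note \<rho>0 = scalar_hom_zero[OF \<open>ring E\<close> \<rho>]
  define \<Phi> where "\<Phi> f = (\<Oplus>\<^bsub>E\<^esub>x\<in>Poly_Mapping.keys f. \<rho> (Poly_Mapping.lookup f x) \<otimes>\<^bsub>E\<^esub> m x)"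
    for f :: "'m \<Rightarrow>\<^sub>0 'k"
  have ext: "\<Phi> f = (\<Oplus>\<^bsub>E\<^esub>x\<in>S. \<rho> (Poly_Mapping.lookup f x) \<otimes>\<^bsub>E\<^esub> m x)"
    if "finite S" "Poly_Mapping.keys f \<subseteq> S" "S \<subseteq> carrier M" for f S
    unfolding \<Phi>_def
    by (rule E.add.finprod_mono_neutral_cong_left) (use that m \<rho>D in \<open>auto simp: in_keys_iff \<rho>0\<close>)
  have \<Phi>_single: "\<Phi> (Poly_Mapping.single x a) = \<rho> a \<otimes>\<^bsub>E\<^esub> m x" if "x \<in> carrier M" for x a
    using that by (subst ext[of "{x}"]) (auto simp: m \<rho>D)
  have closed: "\<Phi> f \<in> carrier E" if "f \<in> carrier ?A" for f
    unfolding \<Phi>_def using that by (intro E.finsum_closed) (auto simp: m \<rho>D monoid_algebra_simps)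
  have \<Phi>_add: "\<Phi> (f + g) = \<Phi> f \<oplus>\<^bsub>E\<^esub> \<Phi> g" if "f \<in> carrier ?A" "g \<in> carrier ?A" for f g
  proof -
    let ?S = "Poly_Mapping.keys f \<union> Poly_Mapping.keys g"
    have S: "finite ?S" "?S \<subseteq> carrier M" using that by (auto simp: monoid_algebra_simps)
    have "\<Phi> (f + g) = (\<Oplus>\<^bsub>E\<^esub>x\<in>?S. \<rho> (Poly_Mapping.lookup f x) \<otimes>\<^bsub>E\<^esub> m x \<oplus>\<^bsub>E\<^esub>
        \<rho> (Poly_Mapping.lookup g x) \<otimes>\<^bsub>E\<^esub> m x)"
      using S Poly_Mapping.keys_add[of f g]
      by (subst ext[of ?S])
        (auto intro!: E.finsum_cong' simp: lookup_add \<rho>D m E.l_distr subset_iff simp flip: E.finsum_addf)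
    also have "\<dots> = (\<Oplus>\<^bsub>E\<^esub>x\<in>?S. \<rho> (Poly_Mapping.lookup f x) \<otimes>\<^bsub>E\<^esub> m x) \<oplus>\<^bsub>E\<^esub>
        (\<Oplus>\<^bsub>E\<^esub>x\<in>?S. \<rho> (Poly_Mapping.lookup g x) \<otimes>\<^bsub>E\<^esub> m x)"
      using S by (intro E.finsum_addf) (auto simp: \<rho>D m)
    also have "\<dots> = \<Phi> f \<oplus>\<^bsub>E\<^esub> \<Phi> g"
      using S by (simp add: ext[of ?S])
    finally show ?thesis .
  qed
  have \<Phi>_zero: "\<Phi> 0 = \<zero>\<^bsub>E\<^esub>" by (simp add: \<Phi>_def)
  note dist = monoid_algebra_distrib_left monoid_algebra_distrib_right
  have mult: "\<Phi> (f \<otimes>\<^bsub>?A\<^esub> g) = \<Phi> f \<otimes>\<^bsub>E\<^esub> \<Phi> g" if f: "f \<in> carrier ?A" and g: "g \<in> carrier ?A" for f g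
  proof -
    \<comment> \<open>Membership is part of the induction claim: the additive case of the induction
      rule supplies only the claim itself, and additivity of \<open>\<Phi>\<close> needs
      membership.\<close>
    have "f \<in> carrier ?A \<and> \<Phi> (f \<otimes>\<^bsub>?A\<^esub> g) = \<Phi> f \<otimes>\<^bsub>E\<^esub> \<Phi> g"
      using f
    proof (induction f rule: monoid_algebra_induct)
      case zero
      then show ?case using g closed by (simp add: monoid_algebra_zero_mult \<Phi>_zero monoid_algebra_simps)
    next
      case (add f1 f2)
      then have "f1 \<in> carrier ?A" "f2 \<in> carrier ?A" by auto
      then have "f1 \<oplus>\<^bsub>?A\<^esub> f2 \<in> carrier ?A" by blast
      then show ?case
        using add g A.m_closed[of f1 g] A.m_closed[of f2 g]
        by (simp add: dist \<Phi>_add closed E.l_distr monoid_algebra_simps(2))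
    next
      case (single x a)
      have "g \<in> carrier ?A \<and> \<Phi> (Poly_Mapping.single x a \<otimes>\<^bsub>?A\<^esub> g) = \<Phi> (Poly_Mapping.single x a) \<otimes>\<^bsub>E\<^esub> \<Phi> g"
        using g
      proof (induction g rule: monoid_algebra_induct)
        case zero
        then show ?case using single closed[of "Poly_Mapping.single x a"]
          by (simp add: monoid_algebra_zero_mult \<Phi>_zero monoid_algebra_simps)
      next
        case (add g1 g2)
        then have g12: "g1 \<in> carrier ?A" "g2 \<in> carrier ?A" by auto
        then have "g1 \<oplus>\<^bsub>?A\<^esub> g2 \<in> carrier ?A" by blast
        moreover have s: "Poly_Mapping.single x a \<in> carrier ?A"
          using single by (simp add: monoid_algebra_simps)
        ultimately show ?case
          using add A.m_closed[OF s g12(1)] A.m_closed[OF s g12(2)] g12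
          by (simp add: dist \<Phi>_add closed E.r_distr monoid_algebra_simps(2))
      next
        case (single y b)
        have "\<Phi> (Poly_Mapping.single x a \<otimes>\<^bsub>?A\<^esub> Poly_Mapping.single y b) =
            \<rho> a \<otimes>\<^bsub>E\<^esub> (\<rho> b \<otimes>\<^bsub>E\<^esub> m x) \<otimes>\<^bsub>E\<^esub> m y"
          using \<open>x \<in> carrier M\<close> \<open>y \<in> carrier M\<close>
          by (simp add: monoid_algebra_mult_single \<Phi>_single m \<rho>D E.m_assoc)
        also have "\<dots> = \<rho> a \<otimes>\<^bsub>E\<^esub> (m x \<otimes>\<^bsub>E\<^esub> \<rho> b) \<otimes>\<^bsub>E\<^esub> m y"
          using \<open>x \<in> carrier M\<close> by (simp add: comm)
        also have "\<dots> = \<Phi> (Poly_Mapping.single x a) \<otimes>\<^bsub>E\<^esub> \<Phi> (Poly_Mapping.single y b)"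
          using \<open>x \<in> carrier M\<close> \<open>y \<in> carrier M\<close> by (simp add: \<Phi>_single m \<rho>D E.m_assoc)
        finally show ?case
          using \<open>y \<in> carrier M\<close> by (simp add: monoid_algebra_simps)
      qed
      then show ?case using single by (simp add: monoid_algebra_simps)
    qed
    then show ?thesis by blast
  qed
  have "\<Phi> \<in> ring_hom ?A E"
    by (rule ring_hom_memI) (use closed mult \<Phi>_add in \<open>auto simp: monoid_algebra_simps \<Phi>_single m \<rho>D\<close>)
  then show ?thesis using \<Phi>_single by blast
qed

section \<open>Endomorphism rings and modules\<close>

text \<open>Endomorphisms take the fixed value \<open>undefined\<close> outside the carrier, so two
  of them that agree on the carrier are equal and the ring axioms hold as genuine equations.\<close>

definition add_end :: "('v, 'x) ring_scheme \<Rightarrow> ('v \<Rightarrow> 'v) set" where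
  "add_end V = {f \<in> carrier V \<rightarrow>\<^sub>E carrier V.
     \<forall>x\<in>carrier V. \<forall>y\<in>carrier V. f (x \<oplus>\<^bsub>V\<^esub> y) = f x \<oplus>\<^bsub>V\<^esub> f y}"

definition end_ring :: "('v, 'x) ring_scheme \<Rightarrow> ('v \<Rightarrow> 'v) ring" where
  "end_ring V = \<lparr>carrier = add_end V, monoid.mult = (\<lambda>f g. compose (carrier V) f g),
     one = (\<lambda>x\<in>carrier V. x), zero = (\<lambda>x\<in>carrier V. \<zero>\<^bsub>V\<^esub>),
     add = (\<lambda>f g. \<lambda>x\<in>carrier V. f x \<oplus>\<^bsub>V\<^esub> g x)\<rparr>"

lemma end_ring_apply:
  "x \<in> carrier V \<Longrightarrow> (f \<otimes>\<^bsub>end_ring V\<^esub> g) x = f (g x)"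
  "x \<in> carrier V \<Longrightarrow> (f \<oplus>\<^bsub>end_ring V\<^esub> g) x = f x \<oplus>\<^bsub>V\<^esub> g x"
  "x \<in> carrier V \<Longrightarrow> \<one>\<^bsub>end_ring V\<^esub> x = x"
  "x \<in> carrier V \<Longrightarrow> \<zero>\<^bsub>end_ring V\<^esub> x = \<zero>\<^bsub>V\<^esub>"
  "f \<in> carrier (end_ring V) \<Longrightarrow> x \<in> carrier V \<Longrightarrow> f x \<in> carrier V"
  by (auto simp: end_ring_def compose_def add_end_def)

lemma end_ring_eqI:
  assumes "f \<in> carrier (end_ring V)" "g \<in> carrier (end_ring V)" "\<And>x. x \<in> carrier V \<Longrightarrow> f x = g x"
  shows "f = g"
  using assms by (auto simp: end_ring_def add_end_def intro: PiE_ext)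

context abelian_group
begin

lemma end_ring_memI:
  assumes "\<And>x. x \<in> carrier G \<Longrightarrow> f x \<in> carrier G"
    and "\<And>x y. x \<in> carrier G \<Longrightarrow> y \<in> carrier G \<Longrightarrow> f (x \<oplus> y) = f x \<oplus> f y"
  shows "(\<lambda>x\<in>carrier G. f x) \<in> carrier (end_ring G)"
  using assms by (auto simp: end_ring_def add_end_def)

lemma end_ring_memD:
  assumes "f \<in> carrier (end_ring G)"
  shows "f \<in> carrier G \<rightarrow>\<^sub>E carrier G"
    "x \<in> carrier G \<Longrightarrow> y \<in> carrier G \<Longrightarrow> f (x \<oplus> y) = f x \<oplus> f y"
  using assms by (auto simp: end_ring_def add_end_def)

lemma ring_end_ring: "ring (end_ring G)"
proof -
  have add_mem: "f \<oplus>\<^bsub>end_ring G\<^esub> g \<in> carrier (end_ring G)"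
    if "f \<in> carrier (end_ring G)" "g \<in> carrier (end_ring G)" for f g
  proof -
    have "(\<lambda>x\<in>carrier G. f x \<oplus> g x) \<in> carrier (end_ring G)"
      by (rule end_ring_memI)
        (use that in \<open>auto simp: end_ring_memD end_ring_apply a_ac\<close>)
    then show ?thesis by (simp add: end_ring_def)
  qed
  have mult_mem: "f \<otimes>\<^bsub>end_ring G\<^esub> g \<in> carrier (end_ring G)"
    if "f \<in> carrier (end_ring G)" "g \<in> carrier (end_ring G)" for f g
  proof -
    have "(\<lambda>x\<in>carrier G. f (g x)) \<in> carrier (end_ring G)"
      by (rule end_ring_memI)
        (use that in \<open>auto simp: end_ring_memD end_ring_apply a_ac\<close>)
    then show ?thesis by (simp add: end_ring_def compose_def)
  qed
  have one_mem: "\<one>\<^bsub>end_ring G\<^esub> \<in> carrier (end_ring G)"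
    and zero_mem: "\<zero>\<^bsub>end_ring G\<^esub> \<in> carrier (end_ring G)"
    by (auto simp: end_ring_def add_end_def)
  note mem = add_mem mult_mem one_mem zero_mem
  show ?thesis
  proof (rule ringI)
    show "abelian_group (end_ring G)"
    proof (rule abelian_groupI)
      fix f assume f: "f \<in> carrier (end_ring G)"
      let ?g = "\<lambda>x\<in>carrier G. \<ominus> f x"
      have g: "?g \<in> carrier (end_ring G)"
        by (rule end_ring_memI)
          (use f in \<open>auto simp: end_ring_memD end_ring_apply minus_add a_ac\<close>)
      have "?g \<oplus>\<^bsub>end_ring G\<^esub> f = \<zero>\<^bsub>end_ring G\<^esub>"
        by (rule end_ring_eqI[of _ G]) (use f g in \<open>auto simp: mem end_ring_apply l_neg\<close>)
      then show "\<exists>g\<in>carrier (end_ring G). g \<oplus>\<^bsub>end_ring G\<^esub> f = \<zero>\<^bsub>end_ring G\<^esub>" using g by blast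
    qed (auto intro!: end_ring_eqI mem simp: end_ring_apply a_ac)
    show "monoid (end_ring G)"
      by (rule monoidI) (auto intro!: end_ring_eqI mem simp: end_ring_apply)
  qed (auto intro!: end_ring_eqI mem simp: end_ring_apply end_ring_memD)
qed

end

text \<open>Every module over a twisted algebra arises this way: a universal property delivers
  \<open>\<Phi>\<close>, and the action is compared with it on the carriers only.\<close>

lemma left_module_of_end_hom:
  assumes "ring A" "abelian_group V" "\<Phi> \<in> ring_hom A (end_ring V)"
    and "\<And>a x. a \<in> carrier A \<Longrightarrow> x \<in> carrier V \<Longrightarrow> a \<odot>\<^bsub>V\<^esub> x = \<Phi> a x"
  shows "left_module A V"
proof -
  interpret A: ring A by fact
  interpret V: abelian_group V by fact
  have c: "\<Phi> a \<in> carrier (end_ring V)" if "a \<in> carrier A" for a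
    using assms(3) that by (rule ring_hom_closed)
  show ?thesis
    by unfold_locales
      (use assms(3) c in \<open>auto simp: assms(4) ring_hom_add ring_hom_mult ring_hom_one end_ring_apply
        V.end_ring_memD\<close>)
qed

text \<open>Restriction of scalars along \<open>\<phi>\<close>. \<open>V'\<close> shares the
  additive group with \<open>V\<close> but is a separate record, because its action has another type
  of scalars.\<close>

lemma left_module_restrict:
  assumes "left_module A V" "ring B" "\<phi> \<in> ring_hom B A"
    "carrier V' = carrier V" "add V' = add V" "zero V' = zero V"
    "\<And>b x. b \<in> carrier B \<Longrightarrow> x \<in> carrier V \<Longrightarrow> b \<odot>\<^bsub>V'\<^esub> x = \<phi> b \<odot>\<^bsub>V\<^esub> x"
  shows "left_module B V'"
proof -
  interpret left_module A V by fact
  interpret B: ring B by fact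
  have "abelian_group V'"
    by (rule abelian_groupI) (auto simp: assms V.a_ac V.l_neg intro: bexI[of _ "\<ominus>\<^bsub>V\<^esub> _"])
  then interpret V': abelian_group V' .
  note c = ring_hom_closed[OF assms(3)]
  show ?thesis
    by unfold_locales
      (use assms(3) c in \<open>auto simp: assms(4-) ring_hom_add ring_hom_mult ring_hom_one smult_closed
        smult_l_distr smult_r_distr smult_assoc smult_one\<close>)
qed

section \<open>Weight decompositions\<close>

context abelian_group
begin

lemma minus_eq_iff:
  assumes "a \<in> carrier G" "b \<in> carrier G" "c \<in> carrier G"
  shows "a \<ominus> b = c \<longleftrightarrow> a = b \<oplus> c"
  using add.inv_solve_right[of c a b] assms by (auto simp: minus_eq a_comm)

lemma minus_eq_zero_iff:
  "a \<in> carrier G \<Longrightarrow> b \<in> carrier G \<Longrightarrow> a \<ominus> b = \<zero> \<longleftrightarrow> a = b"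
  using minus_eq_iff[of a b \<zero>] by simp

end

locale weight_decomposition = abelian_group V for V :: "('v, 'x) ring_scheme" (structure) +
  fixes W :: "'p::ab_group_add \<Rightarrow> 'v set"
  assumes decomp: "direct_sum_decomp V W"
begin

lemma W_subgroup: "subgroup (W \<mu>) (add_monoid V)"
  using decomp by (auto simp: direct_sum_decomp_def)

lemma W_carrier: "x \<in> W \<mu> \<Longrightarrow> x \<in> carrier V"
  using subgroup.subset[OF W_subgroup] by auto

lemma W_zero: "\<zero> \<in> W \<mu>"
  using subgroup.one_closed[OF W_subgroup] by simp

lemma W_add: "x \<in> W \<mu> \<Longrightarrow> y \<in> W \<mu> \<Longrightarrow> x \<oplus> y \<in> W \<mu>"
  using subgroup.m_closed[OF W_subgroup] by simp

lemma W_neg: "x \<in> W \<mu> \<Longrightarrow> \<ominus> x \<in> W \<mu>"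
  using subgroup.m_inv_closed[OF W_subgroup] by (simp add: a_inv_def)

definition component :: "'v \<Rightarrow> 'p \<Rightarrow> 'v" where
  "component x = (THE c. finite {\<mu>. c \<mu> \<noteq> \<zero>} \<and> (\<forall>\<mu>. c \<mu> \<in> W \<mu>) \<and> x = (\<Oplus>\<mu>\<in>{\<mu>. c \<mu> \<noteq> \<zero>}. c \<mu>))"

lemma component:
  assumes "x \<in> carrier V"
  shows "finite {\<mu>. component x \<mu> \<noteq> \<zero>}" "component x \<mu> \<in> W \<mu>" "x = (\<Oplus>\<mu>\<in>{\<mu>. component x \<mu> \<noteq> \<zero>}. component x \<mu>)"
proof -
  have "\<exists>!c. finite {\<mu>. c \<mu> \<noteq> \<zero>} \<and> (\<forall>\<mu>. c \<mu> \<in> W \<mu>) \<and> x = (\<Oplus>\<mu>\<in>{\<mu>. c \<mu> \<noteq> \<zero>}. c \<mu>)"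
    using decomp assms by (auto simp: direct_sum_decomp_def)
  from theI'[OF this] show "finite {\<mu>. component x \<mu> \<noteq> \<zero>}" "component x \<mu> \<in> W \<mu>"
    "x = (\<Oplus>\<mu>\<in>{\<mu>. component x \<mu> \<noteq> \<zero>}. component x \<mu>)"
    unfolding component_def[symmetric] by auto
qed

lemma component_carrier: "x \<in> carrier V \<Longrightarrow> component x \<mu> \<in> carrier V"
  using component(2) W_carrier by blast

lemma finsum_superset:
  assumes "finite S" "\<And>\<mu>. \<mu> \<in> S \<Longrightarrow> c \<mu> \<in> carrier V" "\<And>\<mu>. \<mu> \<notin> S \<Longrightarrow> c \<mu> = \<zero>"
  shows "(\<Oplus>\<mu>\<in>{\<mu>. c \<mu> \<noteq> \<zero>}. c \<mu>) = (\<Oplus>\<mu>\<in>S. c \<mu>)"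
  by (rule add.finprod_mono_neutral_cong_left) (use assms in auto)

lemma component_unique:
  assumes "finite S" "\<And>\<mu>. c \<mu> \<in> W \<mu>" "\<And>\<mu>. \<mu> \<notin> S \<Longrightarrow> c \<mu> = \<zero>" "x = (\<Oplus>\<mu>\<in>S. c \<mu>)"
  shows "component x = c"
proof -
  have "x \<in> carrier V" unfolding assms(4) using assms(2) W_carrier by (intro finsum_closed) auto
  then have ex: "\<exists>!c. finite {\<mu>. c \<mu> \<noteq> \<zero>} \<and> (\<forall>\<mu>. c \<mu> \<in> W \<mu>) \<and> x = (\<Oplus>\<mu>\<in>{\<mu>. c \<mu> \<noteq> \<zero>}. c \<mu>)"
    using decomp by (auto simp: direct_sum_decomp_def)
  have "finite {\<mu>. c \<mu> \<noteq> \<zero>}" by (rule finite_subset[OF _ assms(1)]) (use assms in auto)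
  moreover have "x = (\<Oplus>\<mu>\<in>{\<mu>. c \<mu> \<noteq> \<zero>}. c \<mu>)"
    using finsum_superset[OF assms(1) W_carrier[OF assms(2)] assms(3)] assms(4) by simp
  ultimately show ?thesis
    unfolding component_def using assms(2) by (intro the1_equality ex) auto
qed

lemma component_sum_superset:
  assumes "x \<in> carrier V" "finite S" "{\<mu>. component x \<mu> \<noteq> \<zero>} \<subseteq> S"
  shows "(\<Oplus>\<mu>\<in>S. component x \<mu>) = x"
  using assms(3) component(3)[OF assms(1)]
    finsum_superset[of S "component x"] component_carrier[OF assms(1)] assms(2) by (metis (mono_tags, lifting) mem_Collect_eq subsetD)

lemma component_homogeneous:
  assumes "x \<in> W \<mu>"
  shows "component x = (\<lambda>\<nu>. if \<nu> = \<mu> then x else \<zero>)"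
  by (rule component_unique[of "{\<mu>}"]) (use assms W_zero W_carrier in auto)

lemma component_add:
  assumes "x \<in> carrier V" "y \<in> carrier V"
  shows "component (x \<oplus> y) = (\<lambda>\<mu>. component x \<mu> \<oplus> component y \<mu>)"
proof (rule component_unique)
  let ?S = "{\<mu>. component x \<mu> \<noteq> \<zero>} \<union> {\<mu>. component y \<mu> \<noteq> \<zero>}"
  show fin: "finite ?S" using assms component(1) by auto
  show "component x \<mu> \<oplus> component y \<mu> \<in> W \<mu>" for \<mu> using assms component(2) by (simp add: W_add)
  show "component x \<mu> \<oplus> component y \<mu> = \<zero>" if "\<mu> \<notin> ?S" for \<mu> using that by auto
  have "(\<Oplus>\<mu>\<in>?S. component x \<mu> \<oplus> component y \<mu>) = (\<Oplus>\<mu>\<in>?S. component x \<mu>) \<oplus> (\<Oplus>\<mu>\<in>?S. component y \<mu>)"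
    using assms component_carrier by (intro finsum_addf) auto
  then show "x \<oplus> y = (\<Oplus>\<mu>\<in>?S. component x \<mu> \<oplus> component y \<mu>)"
    using assms fin by (simp add: component_sum_superset)
qed

lemma homogeneous_induct [consumes 1, case_names homogeneous add]:
  assumes "x \<in> carrier V" "\<And>x \<mu>. x \<in> W \<mu> \<Longrightarrow> P x"
    "\<And>x y. x \<in> carrier V \<Longrightarrow> y \<in> carrier V \<Longrightarrow> P x \<Longrightarrow> P y \<Longrightarrow> P (x \<oplus> y)"
  shows "P x"
proof -
  have "P (\<Oplus>\<mu>\<in>S. component x \<mu>)" if "finite S" for S
    using that
  proof (induction S rule: finite_induct)
    case empty
    then show ?case using assms(2)[OF W_zero] by simp
  next
    case (insert \<mu> S)
    have "P (component x \<mu>)" using assms(2)[OF component(2)[OF assms(1)]] .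
    then show ?case using insert assms component_carrier
      by (subst finsum_insert) (auto intro!: assms(3) finsum_closed)
  qed
  then show ?thesis using component(1,3)[OF assms(1)] by metis
qed

text \<open>Homogeneous elements generate the group. Operator identities are checked through this,
  because only on a fixed weight space do the K_i and the scalings become scalars.\<close>

lemma additive_eqI:
  assumes "f \<in> carrier V \<rightarrow> carrier U" "g \<in> carrier V \<rightarrow> carrier U"
    and "\<And>x y. x \<in> carrier V \<Longrightarrow> y \<in> carrier V \<Longrightarrow> f (x \<oplus> y) = f x \<oplus>\<^bsub>U\<^esub> f y"
    and "\<And>x y. x \<in> carrier V \<Longrightarrow> y \<in> carrier V \<Longrightarrow> g (x \<oplus> y) = g x \<oplus>\<^bsub>U\<^esub> g y"
    and "\<And>\<mu> x. x \<in> W \<mu> \<Longrightarrow> f x = g x" "x \<in> carrier V"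
  shows "f x = g x"
  using assms(6) by (induction x rule: homogeneous_induct) (auto simp: assms(3,4,5))

text \<open>Glues one additive map per weight space into a map on the whole group. When each
  \<open>T \<mu>\<close> is additive, vanishing components contribute zero, so any larger finite set
  of weights gives the same sum.\<close>

definition weight_ext :: "('p \<Rightarrow> 'v \<Rightarrow> 'v) \<Rightarrow> 'v \<Rightarrow> 'v" where
  "weight_ext T x = (\<Oplus>\<mu>\<in>{\<mu>. component x \<mu> \<noteq> \<zero>}. T \<mu> (component x \<mu>))"

context
  fixes T :: "'p \<Rightarrow> 'v \<Rightarrow> 'v"
  assumes T_closed: "\<And>\<mu> x. x \<in> W \<mu> \<Longrightarrow> T \<mu> x \<in> carrier V"
    and T_add: "\<And>\<mu> x y. x \<in> W \<mu> \<Longrightarrow> y \<in> W \<mu> \<Longrightarrow> T \<mu> (x \<oplus> y) = T \<mu> x \<oplus> T \<mu> y"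
begin

lemma T_zero: "T \<mu> \<zero> = \<zero>"
  using T_add[OF W_zero W_zero, of \<mu>] T_closed[OF W_zero] by simp

lemma weight_ext_superset:
  assumes "x \<in> carrier V" "finite S" "{\<mu>. component x \<mu> \<noteq> \<zero>} \<subseteq> S"
  shows "weight_ext T x = (\<Oplus>\<mu>\<in>S. T \<mu> (component x \<mu>))"
  unfolding weight_ext_def
  by (rule add.finprod_mono_neutral_cong_left)
    (use assms T_closed T_zero component(2) in \<open>auto intro!: T_closed\<close>)

lemma weight_ext_closed: "x \<in> carrier V \<Longrightarrow> weight_ext T x \<in> carrier V"
  unfolding weight_ext_def by (intro finsum_closed) (auto intro!: T_closed component)

lemma weight_ext_add:
  assumes "x \<in> carrier V" "y \<in> carrier V"
  shows "weight_ext T (x \<oplus> y) = weight_ext T x \<oplus> weight_ext T y"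
proof -
  let ?S = "{\<mu>. component x \<mu> \<noteq> \<zero>} \<union> {\<mu>. component y \<mu> \<noteq> \<zero>}"
  have fin: "finite ?S" using assms component(1) by auto
  have "weight_ext T (x \<oplus> y) = (\<Oplus>\<mu>\<in>?S. T \<mu> (component (x \<oplus> y) \<mu>))"
    using assms fin by (intro weight_ext_superset) (auto simp: component_add)
  also have "\<dots> = (\<Oplus>\<mu>\<in>?S. T \<mu> (component x \<mu>) \<oplus> T \<mu> (component y \<mu>))"
    using assms component(2) by (intro finsum_cong') (auto simp: component_add T_add T_closed)
  also have "\<dots> = weight_ext T x \<oplus> weight_ext T y"
    using assms fin
    by (subst finsum_addf) (auto simp: weight_ext_superset[of _ ?S] intro!: T_closed component)
  finally show ?thesis .
qed

lemma weight_ext_homogeneous: "x \<in> W \<mu> \<Longrightarrow> weight_ext T x = T \<mu> x"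
  by (subst weight_ext_superset[of _ "{\<mu>}"]) (auto simp: component_homogeneous W_carrier T_closed)

end

end

section \<open>Graded modules over a commutative ring and weight-dependent scalings\<close>

locale weight_space_module = weight_decomposition V W
  for V :: "('v, 'x) ring_scheme" (structure) and W :: "'p::ab_group_add \<Rightarrow> 'v set" +
  fixes \<rho> :: "'k::comm_ring_1 \<Rightarrow> 'v \<Rightarrow> 'v"
  assumes \<rho>_closed: "x \<in> carrier V \<Longrightarrow> \<rho> a x \<in> carrier V"
    and \<rho>_W: "x \<in> W \<mu> \<Longrightarrow> \<rho> a x \<in> W \<mu>"
    and \<rho>_add: "x \<in> carrier V \<Longrightarrow> y \<in> carrier V \<Longrightarrow> \<rho> a (x \<oplus> y) = \<rho> a x \<oplus> \<rho> a y"
    and \<rho>_plus: "x \<in> carrier V \<Longrightarrow> \<rho> (a + b) x = \<rho> a x \<oplus> \<rho> b x"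
    and \<rho>_mult: "x \<in> carrier V \<Longrightarrow> \<rho> (a * b) x = \<rho> a (\<rho> b x)"
    and \<rho>_one: "x \<in> carrier V \<Longrightarrow> \<rho> 1 x = x"
begin

lemma \<rho>_zero_left: "x \<in> carrier V \<Longrightarrow> \<rho> 0 x = \<zero>"
  using \<rho>_plus[of x 0 0] \<rho>_closed[of x 0] by simp

lemma \<rho>_zero: "\<rho> a \<zero> = \<zero>"
  using \<rho>_add[of \<zero> \<zero> a] \<rho>_closed[of \<zero> a] by simp

lemma \<rho>_uminus:
  assumes "x \<in> carrier V"
  shows "\<rho> (- a) x = \<ominus> \<rho> a x"
proof -
  have "\<rho> (- a) x \<oplus> \<rho> a x = \<zero>"
    using \<rho>_plus[OF assms, of "-a" a] \<rho>_zero_left[OF assms] by simp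
  then show ?thesis using minus_equality assms \<rho>_closed by metis
qed

lemma \<rho>_diff: "x \<in> carrier V \<Longrightarrow> \<rho> (a - b) x = \<rho> a x \<ominus> \<rho> b x"
  using \<rho>_plus[of x a "- b"] by (simp add: \<rho>_uminus a_minus_def)

lemma \<rho>_commute: "x \<in> carrier V \<Longrightarrow> \<rho> a (\<rho> b x) = \<rho> b (\<rho> a x)"
  using \<rho>_mult[of x a b] \<rho>_mult[of x b a] by (simp add: mult.commute)

lemma \<rho>_finsum:
  assumes "finite S" "\<And>k. k \<in> S \<Longrightarrow> f k \<in> carrier V"
  shows "\<rho> a (\<Oplus>k\<in>S. f k) = (\<Oplus>k\<in>S. \<rho> a (f k))"
  using assms
proof (induction S rule: finite_induct)
  case (insert k S)
  then show ?case by (subst (1 2) finsum_insert) (auto simp: \<rho>_add \<rho>_closed intro!: finsum_closed)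
qed (simp add: \<rho>_zero)

text \<open>These degree-zero operators realise the twisting units, and also the action of K_i, for
  \<open>g \<mu> = \<kappa> i (crt C i \<mu>)\<close>.\<close>

definition scaling :: "('p \<Rightarrow> 'k) \<Rightarrow> 'v \<Rightarrow> 'v" where
  "scaling g = weight_ext (\<lambda>\<mu>. \<rho> (g \<mu>))"

lemma scaling_closed: "x \<in> carrier V \<Longrightarrow> scaling g x \<in> carrier V"
  and scaling_add: "x \<in> carrier V \<Longrightarrow> y \<in> carrier V \<Longrightarrow> scaling g (x \<oplus> y) = scaling g x \<oplus> scaling g y"
  and scaling_homogeneous: "x \<in> W \<mu> \<Longrightarrow> scaling g x = \<rho> (g \<mu>) x"
  unfolding scaling_def
  by (intro weight_ext_closed weight_ext_add weight_ext_homogeneous;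
    simp add: \<rho>_closed \<rho>_add W_carrier)+

lemma scaling_\<rho>:
  assumes "x \<in> carrier V"
  shows "scaling g (\<rho> a x) = \<rho> a (scaling g x)"
  by (rule additive_eqI[where U = V])
    (auto simp: assms scaling_closed \<rho>_closed \<rho>_add scaling_add,
      simp add: scaling_homogeneous[OF \<rho>_W] scaling_homogeneous \<rho>_commute W_carrier)

lemma scaling_mult:
  assumes "x \<in> carrier V" "\<And>\<mu>. g \<mu> * h \<mu> = k \<mu>"
  shows "scaling g (scaling h x) = scaling k x"
proof (rule additive_eqI[where U = V, OF _ _ _ _ _ assms(1)])
  fix x \<mu> assume "x \<in> W \<mu>"
  then show "scaling g (scaling h x) = scaling k x"
    by (simp add: scaling_homogeneous[OF \<rho>_W] scaling_homogeneous \<rho>_mult W_carrier flip: assms(2))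
qed (auto simp: scaling_closed scaling_add)

lemma scaling_one:
  assumes "x \<in> carrier V"
  shows "scaling (\<lambda>_. 1) x = x"
  by (rule additive_eqI[where U = V, OF _ _ _ _ _ assms])
    (auto simp: scaling_closed scaling_add scaling_homogeneous \<rho>_one W_carrier)

text \<open>\<open>T\<close> moves the weight \<mu> to \<mu> + \<beta>, so the factor seen after
  \<open>T\<close> is the one of the shifted weight. The shifted function is a variable
  \<open>h\<close> with an equation, which leaves its form to the application.\<close>

lemma scaling_shift:
  assumes T: "T \<in> carrier V \<rightarrow> carrier V"
      "\<And>x y. x \<in> carrier V \<Longrightarrow> y \<in> carrier V \<Longrightarrow> T (x \<oplus> y) = T x \<oplus> T y"
      "\<And>a x. x \<in> carrier V \<Longrightarrow> T (\<rho> a x) = \<rho> a (T x)"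
      "\<And>\<mu> x. x \<in> W \<mu> \<Longrightarrow> T x \<in> W (\<mu> + \<beta>)"
    and "x \<in> carrier V" "\<And>\<mu>. h \<mu> = g (\<mu> + \<beta>)"
  shows "scaling g (T x) = T (scaling h x)"
proof (rule additive_eqI[where U = V, OF _ _ _ _ _ assms(5)])
  fix x \<mu> assume "x \<in> W \<mu>"
  then show "scaling g (T x) = T (scaling h x)"
    using T by (simp add: scaling_homogeneous[OF T(4)] scaling_homogeneous W_carrier assms(6))
qed (use T in \<open>auto simp: scaling_closed scaling_add Pi_iff\<close>)

end

section \<open>Representations by operators on weight spaces\<close>

definition (in weight_space_module) weight_operator :: "'p \<Rightarrow> ('v \<Rightarrow> 'v) \<Rightarrow> bool" where
  "weight_operator \<beta> T \<longleftrightarrow> (\<forall>x\<in>carrier V. T x \<in> carrier V) \<and>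
     (\<forall>x\<in>carrier V. \<forall>y\<in>carrier V. T (x \<oplus> y) = T x \<oplus> T y) \<and>
     (\<forall>a. \<forall>x\<in>carrier V. T (\<rho> a x) = \<rho> a (T x)) \<and>
     (\<forall>\<mu>. \<forall>x\<in>W \<mu>. T x \<in> W (\<mu> + \<beta>))"

context weight_space_module
begin

lemma weight_operatorD:
  assumes "weight_operator \<beta> T"
  shows "x \<in> carrier V \<Longrightarrow> T x \<in> carrier V"
    "x \<in> carrier V \<Longrightarrow> y \<in> carrier V \<Longrightarrow> T (x \<oplus> y) = T x \<oplus> T y"
    "x \<in> carrier V \<Longrightarrow> T (\<rho> a x) = \<rho> a (T x)"
    "x \<in> W \<mu> \<Longrightarrow> T x \<in> W (\<mu> + \<beta>)"
  using assms by (auto simp: weight_operator_def)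

lemma weight_operator_zero:
  assumes "weight_operator \<beta> T"
  shows "T \<zero> = \<zero>"
  using weight_operatorD(1)[OF assms, of \<zero>] weight_operatorD(2)[OF assms, of \<zero> \<zero>] by simp

lemma weight_operator_comp:
  assumes "weight_operator \<beta> S" "weight_operator \<gamma> T"
  shows "weight_operator (\<gamma> + \<beta>) (\<lambda>x. S (T x))"
  using weight_operatorD[OF assms(1)] weight_operatorD[OF assms(2)]
  by (simp add: weight_operator_def flip: add.assoc)

lemma weight_operator_id: "weight_operator 0 (\<lambda>x. x)"
  by (auto simp: weight_operator_def)

lemma weight_operator_funpow:
  assumes "weight_operator \<beta> T"
  shows "weight_operator (\<Sum>_<n. \<beta>) (T ^^ n)"
proof (induction n)
  case 0 then show ?case using weight_operator_id by (simp add: id_def)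
next
  case (Suc n)
  then show ?case using weight_operator_comp[OF assms Suc] by (simp add: comp_def add.commute)
qed

lemma weight_operator_\<rho>: "weight_operator 0 (\<rho> a)"
  by (auto simp: weight_operator_def \<rho>_closed \<rho>_add \<rho>_W \<rho>_commute)

lemma weight_operator_scaling: "weight_operator 0 (scaling g)"
  by (auto simp: weight_operator_def scaling_closed scaling_add scaling_\<rho> scaling_homogeneous \<rho>_W)

lemma scaling_commute:
  assumes "weight_operator \<beta> T" "x \<in> carrier V" "\<And>\<mu>. h \<mu> = g (\<mu> + \<beta>)"
  shows "scaling g (T x) = T (scaling h x)"
  by (rule scaling_shift) (use weight_operatorD[OF assms(1)] assms(2,3) in auto)

end

text \<open>What remains of a weight module once the K_i are forgotten. They act on a weight space
  by known scalars, so the inhomogeneous term of the commutation relation has become the scalar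
  \<open>H i n\<close>, with n the pairing of h_i and the weight. Hence the relations are imposed on
  weight vectors.\<close>

locale quantum_rep = weight_space_module V W \<rho>
  for V :: "('v, 'x) ring_scheme" (structure) and W :: "'p::ab_group_add \<Rightarrow> 'v set"
    and \<rho> :: "'k::comm_ring_1 \<Rightarrow> 'v \<Rightarrow> 'v" +
  fixes C :: "('i, 'p) superdatum" and t :: "'i \<Rightarrow> 'i \<Rightarrow> 'k" and H :: "'i \<Rightarrow> int \<Rightarrow> 'k"
    and se sf :: "'i \<Rightarrow> 'i \<Rightarrow> nat \<Rightarrow> 'k" and E F :: "'i \<Rightarrow> 'v \<Rightarrow> 'v"
  assumes E_op: "weight_operator (rt C i) (E i)"
    and F_op: "weight_operator (- rt C i) (F i)"
    and EF: "x \<in> W \<mu> \<Longrightarrow> E i (F j x) =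
      \<rho> (t i j) (F j (E i x)) \<oplus> (if i = j then \<rho> (H i (crt C i \<mu>)) x else \<zero>)"
    and serre_E: "i \<noteq> j \<Longrightarrow> x \<in> W \<mu> \<Longrightarrow> (\<Oplus>k\<in>{..serre_len C i j}.
      \<rho> (se i j k) ((E i ^^ (serre_len C i j - k)) (E j ((E i ^^ k) x)))) = \<zero>"
    and serre_F: "i \<noteq> j \<Longrightarrow> x \<in> W \<mu> \<Longrightarrow> (\<Oplus>k\<in>{..serre_len C i j}.
      \<rho> (sf i j k) ((F i ^^ (serre_len C i j - k)) (F j ((F i ^^ k) x)))) = \<zero>"

section \<open>Modules over presented algebras\<close>

text \<open>Meaningful only for the words \<open>[]\<close>, \<open>[gK i]\<close> and \<open>[gKinv i]\<close>.\<close>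

definition K_value :: "('i \<Rightarrow> int \<Rightarrow> 'k::comm_ring_1) \<Rightarrow> 'i \<Rightarrow> int \<Rightarrow> 'i gen list \<Rightarrow> 'k" where
  "K_value \<kappa> i n w = (if w = [] then 1 else if w = [gK i] then \<kappa> i n else \<kappa> i (- n))"

text \<open>One locale covers all three presentations. \<open>\<kappa> i n\<close> is the eigenvalue
  of K_i where h_i pairs to n with the weight. The inhomogeneous term is a multiple
  \<open>hc i\<close> of a difference of two words: 1 - K_i for the superalgebra over \<pi>, and K_i
  minus its inverse for the other two. \<open>H\<close> is the value of this term on a weight
  space.\<close>

locale quantum_presentation = cartan_superdatum C for C :: "('i, 'p::ab_group_add) superdatum" +
  fixes \<kappa>K \<kappa>K' t :: "'i \<Rightarrow> 'i \<Rightarrow> 'k::comm_ring_1" and h :: "'i \<Rightarrow> 'i gen list \<Rightarrow>\<^sub>0 'k"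
    and se sf :: "'i \<Rightarrow> 'i \<Rightarrow> nat \<Rightarrow> 'k" and \<kappa> H :: "'i \<Rightarrow> int \<Rightarrow> 'k"
    and hc :: "'i \<Rightarrow> 'k" and u w :: "'i \<Rightarrow> 'i gen list"
  assumes \<kappa>_add: "\<kappa> i (m + n) = \<kappa> i m * \<kappa> i n" and \<kappa>_zero: "\<kappa> i 0 = 1"
    and \<kappa>K: "\<kappa>K i j = \<kappa> i (cm C i j)" "\<kappa>K' i j = \<kappa> i (- cm C i j)"
    and h: "h i = mon (hc i) (u i) - mon (hc i) (w i)"
    and uw: "u i \<in> {[], [gK i], [gKinv i]}" "w i \<in> {[], [gK i], [gKinv i]}"
    and H: "H i n = hc i * (K_value \<kappa> i n (u i) - K_value \<kappa> i n (w i))"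
begin

abbreviation "FA \<equiv> (free_algebra :: ('i gen list \<Rightarrow>\<^sub>0 'k) ring)"

definition rels :: "('i gen list \<Rightarrow>\<^sub>0 'k) set" where
  "rels = qgroup_rels C \<kappa>K \<kappa>K' t h se sf"

definition B :: "('i, 'p, 'k, ('i gen list \<Rightarrow>\<^sub>0 'k) set) gr_algebra" where
  "B = presented_algebra C rels"

definition cl :: "('i gen list \<Rightarrow>\<^sub>0 'k) \<Rightarrow> ('i gen list \<Rightarrow>\<^sub>0 'k) set" where
  "cl f = Idl\<^bsub>FA\<^esub> rels +>\<^bsub>FA\<^esub> f"

sublocale FA: ring FA by (rule ring_free_algebra)

lemma FA_simps:
  shows "carrier FA = UNIV" and "mon a v \<otimes>\<^bsub>FA\<^esub> mon b v' = mon (a * b) (v @ v')"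
    and "\<one>\<^bsub>FA\<^esub> = mon 1 []" and "\<zero>\<^bsub>FA\<^esub> = 0" and "f \<oplus>\<^bsub>FA\<^esub> g = f + g"
proof -
  show "mon a v \<otimes>\<^bsub>FA\<^esub> mon b v' = mon (a * b) (v @ v')"
    unfolding monoid_algebra_mult_single by (simp add: word_monoid_def)
qed (simp_all add: monoid_algebra_def word_monoid_def)

lemma ideal_rels: "ideal (Idl\<^bsub>FA\<^esub> rels) FA"
  by (rule FA.genideal_ideal) (simp add: FA_simps)

lemma B_fields: "carrier B = carrier (FA Quot (Idl\<^bsub>FA\<^esub> rels))"
  "monoid.mult B = monoid.mult (FA Quot (Idl\<^bsub>FA\<^esub> rels))"
  "one B = one (FA Quot (Idl\<^bsub>FA\<^esub> rels))"
  "zero B = zero (FA Quot (Idl\<^bsub>FA\<^esub> rels))" "add B = add (FA Quot (Idl\<^bsub>FA\<^esub> rels))"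
  by (simp_all add: B_def presented_algebra_def Let_def ring.defs monoid.defs)

lemma B_gens: "scl B c = cl (mon c [])" "eel B i = cl (mon 1 [gE i])" "fel B i = cl (mon 1 [gF i])"
  "Kel B i = cl (mon 1 [gK i])"
  "hcomp B \<beta> = cl ` {f. \<forall>w \<in> Poly_Mapping.keys f. word_deg C w = \<beta>}"
  by (simp_all add: B_def presented_algebra_def Let_def ring.defs monoid.defs cl_def)

lemma ring_B: "ring B"
proof -
  interpret Q: ring "FA Quot (Idl\<^bsub>FA\<^esub> rels)" by (rule ideal.quotient_is_ring[OF ideal_rels])
  have "abelian_group B"
    by (rule abelian_groupI) (auto simp: B_fields Q.a_ac Q.l_neg intro: bexI[of _ "\<ominus>\<^bsub>_\<^esub> _"])
  then show ?thesis
    by (rule ringI) (auto simp: B_fields Q.m_assoc Q.l_distr Q.r_distr intro!: monoidI)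
qed

lemma carrier_B: "carrier B = range cl"
  by (auto simp: B_fields FactRing_def A_RCOSETS_def' cl_def FA_simps)

lemma cl_hom: "cl \<in> ring_hom FA B"
proof -
  have "(\<lambda>f. Idl\<^bsub>FA\<^esub> rels +>\<^bsub>FA\<^esub> f) \<in> ring_hom FA (FA Quot (Idl\<^bsub>FA\<^esub> rels))"
    using ideal.rcos_ring_hom[OF ideal_rels] by simp
  then show ?thesis
    by (simp add: ring_hom_def B_fields cl_def[abs_def])
qed

lemma cl_add: "cl (f + g) = cl f \<oplus>\<^bsub>B\<^esub> cl g"
  and cl_mult: "cl (f \<otimes>\<^bsub>FA\<^esub> g) = cl f \<otimes>\<^bsub>B\<^esub> cl g"
  and cl_one: "cl (mon 1 []) = \<one>\<^bsub>B\<^esub>"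
  and cl_closed: "cl f \<in> carrier B"
  using cl_hom by (auto simp: ring_hom_def FA_simps carrier_B)

lemma cl_mon_append: "cl (mon (a * b) (v @ v')) = cl (mon a v) \<otimes>\<^bsub>B\<^esub> cl (mon b v')"
  by (simp add: FA_simps flip: cl_mult)

lemma cl_zero: "cl 0 = \<zero>\<^bsub>B\<^esub>"
proof -
  interpret B: ring B by (rule ring_B)
  have "cl 0 \<oplus>\<^bsub>B\<^esub> cl 0 = cl 0" using cl_add[of 0 0] by simp
  then show ?thesis using cl_closed B.add.l_cancel_one by metis
qed

lemma cl_rel: "r \<in> rels \<Longrightarrow> cl r = \<zero>\<^bsub>B\<^esub>"
proof -
  assume "r \<in> rels"
  then have "r \<in> Idl\<^bsub>FA\<^esub> rels" using FA.genideal_self[of rels] by (auto simp: FA_simps)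
  then have "cl r = Idl\<^bsub>FA\<^esub> rels" unfolding cl_def
    using FA.a_coset_join2 ideal_rels
    by (metis FA_simps(1) UNIV_I additive_subgroup.a_subgroup ideal_def)
  then show ?thesis by (simp add: B_fields FactRing_def)
qed

lemma scl_hom: "scalar_hom (scl B) B"
proof -
  have "cl (mon (a + b) []) = cl (mon a []) \<oplus>\<^bsub>B\<^esub> cl (mon b [])"
    "cl (mon (a * b) []) = cl (mon a []) \<otimes>\<^bsub>B\<^esub> cl (mon b [])" for a b
    by (simp_all add: cl_mon_append[of "[]" "[]" a b, simplified] single_add cl_add)
  then show ?thesis by (auto simp: scalar_hom_def B_gens cl_closed cl_one)
qed

text \<open>The inverses of the K_i are listed among the generators, since a subset closed under
  sums and products need not be closed under inversion.\<close>

lemma B_generated: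
  assumes closed: "\<And>a b. a \<in> S \<Longrightarrow> b \<in> S \<Longrightarrow> a \<oplus>\<^bsub>B\<^esub> b \<in> S" "\<And>a b. a \<in> S \<Longrightarrow> b \<in> S \<Longrightarrow> a \<otimes>\<^bsub>B\<^esub> b \<in> S"
    and gens: "\<And>c. scl B c \<in> S" "\<And>i. eel B i \<in> S" "\<And>i. fel B i \<in> S" "\<And>i. Kel B i \<in> S"
      "\<And>i. cl (mon 1 [gKinv i]) \<in> S"
    and "a \<in> carrier B"
  shows "a \<in> S"
proof -
  have gen: "cl (mon 1 [g]) \<in> S" for g
    using gens by (cases g) (simp_all add: B_gens)
  have mon: "cl (mon c v) \<in> S" for c v
  proof (induction v arbitrary: c)
    case Nil then show ?case using gens(1)[of c] by (simp add: B_gens)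
  next
    case (Cons g v)
    have "cl (mon c ([] @ [g] @ v)) = cl (mon c []) \<otimes>\<^bsub>B\<^esub> (cl (mon 1 [g]) \<otimes>\<^bsub>B\<^esub> cl (mon 1 v))"
      using cl_mon_append[of "[]" "[g] @ v" c 1] cl_mon_append[of "[g]" v 1 1] by simp
    then show ?case using gens(1)[of c] gen Cons closed by (simp add: B_gens)
  qed
  obtain f where f: "a = cl f" using assms(8) by (auto simp: carrier_B)
  have "f \<in> carrier FA" by (simp add: FA_simps)
  then have "cl f \<in> S"
    by (induction f rule: monoid_algebra_induct)
      (use mon[of "[]" 0] in \<open>auto simp: mon cl_add closed\<close>)
  then show ?thesis by (simp add: f)
qed

end

subsection \<open>The operators on a weight module satisfy the relations\<close>

locale presented_module = quantum_presentation C \<kappa>K \<kappa>K' t h se sf \<kappa> H hc u w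
  for C :: "('i, 'p::ab_group_add) superdatum" and \<kappa>K \<kappa>K' t :: "'i \<Rightarrow> 'i \<Rightarrow> 'k::comm_ring_1"
    and h se sf \<kappa> H hc u w +
  fixes M :: "(('i gen list \<Rightarrow>\<^sub>0 'k) set, 'v, 'p) wt_module"
  assumes weight_module: "weight_module C B \<kappa> M"
begin

sublocale left_module B M using weight_module by (simp add: weight_module_def)

abbreviation "act f x \<equiv> cl f \<odot>\<^bsub>M\<^esub> x"

lemma act_closed: "x \<in> carrier M \<Longrightarrow> act f x \<in> carrier M"
  by (simp add: smult_closed cl_closed)

lemma act_append: "x \<in> carrier M \<Longrightarrow> act (mon (a * b) (v @ v')) x = act (mon a v) (act (mon b v') x)"
  by (simp add: cl_mon_append cl_closed smult_assoc)

lemma act_scl: "x \<in> carrier M \<Longrightarrow> act (mon c v) x = scl B c \<odot>\<^bsub>M\<^esub> act (mon 1 v) x"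
  using act_append[of x "[]" v c 1] by (simp add: B_gens)

lemma act_scl_commute:
  "x \<in> carrier M \<Longrightarrow> act (mon 1 v) (scl B c \<odot>\<^bsub>M\<^esub> x) = scl B c \<odot>\<^bsub>M\<^esub> act (mon 1 v) x"
  using act_append[of x v "[]" 1 c] act_append[of x "[]" v c 1] by (simp add: B_gens)

lemma act_add: "x \<in> carrier M \<Longrightarrow> act (f + g) x = act f x \<oplus>\<^bsub>M\<^esub> act g x"
  by (simp add: cl_add smult_l_distr cl_closed)

lemma act_zero: "x \<in> carrier M \<Longrightarrow> act 0 x = \<zero>\<^bsub>M\<^esub>"
  using act_add[of x 0 0] act_closed[of x 0] by simp

lemma act_diff: "x \<in> carrier M \<Longrightarrow> act (f - g) x = act f x \<ominus>\<^bsub>M\<^esub> act g x"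
proof -
  assume x: "x \<in> carrier M"
  have "act f x = act (f - g) x \<oplus>\<^bsub>M\<^esub> act g x" using act_add[OF x, of "f - g" g] by simp
  then show ?thesis using x act_closed[of x]
    by (metis V.a_comm V.add.inv_solve_right V.minus_eq)
qed

lemma act_sum: "x \<in> carrier M \<Longrightarrow> finite S \<Longrightarrow> act (\<Sum>k\<in>S. f k) x = (\<Oplus>\<^bsub>M\<^esub>k\<in>S. act (f k) x)"
proof (induction S rule: infinite_finite_induct)
  case (insert k S)
  then show ?case by (subst V.finsum_insert) (auto simp: act_add act_closed)
qed (auto simp: act_zero)

lemma act_rel: "r \<in> rels \<Longrightarrow> x \<in> carrier M \<Longrightarrow> act r x = \<zero>\<^bsub>M\<^esub>"
  using act_zero[of x] by (simp add: cl_rel cl_zero)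

lemma act_replicate:
  assumes "x \<in> carrier M"
  shows "act (mon 1 (replicate n g @ v)) x = (act (mon 1 [g]) ^^ n) (act (mon 1 v) x)"
proof (induction n)
  case (Suc n)
  then show ?case using act_append[OF assms, of "[g]" "replicate n g @ v" 1 1] by simp
qed simp

lemma act_serre:
  assumes "x \<in> carrier M"
  shows "act (mon c (replicate m g @ [g'] @ replicate n g)) x =
    scl B c \<odot>\<^bsub>M\<^esub> (act (mon 1 [g]) ^^ m) (act (mon 1 [g']) ((act (mon 1 [g]) ^^ n) x))"
proof -
  have one: "act (mon 1 []) x = x" using assms smult_one by (simp add: cl_one)
  have "act (mon 1 (replicate n g)) x = (act (mon 1 [g]) ^^ n) x"
    using act_replicate[OF assms, of n g "[]"] by (simp add: one)
  moreover have "act (mon 1 ([g'] @ replicate n g)) x = act (mon 1 [g']) (act (mon 1 (replicate n g)) x)"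
    using act_append[OF assms, of "[g']" "replicate n g" 1 1] by simp
  ultimately show ?thesis using act_scl[OF assms, where c = c] act_replicate[OF assms] by simp
qed

lemma act_grade: "x \<in> wtsp M \<mu> \<Longrightarrow> act (mon c v) x \<in> wtsp M (\<mu> + word_deg C v)"
proof -
  have "cl (mon c v) \<in> hcomp B (word_deg C v)" by (auto simp: B_gens split: if_splits)
  then show "x \<in> wtsp M \<mu> \<Longrightarrow> ?thesis" using weight_module by (auto simp: weight_module_def)
qed

sublocale weight_space_module M "wtsp M" "\<lambda>c x. scl B c \<odot>\<^bsub>M\<^esub> x"
proof -
  interpret wd: weight_decomposition M "wtsp M"
    by unfold_locales (use weight_module in \<open>simp add: weight_module_def\<close>)
  show "weight_space_module M (wtsp M) (\<lambda>c x. scl B c \<odot>\<^bsub>M\<^esub> x)"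
  proof unfold_locales
    fix x y \<mu> a
    show "x \<in> wtsp M \<mu> \<Longrightarrow> scl B a \<odot>\<^bsub>M\<^esub> x \<in> wtsp M \<mu>"
      using act_grade[of x \<mu> "[]" a] by (simp add: word_deg_def B_gens)
    show "x \<in> carrier M \<Longrightarrow> y \<in> carrier M \<Longrightarrow> scl B a \<odot>\<^bsub>M\<^esub> (x \<oplus>\<^bsub>M\<^esub> y) = scl B a \<odot>\<^bsub>M\<^esub> x \<oplus>\<^bsub>M\<^esub> scl B a \<odot>\<^bsub>M\<^esub> y"
      by (simp add: smult_r_distr scalar_homD[OF scl_hom])
  qed (use scalar_homD[OF scl_hom] in \<open>simp_all add: act_closed smult_closed smult_one smult_l_distr smult_assoc\<close>)
qed

lemma weight_operator_act:
  "word_deg C v = \<beta> \<Longrightarrow> weight_operator \<beta> (act (mon 1 v))"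
  by (auto simp: weight_operator_def act_closed smult_r_distr cl_closed act_scl_commute act_grade)

lemma Kel_act: "x \<in> wtsp M \<mu> \<Longrightarrow> act (mon 1 [gK i]) x = scl B (\<kappa> i (crt C i \<mu>)) \<odot>\<^bsub>M\<^esub> x"
  using weight_module by (auto simp: weight_module_def B_gens)

text \<open>Weight modules prescribe the action of K_i only. Its inverse has degree 0 and keeps the
  weight space, so K_i acts on \<open>?y\<close> by the known scalar too, and this scalar is
  cancelled by \<open>\<kappa> i (- ?n)\<close>.\<close>

lemma Kinv_act:
  assumes "x \<in> wtsp M \<mu>"
  shows "act (mon 1 [gKinv i]) x = scl B (\<kappa> i (- crt C i \<mu>)) \<odot>\<^bsub>M\<^esub> x"
proof -
  let ?y = "act (mon 1 [gKinv i]) x" and ?n = "crt C i \<mu>"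
  have x: "x \<in> carrier M" using assms W_carrier by auto
  have "mon 1 [gK i, gKinv i] - mon 1 [] \<in> rels" by (auto simp: rels_def qgroup_rels_def)
  from act_rel[OF this x] have "act (mon 1 [gK i, gKinv i]) x = x"
    using x by (simp add: act_diff act_closed cl_one smult_one V.minus_eq_zero_iff)
  then have "act (mon 1 [gK i]) ?y = x" using act_append[OF x, of "[gK i]" "[gKinv i]" 1 1] by simp
  moreover have "?y \<in> wtsp M \<mu>" using act_grade[OF assms, of "[gKinv i]" 1] by (simp add: word_deg_def)
  ultimately have eq: "x = scl B (\<kappa> i ?n) \<odot>\<^bsub>M\<^esub> ?y" by (simp add: Kel_act)
  have "\<kappa> i (- ?n) * \<kappa> i ?n = 1" using \<kappa>_add[of i "- ?n" ?n] by (simp add: \<kappa>_zero)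
  then have "scl B (\<kappa> i (- ?n)) \<odot>\<^bsub>M\<^esub> x = ?y"
    using x by (subst eq) (simp add: \<rho>_mult[symmetric] act_closed \<rho>_one)
  then show ?thesis by simp
qed

lemma K_word_act:
  assumes "x \<in> wtsp M \<mu>" "v \<in> {[], [gK i], [gKinv i]}"
  shows "act (mon 1 v) x = scl B (K_value \<kappa> i (crt C i \<mu>) v) \<odot>\<^bsub>M\<^esub> x"
  using assms Kel_act Kinv_act by (auto simp: K_value_def cl_one smult_one W_carrier \<rho>_one)

lemma h_act:
  assumes "x \<in> wtsp M \<mu>"
  shows "act (h i) x = scl B (H i (crt C i \<mu>)) \<odot>\<^bsub>M\<^esub> x"
proof -
  have x: "x \<in> carrier M" using assms W_carrier by auto
  show ?thesis unfolding h[of i] H right_diff_distrib act_diff[OF x] act_scl[OF x, where c = "hc i"] \<rho>_diff[OF x]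
    using x uw by (simp add: K_word_act[OF assms uw(1)[of i]] K_word_act[OF assms uw(2)[of i]] \<rho>_mult)
qed

text \<open>Each defining relation vanishes in \<open>B\<close> and therefore kills every vector; on
  a weight vector the term \<open>h i\<close> turns into \<open>H\<close>.\<close>

lemma quantum_rep_act:
  "quantum_rep M (wtsp M) (\<lambda>c x. scl B c \<odot>\<^bsub>M\<^esub> x) C t H se sf
    (\<lambda>i x. eel B i \<odot>\<^bsub>M\<^esub> x) (\<lambda>i x. fel B i \<odot>\<^bsub>M\<^esub> x)"
proof unfold_locales
  fix i j x \<mu>
  show "weight_operator (rt C i) (\<lambda>x. eel B i \<odot>\<^bsub>M\<^esub> x)"
    using weight_operator_act[of "[gE i]"] by (simp add: B_gens word_deg_def)
  show "weight_operator (- rt C i) (\<lambda>x. fel B i \<odot>\<^bsub>M\<^esub> x)"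
    using weight_operator_act[of "[gF i]"] by (simp add: B_gens word_deg_def)
  assume xW: "x \<in> wtsp M \<mu>"
  then have x: "x \<in> carrier M" using W_carrier by auto
  let ?z = "if i = j then scl B (H i (crt C i \<mu>)) \<odot>\<^bsub>M\<^esub> x else \<zero>\<^bsub>M\<^esub>"
  have "mon 1 [gE i, gF j] - mon (t i j) [gF j, gE i] - (if i = j then h i else 0) \<in> rels"
    by (auto simp: rels_def qgroup_rels_def)
  from act_rel[OF this x]
  have "act (mon 1 [gE i, gF j]) x \<ominus>\<^bsub>M\<^esub> act (mon (t i j) [gF j, gE i]) x \<ominus>\<^bsub>M\<^esub> ?z = \<zero>\<^bsub>M\<^esub>"
    using x xW by (simp add: act_diff h_act act_zero split: if_splits)
  moreover have z: "?z \<in> carrier M" using x by (simp add: \<rho>_closed)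
  ultimately have "act (mon 1 [gE i, gF j]) x \<ominus>\<^bsub>M\<^esub> act (mon (t i j) [gF j, gE i]) x = ?z"
    by (intro iffD1[OF V.minus_eq_zero_iff[OF V.minus_closed[OF act_closed[OF x] act_closed[OF x]] z]])
  then have "act (mon 1 [gE i, gF j]) x = act (mon (t i j) [gF j, gE i]) x \<oplus>\<^bsub>M\<^esub> ?z"
    by (rule iffD1[OF V.minus_eq_iff[OF act_closed[OF x] act_closed[OF x] z]])
  then show "eel B i \<odot>\<^bsub>M\<^esub> (fel B j \<odot>\<^bsub>M\<^esub> x) = scl B (t i j) \<odot>\<^bsub>M\<^esub> (fel B j \<odot>\<^bsub>M\<^esub> (eel B i \<odot>\<^bsub>M\<^esub> x)) \<oplus>\<^bsub>M\<^esub> ?z"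
    unfolding act_scl[OF x, where c = "t i j"]
    using act_append[OF x, of "[gE i]" "[gF j]" 1 1] act_append[OF x, of "[gF j]" "[gE i]" 1 1] by (simp add: B_gens)
  assume ij: "i \<noteq> j"
  show "(\<Oplus>\<^bsub>M\<^esub>k\<in>{..serre_len C i j}. scl B (se i j k) \<odot>\<^bsub>M\<^esub> ((\<lambda>x. eel B i \<odot>\<^bsub>M\<^esub> x) ^^ (serre_len C i j - k))
      (eel B j \<odot>\<^bsub>M\<^esub> (((\<lambda>x. eel B i \<odot>\<^bsub>M\<^esub> x) ^^ k) x))) = \<zero>\<^bsub>M\<^esub>"
  proof -
    have "(\<Sum>k\<le>serre_len C i j. mon (se i j k)
           (replicate (serre_len C i j - k) (gE i) @ [gE j] @ replicate k (gE i))) \<in> rels"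
      unfolding rels_def qgroup_rels_def using ij
      by (intro UnI2 UN_I[of i] UN_I[of j] UNIV_I) auto
    from act_rel[OF this x] show ?thesis
      unfolding act_sum[OF x finite_atMost] act_serre[OF x] by (simp only: B_gens(2,3))
  qed
  show "(\<Oplus>\<^bsub>M\<^esub>k\<in>{..serre_len C i j}. scl B (sf i j k) \<odot>\<^bsub>M\<^esub> ((\<lambda>x. fel B i \<odot>\<^bsub>M\<^esub> x) ^^ (serre_len C i j - k))
      (fel B j \<odot>\<^bsub>M\<^esub> (((\<lambda>x. fel B i \<odot>\<^bsub>M\<^esub> x) ^^ k) x))) = \<zero>\<^bsub>M\<^esub>"
  proof -
    have "(\<Sum>k\<le>serre_len C i j. mon (sf i j k)
           (replicate (serre_len C i j - k) (gF i) @ [gF j] @ replicate k (gF i))) \<in> rels"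
      unfolding rels_def qgroup_rels_def using ij
      by (intro UnI2 UN_I[of i] UN_I[of j] UNIV_I) auto
    from act_rel[OF this x] show ?thesis
      unfolding act_sum[OF x finite_atMost] act_serre[OF x] by (simp only: B_gens(2,3))
  qed
qed

end

context quantum_presentation
begin

text \<open>The elements of \<open>B\<close> that commute with \<open>f\<close> are closed under
  sums and products. K_i and its inverse belong to them without further assumption: they act by
  scalars determined by the weight, and \<open>f\<close> preserves weights.\<close>

lemma presented_hom_commutes:
  assumes "weight_module C B \<kappa> M" "weight_module C B \<kappa> N"
    and f: "f \<in> carrier M \<rightarrow> carrier N"
      "\<And>x y. x \<in> carrier M \<Longrightarrow> y \<in> carrier M \<Longrightarrow> f (x \<oplus>\<^bsub>M\<^esub> y) = f x \<oplus>\<^bsub>N\<^esub> f y"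
      "\<And>\<mu> x. x \<in> wtsp M \<mu> \<Longrightarrow> f x \<in> wtsp N \<mu>"
    and scl: "\<And>c x. x \<in> carrier M \<Longrightarrow> f (scl B c \<odot>\<^bsub>M\<^esub> x) = scl B c \<odot>\<^bsub>N\<^esub> f x"
    and eel: "\<And>i x. x \<in> carrier M \<Longrightarrow> f (eel B i \<odot>\<^bsub>M\<^esub> x) = eel B i \<odot>\<^bsub>N\<^esub> f x"
    and fel: "\<And>i x. x \<in> carrier M \<Longrightarrow> f (fel B i \<odot>\<^bsub>M\<^esub> x) = fel B i \<odot>\<^bsub>N\<^esub> f x"
    and "a \<in> carrier B" "x \<in> carrier M"
  shows "f (a \<odot>\<^bsub>M\<^esub> x) = a \<odot>\<^bsub>N\<^esub> f x"
proof -
  interpret M: presented_module C \<kappa>K \<kappa>K' t h se sf \<kappa> H hc u w M by unfold_locales fact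
  interpret N: presented_module C \<kappa>K \<kappa>K' t h se sf \<kappa> H hc u w N by unfold_locales fact
  interpret B: ring B by (rule ring_B)
  have fc: "f x \<in> carrier N" if "x \<in> carrier M" for x using f(1) that by auto
  let ?X = "{a \<in> carrier B. \<forall>x\<in>carrier M. f (a \<odot>\<^bsub>M\<^esub> x) = a \<odot>\<^bsub>N\<^esub> f x}"
  have hom_ext: "f (M.act (mon 1 [g]) x) = N.act (mon 1 [g]) (f x)"
    if "\<And>\<mu> x. x \<in> wtsp M \<mu> \<Longrightarrow> f (M.act (mon 1 [g]) x) = N.act (mon 1 [g]) (f x)"
      and "x \<in> carrier M" for g x
    by (rule M.additive_eqI[where U = N])
      (use f that fc in \<open>auto simp: M.act_closed N.act_closed cl_closed M.smult_r_distr N.smult_r_distr\<close>)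
  have "a \<in> ?X"
  proof (rule B_generated[OF _ _ _ _ _ _ _ \<open>a \<in> carrier B\<close>])
    fix i
    have "f (M.act (mon 1 [gK i]) x) = N.act (mon 1 [gK i]) (f x)" if "x \<in> wtsp M \<mu>" for x \<mu>
      using that by (simp add: M.Kel_act N.Kel_act[OF f(3)] scl M.W_carrier)
    then show "Kel B i \<in> ?X" by (simp add: B_gens cl_closed hom_ext)
    have "f (M.act (mon 1 [gKinv i]) x) = N.act (mon 1 [gKinv i]) (f x)" if "x \<in> wtsp M \<mu>" for x \<mu>
      using that by (simp add: M.Kinv_act N.Kinv_act[OF f(3)] scl M.W_carrier)
    then show "cl (mon 1 [gKinv i]) \<in> ?X" by (simp add: cl_closed hom_ext)
    show "eel B i \<in> ?X" "fel B i \<in> ?X" using eel fel by (simp_all add: B_gens cl_closed)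
  next
    fix c show "scl B c \<in> ?X" using scl by (simp add: B_gens cl_closed)
  next
    fix a b assume "a \<in> ?X" "b \<in> ?X"
    then show "a \<oplus>\<^bsub>B\<^esub> b \<in> ?X" "a \<otimes>\<^bsub>B\<^esub> b \<in> ?X"
      by (auto simp: M.smult_l_distr N.smult_l_distr M.smult_assoc N.smult_assoc f M.smult_closed fc)
  qed
  then show ?thesis using assms by simp
qed

end

subsection \<open>Operators satisfying the relations define a module\<close>

lemma (in abelian_group) ring_hom_minus_apply:
  assumes "ring A" "\<Phi> \<in> ring_hom A (end_ring G)" "f \<in> carrier A" "g \<in> carrier A" "x \<in> carrier G"
  shows "\<Phi> (f \<ominus>\<^bsub>A\<^esub> g) x = \<Phi> f x \<ominus> \<Phi> g x"
proof -
  interpret A: ring A by fact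
  have "\<Phi> f = \<Phi> (f \<ominus>\<^bsub>A\<^esub> g) \<oplus>\<^bsub>end_ring G\<^esub> \<Phi> g"
    using ring_hom_add[OF assms(2) A.minus_closed[OF assms(3,4)] assms(4)] assms(3,4)
    by (simp add: A.minus_eq A.a_assoc A.l_neg)
  then have "\<Phi> f x = \<Phi> g x \<oplus> \<Phi> (f \<ominus>\<^bsub>A\<^esub> g) x"
    using assms ring_hom_closed[OF assms(2)] A.minus_closed[OF assms(3,4)]
    by (simp add: end_ring_apply a_comm)
  moreover have "\<Phi> a x \<in> carrier G" if "a \<in> carrier A" for a
    using end_ring_apply(5)[OF ring_hom_closed[OF assms(2) that] assms(5)] .
  ultimately have "\<Phi> f x \<ominus> \<Phi> g x = \<Phi> (f \<ominus>\<^bsub>A\<^esub> g) x"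
    by (intro iffD2[OF minus_eq_iff]) (use assms A.minus_closed[OF assms(3,4)] in auto)
  then show ?thesis ..
qed

lemma sum_single_lookup:
  "(\<Sum>x\<in>Poly_Mapping.keys f. Poly_Mapping.single x (Poly_Mapping.lookup f x)) = f"
  by (rule poly_mapping_eqI) (auto simp: lookup_sum lookup_single when_def sum.delta in_keys_iff)

fun gen_op :: "('i \<Rightarrow> 'v \<Rightarrow> 'v) \<Rightarrow> ('i \<Rightarrow> 'v \<Rightarrow> 'v) \<Rightarrow> ('i \<Rightarrow> 'v \<Rightarrow> 'v) \<Rightarrow> ('i \<Rightarrow> 'v \<Rightarrow> 'v) \<Rightarrow> 'i gen \<Rightarrow> 'v \<Rightarrow> 'v"
where
  "gen_op E F K K' (gE i) = E i"
| "gen_op E F K K' (gF i) = F i"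
| "gen_op E F K K' (gK i) = K i"
| "gen_op E F K K' (gKinv i) = K' i"

locale presentation_rep = quantum_presentation C \<kappa>K \<kappa>K' t h se sf \<kappa> H hc u w +
  quantum_rep V W \<rho> C t H se sf E F
  for C :: "('i, 'p::ab_group_add) superdatum" and \<kappa>K \<kappa>K' t :: "'i \<Rightarrow> 'i \<Rightarrow> 'k::comm_ring_1"
    and h se sf \<kappa> H hc u w
    and V :: "('v, 'x) ring_scheme" (structure) and W \<rho> E F
begin

text \<open>The rightmost letter acts first. The letters K_i are interpreted by the scalings that a
  weight module forces.\<close>

definition wop :: "'i gen list \<Rightarrow> 'v \<Rightarrow> 'v" where
  "wop v = foldr (gen_op E F (\<lambda>i. scaling (\<lambda>\<mu>. \<kappa> i (crt C i \<mu>))) (\<lambda>i. scaling (\<lambda>\<mu>. \<kappa> i (- crt C i \<mu>)))) v"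

lemma wop_simps [simp]: "wop [] x = x" "wop (gE i # v) x = E i (wop v x)" "wop (gF i # v) x = F i (wop v x)"
  "wop (gK i # v) x = scaling (\<lambda>\<mu>. \<kappa> i (crt C i \<mu>)) (wop v x)"
  "wop (gKinv i # v) x = scaling (\<lambda>\<mu>. \<kappa> i (- crt C i \<mu>)) (wop v x)"
  "wop (v @ v') x = wop v (wop v' x)"
  by (simp_all add: wop_def)

lemma wop_replicate: "wop (replicate n (gE i)) = E i ^^ n" "wop (replicate n (gF i)) = F i ^^ n"
  by (induction n) auto

lemma wop_operator: "weight_operator (word_deg C v) (wop v)"
proof (induction v)
  case Nil then show ?case using weight_operator_id by (simp add: word_deg_def wop_def id_def)
next
  case (Cons g v)
  have "weight_operator (gen_deg C g) (wop [g])"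
    by (cases g) (auto simp: wop_def E_op F_op weight_operator_scaling)
  from weight_operator_comp[OF this Cons] show ?case
    using wop_simps(6)[of "[g]" v] by (simp add: word_deg_def add.commute)
qed

text \<open>The free algebra acts through words, the relations die because they die on weight
  vectors, and the map factors through the quotient. The last conjunct, on degree-zero operators
  \<open>S\<close> commuting with all \<open>E i\<close> and \<open>F i\<close>, serves the tensor
  products: it makes the scalars of a larger ring commute with the action of
  \<open>B\<close>.\<close>

lemma presented_hom_ex:
  "\<exists>\<Phi> \<in> ring_hom B (end_ring V).
    (\<forall>c. \<forall>x\<in>carrier V. \<Phi> (scl B c) x = \<rho> c x) \<and>
    (\<forall>i. \<forall>x\<in>carrier V. \<Phi> (eel B i) x = E i x) \<and>
    (\<forall>i. \<forall>x\<in>carrier V. \<Phi> (fel B i) x = F i x) \<and>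
    (\<forall>i \<mu>. \<forall>x\<in>W \<mu>. \<Phi> (Kel B i) x = \<rho> (\<kappa> i (crt C i \<mu>)) x) \<and>
    (\<forall>\<beta> \<mu>. \<forall>a\<in>hcomp B \<beta>. \<forall>x\<in>W \<mu>. \<Phi> a x \<in> W (\<mu> + \<beta>)) \<and>
    (\<forall>S. weight_operator 0 S \<longrightarrow> (\<forall>i. \<forall>x\<in>carrier V. S (E i x) = E i (S x)) \<longrightarrow>
      (\<forall>i. \<forall>x\<in>carrier V. S (F i x) = F i (S x)) \<longrightarrow>
      (\<forall>a\<in>carrier B. \<forall>x\<in>carrier V. \<Phi> a (S x) = S (\<Phi> a x)))"
proof -
  interpret End: ring "end_ring V" by (rule ring_end_ring)
  let ?\<rho> = "\<lambda>c. \<lambda>x\<in>carrier V. \<rho> c x" and ?m = "\<lambda>v. \<lambda>x\<in>carrier V. wop v x"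
  note wD = weight_operatorD[OF wop_operator]
  have \<rho>_mem: "?\<rho> c \<in> carrier (end_ring V)" for c
    by (rule end_ring_memI) (auto simp: \<rho>_closed \<rho>_add)
  have m_mem: "?m v \<in> carrier (end_ring V)" for v
    by (rule end_ring_memI) (auto simp: wD)
  have \<rho>hom: "scalar_hom ?\<rho> (end_ring V)"
    unfolding scalar_hom_def
    by (intro conjI allI end_ring_eqI; use \<rho>_mem in \<open>auto simp: end_ring_apply \<rho>_one \<rho>_plus \<rho>_mult \<rho>_closed\<close>)
  have "\<exists>\<Phi> \<in> ring_hom FA (end_ring V). \<forall>v\<in>carrier word_monoid. \<forall>a.
      \<Phi> (mon a v) = ?\<rho> a \<otimes>\<^bsub>end_ring V\<^esub> ?m v"
  proof (rule monoid_algebra_hom_ex[OF End.ring_axioms _ \<rho>hom])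
    show "monoid (word_monoid :: 'i gen list monoid)"
      by (auto simp: word_monoid_def intro: monoidI)
    show "?m v \<in> carrier (end_ring V)" for v by (rule m_mem)
    show "?m \<one>\<^bsub>word_monoid\<^esub> = \<one>\<^bsub>end_ring V\<^esub>"
      by (rule end_ring_eqI[of _ V]) (use m_mem[of "[]"] in \<open>auto simp: word_monoid_def end_ring_apply\<close>)
    show "?m (v \<otimes>\<^bsub>word_monoid\<^esub> v') = ?m v \<otimes>\<^bsub>end_ring V\<^esub> ?m v'" for v v'
      by (rule end_ring_eqI[of _ V]) (use m_mem m_mem[of "v @ v'"] in \<open>auto simp: word_monoid_def end_ring_apply wD\<close>)
    show "?m v \<otimes>\<^bsub>end_ring V\<^esub> ?\<rho> a = ?\<rho> a \<otimes>\<^bsub>end_ring V\<^esub> ?m v" for v a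
      by (rule end_ring_eqI[of _ V]) (use m_mem \<rho>_mem in \<open>auto simp: end_ring_apply wD \<rho>_closed\<close>)
  qed
  then obtain \<Phi> where \<Phi>: "\<Phi> \<in> ring_hom FA (end_ring V)"
    and "\<And>v a. \<Phi> (mon a v) = ?\<rho> a \<otimes>\<^bsub>end_ring V\<^esub> ?m v" by (auto simp: word_monoid_def)
  then have mon: "\<Phi> (mon a v) x = \<rho> a (wop v x)" if "x \<in> carrier V" for a v x
    using that by (simp add: end_ring_apply wD)
  have \<Phi>c: "\<Phi> f \<in> carrier (end_ring V)" for f using ring_hom_closed[OF \<Phi>] by (simp add: FA_simps)
  have \<Phi>cx: "\<Phi> f x \<in> carrier V" if "x \<in> carrier V" for f x using end_ring_apply(5)[OF \<Phi>c that] .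
  have \<Phi>_add: "\<Phi> (f + g) x = \<Phi> f x \<oplus> \<Phi> g x" if "x \<in> carrier V" for f g x
    using ring_hom_add[OF \<Phi>, of f g] that by (simp add: FA_simps end_ring_apply)
  have minus: "f \<ominus>\<^bsub>FA\<^esub> g = f - g" for f g
    by (rule monoid_algebra_minus) (auto simp: FA_simps(1), auto simp: word_monoid_def intro: monoidI)
  have \<Phi>_diff: "\<Phi> (f - g) x = \<Phi> f x \<ominus> \<Phi> g x" if "x \<in> carrier V" for f g x
    using ring_hom_minus_apply[OF FA.ring_axioms \<Phi>, of f g x] that by (simp add: minus FA_simps(1))
  have \<Phi>_zero: "\<Phi> 0 x = \<zero>" if "x \<in> carrier V" for x
    using \<Phi>_add[OF that, of 0 0] \<Phi>cx[OF that, of 0] by simp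
  have \<Phi>_sum: "\<Phi> (\<Sum>k\<in>S. f k) x = (\<Oplus>k\<in>S. \<Phi> (f k) x)" if "x \<in> carrier V" "finite S" for f :: "nat \<Rightarrow> _" and S x
    using that(2)
    by (induction S rule: finite_induct) (use that(1) in \<open>auto simp: \<Phi>_zero \<Phi>_add \<Phi>cx\<close>)
  have inv: "\<kappa> i (- n) * \<kappa> i n = 1" for i n using \<kappa>_add[of i "- n" n] by (simp add: \<kappa>_zero)
  have inv': "\<kappa> i n * \<kappa> i (- n) = 1" for i n using inv[of i n] by (simp add: mult.commute)
  have cv: "wop v x \<in> carrier V" if "x \<in> carrier V" for v x using wD(1) that by blast
  have Eq0: "\<Phi> r = \<zero>\<^bsub>end_ring V\<^esub>" if "\<And>\<mu> x. x \<in> W \<mu> \<Longrightarrow> \<Phi> r x = \<zero>" for r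
  proof (rule end_ring_eqI[of _ V])
    fix x assume "x \<in> carrier V"
    then have "\<Phi> r x = \<zero>"
      by (rule additive_eqI[where f = "\<Phi> r" and U = V and g = "\<lambda>_. \<zero>", rotated 5])
        (simp_all add: \<Phi>cx that end_ring_memD(2)[OF \<Phi>c])
    then show "\<Phi> r x = \<zero>\<^bsub>end_ring V\<^esub> x" using \<open>x \<in> carrier V\<close> by (simp add: end_ring_apply)
  qed (auto simp: \<Phi>c)
  have word: "wop v x = \<rho> (K_value \<kappa> i (crt C i \<mu>) v) x" if "x \<in> W \<mu>" "v \<in> {[], [gK i], [gKinv i]}" for v x i \<mu>
    using that by (auto simp: K_value_def scaling_homogeneous \<rho>_one W_carrier)
  have h_val: "\<Phi> (h i) x = \<rho> (H i (crt C i \<mu>)) x" if "x \<in> W \<mu>" for i x \<mu>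
    using that W_carrier[OF that]
    by (simp add: h[of i] H \<Phi>_diff mon word[OF that uw(1)[of i]] word[OF that uw(2)[of i]] right_diff_distrib \<rho>_diff \<rho>_mult)
  have \<kappa>_hom: "scaling (\<lambda>\<mu>. \<kappa> i (crt C i \<mu>)) x = \<rho> (\<kappa> i (crt C i \<mu>)) x"
    "scaling (\<lambda>\<mu>. \<kappa> i (- crt C i \<mu>)) x = \<rho> (\<kappa> i (- crt C i \<mu>)) x" if "x \<in> W \<mu>" for i x \<mu>
    using that by (simp_all add: scaling_homogeneous)
  have crt0: "crt C i 0 = 0" for i using crt_hom[of i 0 0] by simp
  have crt_minus: "crt C i (- \<mu>) = - crt C i \<mu>" for i \<mu> using crt_hom[of i \<mu> "- \<mu>"] crt0 by simp
  have EW: "E i x \<in> W (\<mu> + rt C i)" and FW: "F i x \<in> W (\<mu> - rt C i)" if "x \<in> W \<mu>" for i x \<mu>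
    using weight_operatorD(4)[OF E_op that] weight_operatorD(4)[OF F_op that] by simp_all
  \<comment> \<open>The relations with K_i reduce to identities between scalars; additivity of
    \<open>\<kappa>\<close> together with \<open>crt_rt\<close> produces the conjugation factors
    \<open>\<kappa>K\<close> and \<open>\<kappa>K'\<close>.\<close>
  have rel: "\<Phi> r x = \<zero>" if r: "r \<in> rels" and xW: "x \<in> W \<mu>" for r x \<mu>
  proof -
    have x: "x \<in> carrier V" using xW by (rule W_carrier)
    have K1: "\<Phi> (mon 1 [gK i, gKinv i] - mon 1 []) x = \<zero>" for i
      using x xW \<kappa>_hom(1)[OF \<rho>_W[OF xW]]
      by (simp add: \<Phi>_diff mon \<kappa>_hom \<rho>_one \<rho>_closed minus_eq_zero_iff inv inv' mult.commute flip: \<rho>_mult)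
    have K2: "\<Phi> (mon 1 [gKinv i, gK i] - mon 1 []) x = \<zero>" for i
      using x xW \<kappa>_hom(2)[OF \<rho>_W[OF xW]]
      by (simp add: \<Phi>_diff mon \<kappa>_hom \<rho>_one \<rho>_closed minus_eq_zero_iff inv inv' mult.commute flip: \<rho>_mult)
    have KK: "\<Phi> (mon 1 [gK i, gK j] - mon 1 [gK j, gK i]) x = \<zero>" for i j
      using x xW \<kappa>_hom(1)[OF \<rho>_W[OF xW]]
      by (simp add: \<Phi>_diff mon \<kappa>_hom \<rho>_one \<rho>_closed minus_eq_zero_iff inv inv' mult.commute flip: \<rho>_mult)
    have KE: "\<Phi> (mon 1 [gK i, gE j, gKinv i] - mon (\<kappa>K i j) [gE j]) x = \<zero>" for i j
    proof -
      have "scaling (\<lambda>\<mu>. \<kappa> i (crt C i \<mu>)) (E j (\<rho> (\<kappa> i (- crt C i \<mu>)) x))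
        = \<rho> (\<kappa> i (crt C i (\<mu> + rt C j)) * \<kappa> i (- crt C i \<mu>)) (E j x)"
        using x \<kappa>_hom(1)[OF EW[OF \<rho>_W[OF xW]]] weight_operatorD[OF E_op, of x] by (simp add: \<rho>_mult)
      moreover have "\<kappa> i (crt C i (\<mu> + rt C j)) * \<kappa> i (- crt C i \<mu>) = \<kappa>K i j"
        by (simp add: crt_hom crt_rt \<kappa>K flip: \<kappa>_add)
      ultimately show ?thesis using x xW weight_operatorD[OF E_op, of x]
        by (simp add: \<Phi>_diff mon \<kappa>_hom \<rho>_one \<rho>_closed minus_eq_zero_iff weight_operatorD(1)[OF E_op])
    qed
    have KF: "\<Phi> (mon 1 [gK i, gF j, gKinv i] - mon (\<kappa>K' i j) [gF j]) x = \<zero>" for i j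
    proof -
      have "scaling (\<lambda>\<mu>. \<kappa> i (crt C i \<mu>)) (F j (\<rho> (\<kappa> i (- crt C i \<mu>)) x))
        = \<rho> (\<kappa> i (crt C i (\<mu> - rt C j)) * \<kappa> i (- crt C i \<mu>)) (F j x)"
        using x \<kappa>_hom(1)[OF FW[OF \<rho>_W[OF xW]]] weight_operatorD[OF F_op, of x] by (simp add: \<rho>_mult)
      moreover have "\<kappa> i (crt C i (\<mu> - rt C j)) * \<kappa> i (- crt C i \<mu>) = \<kappa>K' i j"
        using crt_hom[of i \<mu> "- rt C j"] by (simp add: crt_minus crt_rt \<kappa>K flip: \<kappa>_add)
      ultimately show ?thesis using x xW weight_operatorD[OF F_op, of x]
        by (simp add: \<Phi>_diff mon \<kappa>_hom \<rho>_one \<rho>_closed minus_eq_zero_iff weight_operatorD(1)[OF F_op])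
    qed
    have EFr: "\<Phi> (mon 1 [gE i, gF j] - mon (t i j) [gF j, gE i] - (if i = j then h i else 0)) x = \<zero>" for i j
    proof -
      let ?z = "if i = j then \<rho> (H i (crt C i \<mu>)) x else \<zero>"
      have c: "E i (F j x) \<in> carrier V" "\<rho> (t i j) (F j (E i x)) \<in> carrier V" "?z \<in> carrier V"
        using x weight_operatorD(1)[OF F_op] weight_operatorD(1)[OF E_op] by (auto simp: \<rho>_closed)
      have "E i (F j x) \<ominus> \<rho> (t i j) (F j (E i x)) = ?z"
        using iffD2[OF minus_eq_iff[OF c] EF[OF xW]] .
      moreover have "\<Phi> (if i = j then h i else 0) x = ?z" using h_val[OF xW] x by (simp add: \<Phi>_zero)
      ultimately show ?thesis using x c(3)
        by (simp add: \<Phi>_diff mon \<rho>_one c minus_eq_zero_iff del: if_split)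
    qed
    have SE: "\<Phi> (\<Sum>k\<le>serre_len C i j. mon (se i j k)
           (replicate (serre_len C i j - k) (gE i) @ [gE j] @ replicate k (gE i))) x = \<zero>" if "j \<noteq> i" for i j
      using serre_E[OF not_sym[OF that] xW] x by (simp add: \<Phi>_sum mon wop_replicate)
    have SF: "\<Phi> (\<Sum>k\<le>serre_len C i j. mon (sf i j k)
           (replicate (serre_len C i j - k) (gF i) @ [gF j] @ replicate k (gF i))) x = \<zero>" if "j \<noteq> i" for i j
      using serre_F[OF not_sym[OF that] xW] x by (simp add: \<Phi>_sum mon wop_replicate)
    from r show ?thesis unfolding rels_def qgroup_rels_def
      by (elim UnE UN_E insertE emptyE; hypsubst)
        (rule K1 K2 KK KE KF EFr | rule SE, simp; fail | rule SF, simp; fail)+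
  qed
  have grade: "\<Phi> f x \<in> W (\<mu> + \<beta>)" if f: "\<forall>w \<in> Poly_Mapping.keys f. word_deg C w = \<beta>" and xW: "x \<in> W \<mu>" for f x \<mu> \<beta>
  proof -
    have "\<Phi> (\<Sum>v\<in>S. mon (Poly_Mapping.lookup f v) v) x \<in> W (\<mu> + \<beta>)" if "finite S" "S \<subseteq> Poly_Mapping.keys f" for S
      using that
    proof (induction S rule: finite_induct)
      case empty then show ?case using W_zero by (simp add: \<Phi>_zero W_carrier[OF xW])
    next
      case (insert v S)
      have "word_deg C v = \<beta>" using bspec[OF f, of v] insert.prems by simp
      then have "wop v x \<in> W (\<mu> + \<beta>)" using wD(4)[OF xW, of v] by simp
      moreover have "\<Phi> (\<Sum>v\<in>S. mon (Poly_Mapping.lookup f v) v) x \<in> W (\<mu> + \<beta>)"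
        using insert.IH insert.prems by simp
      ultimately show ?case
        unfolding sum.insert[OF insert.hyps] \<Phi>_add[OF W_carrier[OF xW]] mon[OF W_carrier[OF xW]]
        by (intro W_add \<rho>_W)
    qed
    from this[OF finite_keys subset_refl]
    show ?thesis unfolding sum_single_lookup .
  qed
  have comm: "\<Phi> f (S x) = S (\<Phi> f x)"
    if S: "weight_operator 0 S" "\<forall>i. \<forall>x\<in>carrier V. S (E i x) = E i (S x)"
      "\<forall>i. \<forall>x\<in>carrier V. S (F i x) = F i (S x)" and x: "x \<in> carrier V" for f S x
  proof -
    note SD = weight_operatorD[OF S(1)]
    have w: "wop v (S x) = S (wop v x)" for v
    proof (induction v)
      case (Cons g v)
      \<comment> \<open>The letters K_i act by scalings, and a scaling commutes with an operator
        that does not shift the weight.\<close>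
      have "scaling k (S (wop v x)) = S (scaling k (wop v x))" for k
        using scaling_commute[OF S(1) cv[OF x]] by simp
      then show ?case using Cons S(2,3) cv[OF x] by (cases g) simp_all
    qed simp
    have "f \<in> carrier FA" by (simp add: FA_simps)
    then show ?thesis
    proof (induction f rule: monoid_algebra_induct)
      case zero then show ?case by (simp add: \<Phi>_zero SD(1) x weight_operator_zero[OF S(1)])
    next
      case (single v a) then show ?case by (simp add: mon SD(1) x w SD(3) cv)
    next
      case (add f g) then show ?case by (simp add: \<Phi>_add SD(1) x SD(2) \<Phi>cx)
    qed
  qed
  have ker: "\<Phi> r = \<zero>\<^bsub>end_ring V\<^esub>" if "r \<in> rels" for r
    by (rule Eq0) (rule rel[OF that])
  interpret \<Phi>: ring_hom_ring FA "end_ring V" \<Phi>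
    by (rule ring_hom_ringI2[OF FA.ring_axioms End.ring_axioms \<Phi>])
  have "Idl\<^bsub>FA\<^esub> rels \<subseteq> a_kernel FA (end_ring V) \<Phi>"
  proof (rule FA.genideal_minimal[OF \<Phi>.kernel_is_ideal])
    show "rels \<subseteq> a_kernel FA (end_ring V) \<Phi>"
    proof
      fix r assume "r \<in> rels"
      then show "r \<in> a_kernel FA (end_ring V) \<Phi>"
        unfolding a_kernel_def' FA_simps(1) mem_Collect_eq by (intro conjI UNIV_I ker)
    qed
  qed
  then have "\<Phi> f = \<zero>\<^bsub>end_ring V\<^esub>" if "f \<in> Idl\<^bsub>FA\<^esub> rels" for f
    using that unfolding a_kernel_def' by blast
  from quotient_ring_hom_ex[OF FA.ring_axioms End.ring_axioms \<Phi> ideal_rels this]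
  obtain \<Psi> where \<Psi>: "\<Psi> \<in> ring_hom (FA Quot (Idl\<^bsub>FA\<^esub> rels)) (end_ring V)" "\<And>f. \<Psi> (cl f) = \<Phi> f"
    unfolding FA_simps(1) cl_def by blast
  have \<Psi>': "\<Psi> \<in> ring_hom B (end_ring V)"
    using \<Psi>(1) by (simp add: ring_hom_def B_fields)
  show ?thesis
    by (rule bexI[OF _ \<Psi>'])
      (auto simp: B_gens carrier_B \<Psi>(2) mon \<rho>_one W_carrier weight_operatorD(1)[OF E_op]
        weight_operatorD(1)[OF F_op] \<kappa>_hom \<rho>_closed grade comm)
qed

end

section \<open>Units and integer powers\<close>

lemma uinv_eqI:
  assumes "x * y = 1"
  shows "uinv x = y"
  unfolding uinv_def
proof (rule the_equality[of "\<lambda>y. x * y = 1", OF assms])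
  fix z assume "x * z = 1"
  then have "z = (x * y) * z" "y = (x * z) * y" using assms by simp_all
  then show "z = y" by (simp add: ac_simps)
qed

lemma uinv_right: "x dvd 1 \<Longrightarrow> x * uinv x = 1"
  by (metis uinv_eqI dvdE)

lemma uinv_left: "x dvd 1 \<Longrightarrow> uinv x * x = 1"
  by (metis uinv_right mult.commute)

lemma uinv_unit: "x dvd 1 \<Longrightarrow> uinv x dvd 1"
  by (metis uinv_left dvd_triv_left)

lemma uinv_one [simp]: "uinv 1 = 1" by (rule uinv_eqI) simp

lemma uinv_uinv: "x dvd 1 \<Longrightarrow> uinv (uinv x) = x"
  by (rule uinv_eqI) (rule uinv_left)

lemma unit_mult: "x dvd 1 \<Longrightarrow> y dvd 1 \<Longrightarrow> x * y dvd (1 :: 'k::comm_ring_1)"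
  using mult_dvd_mono[of x 1 y 1] by simp

lemma unit_power: "x dvd 1 \<Longrightarrow> x ^ n dvd (1 :: 'k::comm_ring_1)"
  by (induction n) (auto intro: unit_mult)

lemma unit_prod: "(\<And>a. a \<in> S \<Longrightarrow> f a dvd 1) \<Longrightarrow> prod f S dvd (1 :: 'k::comm_ring_1)"
  by (induction S rule: infinite_finite_induct) (auto intro: unit_mult)

lemma uinv_mult: "x dvd 1 \<Longrightarrow> y dvd 1 \<Longrightarrow> uinv (x * y) = uinv x * uinv y"
proof (rule uinv_eqI)
  assume "x dvd 1" "y dvd 1"
  then have "(x * uinv x) * (y * uinv y) = 1" by (simp add: uinv_right)
  then show "x * y * (uinv x * uinv y) = 1" by (simp add: ac_simps)
qed

lemma uinv_power: "x dvd 1 \<Longrightarrow> uinv (x ^ n) = uinv x ^ n"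
  by (rule uinv_eqI) (simp add: uinv_right flip: power_mult_distrib)

lemma unit_cancel_left:
  assumes "a dvd (1 :: 'k::comm_ring_1)" "a * x = a * y"
  shows "x = y"
proof -
  have "uinv a * (a * x) = uinv a * (a * y)" using assms(2) by simp
  then show ?thesis using uinv_left[OF assms(1)] by (simp flip: mult.assoc)
qed

lemma zpow_of_nat [simp]: "zpow x (int n) = x ^ n" by (simp add: zpow_def)
lemma zpow_neg_nat [simp]: "zpow x (- int n) = uinv x ^ n" by (simp add: zpow_def)
lemma zpow_zero [simp]: "zpow x 0 = 1" by (simp add: zpow_def)
lemma zpow_one [simp]: "zpow x 1 = x" by (simp add: zpow_def)
lemma zpow_minus_one [simp]: "zpow x (- 1) = uinv x" by (simp add: zpow_def)

lemma zpow_Suc: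
  assumes "x dvd 1"
  shows "zpow x (n + 1) = x * zpow x n"
proof (cases "n \<ge> 0")
  case True
  then obtain k where "n = int k" using nonneg_int_cases by blast
  then show ?thesis using zpow_of_nat[of x "Suc k"] by (simp add: add.commute)
next
  case False
  then obtain k where k: "n = - int (Suc k)"
    by (metis add.commute int_cases le_add_same_cancel1 of_nat_0_le_iff)
  have "x * (uinv x * uinv x ^ k) = uinv x ^ k" using uinv_right[OF assms] by (simp flip: mult.assoc)
  moreover have "n + 1 = - int k" using k by simp
  ultimately show ?thesis using zpow_neg_nat[of x "Suc k"] by (simp only: k zpow_neg_nat power_Suc)
qed

lemma zpow_pred:
  assumes "x dvd 1"
  shows "zpow x (n - 1) = uinv x * zpow x n"
  using zpow_Suc[OF assms, of "n - 1"] uinv_left[OF assms] by (simp flip: mult.assoc)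

lemma zpow_add: "x dvd 1 \<Longrightarrow> zpow x (m + n) = zpow x m * zpow x n"
proof (induction n rule: int_induct[where k = 0])
  case (step1 i)
  then show ?case using zpow_Suc[of x "m + i"] zpow_Suc[of x i] by (simp add: ac_simps)
next
  case (step2 i)
  then show ?case using zpow_pred[of x "m + i"] zpow_pred[of x i] by (simp add: ac_simps add_diff_eq)
qed simp

lemma zpow_unit: "x dvd 1 \<Longrightarrow> zpow x n dvd 1"
  by (auto simp: zpow_def intro: unit_power uinv_unit)

lemma zpow_minus: "x dvd 1 \<Longrightarrow> zpow x (- n) = uinv (zpow x n)"
  by (rule uinv_eqI[symmetric]) (simp flip: zpow_add)

lemma zpow_mult_distrib: "x dvd 1 \<Longrightarrow> y dvd 1 \<Longrightarrow> zpow (x * y) n = zpow x n * zpow y n"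
  by (simp add: zpow_def power_mult_distrib uinv_mult)

lemma zpow_mult:
  assumes "x dvd 1"
  shows "zpow x (m * n) = zpow (zpow x m) n"
proof (induction n rule: int_induct[where k = 0])
  case (step1 i)
  then show ?case using assms by (simp add: distrib_left zpow_add zpow_Suc zpow_unit mult.commute)
next
  case (step2 i)
  then show ?case using assms zpow_add[OF assms, of "m * i" "- m"]
    by (simp add: right_diff_distrib zpow_pred zpow_unit zpow_minus mult.commute)
qed simp

lemma zpow_one_left [simp]: "zpow 1 n = 1"
  by (simp add: zpow_def)

section \<open>Twisting by scalings of weight spaces\<close>

context weight_space_module
begin

text \<open>After l steps the weight has moved by l \<beta> and the value of \<open>a\<close> has
  been multiplied by \<open>A ^ l\<close>; the n-th power collects these values for l < n.\<close>

lemma twisted_funpow: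
  assumes X: "weight_operator \<beta> T" and a: "\<And>\<mu>. a (\<mu> + \<beta>) = A * a \<mu>" and x: "x \<in> W \<mu>"
  shows "((\<lambda>x. T (scaling a x)) ^^ n) x = \<rho> (\<Prod>l<n. A ^ l * a \<mu>) ((T ^^ n) x)"
    and "a (\<mu> + (\<Sum>_<n. \<beta>)) = A ^ n * a \<mu>"
proof -
  show a_pow: "a (\<mu> + (\<Sum>_<n. \<beta>)) = A ^ n * a \<mu>" for n
  proof (induction n)
    case (Suc n)
    have "\<mu> + (\<Sum>_<Suc n. \<beta>) = \<mu> + (\<Sum>_<n. \<beta>) + \<beta>" unfolding sum.lessThan_Suc by (simp only: ac_simps)
    then show ?case using Suc by (simp only: a) (simp add: ac_simps)
  qed simp
  have xc: "x \<in> carrier V" using x by (rule W_carrier)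
  note Tn = weight_operatorD[OF weight_operator_funpow[OF X]]
  show "((\<lambda>x. T (scaling a x)) ^^ n) x = \<rho> (\<Prod>l<n. A ^ l * a \<mu>) ((T ^^ n) x)"
  proof (induction n)
    case 0 then show ?case by (simp add: \<rho>_one xc)
  next
    case (Suc n)
    have y: "(T ^^ n) x \<in> W (\<mu> + (\<Sum>_<n. \<beta>))" using Tn(4)[OF x] .
    have "((\<lambda>x. T (scaling a x)) ^^ Suc n) x = T (\<rho> (A ^ n * a \<mu>) (\<rho> (\<Prod>l<n. A ^ l * a \<mu>) ((T ^^ n) x)))"
      using Suc by (simp add: scaling_homogeneous[OF \<rho>_W[OF y]] a_pow)
    also have "\<dots> = \<rho> (A ^ n * a \<mu>) (\<rho> (\<Prod>l<n. A ^ l * a \<mu>) (T ((T ^^ n) x)))"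
      using Tn(1)[OF xc] by (simp add: weight_operatorD[OF X] \<rho>_closed)
    finally show ?case using Tn(1)[OF xc] weight_operatorD(1)[OF X] by (simp add: mult.commute \<rho>_mult \<rho>_commute)
  qed
qed

text \<open>In the k-th term the m twisted applications of \<open>S\<close> contribute a product
  over l < m that is the same for all k. What depends on k is how the two kinds of operators see
  each other: \<open>Q ^ k\<close> arises because \<open>T\<close> comes after k steps of
  \<open>S\<close>, and \<open>P ^ (m - k)\<close> from the steps of \<open>S\<close> made after
  \<open>T\<close>. So the new coefficients, corrected by these powers, only have to be proportional
  to the old ones.\<close>

lemma twisted_serre:
  assumes S: "weight_operator \<beta> S" and T: "weight_operator \<gamma> T"
    and a: "\<And>\<mu>. a (\<mu> + \<beta>) = A * a \<mu>" "\<And>\<mu>. a (\<mu> + \<gamma>) = P * a \<mu>" and b: "\<And>\<mu>. b (\<mu> + \<beta>) = Q * b \<mu>"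
    and x: "x \<in> W \<mu>"
    and c: "\<And>k. k \<le> m \<Longrightarrow> c' k * Q ^ k * P ^ (m - k) = z * c k"
    and zero: "(\<Oplus>k\<in>{..m}. \<rho> (c k) ((S ^^ (m - k)) (T ((S ^^ k) x)))) = \<zero>"
  shows "(\<Oplus>k\<in>{..m}. \<rho> (c' k) (((\<lambda>x. S (scaling a x)) ^^ (m - k)) (T (scaling b (((\<lambda>x. S (scaling a x)) ^^ k) x))))) = \<zero>"
proof -
  have xc: "x \<in> carrier V" using x by (rule W_carrier)
  note Sn = weight_operatorD[OF weight_operator_funpow[OF S]] and TD = weight_operatorD[OF T]
  \<comment> \<open>The part of the twisting factor that all terms of the Serre sum share.\<close>
  define G where "G = (\<Prod>l<m. A ^ l * a \<mu>) * b \<mu>"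
  have split: "(\<Prod>l<k + n. f l) = (\<Prod>l<k. f l) * (\<Prod>l<n. f (k + l))" for f :: "nat \<Rightarrow> 'k" and k n
    by (induction n) (auto simp: ac_simps)
  have tm: "((\<lambda>x. S (scaling a x)) ^^ (m - k)) (T (scaling b (((\<lambda>x. S (scaling a x)) ^^ k) x))) =
      \<rho> (G * (Q ^ k * P ^ (m - k))) ((S ^^ (m - k)) (T ((S ^^ k) x)))" if "k \<le> m" for k
  proof -
    let ?g = "\<Prod>l<k. A ^ l * a \<mu>" and ?\<nu> = "\<mu> + (\<Sum>_<k. \<beta>)"
    have y: "(S ^^ k) x \<in> W ?\<nu>" using Sn(4)[OF x] .
    then have yc: "(S ^^ k) x \<in> carrier V" by (rule W_carrier)
    have bk: "b ?\<nu> = Q ^ k * b \<mu>" by (rule twisted_funpow(2)[where a = b, OF S b x])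
    have ak: "a (?\<nu> + \<gamma>) = P * (A ^ k * a \<mu>)" using a(2) twisted_funpow(2)[where a = a, OF S a(1) x] by simp
    have "T (scaling b (((\<lambda>x. S (scaling a x)) ^^ k) x)) = T (scaling b (\<rho> ?g ((S ^^ k) x)))"
      by (simp add: twisted_funpow(1)[where a = a, OF S a(1) x])
    also have "\<dots> = \<rho> (Q ^ k * b \<mu> * ?g) (T ((S ^^ k) x))"
      using yc by (simp add: scaling_homogeneous[OF \<rho>_W[OF y]] bk TD \<rho>_closed \<rho>_mult)
    finally have 1: "T (scaling b (((\<lambda>x. S (scaling a x)) ^^ k) x)) = \<rho> (Q ^ k * b \<mu> * ?g) (T ((S ^^ k) x))" .
    have Ty: "T ((S ^^ k) x) \<in> W (?\<nu> + \<gamma>)" using TD(4)[OF y] .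
    have "((\<lambda>x. S (scaling a x)) ^^ (m - k)) (\<rho> (Q ^ k * b \<mu> * ?g) (T ((S ^^ k) x))) =
        \<rho> ((\<Prod>l<m - k. A ^ l * (P * (A ^ k * a \<mu>))) * (Q ^ k * b \<mu> * ?g)) ((S ^^ (m - k)) (T ((S ^^ k) x)))"
      using twisted_funpow(1)[where a = a, OF S a(1) \<rho>_W[OF Ty], of "m - k"] Sn(1,3)[OF TD(1)[OF yc]]
      by (simp add: ak \<rho>_mult)
    \<comment> \<open>The steps after \<open>T\<close> continue the product where the first k steps
      stopped, with an additional factor \<open>P\<close> each.\<close>
    also have "(\<Prod>l<m - k. A ^ l * (P * (A ^ k * a \<mu>))) = P ^ (m - k) * (\<Prod>l<m - k. A ^ (k + l) * a \<mu>)"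
    proof -
      have "(\<Prod>l<m - k. A ^ l * (P * (A ^ k * a \<mu>))) = (\<Prod>l<m - k. P * (A ^ (k + l) * a \<mu>))"
        by (simp add: power_add ac_simps)
      then show ?thesis by (simp add: prod.distrib)
    qed
    also have "P ^ (m - k) * (\<Prod>l<m - k. A ^ (k + l) * a \<mu>) * (Q ^ k * b \<mu> * ?g) = G * (Q ^ k * P ^ (m - k))"
      using split[of "\<lambda>l. A ^ l * a \<mu>" k "m - k"] that unfolding G_def by (simp add: ac_simps)
    finally show ?thesis unfolding 1 .
  qed
  have cl: "(S ^^ (m - k)) (T ((S ^^ k) x)) \<in> carrier V" for k using Sn(1) TD(1) xc by blast
  have "(\<Oplus>k\<in>{..m}. \<rho> (c' k) (((\<lambda>x. S (scaling a x)) ^^ (m - k)) (T (scaling b (((\<lambda>x. S (scaling a x)) ^^ k) x)))))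
      = (\<Oplus>k\<in>{..m}. \<rho> (G * z) (\<rho> (c k) ((S ^^ (m - k)) (T ((S ^^ k) x)))))"
  proof (rule finsum_cong')
    fix k assume "k \<in> {..m}"
    then have k: "k \<le> m" by simp
    have "c' k * (G * (Q ^ k * P ^ (m - k))) = G * (c' k * Q ^ k * P ^ (m - k))" by (simp only: ac_simps)
    also have "\<dots> = G * z * c k" unfolding c[OF k] by (simp only: ac_simps)
    finally show "\<rho> (c' k) (((\<lambda>x. S (scaling a x)) ^^ (m - k)) (T (scaling b (((\<lambda>x. S (scaling a x)) ^^ k) x)))) =
        \<rho> (G * z) (\<rho> (c k) ((S ^^ (m - k)) (T ((S ^^ k) x))))"
      unfolding tm[OF k] \<rho>_mult[OF cl, symmetric] by (rule arg_cong)
  qed (auto simp: cl \<rho>_closed)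
  also have "\<dots> = \<rho> (G * z) (\<Oplus>k\<in>{..m}. \<rho> (c k) ((S ^^ (m - k)) (T ((S ^^ k) x))))"
    by (rule \<rho>_finsum[symmetric]) (auto simp: cl \<rho>_closed)
  finally show ?thesis by (simp only: zero \<rho>_zero)
qed

end

section \<open>Changing the constants of a representation\<close>

definition serre_twist :: "('i, 'p) superdatum \<Rightarrow> ('i \<Rightarrow> 'i \<Rightarrow> nat \<Rightarrow> 'k::comm_ring_1) \<Rightarrow> ('i \<Rightarrow> 'i \<Rightarrow> nat \<Rightarrow> 'k) \<Rightarrow>
   ('i \<Rightarrow> 'i \<Rightarrow> 'k) \<Rightarrow> bool" where
  "serre_twist C s s' A \<longleftrightarrow> (\<forall>i j. i \<noteq> j \<longrightarrow> (\<exists>z. z dvd 1 \<and> (\<forall>k\<le>serre_len C i j.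
     s' i j k * A j i ^ k * A i j ^ (serre_len C i j - k) = z * s i j k)))"

text \<open>\<open>A i j\<close> and \<open>D i j\<close> are the weight-independent ratios under
  translation by a simple root. On weight \<mu> the product E_i F_j acquires the factor
  \<open>c i (\<mu> - rt C j) * d j \<mu>\<close>, and F_j E_i acquires
  \<open>d j (\<mu> + rt C i) * c i \<mu>\<close>. Their comparison gives the condition on
  \<open>t\<close> and \<open>t'\<close>; the first factor for i = j gives the condition on
  \<open>H\<close>.\<close>

definition twist :: "('i, 'p::ab_group_add) superdatum \<Rightarrow>
    ('i \<Rightarrow> 'i \<Rightarrow> 'k::comm_ring_1) \<Rightarrow> ('i \<Rightarrow> int \<Rightarrow> 'k) \<Rightarrow> ('i \<Rightarrow> 'i \<Rightarrow> nat \<Rightarrow> 'k) \<Rightarrow> ('i \<Rightarrow> 'i \<Rightarrow> nat \<Rightarrow> 'k) \<Rightarrow>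
    ('i \<Rightarrow> 'i \<Rightarrow> 'k) \<Rightarrow> ('i \<Rightarrow> int \<Rightarrow> 'k) \<Rightarrow> ('i \<Rightarrow> 'i \<Rightarrow> nat \<Rightarrow> 'k) \<Rightarrow> ('i \<Rightarrow> 'i \<Rightarrow> nat \<Rightarrow> 'k) \<Rightarrow>
    ('i \<Rightarrow> 'p \<Rightarrow> 'k) \<Rightarrow> ('i \<Rightarrow> 'p \<Rightarrow> 'k) \<Rightarrow> bool" where
  "twist C t H se sf t' H' se' sf' c d \<longleftrightarrow>
     (\<forall>i \<mu>. c i \<mu> dvd 1) \<and> (\<forall>i \<mu>. d i \<mu> dvd 1) \<and>
     (\<exists>A D. (\<forall>i j \<mu>. c i (\<mu> + rt C j) = A i j * c i \<mu>) \<and> (\<forall>i j \<mu>. d i (\<mu> - rt C j) = D i j * d i \<mu>) \<and>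
     (\<forall>i j. t i j * D j i = t' i j * A i j) \<and> serre_twist C se se' A \<and> serre_twist C sf sf' D) \<and>
     (\<forall>i \<mu>. c i (\<mu> - rt C i) * d i \<mu> * H i (crt C i \<mu>) = H' i (crt C i \<mu>))"

lemma quantum_rep_twist:
  fixes V (structure)
  assumes "quantum_rep V W \<rho> C t H se sf E F" and tw: "twist C t H se sf t' H' se' sf' c d"
  shows "quantum_rep V W \<rho> C t' H' se' sf' (\<lambda>i x. E i (weight_space_module.scaling V W \<rho> (c i) x))
    (\<lambda>i x. F i (weight_space_module.scaling V W \<rho> (d i) x))"
proof -
  interpret quantum_rep V W \<rho> C t H se sf E F by fact
  obtain A D where c: "\<And>i j \<mu>. c i (\<mu> + rt C j) = A i j * c i \<mu>"
    and d: "\<And>i j \<mu>. d i (\<mu> + - rt C j) = D i j * d i \<mu>"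
    and t: "\<And>i j. t i j * D j i = t' i j * A i j"
    and s: "serre_twist C se se' A" "serre_twist C sf sf' D"
    using tw unfolding twist_def by auto
  have H: "c i (\<mu> + - rt C i) * d i \<mu> * H i (crt C i \<mu>) = H' i (crt C i \<mu>)" for i \<mu>
    using tw unfolding twist_def by auto
  note ED = weight_operatorD[OF E_op] and FD = weight_operatorD[OF F_op]
  show ?thesis
  proof unfold_locales
    fix i j x \<mu>
    show "weight_operator (rt C i) (\<lambda>x. E i (scaling (c i) x))"
      using weight_operator_comp[OF E_op weight_operator_scaling] by simp
    show "weight_operator (- rt C i) (\<lambda>x. F i (scaling (d i) x))"
      using weight_operator_comp[OF F_op weight_operator_scaling] by simp
    assume x: "x \<in> W \<mu>"
    then have xc: "x \<in> carrier V" by (rule W_carrier)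
    have d': "d j \<mu> = D j i * d j (\<mu> + rt C i)" using d[of j "\<mu> + rt C i" i] by simp
    have c': "c i \<mu> = A i j * c i (\<mu> + - rt C j)" using c[of i "\<mu> + - rt C j" j] by simp
    have Fc: "F j x \<in> carrier V" "E i x \<in> carrier V" "F j (E i x) \<in> carrier V" "E i (F j x) \<in> carrier V"
      using ED(1) FD(1) xc by blast+
    have "E i (scaling (c i) (F j (scaling (d j) x))) = \<rho> (c i (\<mu> + - rt C j) * d j \<mu>) (E i (F j x))"
      using xc Fc by (simp add: scaling_homogeneous[OF x] FD(3) scaling_homogeneous[OF \<rho>_W[OF FD(4)[OF x]]]
        ED(3) \<rho>_closed \<rho>_mult)
    also have "\<dots> = \<rho> (c i (\<mu> + - rt C j) * d j \<mu> * t i j) (F j (E i x))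
        \<oplus> (if i = j then \<rho> (c i (\<mu> + - rt C j) * d j \<mu> * H i (crt C i \<mu>)) x else \<zero>)"
      using xc Fc by (simp add: EF[OF x] \<rho>_add \<rho>_closed \<rho>_mult \<rho>_zero)
    also have "(if i = j then \<rho> (c i (\<mu> + - rt C j) * d j \<mu> * H i (crt C i \<mu>)) x else \<zero>) =
        (if i = j then \<rho> (H' i (crt C i \<mu>)) x else \<zero>)" using H[of j \<mu>] by simp
    also have "c i (\<mu> + - rt C j) * d j \<mu> * t i j = t' i j * (d j (\<mu> + rt C i) * c i \<mu>)"
    proof -
      have "c i (\<mu> + - rt C j) * d j \<mu> * t i j = c i (\<mu> + - rt C j) * d j (\<mu> + rt C i) * (t i j * D j i)"
        unfolding d' by (simp only: ac_simps)
      then show ?thesis unfolding t c' by (simp only: ac_simps)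
    qed
    also have "\<rho> (t' i j * (d j (\<mu> + rt C i) * c i \<mu>)) (F j (E i x)) =
        \<rho> (t' i j) (F j (scaling (d j) (E i (scaling (c i) x))))"
      using xc Fc by (simp add: scaling_homogeneous[OF x] ED(3) scaling_homogeneous[OF \<rho>_W[OF ED(4)[OF x]]]
        FD(3) \<rho>_closed \<rho>_mult)
    finally show "E i (scaling (c i) (F j (scaling (d j) x))) =
        \<rho> (t' i j) (F j (scaling (d j) (E i (scaling (c i) x)))) \<oplus>
        (if i = j then \<rho> (H' i (crt C i \<mu>)) x else \<zero>)" .
    assume ij: "i \<noteq> j"
    obtain z where "\<And>k. k \<le> serre_len C i j \<Longrightarrow>
        se' i j k * A j i ^ k * A i j ^ (serre_len C i j - k) = z * se i j k"
      using s(1) ij unfolding serre_twist_def by blast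
    then show "(\<Oplus>k\<in>{..serre_len C i j}. \<rho> (se' i j k) (((\<lambda>x. E i (scaling (c i) x)) ^^ (serre_len C i j - k))
        (E j (scaling (c j) (((\<lambda>x. E i (scaling (c i) x)) ^^ k) x))))) = \<zero>"
      by (rule twisted_serre[where a = "c i" and b = "c j" and c = "se i j" and c' = "se' i j",
        OF E_op E_op c c c x _ serre_E[OF ij x]])
    obtain z where "\<And>k. k \<le> serre_len C i j \<Longrightarrow>
        sf' i j k * D j i ^ k * D i j ^ (serre_len C i j - k) = z * sf i j k"
      using s(2) ij unfolding serre_twist_def by blast
    then show "(\<Oplus>k\<in>{..serre_len C i j}. \<rho> (sf' i j k) (((\<lambda>x. F i (scaling (d i) x)) ^^ (serre_len C i j - k))
        (F j (scaling (d j) (((\<lambda>x. F i (scaling (d i) x)) ^^ k) x))))) = \<zero>"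
      by (rule twisted_serre[where a = "d i" and b = "d j" and c = "sf i j" and c' = "sf' i j",
        OF F_op F_op d d d x _ serre_F[OF ij x]])
  qed
qed

text \<open>The proportionality factor of the Serre coefficients is a unit by definition, which is
  what makes the condition reversible.\<close>

lemma serre_twist_inverse:
  assumes "serre_twist C s s' A" "\<And>i j. A i j dvd 1"
  shows "serre_twist C s' s (\<lambda>i j. uinv (A i j))"
  unfolding serre_twist_def
proof (intro allI impI)
  fix i j :: 'a assume "i \<noteq> j"
  then obtain z where z: "z dvd 1" and eq: "\<And>k. k \<le> serre_len C i j \<Longrightarrow>
      s' i j k * A j i ^ k * A i j ^ (serre_len C i j - k) = z * s i j k"
    using assms(1) unfolding serre_twist_def by blast
  show "\<exists>z. z dvd 1 \<and> (\<forall>k\<le>serre_len C i j.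
     s i j k * uinv (A j i) ^ k * uinv (A i j) ^ (serre_len C i j - k) = z * s' i j k)"
  proof (intro exI[of _ "uinv z"] conjI allI impI uinv_unit z)
    fix k assume k: "k \<le> serre_len C i j"
    let ?m = "serre_len C i j - k"
    let ?p = "uinv (A j i) ^ k" and ?q = "uinv (A i j) ^ ?m"
    have p: "A j i ^ k * ?p = 1" "A i j ^ ?m * ?q = 1"
      by (simp_all add: uinv_right assms(2) flip: power_mult_distrib)
    have "s i j k * ?p * ?q = uinv z * (z * s i j k) * ?p * ?q"
      using uinv_left[OF z] by (simp flip: mult.assoc)
    also have "\<dots> = uinv z * s' i j k * (A j i ^ k * ?p) * (A i j ^ ?m * ?q)"
      unfolding eq[OF k, symmetric] by (simp only: ac_simps)
    finally show "s i j k * ?p * ?q = uinv z * s' i j k" unfolding p by simp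
  qed
qed

lemma twist_inverse:
  assumes "twist C t H se sf t' H' se' sf' c d"
  shows "twist C t' H' se' sf' t H se sf (\<lambda>i \<mu>. uinv (c i \<mu>)) (\<lambda>i \<mu>. uinv (d i \<mu>))"
proof -
  obtain A D where c: "\<And>i j \<mu>. c i (\<mu> + rt C j) = A i j * c i \<mu>"
    and d: "\<And>i j \<mu>. d i (\<mu> - rt C j) = D i j * d i \<mu>"
    and t: "\<And>i j. t i j * D j i = t' i j * A i j"
    and s: "serre_twist C se se' A" "serre_twist C sf sf' D"
    and H: "\<And>i \<mu>. c i (\<mu> - rt C i) * d i \<mu> * H i (crt C i \<mu>) = H' i (crt C i \<mu>)"
    and u: "\<And>i \<mu>. c i \<mu> dvd 1" "\<And>i \<mu>. d i \<mu> dvd 1"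
    using assms unfolding twist_def by auto
  have A: "A i j dvd 1" for i j using u(1)[of i "0 + rt C j"] unfolding c by (rule dvd_mult_left)
  have D: "D i j dvd 1" for i j using u(2)[of i "0 - rt C j"] unfolding d by (rule dvd_mult_left)
  show ?thesis unfolding twist_def
  proof (intro conjI allI exI)
    fix i j \<mu>
    show "uinv (c i (\<mu> + rt C j)) = uinv (A i j) * uinv (c i \<mu>)" unfolding c by (rule uinv_mult[OF A u(1)])
    show "uinv (d i (\<mu> - rt C j)) = uinv (D i j) * uinv (d i \<mu>)" unfolding d by (rule uinv_mult[OF D u(2)])
    have "t' i j * uinv (D j i) = (t' i j * A i j) * uinv (A i j) * uinv (D j i)"
      using uinv_right[OF A, of i j] by (simp add: mult.assoc)
    also have "\<dots> = t i j * uinv (A i j) * (D j i * uinv (D j i))" unfolding t[symmetric] by (simp only: ac_simps)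
    finally show "t' i j * uinv (D j i) = t i j * uinv (A i j)" using uinv_right[OF D] by simp
    show "uinv (c i (\<mu> - rt C i)) * uinv (d i \<mu>) * H' i (crt C i \<mu>) = H i (crt C i \<mu>)"
    proof -
      have "uinv (c i (\<mu> - rt C i)) * uinv (d i \<mu>) * H' i (crt C i \<mu>) =
          (uinv (c i (\<mu> - rt C i)) * c i (\<mu> - rt C i)) * (uinv (d i \<mu>) * d i \<mu>) * H i (crt C i \<mu>)"
        unfolding H[symmetric] by (simp only: ac_simps)
      then show ?thesis by (simp add: uinv_left u)
    qed
  qed (auto intro!: serre_twist_inverse s A D uinv_unit u)
qed

subsection \<open>Existence of twists\<close>

text \<open>A combination of simple roots with coefficients n_j is sent to the product of the
  \<open>z j\<close> raised to n_j, which is single-valued by linear independence. Other cosets of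
  the root lattice are moved into it by subtracting a chosen point.\<close>

lemma (in cartan_superdatum) weight_function_ex:
  fixes z :: "'i \<Rightarrow> 'k::comm_ring_1"
  assumes z: "\<And>j. z j dvd 1"
  shows "\<exists>c :: 'p \<Rightarrow> 'k. (\<forall>\<mu>. c \<mu> dvd 1) \<and> (\<forall>j \<mu>. c (\<mu> + rt C j) = z j * c \<mu>)"
proof -
  interpret Z: Modules.module "zscale :: int \<Rightarrow> 'p \<Rightarrow> 'p" by (rule module_zscale)
  let ?R = "range (rt C)"
  define Q where "Q = Z.span ?R"
  have rtQ: "rt C j \<in> Q" for j unfolding Q_def by (rule Z.span_base) auto
  have ind: "Z.independent ?R" using rt_independent .
  \<comment> \<open>Coordinates with respect to the simple roots. They are additive on the root
    lattice, and \<open>n_add\<close> is claimed there only.\<close>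
  define n where "n x j = Z.representation ?R x (rt C j)" for x j
  have fin: "finite {j. n x j \<noteq> 0}" for x
  proof -
    have "finite (rt C -` {v. Z.representation ?R x v \<noteq> 0})"
      using Z.finite_representation rt_inj by (intro finite_vimageI) auto
    then show ?thesis by (rule rev_finite_subset) (auto simp: n_def)
  qed
  have n_add: "n (x + rt C k) j = n x j + (if j = k then 1 else 0)" if "x \<in> Q" for x j k
    using that rtQ[of k] rt_inj unfolding n_def Q_def
    by (subst Z.representation_add[OF ind]) (auto simp: Z.representation_basis[OF ind] inj_eq)
  define c0 where "c0 x = (\<Prod>j\<in>{j. n x j \<noteq> 0}. zpow (z j) (n x j))" for x
  have c0_ext: "c0 x = (\<Prod>j\<in>S. zpow (z j) (n x j))" if "finite S" "{j. n x j \<noteq> 0} \<subseteq> S" for x S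
    unfolding c0_def by (rule prod.mono_neutral_left) (use that in auto)
  have c0_add: "c0 (x + rt C k) = z k * c0 x" if "x \<in> Q" for x k
  proof -
    let ?S = "insert k {j. n x j \<noteq> 0}"
    have S: "finite ?S" "{j. n (x + rt C k) j \<noteq> 0} \<subseteq> ?S" using fin that by (auto simp: n_add)
    have "c0 (x + rt C k) = (\<Prod>j\<in>?S. zpow (z j) (n (x + rt C k) j))" using S by (rule c0_ext)
    also have "\<dots> = zpow (z k) (n x k + 1) * (\<Prod>j\<in>?S - {k}. zpow (z j) (n (x + rt C k) j))"
      using S that by (subst prod.remove[of ?S k]) (auto simp: n_add)
    also have "(\<Prod>j\<in>?S - {k}. zpow (z j) (n (x + rt C k) j)) = (\<Prod>j\<in>?S - {k}. zpow (z j) (n x j))"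
      using that by (intro prod.cong) (auto simp: n_add)
    also have "zpow (z k) (n x k + 1) * \<dots> = z k * (\<Prod>j\<in>?S. zpow (z j) (n x j))"
      using S by (subst prod.remove[of ?S k]) (auto simp: zpow_Suc z mult.assoc)
    also have "(\<Prod>j\<in>?S. zpow (z j) (n x j)) = c0 x" using S by (intro c0_ext[symmetric]) auto
    finally show ?thesis .
  qed
  \<comment> \<open>The predicate depends only on the coset of \<mu>, so all points of a coset
    receive the same \<nu>; this is \<open>s_add\<close>.\<close>
  define s where "s \<mu> = (SOME \<nu>. \<mu> - \<nu> \<in> Q)" for \<mu>
  have s: "\<mu> - s \<mu> \<in> Q" for \<mu>
    unfolding s_def by (rule someI[of _ \<mu>]) (simp add: Q_def Z.span_zero)
  have s_add: "s (\<mu> + rt C j) = s \<mu>" for \<mu> j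
  proof -
    have "\<mu> + rt C j - \<nu> \<in> Q \<longleftrightarrow> \<mu> - \<nu> \<in> Q" for \<nu>
      using Z.span_add[of "\<mu> - \<nu>" ?R "rt C j"] Z.span_diff[of "\<mu> + rt C j - \<nu>" ?R "rt C j"] rtQ[of j]
      unfolding Q_def by (auto simp: algebra_simps)
    then show ?thesis by (simp add: s_def)
  qed
  have "c0 (\<mu> + rt C j - s (\<mu> + rt C j)) = z j * c0 (\<mu> - s \<mu>)" for \<mu> j
    using c0_add[OF s, of \<mu> j] by (simp add: s_add algebra_simps)
  moreover have "c0 x dvd 1" for x unfolding c0_def by (intro unit_prod zpow_unit z)
  ultimately show ?thesis by (intro exI[of _ "\<lambda>\<mu>. c0 (\<mu> - s \<mu>)"]) auto
qed

text \<open>Of two opposite entries one is set to 1 and the other absorbs the whole ratio. The order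
  decides which; where \<open>a i j\<close> is 1, the equation becomes
  \<open>x i j * x j i = 1\<close>. A well-order provides such an order on an arbitrary index
  set.\<close>

lemma antisymmetric_split:
  fixes x :: "'i \<Rightarrow> 'i \<Rightarrow> 'k::comm_ring_1"
  assumes "\<And>i. x i i = 1" "\<And>i j. x i j * x j i = 1"
  shows "\<exists>a. (\<forall>i j. a i j dvd 1) \<and> (\<forall>i j. a i j = x i j * a j i)"
proof -
  obtain r :: "'i rel" where "well_order_on UNIV r" using well_order_on by (rule exE)
  then have tot: "total_on UNIV r" and anti: "antisym r"
    unfolding well_order_on_def linear_order_on_def partial_order_on_def by simp_all
  have r: "(i, j) \<in> r \<longleftrightarrow> (j, i) \<notin> r" if "i \<noteq> j" for i j
    using tot antisymD[OF anti, of i j] that unfolding total_on_def by auto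
  let ?a = "\<lambda>i j. if (i, j) \<in> r then x i j else 1"
  have "x i j dvd 1" for i j by (rule dvdI) (rule assms(2)[of i j, symmetric])
  then have unit: "?a i j dvd 1" for i j by simp
  have eq: "?a i j = x i j * ?a j i" for i j
  proof (cases "i = j")
    case True then show ?thesis by (simp add: assms(1))
  next
    case False
    show ?thesis
    proof (cases "(i, j) \<in> r")
      case True then show ?thesis using r[OF False] by simp
    next
      case ji: False then show ?thesis using r[OF False] by (simp add: assms(2))
    qed
  qed
  show ?thesis by (intro exI[of _ ?a] conjI allI unit eq)
qed

text \<open>Reduces the search for a twist to constants indexed by pairs. Once
  \<open>A i j = x i j * A j i\<close>, the function \<open>c\<close> comes from the lattice
  construction, \<open>d\<close> is dictated by the condition on \<open>H\<close>, and the ratios of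
  \<open>d\<close> come out as \<open>\<gamma> i j * A i j\<close>. In the remaining conditions the
  entries \<open>A j i\<close> cancel or are absorbed by the unit \<open>z\<close>, which leaves
  \<open>x\<close> and \<open>\<gamma>\<close>.\<close>

lemma (in cartan_superdatum) twist_ex:
  fixes t t' x \<gamma> :: "'i \<Rightarrow> 'i \<Rightarrow> 'k::comm_ring_1"
  assumes x: "\<And>i. x i i = 1" "\<And>i j. x i j * x j i = 1"
    and g: "\<And>i n. g i n dvd 1" "\<And>i j n. g i (n - cm C i j) = \<gamma> i j * g i n" "\<And>i n. g i n * H i n = H' i n"
    and t: "\<And>i j. t i j * \<gamma> j i = t' i j * x i j"
    and se: "\<And>i j. i \<noteq> j \<Longrightarrow> \<exists>z. z dvd 1 \<and> (\<forall>k\<le>serre_len C i j.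
      se' i j k * x i j ^ (serre_len C i j - k) = z * se i j k)"
    and sf: "\<And>i j. i \<noteq> j \<Longrightarrow> \<exists>z. z dvd 1 \<and> (\<forall>k\<le>serre_len C i j.
      sf' i j k * \<gamma> j i ^ k * (\<gamma> i j * x i j) ^ (serre_len C i j - k) = z * sf i j k)"
  shows "\<exists>c d. twist C t H se sf t' H' se' sf' c d"
proof -
  obtain A where A: "\<And>i j. A i j dvd 1" "\<And>i j. A i j = x i j * A j i"
    using antisymmetric_split[of x] x by blast
  have "\<forall>i. \<exists>c :: 'p \<Rightarrow> 'k. (\<forall>\<mu>. c \<mu> dvd 1) \<and> (\<forall>j \<mu>. c (\<mu> + rt C j) = A i j * c \<mu>)"
    using weight_function_ex A(1) by blast
  then obtain c where c: "\<And>i \<mu>. c i \<mu> dvd 1" "\<And>i j \<mu>. c i (\<mu> + rt C j) = A i j * c i \<mu>" by metis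
  \<comment> \<open>The solution of
    \<open>c i (\<mu> - rt C i) * d i \<mu> = g i (crt C i \<mu>)\<close>, where \<open>g\<close>
    carries \<open>H\<close> to \<open>H'\<close>.\<close>
  define d where "d i \<mu> = g i (crt C i \<mu>) * uinv (c i (\<mu> - rt C i))" for i \<mu>
  let ?D = "\<lambda>i j. \<gamma> i j * A i j"
  have pw: "A j i ^ k * A j i ^ (m - k) = A j i ^ m" if "k \<le> m" for i j k m
    using that by (simp flip: power_add)
  have crt_diff: "crt C i (\<mu> - rt C j) = crt C i \<mu> - cm C i j" for i j \<mu>
    using crt_hom[of i "\<mu> - rt C j" "rt C j"] by (simp add: crt_rt)
  have "d i (\<mu> - rt C j) = ?D i j * d i \<mu>" for i j \<mu>
  proof -
    let ?y = "c i (\<mu> - rt C j - rt C i)"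
    have "c i (\<mu> - rt C i) = A i j * ?y" using c(2)[of i "\<mu> - rt C j - rt C i" j] by (simp add: algebra_simps)
    then have "A i j * uinv (c i (\<mu> - rt C i)) = (A i j * uinv (A i j)) * uinv ?y"
      using uinv_mult[OF A(1) c(1)] by (simp add: mult.assoc)
    then have "uinv ?y = A i j * uinv (c i (\<mu> - rt C i))" using uinv_right[OF A(1)] by simp
    then show ?thesis by (simp add: d_def crt_diff g(2) ac_simps)
  qed
  moreover have "t i j * ?D j i = t' i j * A i j" for i j
    using t[of i j] A(2)[of i j] by (simp flip: mult.assoc)
  moreover have "serre_twist C se se' A"
    unfolding serre_twist_def
  proof (intro allI impI)
    fix i j :: 'i assume "i \<noteq> j"
    then obtain z where z: "z dvd 1" "\<And>k. k \<le> serre_len C i j \<Longrightarrow>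
      se' i j k * x i j ^ (serre_len C i j - k) = z * se i j k" using se by blast
    show "\<exists>z. z dvd 1 \<and> (\<forall>k\<le>serre_len C i j. se' i j k * A j i ^ k * A i j ^ (serre_len C i j - k) = z * se i j k)"
    proof (intro exI[of _ "A j i ^ serre_len C i j * z"] conjI allI impI unit_mult unit_power A z(1))
      fix k assume k: "k \<le> serre_len C i j"
      show "se' i j k * A j i ^ k * A i j ^ (serre_len C i j - k) = A j i ^ serre_len C i j * z * se i j k"
      proof -
        have "se' i j k * A j i ^ k * A i j ^ (serre_len C i j - k) =
            A j i ^ k * A j i ^ (serre_len C i j - k) * (se' i j k * x i j ^ (serre_len C i j - k))"
          unfolding A(2)[of i j] power_mult_distrib by (simp only: ac_simps)
        then show ?thesis unfolding z(2)[OF k] pw[OF k] by (simp only: ac_simps)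
      qed
    qed
  qed
  moreover have "serre_twist C sf sf' ?D"
    unfolding serre_twist_def
  proof (intro allI impI)
    fix i j :: 'i assume "i \<noteq> j"
    then obtain z where z: "z dvd 1" "\<And>k. k \<le> serre_len C i j \<Longrightarrow>
      sf' i j k * \<gamma> j i ^ k * (\<gamma> i j * x i j) ^ (serre_len C i j - k) = z * sf i j k" using sf by blast
    show "\<exists>z. z dvd 1 \<and> (\<forall>k\<le>serre_len C i j. sf' i j k * ?D j i ^ k * ?D i j ^ (serre_len C i j - k) = z * sf i j k)"
    proof (intro exI[of _ "A j i ^ serre_len C i j * z"] conjI allI impI unit_mult unit_power A z(1))
      fix k assume k: "k \<le> serre_len C i j"
      show "sf' i j k * ?D j i ^ k * ?D i j ^ (serre_len C i j - k) = A j i ^ serre_len C i j * z * sf i j k"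
      proof -
        have "sf' i j k * ?D j i ^ k * ?D i j ^ (serre_len C i j - k) = A j i ^ k * A j i ^ (serre_len C i j - k) *
            (sf' i j k * \<gamma> j i ^ k * (\<gamma> i j * x i j) ^ (serre_len C i j - k))"
          unfolding A(2)[of i j] power_mult_distrib by (simp only: ac_simps)
        then show ?thesis unfolding z(2)[OF k] pw[OF k] by (simp only: ac_simps)
      qed
    qed
  qed
  moreover have "c i (\<mu> - rt C i) * d i \<mu> * H i (crt C i \<mu>) = H' i (crt C i \<mu>)" for i \<mu>
  proof -
    have "c i (\<mu> - rt C i) * d i \<mu> * H i (crt C i \<mu>) =
        (c i (\<mu> - rt C i) * uinv (c i (\<mu> - rt C i))) * (g i (crt C i \<mu>) * H i (crt C i \<mu>))"
      unfolding d_def by (simp only: ac_simps)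
    then show ?thesis by (simp add: uinv_right c g(3))
  qed
  moreover have "d i \<mu> dvd 1" for i \<mu> unfolding d_def by (intro unit_mult g uinv_unit c)
  ultimately have "twist C t H se sf t' H' se' sf' c d"
    unfolding twist_def by (intro conjI allI exI[of _ A] exI[of _ ?D]) (use c in auto)
  then show ?thesis by blast
qed

section \<open>Tensor products of rings\<close>

text \<open>Every ring receives the integers. The tensor product is a quotient of a monoid algebra
  over the integers, so this is the scalar map from which its homomorphisms are built.\<close>

lemma int_scalar_hom:
  assumes "ring E"
  shows "scalar_hom (\<lambda>n::int. [n] \<cdot>\<^bsub>E\<^esub> \<one>\<^bsub>E\<^esub>) E"
proof -
  interpret ring E by fact
  have "[(a * b)] \<cdot>\<^bsub>E\<^esub> \<one>\<^bsub>E\<^esub> = [a] \<cdot>\<^bsub>E\<^esub> \<one>\<^bsub>E\<^esub> \<otimes>\<^bsub>E\<^esub> [b] \<cdot>\<^bsub>E\<^esub> \<one>\<^bsub>E\<^esub>" for a b :: int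
    using add_pow_ldistr_int[of "\<one>\<^bsub>E\<^esub>" "[b] \<cdot>\<^bsub>E\<^esub> \<one>\<^bsub>E\<^esub>" a] add.int_pow_pow[of "\<one>\<^bsub>E\<^esub>" a b]
    by (simp add: mult.commute)
  then show ?thesis unfolding scalar_hom_def
    by (auto simp: add.int_pow_mult)
qed

locale tensor_rings =
  fixes S :: "('s, 'x) ring_scheme" and A :: "('a, 'y) ring_scheme" and \<phi> :: "'r \<Rightarrow> 's" and \<psi> :: "'r \<Rightarrow> 'a"
  assumes ring_S: "ring S" and ring_A: "ring A"
    and \<phi>_closed: "\<phi> r \<in> carrier S" and \<psi>_closed: "\<psi> r \<in> carrier A"
begin

abbreviation "R \<equiv> monoid_algebra (S \<times>\<times> A) :: (('s \<times> 'a) \<Rightarrow>\<^sub>0 int) ring"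
abbreviation "T \<equiv> tensor_ring S A \<phi> \<psi>"
abbreviation "tens \<equiv> pure_tensor S A \<phi> \<psi>"

sublocale S: ring S by (rule ring_S)
sublocale A: ring A by (rule ring_A)

lemma monoid_SA: "monoid (S \<times>\<times> A)"
  by (intro DirProd_monoid S.monoid_axioms A.monoid_axioms)

sublocale R: ring R by (rule ring_monoid_algebra[OF monoid_SA])
sublocale T: ring T by (rule ring_tensor_ring) (simp_all add: ring_S ring_A \<phi>_closed \<psi>_closed)

abbreviation "\<delta> s a \<equiv> Poly_Mapping.single (s, a) (1::int)"

definition gens :: "(('s \<times> 'a) \<Rightarrow>\<^sub>0 int) set" where
  "gens = {\<delta> (s \<oplus>\<^bsub>S\<^esub> t) a - \<delta> s a - \<delta> t a | s t a.
          s \<in> carrier S \<and> t \<in> carrier S \<and> a \<in> carrier A} \<union>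
       {\<delta> s (a \<oplus>\<^bsub>A\<^esub> b) - \<delta> s a - \<delta> s b | s a b.
          s \<in> carrier S \<and> a \<in> carrier A \<and> b \<in> carrier A} \<union>
       {\<delta> (s \<otimes>\<^bsub>S\<^esub> \<phi> r) a - \<delta> s (\<psi> r \<otimes>\<^bsub>A\<^esub> a) | s r a.
          s \<in> carrier S \<and> a \<in> carrier A}"

lemma tensor_ideal_gens: "tensor_ideal S A \<phi> \<psi> = Idl\<^bsub>R\<^esub> gens"
  unfolding tensor_ideal_def gens_def Let_def by (rule refl)

lemma \<delta>_closed: "s \<in> carrier S \<Longrightarrow> a \<in> carrier A \<Longrightarrow> \<delta> s a \<in> carrier R"
  by (simp add: monoid_algebra_simps)

lemma gens_closed: "gens \<subseteq> carrier R"
  unfolding gens_def using \<phi>_closed \<psi>_closed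
  by (auto intro!: monoid_algebra_diff_closed \<delta>_closed)

lemma ideal_gens: "ideal (Idl\<^bsub>R\<^esub> gens) R"
  by (rule R.genideal_ideal[OF gens_closed])

definition proj :: "(('s \<times> 'a) \<Rightarrow>\<^sub>0 int) \<Rightarrow> (('s \<times> 'a) \<Rightarrow>\<^sub>0 int) set" where
  "proj f = Idl\<^bsub>R\<^esub> gens +>\<^bsub>R\<^esub> f"

lemma T_def': "T = R Quot (Idl\<^bsub>R\<^esub> gens)"
  by (simp add: tensor_ring_def tensor_ideal_gens)

lemma tens_proj: "tens s a = proj (\<delta> s a)"
  by (simp add: pure_tensor_def tensor_ideal_gens proj_def)

lemma proj_hom: "proj \<in> ring_hom R T"
  using ideal.rcos_ring_hom[OF ideal_gens] unfolding T_def' proj_def[abs_def] by simp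

lemma carrier_T: "carrier T = proj ` carrier R"
  by (auto simp: T_def' FactRing_def A_RCOSETS_def' proj_def)

lemma proj_add: "f \<in> carrier R \<Longrightarrow> g \<in> carrier R \<Longrightarrow> proj (f + g) = proj f \<oplus>\<^bsub>T\<^esub> proj g"
  using ring_hom_add[OF proj_hom, of f g] by (simp add: monoid_algebra_simps)

lemma proj_closed: "f \<in> carrier R \<Longrightarrow> proj f \<in> carrier T"
  using ring_hom_closed[OF proj_hom] .

lemma proj_zero: "proj 0 = \<zero>\<^bsub>T\<^esub>"
  using ring_hom_zero[OF proj_hom R.ring_axioms T.ring_axioms] by (simp add: monoid_algebra_simps)

lemma proj_diff:
  assumes "f \<in> carrier R" "g \<in> carrier R"
  shows "proj (f - g) = proj f \<ominus>\<^bsub>T\<^esub> proj g"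
proof -
  have d: "f - g \<in> carrier R" using assms by (rule monoid_algebra_diff_closed)
  have "proj f = proj g \<oplus>\<^bsub>T\<^esub> proj (f - g)" using proj_add[OF d assms(2)] proj_closed assms d T.a_comm by simp
  then show ?thesis
    using T.minus_eq_iff[OF proj_closed[OF assms(1)] proj_closed[OF assms(2)] proj_closed[OF d]] by simp
qed

lemma proj_gens: "g \<in> gens \<Longrightarrow> proj g = \<zero>\<^bsub>T\<^esub>"
proof -
  assume g: "g \<in> gens"
  then have "g \<in> Idl\<^bsub>R\<^esub> gens" using R.genideal_self[OF gens_closed] by auto
  then have "proj g = Idl\<^bsub>R\<^esub> gens" unfolding proj_def
    using R.a_coset_join2[of g] ideal_gens g gens_closed by (meson additive_subgroup.a_subgroup ideal_def subsetD)
  then show ?thesis by (simp add: T_def' FactRing_def)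
qed

lemma tens_closed: "s \<in> carrier S \<Longrightarrow> a \<in> carrier A \<Longrightarrow> tens s a \<in> carrier T"
  by (simp add: tens_proj proj_closed \<delta>_closed)

lemma tens_add_left:
  assumes "s \<in> carrier S" "t \<in> carrier S" "a \<in> carrier A"
  shows "tens (s \<oplus>\<^bsub>S\<^esub> t) a = tens s a \<oplus>\<^bsub>T\<^esub> tens t a"
proof -
  let ?u = "\<delta> (s \<oplus>\<^bsub>S\<^esub> t) a"
  have c: "?u \<in> carrier R" "\<delta> s a \<in> carrier R" "\<delta> t a \<in> carrier R" "\<delta> s a + \<delta> t a \<in> carrier R"
    using assms \<delta>_closed R.a_closed[of "\<delta> s a" "\<delta> t a"] by (simp_all add: monoid_algebra_simps(2))
  have "?u - (\<delta> s a + \<delta> t a) \<in> gens" using assms unfolding gens_def by (auto simp: diff_diff_eq)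
  from proj_gens[OF this] have "proj ?u = proj (\<delta> s a + \<delta> t a)"
    unfolding proj_diff[OF c(1,4)] using T.minus_eq_zero_iff[OF proj_closed[OF c(1)] proj_closed[OF c(4)]] by simp
  then show ?thesis by (simp add: tens_proj proj_add c)
qed

lemma tens_add_right:
  assumes "s \<in> carrier S" "a \<in> carrier A" "b \<in> carrier A"
  shows "tens s (a \<oplus>\<^bsub>A\<^esub> b) = tens s a \<oplus>\<^bsub>T\<^esub> tens s b"
proof -
  let ?u = "\<delta> s (a \<oplus>\<^bsub>A\<^esub> b)"
  have c: "?u \<in> carrier R" "\<delta> s a \<in> carrier R" "\<delta> s b \<in> carrier R" "\<delta> s a + \<delta> s b \<in> carrier R"
    using assms \<delta>_closed R.a_closed[of "\<delta> s a" "\<delta> s b"] by (simp_all add: monoid_algebra_simps(2))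
  have "?u - (\<delta> s a + \<delta> s b) \<in> gens" using assms unfolding gens_def by (auto simp: diff_diff_eq)
  from proj_gens[OF this] have "proj ?u = proj (\<delta> s a + \<delta> s b)"
    unfolding proj_diff[OF c(1,4)] using T.minus_eq_zero_iff[OF proj_closed[OF c(1)] proj_closed[OF c(4)]] by simp
  then show ?thesis by (simp add: tens_proj proj_add c)
qed

lemma tens_balanced:
  assumes "s \<in> carrier S" "a \<in> carrier A"
  shows "tens (s \<otimes>\<^bsub>S\<^esub> \<phi> r) a = tens s (\<psi> r \<otimes>\<^bsub>A\<^esub> a)"
proof -
  have c: "\<delta> (s \<otimes>\<^bsub>S\<^esub> \<phi> r) a \<in> carrier R" "\<delta> s (\<psi> r \<otimes>\<^bsub>A\<^esub> a) \<in> carrier R"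
    using assms \<delta>_closed \<phi>_closed \<psi>_closed by simp_all
  have "\<delta> (s \<otimes>\<^bsub>S\<^esub> \<phi> r) a - \<delta> s (\<psi> r \<otimes>\<^bsub>A\<^esub> a) \<in> gens" using assms unfolding gens_def by blast
  from proj_gens[OF this] show ?thesis
    unfolding proj_diff[OF c] tens_proj using T.minus_eq_zero_iff[OF proj_closed[OF c(1)] proj_closed[OF c(2)]] by simp
qed

lemma tens_mult:
  assumes "s \<in> carrier S" "t \<in> carrier S" "a \<in> carrier A" "b \<in> carrier A"
  shows "tens s a \<otimes>\<^bsub>T\<^esub> tens t b = tens (s \<otimes>\<^bsub>S\<^esub> t) (a \<otimes>\<^bsub>A\<^esub> b)"
  using ring_hom_mult[OF proj_hom, of "\<delta> s a" "\<delta> t b"] assms \<delta>_closed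
  by (simp add: tens_proj monoid_algebra_mult_single DirProd_def)

lemma tens_one: "tens \<one>\<^bsub>S\<^esub> \<one>\<^bsub>A\<^esub> = \<one>\<^bsub>T\<^esub>"
  using ring_hom_one[OF proj_hom] by (simp add: tens_proj monoid_algebra_simps DirProd_def)

lemma tens_zero_left: "a \<in> carrier A \<Longrightarrow> tens \<zero>\<^bsub>S\<^esub> a = \<zero>\<^bsub>T\<^esub>"
  using tens_add_left[of "\<zero>\<^bsub>S\<^esub>" "\<zero>\<^bsub>S\<^esub>" a] tens_closed[of "\<zero>\<^bsub>S\<^esub>" a] by simp

lemma tens_uminus:
  assumes "s \<in> carrier S" "a \<in> carrier A"
  shows "\<ominus>\<^bsub>T\<^esub> tens s a = tens (\<ominus>\<^bsub>S\<^esub> s) a"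
  using tens_add_left[of "\<ominus>\<^bsub>S\<^esub> s" s a] assms
  by (intro T.minus_equality) (simp_all add: S.l_neg tens_zero_left tens_closed)

text \<open>Integer multiples need no case of their own: they are repeated sums, and the negative of
  a pure tensor is again pure.\<close>

lemma tensor_induct [consumes 1, case_names tens add]:
  assumes "x \<in> carrier T" "\<And>s a. s \<in> carrier S \<Longrightarrow> a \<in> carrier A \<Longrightarrow> P (tens s a)"
    "\<And>x y. x \<in> carrier T \<Longrightarrow> y \<in> carrier T \<Longrightarrow> P x \<Longrightarrow> P y \<Longrightarrow> P (x \<oplus>\<^bsub>T\<^esub> y)"
  shows "P x"
proof -
  obtain f where f: "f \<in> carrier R" "x = proj f" using assms(1) by (auto simp: carrier_T)
  have z: "P (proj 0)" using assms(2)[of "\<zero>\<^bsub>S\<^esub>" "\<zero>\<^bsub>A\<^esub>"] by (simp add: proj_zero tens_zero_left)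
  have sing: "P (proj (Poly_Mapping.single (s, a) n))" if s: "s \<in> carrier S" "a \<in> carrier A" for s a n
  proof (induction n rule: int_induct[where k = 0])
    case base then show ?case using z by simp
  next
    case (step1 n)
    have c: "Poly_Mapping.single (s, a) n \<in> carrier R" "\<delta> s a \<in> carrier R"
      using s by (auto simp: monoid_algebra_simps)
    show ?case unfolding single_add proj_add[OF c] tens_proj[symmetric]
      by (intro assms(3) step1 assms(2) s tens_closed proj_closed c)
  next
    case (step2 n)
    have c: "Poly_Mapping.single (s, a) n \<in> carrier R" "\<delta> s a \<in> carrier R"
      using s by (auto simp: monoid_algebra_simps)
    have m: "\<ominus>\<^bsub>S\<^esub> s \<in> carrier S" using s by simp
    show ?case unfolding single_diff proj_diff[OF c] tens_proj[symmetric] T.minus_eq tens_uminus[OF s]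
      by (intro assms(3) step2 assms(2) s tens_closed proj_closed c m)
  qed
  have "f \<in> carrier R \<and> P (proj f)" using f(1)
  proof (induction f rule: monoid_algebra_induct)
    case zero then show ?case using z by (simp add: monoid_algebra_simps)
  next
    case (single x a)
    then show ?case using sing[of "fst x" "snd x" a] by (auto simp: monoid_algebra_simps)
  next
    case (add f g)
    then show ?case using assms(3)[of "proj f" "proj g"] R.a_closed[of f g]
      by (simp add: proj_add proj_closed monoid_algebra_simps(2))
  qed
  then show ?thesis using f(2) by simp
qed

text \<open>Universal property for a noncommutative target: commuting images make the product of
  \<open>\<sigma> s\<close> and \<open>\<beta> a\<close> multiplicative in the pair, and
  \<open>bal\<close> makes it respect the relation over the base ring.\<close>

lemma tensor_hom_ex:
  assumes "ring E" and \<sigma>: "\<sigma> \<in> ring_hom S E" and \<beta>: "\<beta> \<in> ring_hom A E"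
    and comm: "\<And>s a. s \<in> carrier S \<Longrightarrow> a \<in> carrier A \<Longrightarrow> \<beta> a \<otimes>\<^bsub>E\<^esub> \<sigma> s = \<sigma> s \<otimes>\<^bsub>E\<^esub> \<beta> a"
    and bal: "\<And>r. \<sigma> (\<phi> r) = \<beta> (\<psi> r)"
  shows "\<exists>\<Phi> \<in> ring_hom T E. \<forall>s\<in>carrier S. \<forall>a\<in>carrier A. \<Phi> (tens s a) = \<sigma> s \<otimes>\<^bsub>E\<^esub> \<beta> a"
proof -
  interpret E: ring E by fact
  let ?\<rho> = "\<lambda>n::int. [n] \<cdot>\<^bsub>E\<^esub> \<one>\<^bsub>E\<^esub>" and ?m = "\<lambda>x. \<sigma> (fst x) \<otimes>\<^bsub>E\<^esub> \<beta> (snd x)"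
  note \<sigma>c = ring_hom_closed[OF \<sigma>] and \<beta>c = ring_hom_closed[OF \<beta>]
  have "\<exists>\<Phi> \<in> ring_hom R E. \<forall>x\<in>carrier (S \<times>\<times> A). \<forall>a. \<Phi> (Poly_Mapping.single x a) = ?\<rho> a \<otimes>\<^bsub>E\<^esub> ?m x"
  proof (rule monoid_algebra_hom_ex[OF E.ring_axioms monoid_SA int_scalar_hom[OF E.ring_axioms]])
    fix x y assume x: "x \<in> carrier (S \<times>\<times> A)" and y: "y \<in> carrier (S \<times>\<times> A)"
    obtain s a t b where xy: "x = (s, a)" "y = (t, b)" by (metis surj_pair)
    have c: "s \<in> carrier S" "t \<in> carrier S" "a \<in> carrier A" "b \<in> carrier A" using x y xy by auto
    show "?m (x \<otimes>\<^bsub>S \<times>\<times> A\<^esub> y) = ?m x \<otimes>\<^bsub>E\<^esub> ?m y"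
    proof -
      have "?m (x \<otimes>\<^bsub>S \<times>\<times> A\<^esub> y) = \<sigma> s \<otimes>\<^bsub>E\<^esub> (\<sigma> t \<otimes>\<^bsub>E\<^esub> \<beta> a) \<otimes>\<^bsub>E\<^esub> \<beta> b"
        using c by (simp add: xy ring_hom_mult[OF \<sigma>] ring_hom_mult[OF \<beta>] E.m_assoc \<sigma>c \<beta>c)
      also have "\<dots> = \<sigma> s \<otimes>\<^bsub>E\<^esub> (\<beta> a \<otimes>\<^bsub>E\<^esub> \<sigma> t) \<otimes>\<^bsub>E\<^esub> \<beta> b" using c by (simp add: comm)
      finally show ?thesis using c by (simp add: xy E.m_assoc \<sigma>c \<beta>c)
    qed
  next
    fix x and n :: int assume "x \<in> carrier (S \<times>\<times> A)"
    then have c: "?m x \<in> carrier E" by (auto simp: \<sigma>c \<beta>c)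
    then show "?m x \<otimes>\<^bsub>E\<^esub> ?\<rho> n = ?\<rho> n \<otimes>\<^bsub>E\<^esub> ?m x"
      using E.add_pow_ldistr_int[OF E.one_closed c, of n] E.add_pow_rdistr_int[OF c E.one_closed, of n] by simp
  qed (auto simp: \<sigma>c \<beta>c ring_hom_one[OF \<sigma>] ring_hom_one[OF \<beta>] DirProd_def)
  then obtain \<Phi> where \<Phi>: "\<Phi> \<in> ring_hom R E" "\<And>s a. s \<in> carrier S \<Longrightarrow> a \<in> carrier A \<Longrightarrow> \<Phi> (\<delta> s a) = \<sigma> s \<otimes>\<^bsub>E\<^esub> \<beta> a"
    by (auto simp: \<sigma>c \<beta>c)
  interpret \<Phi>: ring_hom_ring R E \<Phi> by (rule ring_hom_ringI2[OF R.ring_axioms E.ring_axioms \<Phi>(1)])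
  have diff: "\<Phi> (f - g) = \<Phi> f \<ominus>\<^bsub>E\<^esub> \<Phi> g" if "f \<in> carrier R" "g \<in> carrier R" for f g
  proof -
    have d: "f - g \<in> carrier R" using that by (rule monoid_algebra_diff_closed)
    have "\<Phi> f = \<Phi> g \<oplus>\<^bsub>E\<^esub> \<Phi> (f - g)"
      using ring_hom_add[OF \<Phi>(1) that(2) d] by (simp add: monoid_algebra_simps(2))
    then show ?thesis
      using E.minus_eq_iff[of "\<Phi> f" "\<Phi> g" "\<Phi> (f - g)"] ring_hom_closed[OF \<Phi>(1)] that d by simp
  qed
  have ker: "\<Phi> g = \<zero>\<^bsub>E\<^esub>" if "g \<in> gens" for g
  proof -
    have 0: "a \<ominus>\<^bsub>E\<^esub> b \<ominus>\<^bsub>E\<^esub> c = \<zero>\<^bsub>E\<^esub>" if "a = b \<oplus>\<^bsub>E\<^esub> c" "b \<in> carrier E" "c \<in> carrier E" for a b c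
      using that E.minus_eq_iff[of a b c] E.minus_eq_zero_iff[of "a \<ominus>\<^bsub>E\<^esub> b" c] by simp
    from that consider
      (1) s t a where "g = \<delta> (s \<oplus>\<^bsub>S\<^esub> t) a - \<delta> s a - \<delta> t a" "s \<in> carrier S" "t \<in> carrier S" "a \<in> carrier A"
      | (2) s a b where "g = \<delta> s (a \<oplus>\<^bsub>A\<^esub> b) - \<delta> s a - \<delta> s b" "s \<in> carrier S" "a \<in> carrier A" "b \<in> carrier A"
      | (3) s r a where "g = \<delta> (s \<otimes>\<^bsub>S\<^esub> \<phi> r) a - \<delta> s (\<psi> r \<otimes>\<^bsub>A\<^esub> a)" "s \<in> carrier S" "a \<in> carrier A"
      unfolding gens_def by blast
    then show ?thesis
    proof cases
      case 1
      have c: "\<delta> (s \<oplus>\<^bsub>S\<^esub> t) a \<in> carrier R" "\<delta> s a \<in> carrier R" "\<delta> t a \<in> carrier R"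
        using 1 by (simp_all add: \<delta>_closed)
      show ?thesis using 1 unfolding 1(1) diff[OF monoid_algebra_diff_closed[OF c(1,2)] c(3)] diff[OF c(1,2)]
        by (intro 0) (simp_all add: \<Phi>(2) ring_hom_add[OF \<sigma>] E.l_distr \<sigma>c \<beta>c)
    next
      case 2
      have c: "\<delta> s (a \<oplus>\<^bsub>A\<^esub> b) \<in> carrier R" "\<delta> s a \<in> carrier R" "\<delta> s b \<in> carrier R"
        using 2 by (simp_all add: \<delta>_closed)
      show ?thesis using 2 unfolding 2(1) diff[OF monoid_algebra_diff_closed[OF c(1,2)] c(3)] diff[OF c(1,2)]
        by (intro 0) (simp_all add: \<Phi>(2) ring_hom_add[OF \<beta>] E.r_distr \<sigma>c \<beta>c)
    next
      case 3
      have c: "\<delta> (s \<otimes>\<^bsub>S\<^esub> \<phi> r) a \<in> carrier R" "\<delta> s (\<psi> r \<otimes>\<^bsub>A\<^esub> a) \<in> carrier R"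
        using 3 by (simp_all add: \<delta>_closed \<phi>_closed \<psi>_closed)
      show ?thesis using 3(2,3) unfolding 3(1) diff[OF c]
        by (simp add: \<Phi>(2) ring_hom_mult[OF \<sigma>] ring_hom_mult[OF \<beta>] E.m_assoc \<sigma>c \<beta>c \<phi>_closed \<psi>_closed bal
          E.minus_eq_zero_iff)
    qed
  qed
  have "Idl\<^bsub>R\<^esub> gens \<subseteq> a_kernel R E \<Phi>"
  proof (rule R.genideal_minimal[OF \<Phi>.kernel_is_ideal])
    show "gens \<subseteq> a_kernel R E \<Phi>"
    proof
      fix r assume r: "r \<in> gens"
      show "r \<in> a_kernel R E \<Phi>"
        unfolding a_kernel_def' mem_Collect_eq using ker[OF r] gens_closed r by (intro conjI) (rule subsetD)
    qed
  qed
  then have "\<Phi> f = \<zero>\<^bsub>E\<^esub>" if "f \<in> Idl\<^bsub>R\<^esub> gens" for f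
    using that unfolding a_kernel_def' by blast
  from quotient_ring_hom_ex[OF R.ring_axioms E.ring_axioms \<Phi>(1) ideal_gens this]
  obtain \<Psi> where \<Psi>: "\<Psi> \<in> ring_hom T E" "\<And>f. f \<in> carrier R \<Longrightarrow> \<Psi> (proj f) = \<Phi> f"
    unfolding T_def' proj_def by blast
  show ?thesis
    by (rule bexI[OF _ \<Psi>(1)]) (simp add: tens_proj \<Psi>(2) \<delta>_closed \<Phi>(2))
qed

end

section \<open>Extension of scalars of a presented algebra\<close>

text \<open>A finite sum looks at the carrier and the additive structure only. This identifies sums
  in records that differ in multiplication, action or further fields.\<close>

lemma finsum_cong_structure:
  assumes "carrier U = carrier V" "add U = add V" "zero U = zero V"
  shows "finsum U f A = finsum V f A"
  using assms by (simp add: finsum_def finprod_def)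

lemma poly_mapping_additive_induct [case_names single add]:
  assumes "\<And>k a. P (Poly_Mapping.single k a)" "\<And>x y. P x \<Longrightarrow> P y \<Longrightarrow> P (x + y)"
  shows "P (x :: 'n \<Rightarrow>\<^sub>0 'k::ab_group_add)"
proof -
  have "P (\<Sum>k\<in>S. Poly_Mapping.single k (Poly_Mapping.lookup x k))" if "finite S" for S
    using that
  proof (induction S rule: finite_induct)
    case empty
    show ?case using assms(1)[of undefined 0] by simp
  next
    case (insert k S)
    show ?case unfolding sum.insert[OF insert.hyps] by (intro assms insert.IH)
  qed
  from this[of "Poly_Mapping.keys x", OF finite_keys] show ?thesis unfolding sum_single_lookup .
qed

abbreviation rat_map :: "rat sqrtpi_ext \<Rightarrow> rfun sqrtpi_ext" where
  "rat_map \<equiv> Poly_Mapping.map rfun_of_rat"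

text \<open>Common setting of the tensor products over Q[\<pi>] and over Q. \<open>\<iota>\<close>
  embeds the scalars of \<open>B\<close>, by \<pi> = (\<surd>\<pi>)^2 in one case and by v = q
  \<surd>\<pi> in the other. \<open>crd_sum\<close> asks that coordinates recover the element, not
  that they be unique: over Q(q)[\<pi>] the four powers of \<surd>\<pi> are linearly
  dependent.\<close>

locale pre_scalar_extension = quantum_presentation C \<kappa>K \<kappa>K' t h se sf \<kappa> H hc u w
  for C :: "('i, 'p::ab_group_add) superdatum" and \<kappa>K \<kappa>K' t :: "'i \<Rightarrow> 'i \<Rightarrow> 'k::comm_ring_1"
    and h se sf \<kappa> H hc u w +
  fixes \<phi> :: "'r \<Rightarrow> rat sqrtpi_ext" and \<psi> :: "'r \<Rightarrow> 'k" and crd :: "rfun sqrtpi_ext \<Rightarrow> 4 \<Rightarrow> 'k"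
    and \<iota> :: "'k \<Rightarrow> rfun sqrtpi_ext"
  assumes \<iota>_add: "\<iota> (a + b) = \<iota> a + \<iota> b" and \<iota>_mult: "\<iota> (a * b) = \<iota> a * \<iota> b" and \<iota>_one: "\<iota> 1 = 1"
    and \<iota>_\<psi>: "\<iota> (\<psi> r) = rat_map (\<phi> r)"
    and rat_map_add: "rat_map (s + s') = rat_map s + rat_map s'"
    and rat_map_mult: "rat_map (s * s') = rat_map s * rat_map s'"
    and rat_map_one: "rat_map 1 = 1"
    and crd_add: "crd (x + y) k = crd x k + crd y k"
    and crd_sum: "(\<Sum>k\<in>UNIV. rat_map (Poly_Mapping.single k 1) * \<iota> (crd x k)) = x"
begin

abbreviation "Q \<equiv> (ring_of_type_algebra :: rat sqrtpi_ext ring)"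

lemma Q_simps: "carrier Q = UNIV" "x \<otimes>\<^bsub>Q\<^esub> y = x * y" "x \<oplus>\<^bsub>Q\<^esub> y = x + y" "\<one>\<^bsub>Q\<^esub> = 1"
  by (simp_all add: ring_of_type_algebra_def)

lemma ring_Q: "ring Q"
  by (rule ring_from_type_algebra)

abbreviation "T \<equiv> tensor_ring Q B \<phi> (\<lambda>r. scl B (\<psi> r))"
abbreviation "tens \<equiv> pure_tensor Q B \<phi> (\<lambda>r. scl B (\<psi> r))"

lemma tensor_rings: "tensor_rings Q B \<phi> (\<lambda>r. scl B (\<psi> r))"
  by (rule tensor_rings.intro) (simp_all add: ring_Q ring_B Q_simps scalar_homD(1)[OF scl_hom])

lemma ring_T: "ring T"
  by (rule ring_tensor_ring) (simp_all add: ring_Q ring_B Q_simps scalar_homD(1)[OF scl_hom])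

definition E :: "('i, 'p, rfun sqrtpi_ext, ((rat sqrtpi_ext \<times> ('i gen list \<Rightarrow>\<^sub>0 'k) set) \<Rightarrow>\<^sub>0 int) set) gr_algebra"
  where "E = sqrtpi_tensor \<phi> \<psi> crd B"

lemma E_fields: "carrier E = carrier T" "monoid.mult E = monoid.mult T" "one E = one T"
  "zero E = zero T" "add E = add T"
  by (simp_all add: E_def sqrtpi_tensor_def Let_def ring.defs monoid.defs)

lemma E_gens: "eel E i = tens 1 (eel B i)" "fel E i = tens 1 (fel B i)" "Kel E i = tens 1 (Kel B i)"
  "hcomp E \<beta> = generate (add_monoid T) {tens s b | s b. b \<in> hcomp B \<beta>}"
  "scl E x = (\<Oplus>\<^bsub>T\<^esub>k\<in>UNIV. tens (Poly_Mapping.single k 1) (scl B (crd x k)))"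
  by (simp_all add: E_def sqrtpi_tensor_def Let_def ring.defs monoid.defs)

lemma ring_E: "ring E"
proof -
  interpret T: ring T by (rule ring_T)
  have "abelian_group E"
    by (rule abelian_groupI) (auto simp: E_fields T.a_ac T.l_neg intro: bexI[of _ "\<ominus>\<^bsub>_\<^esub> _"])
  then show ?thesis
    by (rule ringI) (auto simp: E_fields T.m_assoc T.l_distr T.r_distr intro!: monoidI)
qed

lemma scl_B_closed: "scl B c \<in> carrier B"
  using scalar_homD(1)[OF scl_hom] .

lemma gens_B_closed: "eel B i \<in> carrier B" "fel B i \<in> carrier B" "Kel B i \<in> carrier B"
  "b \<in> hcomp B \<beta> \<Longrightarrow> b \<in> carrier B"
  by (auto simp: B_gens cl_closed)

lemma tens_closed: "b \<in> carrier B \<Longrightarrow> tens s b \<in> carrier E"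
  by (simp add: E_fields tensor_rings.tens_closed[OF tensor_rings] Q_simps)

lemma tens_mult: "a \<in> carrier B \<Longrightarrow> b \<in> carrier B \<Longrightarrow> tens s a \<otimes>\<^bsub>E\<^esub> tens s' b = tens (s * s') (a \<otimes>\<^bsub>B\<^esub> b)"
  using tensor_rings.tens_mult[OF tensor_rings, of s s' a b] by (simp add: E_fields Q_simps)

lemma tens_add_left: "a \<in> carrier B \<Longrightarrow> tens (s + s') a = tens s a \<oplus>\<^bsub>E\<^esub> tens s' a"
  using tensor_rings.tens_add_left[OF tensor_rings, of s s' a] by (simp add: E_fields Q_simps)

lemma tens_add_right: "a \<in> carrier B \<Longrightarrow> b \<in> carrier B \<Longrightarrow> tens s (a \<oplus>\<^bsub>B\<^esub> b) = tens s a \<oplus>\<^bsub>E\<^esub> tens s b"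
  using tensor_rings.tens_add_right[OF tensor_rings, of s a b] by (simp add: E_fields Q_simps)

lemma tens_one: "tens 1 \<one>\<^bsub>B\<^esub> = \<one>\<^bsub>E\<^esub>"
  using tensor_rings.tens_one[OF tensor_rings] by (simp add: E_fields Q_simps)

lemma scl_E_closed: "scl E x \<in> carrier E"
proof -
  interpret T: ring T by (rule ring_T)
  show ?thesis
  unfolding E_gens(5) E_fields using tens_closed[OF scl_B_closed]
  by (intro T.finsum_closed) (auto simp: E_fields)
qed

lemma scl_E_add: "scl E (x + y) = scl E x \<oplus>\<^bsub>E\<^esub> scl E y"
proof -
  interpret T: ring T by (rule ring_T)
  show ?thesis
  unfolding E_gens(5) E_fields crd_add scalar_homD(3)[OF scl_hom] tens_add_right[OF scl_B_closed scl_B_closed]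
  using tens_closed[OF scl_B_closed] by (intro T.finsum_addf) (auto simp: E_fields)
qed

lemma scl_E_single:
  assumes "\<And>k. crd x k = (if k = j then d else 0)"
  shows "scl E x = tens (Poly_Mapping.single j 1) (scl B d)"
proof -
  interpret E: ring E by (rule ring_E)
  interpret B: ring B by (rule ring_B)
  have "tens s \<zero>\<^bsub>B\<^esub> = \<zero>\<^bsub>E\<^esub>" for s
    using tens_add_right[OF B.zero_closed B.zero_closed, of s] tens_closed[OF B.zero_closed, of s] by simp
  then have z: "tens s (scl B 0) = \<zero>\<^bsub>E\<^esub>" for s
    by (simp add: scalar_hom_zero[OF ring_B scl_hom])
  have tc: "tens s (scl B b) \<in> carrier E" for s b by (rule tens_closed[OF scl_B_closed])
  have "scl E x = finsum E (\<lambda>k. tens (Poly_Mapping.single k 1) (scl B (crd x k))) UNIV"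
    unfolding E_gens(5) by (rule finsum_cong_structure) (simp_all add: E_fields)
  also have "\<dots> = finsum E (\<lambda>k. if j = k then tens (Poly_Mapping.single k 1) (scl B d) else \<zero>\<^bsub>E\<^esub>) UNIV"
    by (rule E.finsum_cong') (simp_all add: assms z tc)
  also have "\<dots> = tens (Poly_Mapping.single j 1) (scl B d)"
    by (rule E.add.finprod_singleton[where f = "\<lambda>k. tens (Poly_Mapping.single k 1) (scl B d)", simplified])
      (simp_all add: tc)
  finally show ?thesis .
qed

lemma tens_scl_balanced: "tens (s * \<phi> r) (scl B c) = tens s (scl B (\<psi> r * c))"
  using tensor_rings.tens_balanced[OF tensor_rings, of s "scl B c" r]
  by (simp add: Q_simps scl_B_closed scalar_homD(4)[OF scl_hom])

lemma scl_E_reduce: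
  assumes "\<And>j a. scl E (rat_map (Poly_Mapping.single j a) * \<iota> c) = tens (Poly_Mapping.single j a) (scl B c)"
  shows "scl E (rat_map s * \<iota> c) = tens s (scl B c)"
  by (induction s rule: poly_mapping_additive_induct)
    (simp_all add: assms rat_map_add distrib_right scl_E_add tens_add_left scl_B_closed)

end

text \<open>The scalar map of the tensor product is defined through coordinates;
  \<open>scl_E\<close> says that it is the expected map, and multiplicativity follows from that. The
  proof of \<open>scl_E\<close> depends on the base ring and uses facts about \<open>E\<close> and
  \<open>tens\<close>, hence this second layer.\<close>

locale scalar_extension = pre_scalar_extension C \<kappa>K \<kappa>K' t h se sf \<kappa> H hc u w \<phi> \<psi> crd \<iota>
  for C :: "('i, 'p::ab_group_add) superdatum" and \<kappa>K \<kappa>K' t :: "'i \<Rightarrow> 'i \<Rightarrow> 'k::comm_ring_1"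
    and h se sf \<kappa> H hc u w and \<phi> :: "'r \<Rightarrow> rat sqrtpi_ext" and \<psi> \<iota> crd +
  assumes scl_E: "scl E (rat_map s * \<iota> c) = tens s (scl B c)"
begin

lemma scl_E_\<iota>: "scl E (\<iota> c) = tens 1 (scl B c)"
  using scl_E[of 1 c] by (simp add: rat_map_one)

lemma scl_B_one: "scl B 1 = \<one>\<^bsub>B\<^esub>"
  using scalar_homD(2)[OF scl_hom] .

lemma scl_E_rat: "scl E (rat_map s) = tens s \<one>\<^bsub>B\<^esub>"
  using scl_E[of s 1] by (simp add: \<iota>_one scl_B_one)

lemma tens_split: "b \<in> carrier B \<Longrightarrow> tens s b = scl E (rat_map s) \<otimes>\<^bsub>E\<^esub> tens 1 b"
proof -
  interpret B: ring B by (rule ring_B)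
  show "b \<in> carrier B \<Longrightarrow> ?thesis" by (simp add: scl_E_rat tens_mult)
qed

text \<open>By \<open>crd_sum\<close>, the products of an element of Q[\<surd>\<pi>] with an
  embedded scalar of \<open>B\<close> generate the scalars additively.\<close>

lemma elementary_induct [case_names elementary add]:
  assumes "\<And>s c. P (rat_map s * \<iota> c)" "\<And>x y. P x \<Longrightarrow> P y \<Longrightarrow> P (x + y)"
  shows "P x"
proof -
  have "P (\<Sum>k\<in>K. rat_map (Poly_Mapping.single k 1) * \<iota> (crd x k))" if "finite K" for K
    using that
  proof (induction K rule: finite_induct)
    case empty
    have "\<iota> 0 = 0" using \<iota>_add[of 0 0] by simp
    then show ?case using assms(1)[of 1 0] by simp
  next
    case (insert k K)
    show ?case unfolding sum.insert[OF insert.hyps] by (intro assms insert.IH)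
  qed
  from this[of UNIV, OF finite] show ?thesis unfolding crd_sum .
qed

lemma scl_E_hom: "scalar_hom (scl E) E"
proof -
  interpret E: ring E by (rule ring_E)
  have "scl E (x * y) = scl E x \<otimes>\<^bsub>E\<^esub> scl E y" for x y
  proof (induction x rule: elementary_induct)
    case (add x x') then show ?case by (simp add: distrib_right scl_E_add E.l_distr scl_E_closed)
  next
    case (elementary s c)
    show ?case
    proof (induction y rule: elementary_induct)
      case (add x x') then show ?case by (simp add: distrib_left scl_E_add E.r_distr scl_E_closed)
    next
      case (elementary s' c')
      have "rat_map s * \<iota> c * (rat_map s' * \<iota> c') = rat_map (s * s') * \<iota> (c * c')"
        by (simp add: rat_map_mult \<iota>_mult ac_simps)
      then show ?case by (simp add: scl_E tens_mult scl_B_closed scalar_homD(4)[OF scl_hom])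
    qed
  qed
  moreover have "scl E 1 = \<one>\<^bsub>E\<^esub>" using scl_E_\<iota>[of 1] by (simp add: \<iota>_one scl_B_one tens_one)
  ultimately show ?thesis by (auto simp: scalar_hom_def scl_E_closed scl_E_add)
qed

text \<open>Scalars sit on the empty word and their coefficients commute, so they commute with every
  word. Centrality is not part of a \<open>gr_algebra\<close> and has to be derived.\<close>

lemma scl_B_central: "b \<in> carrier B \<Longrightarrow> scl B c \<otimes>\<^bsub>B\<^esub> b = b \<otimes>\<^bsub>B\<^esub> scl B c"
proof -
  assume "b \<in> carrier B"
  then obtain f where f: "b = cl f" by (auto simp: carrier_B)
  interpret B: ring B by (rule ring_B)
  have "f \<in> carrier FA" by (simp add: FA_simps)
  then have "cl (mon c []) \<otimes>\<^bsub>B\<^esub> cl f = cl f \<otimes>\<^bsub>B\<^esub> cl (mon c [])"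
  proof (induction f rule: monoid_algebra_induct)
    case (single v a)
    then show ?case using cl_mon_append[of "[]" v c a] cl_mon_append[of v "[]" a c] by (simp add: mult.commute)
  next
    case (add f g)
    then show ?case by (simp add: cl_add B.l_distr B.r_distr cl_closed)
  qed (simp add: cl_zero cl_closed)
  then show ?thesis by (simp add: f B_gens)
qed

lemma scl_E_central: "b \<in> carrier B \<Longrightarrow> scl E x \<otimes>\<^bsub>E\<^esub> tens 1 b = tens 1 b \<otimes>\<^bsub>E\<^esub> scl E x"
proof (induction x rule: elementary_induct)
  case (elementary s c)
  then show ?case by (simp add: scl_E tens_mult scl_B_closed scl_B_central)
next
  case (add x y)
  interpret E: ring E by (rule ring_E)
  show ?case using add by (simp add: scl_E_add E.l_distr E.r_distr scl_E_closed tens_closed)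
qed

lemma tens1_hom: "(\<lambda>b. tens 1 b) \<in> ring_hom B E"
  by (rule ring_hom_memI) (auto simp: tens_closed tens_mult tens_add_right tens_one)

lemma tens_hcomp: "b \<in> hcomp B \<beta> \<Longrightarrow> tens s b \<in> hcomp E \<beta>"
  unfolding E_gens by (rule generate.incl) blast

text \<open>Since scalars have degree 0, the grading axiom of a weight module makes its weight
  spaces stable under them.\<close>

lemma scl_E_hcomp: "scl E x \<in> hcomp E 0"
proof (induction x rule: elementary_induct)
  case (elementary s c)
  have "scl B c \<in> hcomp B 0" by (auto simp: B_gens word_deg_def split: if_splits)
  then show ?case unfolding scl_E by (rule tens_hcomp)
next
  case (add x y)
  then show ?case unfolding scl_E_add E_gens(4)
    using generate.eng[of "scl E x" "add_monoid T" _ "scl E y"] by (simp add: E_fields)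
qed

end

subsection \<open>Restriction to the presented algebra\<close>

context scalar_extension
begin

definition restricted :: "((rat sqrtpi_ext \<times> ('i gen list \<Rightarrow>\<^sub>0 'k) set \<Rightarrow>\<^sub>0 int) set, 'v, 'p) wt_module \<Rightarrow>
  (('i gen list \<Rightarrow>\<^sub>0 'k) set, 'v, 'p) wt_module" where
  "restricted N = \<lparr>carrier = carrier N, monoid.mult = monoid.mult N, one = one N, zero = zero N,
     add = add N, module.smult = (\<lambda>b x. tens 1 b \<odot>\<^bsub>N\<^esub> x), wtsp = wtsp N\<rparr>"

lemma restricted_simps [simp]: "carrier (restricted N) = carrier N" "zero (restricted N) = zero N"
  "add (restricted N) = add N" "b \<odot>\<^bsub>restricted N\<^esub> x = tens 1 b \<odot>\<^bsub>N\<^esub> x" "wtsp (restricted N) = wtsp N"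
  by (simp_all add: restricted_def)

lemma smult_restricted [simp]: "module.smult (restricted N) b = module.smult N (tens 1 b)"
  by (simp add: restricted_def)

lemma restricted_weight_module:
  assumes N: "weight_module C E \<kappa>E N" and \<kappa>E: "\<And>i n. \<kappa>E i n = \<iota> (\<kappa> i n)"
  shows "weight_module C B \<kappa> (restricted N)"
proof -
  interpret N: left_module E N using N by (simp add: weight_module_def)
  have "left_module B (restricted N)"
    by (rule left_module_restrict[OF N.left_module_axioms ring_B tens1_hom]) simp_all
  moreover have "direct_sum_decomp (restricted N) (wtsp N)"
  proof -
    have "finsum (restricted N) g K = finsum N g K" for g :: "'p \<Rightarrow> _" and K
      by (rule finsum_cong_structure) simp_all
    then show ?thesis
      using N by (simp add: weight_module_def direct_sum_decomp_def subgroup_def m_inv_def)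
  qed
  moreover have "tens 1 b \<odot>\<^bsub>N\<^esub> x \<in> wtsp N (\<mu> + \<beta>)" if "b \<in> hcomp B \<beta>" "x \<in> wtsp N \<mu>" for b x \<beta> \<mu>
    using N tens_hcomp[OF that(1)] that(2) by (simp add: weight_module_def)
  moreover have "tens 1 (Kel B i) \<odot>\<^bsub>N\<^esub> x = tens 1 (scl B (\<kappa> i (crt C i \<mu>))) \<odot>\<^bsub>N\<^esub> x" if "x \<in> wtsp N \<mu>" for i x \<mu>
    using N that by (simp add: weight_module_def E_gens(3) \<kappa>E scl_E_\<iota>)
  ultimately show ?thesis by (simp add: weight_module_def)
qed

lemma weight_space_module_extended:
  assumes N: "weight_module C E \<kappa>E N"
  shows "weight_space_module N (wtsp N) (\<lambda>c x. scl E c \<odot>\<^bsub>N\<^esub> x)"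
proof -
  interpret N: left_module E N using N by (simp add: weight_module_def)
  interpret wd: weight_decomposition N "wtsp N"
    by unfold_locales (use N in \<open>simp add: weight_module_def\<close>)
  show ?thesis
  proof unfold_locales
    fix x \<mu> a assume "x \<in> wtsp N \<mu>"
    then have "scl E a \<odot>\<^bsub>N\<^esub> x \<in> wtsp N (\<mu> + 0)"
      using N scl_E_hcomp[of a] unfolding weight_module_def by blast
    then show "scl E a \<odot>\<^bsub>N\<^esub> x \<in> wtsp N \<mu>" by simp
  qed (use scalar_homD[OF scl_E_hom] in \<open>simp_all add: N.smult_closed N.smult_one N.smult_l_distr
    N.smult_r_distr N.smult_assoc\<close>)
qed

text \<open>The relations come from the restriction to \<open>B\<close>, with constants rewritten
  through \<open>\<iota>\<close>. Linearity over the larger scalar ring is an additional claim; it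
  holds because \<open>scl E\<close> commutes with all \<open>tens 1 b\<close>.\<close>

lemma quantum_rep_extended:
  assumes N: "weight_module C E \<kappa>E N" and \<kappa>E: "\<And>i n. \<kappa>E i n = \<iota> (\<kappa> i n)"
  shows "quantum_rep N (wtsp N) (\<lambda>c x. scl E c \<odot>\<^bsub>N\<^esub> x) C (\<lambda>i j. \<iota> (t i j)) (\<lambda>i n. \<iota> (H i n))
    (\<lambda>i j k. \<iota> (se i j k)) (\<lambda>i j k. \<iota> (sf i j k))
    (\<lambda>i x. eel E i \<odot>\<^bsub>N\<^esub> x) (\<lambda>i x. fel E i \<odot>\<^bsub>N\<^esub> x)"
proof -
  interpret N: left_module E N using N by (simp add: weight_module_def)
  interpret PM: presented_module C \<kappa>K \<kappa>K' t h se sf \<kappa> H hc u w "restricted N"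
    by unfold_locales (rule restricted_weight_module[OF N \<kappa>E])
  interpret W: weight_space_module N "wtsp N" "\<lambda>c x. scl E c \<odot>\<^bsub>N\<^esub> x"
    by (rule weight_space_module_extended[OF N])
  note q = quantum_rep.E_op[OF PM.quantum_rep_act] quantum_rep.F_op[OF PM.quantum_rep_act]
    quantum_rep.EF[OF PM.quantum_rep_act] quantum_rep.serre_E[OF PM.quantum_rep_act]
    quantum_rep.serre_F[OF PM.quantum_rep_act]
  have comm: "tens 1 b \<odot>\<^bsub>N\<^esub> (scl E a \<odot>\<^bsub>N\<^esub> x) = scl E a \<odot>\<^bsub>N\<^esub> (tens 1 b \<odot>\<^bsub>N\<^esub> x)"
    if "b \<in> carrier B" "x \<in> carrier N" for a b x
    unfolding N.smult_assoc[OF scl_E_closed tens_closed[OF that(1)] that(2), symmetric]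
      N.smult_assoc[OF tens_closed[OF that(1)] scl_E_closed that(2), symmetric] scl_E_central[OF that(1)] ..
  have fs: "finsum (restricted N) f K = finsum N f K" for f :: "nat \<Rightarrow> _" and K
    by (rule finsum_cong_structure) simp_all
  have tB: "tens 1 b \<odot>\<^bsub>N\<^esub> x \<in> carrier N" if "b \<in> carrier B" "x \<in> carrier N" for b x
    using that by (simp add: N.smult_closed tens_closed)
  show ?thesis
  proof unfold_locales
    fix i j x \<mu>
    show "W.weight_operator (rt C i) (\<lambda>x. eel E i \<odot>\<^bsub>N\<^esub> x)" "W.weight_operator (- rt C i) (\<lambda>x. fel E i \<odot>\<^bsub>N\<^esub> x)"
      using PM.weight_operatorD(4)[OF q(1)[of i]] PM.weight_operatorD(4)[OF q(2)[of i]]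
      by (simp_all add: W.weight_operator_def E_gens(1-3) tB gens_B_closed comm N.smult_r_distr tens_closed)
    assume x: "x \<in> wtsp N \<mu>"
    show "eel E i \<odot>\<^bsub>N\<^esub> (fel E j \<odot>\<^bsub>N\<^esub> x) = scl E (\<iota> (t i j)) \<odot>\<^bsub>N\<^esub> (fel E j \<odot>\<^bsub>N\<^esub> (eel E i \<odot>\<^bsub>N\<^esub> x)) \<oplus>\<^bsub>N\<^esub>
      (if i = j then scl E (\<iota> (H i (crt C i \<mu>))) \<odot>\<^bsub>N\<^esub> x else \<zero>\<^bsub>N\<^esub>)"
      using q(3)[of x \<mu> i j] x by (simp add: E_gens(1-3) scl_E_\<iota>)
    assume ij: "i \<noteq> j"
    show "(\<Oplus>\<^bsub>N\<^esub>k\<in>{..serre_len C i j}. scl E (\<iota> (se i j k)) \<odot>\<^bsub>N\<^esub> ((\<lambda>x. eel E i \<odot>\<^bsub>N\<^esub> x) ^^ (serre_len C i j - k))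
      (eel E j \<odot>\<^bsub>N\<^esub> (((\<lambda>x. eel E i \<odot>\<^bsub>N\<^esub> x) ^^ k) x))) = \<zero>\<^bsub>N\<^esub>"
      using q(4)[of i j x \<mu>] x ij unfolding fs by (simp add: E_gens(1-3) scl_E_\<iota>)
    show "(\<Oplus>\<^bsub>N\<^esub>k\<in>{..serre_len C i j}. scl E (\<iota> (sf i j k)) \<odot>\<^bsub>N\<^esub> ((\<lambda>x. fel E i \<odot>\<^bsub>N\<^esub> x) ^^ (serre_len C i j - k))
      (fel E j \<odot>\<^bsub>N\<^esub> (((\<lambda>x. fel E i \<odot>\<^bsub>N\<^esub> x) ^^ k) x))) = \<zero>\<^bsub>N\<^esub>"
      using q(5)[of i j x \<mu>] x ij unfolding fs by (simp add: E_gens(1-3) scl_E_\<iota>)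
  qed
qed

text \<open>A pure tensor is a scalar times some \<open>tens 1 b\<close>, so commuting with scalars
  and with \<open>B\<close> is enough.\<close>

lemma extended_hom_commutes:
  assumes M: "weight_module C E \<kappa>E M" and N: "weight_module C E \<kappa>E N" and \<kappa>E: "\<And>i n. \<kappa>E i n = \<iota> (\<kappa> i n)"
    and f: "f \<in> carrier M \<rightarrow> carrier N"
      "\<And>x y. x \<in> carrier M \<Longrightarrow> y \<in> carrier M \<Longrightarrow> f (x \<oplus>\<^bsub>M\<^esub> y) = f x \<oplus>\<^bsub>N\<^esub> f y"
      "\<And>\<mu> x. x \<in> wtsp M \<mu> \<Longrightarrow> f x \<in> wtsp N \<mu>"
    and scl: "\<And>c x. x \<in> carrier M \<Longrightarrow> f (scl E c \<odot>\<^bsub>M\<^esub> x) = scl E c \<odot>\<^bsub>N\<^esub> f x"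
    and eel: "\<And>i x. x \<in> carrier M \<Longrightarrow> f (eel E i \<odot>\<^bsub>M\<^esub> x) = eel E i \<odot>\<^bsub>N\<^esub> f x"
    and fel: "\<And>i x. x \<in> carrier M \<Longrightarrow> f (fel E i \<odot>\<^bsub>M\<^esub> x) = fel E i \<odot>\<^bsub>N\<^esub> f x"
    and "a \<in> carrier E" "x \<in> carrier M"
  shows "f (a \<odot>\<^bsub>M\<^esub> x) = a \<odot>\<^bsub>N\<^esub> f x"
proof -
  interpret M: left_module E M using M by (simp add: weight_module_def)
  interpret N: left_module E N using N by (simp add: weight_module_def)
  have fc: "f x \<in> carrier N" if "x \<in> carrier M" for x using f(1) that by auto
  have B1: "f (tens 1 b \<odot>\<^bsub>M\<^esub> x) = tens 1 b \<odot>\<^bsub>N\<^esub> f x" if "b \<in> carrier B" "x \<in> carrier M" for b x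
  proof -
    have "f (b \<odot>\<^bsub>restricted M\<^esub> x) = b \<odot>\<^bsub>restricted N\<^esub> f x"
      by (rule presented_hom_commutes[OF restricted_weight_module[OF M \<kappa>E] restricted_weight_module[OF N \<kappa>E]])
        (unfold restricted_simps, unfold scl_E_\<iota>[symmetric] E_gens(1,2)[symmetric],
          (rule f scl eel fel that; assumption)+)
    then show ?thesis by simp
  qed
  have "a \<in> carrier T" using assms by (simp add: E_fields)
  then have "\<forall>x\<in>carrier M. f (a \<odot>\<^bsub>M\<^esub> x) = a \<odot>\<^bsub>N\<^esub> f x"
  proof (induction a rule: tensor_rings.tensor_induct[OF tensor_rings, consumes 1, case_names tens add])
    case (tens s b)
    then show ?case using B1 scl
      by (simp add: tens_split[of b s] M.smult_assoc N.smult_assoc scl_E_closed tens_closed fc M.smult_closed)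
  next
    case (add a b)
    have ab: "a \<oplus>\<^bsub>T\<^esub> b = a \<oplus>\<^bsub>E\<^esub> b" "a \<in> carrier E" "b \<in> carrier E" using add by (simp_all add: E_fields)
    show ?case unfolding ab(1) using add.IH ab(2,3)
      by (simp add: M.smult_l_distr N.smult_l_distr f(2) M.smult_closed fc)
  qed
  then show ?thesis using assms by blast
qed

text \<open>Letting the scalars of \<open>B\<close> act through \<open>\<iota>\<close> yields a
  representation to which the universal property of \<open>B\<close> applies, while Q[\<surd>\<pi>]
  acts by scalars. The two actions commute because scalars commute with \<open>e\<close> and
  \<open>f\<close>, and by \<open>\<iota>_\<psi>\<close> they agree on the common base ring, so the
  tensor product acts.\<close>

lemma extended_hom_ex:
  fixes V (structure)
  assumes q: "quantum_rep V W \<rho> C (\<lambda>i j. \<iota> (t i j)) (\<lambda>i n. \<iota> (H i n))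
    (\<lambda>i j k. \<iota> (se i j k)) (\<lambda>i j k. \<iota> (sf i j k)) e f"
  shows "\<exists>\<Phi> \<in> ring_hom E (end_ring V).
    (\<forall>c. \<forall>x\<in>carrier V. \<Phi> (scl E c) x = \<rho> c x) \<and>
    (\<forall>i. \<forall>x\<in>carrier V. \<Phi> (eel E i) x = e i x) \<and>
    (\<forall>i. \<forall>x\<in>carrier V. \<Phi> (fel E i) x = f i x) \<and>
    (\<forall>i \<mu>. \<forall>x\<in>W \<mu>. \<Phi> (Kel E i) x = \<rho> (\<iota> (\<kappa> i (crt C i \<mu>))) x) \<and>
    (\<forall>\<beta> \<mu>. \<forall>a\<in>hcomp E \<beta>. \<forall>x\<in>W \<mu>. \<Phi> a x \<in> W (\<mu> + \<beta>))"
proof -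
  interpret q: quantum_rep V W \<rho> C "\<lambda>i j. \<iota> (t i j)" "\<lambda>i n. \<iota> (H i n)"
    "\<lambda>i j k. \<iota> (se i j k)" "\<lambda>i j k. \<iota> (sf i j k)" e f by (rule q)
  interpret End: ring "end_ring V" by (rule q.ring_end_ring)
  interpret T: ring T by (rule ring_T)
  let ?r = "\<lambda>c. \<rho> (\<iota> c)"
  interpret k: weight_space_module V W ?r
    by unfold_locales (simp_all add: q.\<rho>_closed q.\<rho>_W q.\<rho>_add q.\<rho>_plus q.\<rho>_mult q.\<rho>_one \<iota>_add \<iota>_mult \<iota>_one)
  have op: "k.weight_operator \<beta> T" if "q.weight_operator \<beta> T" for \<beta> T
    using that by (auto simp: k.weight_operator_def q.weight_operator_def)
  interpret k: presentation_rep C \<kappa>K \<kappa>K' t h se sf \<kappa> H hc u w V W ?r e f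
  proof unfold_locales
    show "k.weight_operator (rt C i) (e i)" "k.weight_operator (- rt C i) (f i)" for i
      by (intro op q.E_op q.F_op)+
  qed (simp_all add: q.EF q.serre_E q.serre_F)
  obtain \<Phi>B where \<Phi>B0: "\<Phi>B \<in> ring_hom B (end_ring V)"
    "\<forall>c. \<forall>x\<in>carrier V. \<Phi>B (scl B c) x = \<rho> (\<iota> c) x"
    "\<forall>i. \<forall>x\<in>carrier V. \<Phi>B (eel B i) x = e i x"
    "\<forall>i. \<forall>x\<in>carrier V. \<Phi>B (fel B i) x = f i x"
    "\<forall>i \<mu>. \<forall>x\<in>W \<mu>. \<Phi>B (Kel B i) x = \<rho> (\<iota> (\<kappa> i (crt C i \<mu>))) x"
    "\<forall>\<beta> \<mu>. \<forall>a\<in>hcomp B \<beta>. \<forall>x\<in>W \<mu>. \<Phi>B a x \<in> W (\<mu> + \<beta>)"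
    "\<forall>S. k.weight_operator 0 S \<longrightarrow> (\<forall>i. \<forall>x\<in>carrier V. S (e i x) = e i (S x)) \<longrightarrow>
      (\<forall>i. \<forall>x\<in>carrier V. S (f i x) = f i (S x)) \<longrightarrow>
      (\<forall>a\<in>carrier B. \<forall>x\<in>carrier V. \<Phi>B a (S x) = S (\<Phi>B a x))"
    using k.presented_hom_ex by (elim bexE conjE) (rule that)
  note \<Phi>B = \<Phi>B0(1) \<Phi>B0(2-6)[rule_format]
  note comm0 = \<Phi>B0(7)[THEN spec, THEN mp, THEN mp, THEN mp, THEN bspec, THEN bspec]
  have comm: "\<Phi>B a (\<rho> c x) = \<rho> c (\<Phi>B a x)" if "a \<in> carrier B" "x \<in> carrier V" for a c x
    by (rule comm0[OF op[OF q.weight_operator_\<rho>] _ _ that])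
      (auto simp: q.weight_operatorD(3)[OF q.E_op] q.weight_operatorD(3)[OF q.F_op])
  have Bx: "\<Phi>B a x \<in> carrier V" if "a \<in> carrier B" "x \<in> carrier V" for a x
    using end_ring_apply(5)[OF ring_hom_closed[OF \<Phi>B(1) that(1)] that(2)] .
  let ?\<sigma> = "\<lambda>s. \<lambda>x\<in>carrier V. \<rho> (rat_map s) x"
  have \<sigma>c: "?\<sigma> s \<in> carrier (end_ring V)" for s
    by (rule q.end_ring_memI) (auto simp: q.\<rho>_closed q.\<rho>_add)
  note \<sigma>c' = \<sigma>c \<sigma>c[of "s * s'" for s s', unfolded rat_map_mult] \<sigma>c[of "s + s'" for s s', unfolded rat_map_add]
    \<sigma>c[of 1, unfolded rat_map_one]
  have \<sigma>: "?\<sigma> \<in> ring_hom Q (end_ring V)"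
    by (rule ring_hom_memI; (rule \<sigma>c | rule end_ring_eqI[of _ V]))
      (use \<sigma>c' in \<open>auto simp: Q_simps end_ring_apply rat_map_add rat_map_mult rat_map_one q.\<rho>_plus q.\<rho>_mult q.\<rho>_one q.\<rho>_closed\<close>)
  have "\<exists>\<Phi> \<in> ring_hom T (end_ring V). \<forall>s\<in>carrier Q. \<forall>a\<in>carrier B. \<Phi> (tens s a) = ?\<sigma> s \<otimes>\<^bsub>end_ring V\<^esub> \<Phi>B a"
  proof (rule tensor_rings.tensor_hom_ex[OF tensor_rings End.ring_axioms \<sigma> \<Phi>B(1)])
    fix s a assume a: "a \<in> carrier B"
    show "\<Phi>B a \<otimes>\<^bsub>end_ring V\<^esub> ?\<sigma> s = ?\<sigma> s \<otimes>\<^bsub>end_ring V\<^esub> \<Phi>B a"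
      by (rule end_ring_eqI[of _ V])
        (use a \<sigma>c ring_hom_closed[OF \<Phi>B(1) a] in \<open>auto simp: end_ring_apply comm Bx q.\<rho>_closed\<close>)
  next
    fix r
    show "?\<sigma> (\<phi> r) = \<Phi>B (scl B (\<psi> r))"
      by (rule end_ring_eqI[of _ V])
        (use \<sigma>c ring_hom_closed[OF \<Phi>B(1) scl_B_closed] in \<open>auto simp: \<Phi>B(2) \<iota>_\<psi>\<close>)
  qed
  then obtain \<Phi> where \<Phi>T: "\<Phi> \<in> ring_hom T (end_ring V)"
    and "\<And>s a. a \<in> carrier B \<Longrightarrow> \<Phi> (tens s a) = ?\<sigma> s \<otimes>\<^bsub>end_ring V\<^esub> \<Phi>B a" by (auto simp: Q_simps)
  then have tens: "\<Phi> (tens s a) x = \<rho> (rat_map s) (\<Phi>B a x)" if "a \<in> carrier B" "x \<in> carrier V" for s a x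
    using that by (simp add: end_ring_apply Bx)
  have \<Phi>: "\<Phi> \<in> ring_hom E (end_ring V)" using \<Phi>T by (simp add: ring_hom_def E_fields)
  have tens1: "\<Phi> (tens 1 a) x = \<Phi>B a x" if "a \<in> carrier B" "x \<in> carrier V" for a x
    using that by (simp add: tens rat_map_one q.\<rho>_one Bx)
  have scl: "\<Phi> (scl E c) x = \<rho> c x" if "x \<in> carrier V" for c x
  proof (induction c rule: elementary_induct)
    case (elementary s c)
    show ?case using that by (simp add: scl_E tens scl_B_closed \<Phi>B(2) q.\<rho>_mult)
  next
    case (add c d)
    then show ?case using that ring_hom_add[OF \<Phi> scl_E_closed scl_E_closed, of c d]
      by (simp add: scl_E_add end_ring_apply q.\<rho>_plus)
  qed
  \<comment> \<open>\<open>hcomp E\<close> is a generated subgroup, so the claim is proved along its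
    generation, inverses included. Membership in the carrier is carried along for the additivity of
    \<open>\<Phi>\<close>.\<close>
  have grade: "a \<in> carrier T \<and> \<Phi> a x \<in> W (\<mu> + \<beta>)" if a: "a \<in> hcomp E \<beta>" and x: "x \<in> W \<mu>" for a x \<beta> \<mu>
    using a unfolding E_gens(4)
  proof (induction a rule: generate.induct)
    have xc: "x \<in> carrier V" using x by (rule q.W_carrier)
    have z: "\<Phi> \<zero>\<^bsub>T\<^esub> = \<zero>\<^bsub>end_ring V\<^esub>" by (rule ring_hom_zero[OF \<Phi>T T.ring_axioms End.ring_axioms])
    have gen_mem: "a \<in> carrier T \<and> \<Phi> a x \<in> W (\<mu> + \<beta>)" if a': "a \<in> {tens s b | s b. b \<in> hcomp B \<beta>}" for a
    proof -
      obtain s b where ab: "a = tens s b" "b \<in> hcomp B \<beta>" using a' by blast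
      have b: "b \<in> carrier B" using gens_B_closed(4)[OF ab(2)] .
      show ?thesis using tens_closed[OF b] q.\<rho>_W[OF \<Phi>B(6)[OF ab(2) x]] by (simp add: ab(1) tens b xc E_fields)
    qed
    {
      case one
      show ?case using q.W_zero xc by (simp add: z end_ring_apply)
    next
      case (incl a)
      then show ?case by (rule gen_mem)
    next
      case (inv a)
      then have a: "a \<in> carrier T" "\<Phi> a x \<in> W (\<mu> + \<beta>)" using gen_mem by blast+
      have "\<Phi> (\<ominus>\<^bsub>T\<^esub> a) \<oplus>\<^bsub>end_ring V\<^esub> \<Phi> a = \<zero>\<^bsub>end_ring V\<^esub>"
        using ring_hom_add[OF \<Phi>T T.a_inv_closed[OF a(1)] a(1)] a(1) by (simp add: T.l_neg z)
      then have "\<Phi> (\<ominus>\<^bsub>T\<^esub> a) x \<oplus> \<Phi> a x = \<zero>" using xc by (metis end_ring_apply(2,4))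
      moreover have "\<Phi> (\<ominus>\<^bsub>T\<^esub> a) x \<in> carrier V"
        using end_ring_apply(5)[OF ring_hom_closed[OF \<Phi>T T.a_inv_closed[OF a(1)]] xc] .
      ultimately have "\<Phi> (\<ominus>\<^bsub>T\<^esub> a) x = \<ominus> \<Phi> a x" using q.minus_equality q.W_carrier[OF a(2)] by metis
      then show ?case using T.a_inv_closed[OF a(1)] q.W_neg[OF a(2)] by (simp add: a_inv_def)
    next
      case (eng a b)
      then show ?case using ring_hom_add[OF \<Phi>T, of a b] xc by (simp add: end_ring_apply q.W_add)
    }
  qed
  show ?thesis
    by (rule bexI[OF _ \<Phi>]) (use grade in \<open>auto simp: scl E_gens(1-3) tens1 gens_B_closed \<Phi>B q.W_carrier\<close>)
qed

end

section \<open>Categories of weight modules\<close>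

lemma wt_homD:
  assumes "f \<in> wt_hom A V W"
  shows "f \<in> carrier V \<rightarrow>\<^sub>E carrier W"
    "x \<in> carrier V \<Longrightarrow> y \<in> carrier V \<Longrightarrow> f (x \<oplus>\<^bsub>V\<^esub> y) = f x \<oplus>\<^bsub>W\<^esub> f y"
    "a \<in> carrier A \<Longrightarrow> x \<in> carrier V \<Longrightarrow> f (a \<odot>\<^bsub>V\<^esub> x) = a \<odot>\<^bsub>W\<^esub> f x"
    "x \<in> wtsp V \<mu> \<Longrightarrow> f x \<in> wtsp W \<mu>"
    "x \<in> carrier V \<Longrightarrow> f x \<in> carrier W"
proof -
  show "x \<in> wtsp V \<mu> \<Longrightarrow> f x \<in> wtsp W \<mu>" using assms unfolding wt_hom_def by blast
qed (use assms in \<open>auto simp: wt_hom_def\<close>)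

lemma wt_homI:
  assumes "f \<in> carrier V \<rightarrow>\<^sub>E carrier W"
    "\<And>x y. x \<in> carrier V \<Longrightarrow> y \<in> carrier V \<Longrightarrow> f (x \<oplus>\<^bsub>V\<^esub> y) = f x \<oplus>\<^bsub>W\<^esub> f y"
    "\<And>a x. a \<in> carrier A \<Longrightarrow> x \<in> carrier V \<Longrightarrow> f (a \<odot>\<^bsub>V\<^esub> x) = a \<odot>\<^bsub>W\<^esub> f x"
    "\<And>\<mu> x. x \<in> wtsp V \<mu> \<Longrightarrow> f x \<in> wtsp W \<mu>"
  shows "f \<in> wt_hom A V W"
  unfolding wt_hom_def using assms by blast

lemma weight_moduleD:
  assumes "weight_module C A \<kappa> V"
  shows "left_module A V" "weight_decomposition V (wtsp V)"
    "a \<in> hcomp A \<beta> \<Longrightarrow> x \<in> wtsp V \<mu> \<Longrightarrow> a \<odot>\<^bsub>V\<^esub> x \<in> wtsp V (\<mu> + \<beta>)"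
proof -
  show m: "left_module A V" using assms by (simp add: weight_module_def)
  show "weight_decomposition V (wtsp V)"
    using m assms
    by (simp add: weight_decomposition_def weight_decomposition_axioms_def weight_module_def left_module_def)
qed (use assms in \<open>simp add: weight_module_def\<close>)

lemma ModP_simps:
  "V \<in> Ob (ModP C A \<kappa>) \<longleftrightarrow> weight_module C A \<kappa> V" "Hom (ModP C A \<kappa>) = wt_hom A"
  "Idt (ModP C A \<kappa>) = (\<lambda>V. \<lambda>x\<in>carrier V. x)" "Cmp (ModP C A \<kappa>) = (\<lambda>U V W g f. compose (carrier U) g f)"
  by (simp_all add: ModP_def)

lemma wt_hom_id:
  assumes w: "weight_module C A \<kappa> V"
  shows "(\<lambda>x\<in>carrier V. x) \<in> wt_hom A V V"
proof -
  interpret left_module A V by (rule weight_moduleD[OF w])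
  interpret weight_decomposition V "wtsp V" by (rule weight_moduleD(2)[OF w])
  show ?thesis by (rule wt_homI) (simp_all add: smult_closed W_carrier)
qed

lemma wt_hom_compose:
  assumes w: "weight_module C A \<kappa> U" and fg: "f \<in> wt_hom A U V" "g \<in> wt_hom A V W"
  shows "compose (carrier U) g f \<in> wt_hom A U W"
proof -
  interpret left_module A U by (rule weight_moduleD[OF w])
  interpret weight_decomposition U "wtsp U" by (rule weight_moduleD(2)[OF w])
  note fD = wt_homD[OF fg(1)] and gD = wt_homD[OF fg(2)]
  show ?thesis
  proof (rule wt_homI)
    show "compose (carrier U) g f \<in> carrier U \<rightarrow>\<^sub>E carrier W"
      by (simp add: compose_def fD(5) gD(5))
  qed (simp_all add: compose_eq smult_closed W_carrier fD(2-5) gD(2-5))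
qed

lemma is_category_ModP: "is_category (ModP C A \<kappa> :: (('a, 'v, 'p::ab_group_add) wt_module, _) cat)"
proof (rule is_category.intro; unfold ModP_simps)
  fix V W :: "('a, 'v, 'p) wt_module" and f
  assume f: "f \<in> wt_hom A V W"
  note fD = wt_homD[OF f]
  have out: "f x = undefined" if "x \<notin> carrier V" for x using fD(1) that by auto
  show "compose (carrier V) f (\<lambda>x\<in>carrier V. x) = f"
    by (rule ext) (simp add: compose_def restrict_def out)
  show "compose (carrier V) (\<lambda>x\<in>carrier W. x) f = f"
    by (rule ext) (simp add: compose_def restrict_def out fD(5))
  fix U N :: "('a, 'v, 'p) wt_module" and g h
  show "compose (carrier V) h (compose (carrier V) g f) = compose (carrier V) (compose (carrier W) h g) f"
    by (rule ext) (simp add: compose_def restrict_def fD(5))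
qed (rule wt_hom_id wt_hom_compose; assumption)+

lemma is_category_full_subcat:
  assumes "is_category D"
  shows "is_category (full_subcat D P)"
proof -
  interpret is_category D by fact
  show ?thesis
    by (rule is_category.intro; unfold full_subcat_def;
      simp add: Idt_in Cmp_in Cmp_Idt_right Cmp_Idt_left Cmp_assoc)
qed

lemma full_subcat_True: "full_subcat D (\<lambda>_. True) = D"
  by (simp add: full_subcat_def)

text \<open>Since morphisms are left unchanged, naturality of the identity maps is automatic; all
  that matters is that they are morphisms in both directions.\<close>

lemma naturally_isomorphic_identity:
  fixes K :: "('a, 'v, 'p::ab_group_add) wt_module \<Rightarrow> ('a, 'v, 'p) wt_module"
  assumes K: "\<And>V. weight_module C A \<kappa> V \<Longrightarrow> carrier (K V) = carrier V \<and>
    (\<lambda>x\<in>carrier V. x) \<in> wt_hom A (K V) V \<inter> wt_hom A V (K V)"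
  shows "naturally_isomorphic (full_subcat (ModP C A \<kappa>) P) (full_subcat (ModP C A \<kappa>) P)
      K (\<lambda>x y f. f) (\<lambda>x. x) (\<lambda>x y f. f)"
proof -
  have ob: "weight_module C A \<kappa> V" if "V \<in> Ob (full_subcat (ModP C A \<kappa>) P)" for V :: "('a, 'v, 'p) wt_module"
    using that by (simp add: full_subcat_def ModP_def)
  have simps: "Hom (full_subcat (ModP C A \<kappa>) P) = wt_hom A" "Idt (full_subcat (ModP C A \<kappa>) P) = (\<lambda>V. \<lambda>x\<in>carrier V. x)"
    "Cmp (full_subcat (ModP C A \<kappa>) P) = (\<lambda>U V W g f. compose (carrier U) g f)"
    for P :: "('a, 'v, 'p) wt_module \<Rightarrow> bool"
    by (simp_all add: full_subcat_def ModP_def)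
  have idid: "compose S (\<lambda>x\<in>S. x) (\<lambda>x\<in>S. x) = (\<lambda>x\<in>S. x)" for S :: "'v set"
    by (rule ext) (simp add: compose_def)
  show ?thesis
    unfolding naturally_isomorphic_def
  proof (intro exI[of _ "\<lambda>V. \<lambda>x\<in>carrier V. x"] conjI ballI)
    fix V :: "('a, 'v, 'p) wt_module" assume "V \<in> Ob (full_subcat (ModP C A \<kappa>) P)"
    note KV = K[OF ob[OF this]]
    show "(\<lambda>x\<in>carrier V. x) \<in> cat_isos (full_subcat (ModP C A \<kappa>) P) (K V) V"
      unfolding cat_isos_def simps
      by (intro CollectI conjI bexI[of _ "\<lambda>x\<in>carrier V. x"]) (use KV in \<open>simp_all add: idid\<close>)
    fix W :: "('a, 'v, 'p) wt_module" and f assume "W \<in> Ob (full_subcat (ModP C A \<kappa>) P)"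
      and "f \<in> Hom (full_subcat (ModP C A \<kappa>) P) V W"
    then have "f \<in> wt_hom A V W" unfolding simps by blast
    note f = wt_homD(5)[OF this]
    have cV: "carrier (K V) = carrier V" using KV by blast
    show "Cmp (full_subcat (ModP C A \<kappa>) P) (K V) (K W) W (\<lambda>x\<in>carrier W. x) f =
      Cmp (full_subcat (ModP C A \<kappa>) P) (K V) V W f (\<lambda>x\<in>carrier V. x)"
      unfolding simps
    proof (rule ext)
      fix x
      show "compose (carrier (K V)) (\<lambda>x\<in>carrier W. x) f x = compose (carrier (K V)) f (\<lambda>x\<in>carrier V. x) x"
        by (cases "x \<in> carrier V") (simp_all add: compose_def cV f)
    qed
  qed
qed

text \<open>Both functors keep the underlying sets and the morphisms, so that the identity maps provide the
  natural isomorphisms.\<close>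

lemma equivalent_full_subcats_ModP:
  fixes Fo :: "('a, 'v, 'p::ab_group_add) wt_module \<Rightarrow> ('b, 'v, 'p) wt_module"
    and Go :: "('b, 'v, 'p) wt_module \<Rightarrow> ('a, 'v, 'p) wt_module"
  assumes Fo: "\<And>V. weight_module C A \<kappa> V \<Longrightarrow> weight_module C A' \<kappa>' (Fo V) \<and> carrier (Fo V) = carrier V"
    and Go: "\<And>V. weight_module C A' \<kappa>' V \<Longrightarrow> weight_module C A \<kappa> (Go V) \<and> carrier (Go V) = carrier V"
    and P: "\<And>V. weight_module C A \<kappa> V \<Longrightarrow> P V \<Longrightarrow> P' (Fo V)" "\<And>V. weight_module C A' \<kappa>' V \<Longrightarrow> P' V \<Longrightarrow> P (Go V)"
    and Fm: "\<And>V W f. weight_module C A \<kappa> V \<Longrightarrow> weight_module C A \<kappa> W \<Longrightarrow> f \<in> wt_hom A V W \<Longrightarrow> f \<in> wt_hom A' (Fo V) (Fo W)"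
    and Gm: "\<And>V W f. weight_module C A' \<kappa>' V \<Longrightarrow> weight_module C A' \<kappa>' W \<Longrightarrow> f \<in> wt_hom A' V W \<Longrightarrow> f \<in> wt_hom A (Go V) (Go W)"
    and GF: "\<And>V. weight_module C A \<kappa> V \<Longrightarrow> (\<lambda>x\<in>carrier V. x) \<in> wt_hom A (Go (Fo V)) V \<inter> wt_hom A V (Go (Fo V))"
    and FG: "\<And>V. weight_module C A' \<kappa>' V \<Longrightarrow> (\<lambda>x\<in>carrier V. x) \<in> wt_hom A' (Fo (Go V)) V \<inter> wt_hom A' V (Fo (Go V))"
  shows "equivalent_cats (full_subcat (ModP C A \<kappa>) P) (full_subcat (ModP C A' \<kappa>') P')"
proof -
  have 1: "naturally_isomorphic (full_subcat (ModP C A \<kappa>) P) (full_subcat (ModP C A \<kappa>) P)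
      (\<lambda>x. Go (Fo x)) (\<lambda>x y f. f) (\<lambda>x. x) (\<lambda>x y f. f)"
    by (rule naturally_isomorphic_identity) (simp add: GF[simplified] Fo Go)
  have 2: "naturally_isomorphic (full_subcat (ModP C A' \<kappa>') P') (full_subcat (ModP C A' \<kappa>') P')
      (\<lambda>x. Fo (Go x)) (\<lambda>x y f. f) (\<lambda>x. x) (\<lambda>x y f. f)"
    by (rule naturally_isomorphic_identity) (simp add: FG[simplified] Fo Go)
  have 3: "cat_functor (full_subcat (ModP C A \<kappa>) P) (full_subcat (ModP C A' \<kappa>') P') Fo (\<lambda>x y f. f)"
    by (rule cat_functor.intro; unfold full_subcat_def ModP_def; simp add: Fo P Fm)
  have 4: "cat_functor (full_subcat (ModP C A' \<kappa>') P') (full_subcat (ModP C A \<kappa>) P) Go (\<lambda>x y f. f)"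
    by (rule cat_functor.intro; unfold full_subcat_def ModP_def; simp add: Go P Gm)
  show ?thesis
    unfolding equivalent_cats_def
    by (rule conjI[OF is_category_full_subcat[OF is_category_ModP]
        conjI[OF is_category_full_subcat[OF is_category_ModP]]])
      (rule exI[of _ Fo], rule exI[of _ "\<lambda>x y f. f"], rule exI[of _ Go], rule exI[of _ "\<lambda>x y f. f"],
        intro conjI 1 2 3 4)
qed

text \<open>
  An algebra whose weight modules are the representations by operators \<open>E\<^sub>i\<close>, \<open>F\<^sub>i\<close> subject to the
  relations with coefficients \<open>t\<close>, \<open>H\<close>, \<open>se\<close>, \<open>sf\<close>. The implicit type arguments \<open>'b\<close> and \<open>'v\<close> are
  the types of the records at which the universal property is available.
\<close>

locale operator_algebra =
  fixes C :: "('i, 'p::ab_group_add) superdatum" and A :: "('i, 'p, 'k::comm_ring_1, 'a) gr_algebra"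
    and \<kappa> :: "'i \<Rightarrow> int \<Rightarrow> 'k" and t :: "'i \<Rightarrow> 'i \<Rightarrow> 'k" and H :: "'i \<Rightarrow> int \<Rightarrow> 'k"
    and se sf :: "'i \<Rightarrow> 'i \<Rightarrow> nat \<Rightarrow> 'k"
  assumes ring_A: "ring A"
    and gens_closed: "scl A c \<in> carrier A" "eel A i \<in> carrier A" "fel A i \<in> carrier A"
    and module_rep: "weight_module C A \<kappa> (V :: ('a, 'v, 'p) wt_module) \<Longrightarrow>
      quantum_rep V (wtsp V) (\<lambda>c x. scl A c \<odot>\<^bsub>V\<^esub> x) C t H se sf (\<lambda>i x. eel A i \<odot>\<^bsub>V\<^esub> x) (\<lambda>i x. fel A i \<odot>\<^bsub>V\<^esub> x)"
    and rep_hom: "quantum_rep (U :: ('b, 'v, 'p) wt_module) W \<rho> C t H se sf E F \<Longrightarrow>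
      \<exists>\<Phi> \<in> ring_hom A (end_ring U).
        (\<forall>c. \<forall>x\<in>carrier U. \<Phi> (scl A c) x = \<rho> c x) \<and>
        (\<forall>i. \<forall>x\<in>carrier U. \<Phi> (eel A i) x = E i x) \<and>
        (\<forall>i. \<forall>x\<in>carrier U. \<Phi> (fel A i) x = F i x) \<and>
        (\<forall>i \<mu>. \<forall>x\<in>W \<mu>. \<Phi> (Kel A i) x = \<rho> (\<kappa> i (crt C i \<mu>)) x) \<and>
        (\<forall>\<beta> \<mu>. \<forall>a\<in>hcomp A \<beta>. \<forall>x\<in>W \<mu>. \<Phi> a x \<in> W (\<mu> + \<beta>))"
    and hom_commutes: "\<lbrakk>weight_module C A \<kappa> (M :: ('a, 'v, 'p) wt_module);
      weight_module C A \<kappa> (N :: ('a, 'v, 'p) wt_module);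
      f \<in> carrier M \<rightarrow> carrier N;
      \<And>x y. x \<in> carrier M \<Longrightarrow> y \<in> carrier M \<Longrightarrow> f (x \<oplus>\<^bsub>M\<^esub> y) = f x \<oplus>\<^bsub>N\<^esub> f y;
      \<And>\<mu> x. x \<in> wtsp M \<mu> \<Longrightarrow> f x \<in> wtsp N \<mu>;
      \<And>c x. x \<in> carrier M \<Longrightarrow> f (scl A c \<odot>\<^bsub>M\<^esub> x) = scl A c \<odot>\<^bsub>N\<^esub> f x;
      \<And>i x. x \<in> carrier M \<Longrightarrow> f (eel A i \<odot>\<^bsub>M\<^esub> x) = eel A i \<odot>\<^bsub>N\<^esub> f x;
      \<And>i x. x \<in> carrier M \<Longrightarrow> f (fel A i \<odot>\<^bsub>M\<^esub> x) = fel A i \<odot>\<^bsub>N\<^esub> f x;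
      a \<in> carrier A; x \<in> carrier M\<rbrakk> \<Longrightarrow> f (a \<odot>\<^bsub>M\<^esub> x) = a \<odot>\<^bsub>N\<^esub> f x"

text \<open>A relation and not a function: the new action is described on scalars and, for the
  generators, on weight vectors. Between weight modules this determines the result up to the
  identity map.\<close>

definition twisted_module :: "('i, 'p, 'k, 'a) gr_algebra \<Rightarrow> ('i, 'p, 'k, 'b) gr_algebra \<Rightarrow>
  ('i \<Rightarrow> 'p \<Rightarrow> 'k) \<Rightarrow> ('i \<Rightarrow> 'p \<Rightarrow> 'k) \<Rightarrow> ('a, 'v, 'p) wt_module \<Rightarrow> ('b, 'v, 'p) wt_module \<Rightarrow> bool" where
  "twisted_module A A' c d V V' \<longleftrightarrow> carrier V' = carrier V \<and> add V' = add V \<and> zero V' = zero V \<and> wtsp V' = wtsp V \<and>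
     (\<forall>a. \<forall>x\<in>carrier V. scl A' a \<odot>\<^bsub>V'\<^esub> x = scl A a \<odot>\<^bsub>V\<^esub> x) \<and>
     (\<forall>i \<mu>. \<forall>x\<in>wtsp V \<mu>. eel A' i \<odot>\<^bsub>V'\<^esub> x = scl A (c i \<mu>) \<odot>\<^bsub>V\<^esub> (eel A i \<odot>\<^bsub>V\<^esub> x)) \<and>
     (\<forall>i \<mu>. \<forall>x\<in>wtsp V \<mu>. fel A' i \<odot>\<^bsub>V'\<^esub> x = scl A (d i \<mu>) \<odot>\<^bsub>V\<^esub> (fel A i \<odot>\<^bsub>V\<^esub> x))"

lemma twisted_moduleD:
  assumes "twisted_module A A' c d V V'"
  shows "carrier V' = carrier V" "add V' = add V" "zero V' = zero V" "wtsp V' = wtsp V"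
    "x \<in> carrier V \<Longrightarrow> scl A' a \<odot>\<^bsub>V'\<^esub> x = scl A a \<odot>\<^bsub>V\<^esub> x"
    "x \<in> wtsp V \<mu> \<Longrightarrow> eel A' i \<odot>\<^bsub>V'\<^esub> x = scl A (c i \<mu>) \<odot>\<^bsub>V\<^esub> (eel A i \<odot>\<^bsub>V\<^esub> x)"
    "x \<in> wtsp V \<mu> \<Longrightarrow> fel A' i \<odot>\<^bsub>V'\<^esub> x = scl A (d i \<mu>) \<odot>\<^bsub>V\<^esub> (fel A i \<odot>\<^bsub>V\<^esub> x)"
  using assms unfolding twisted_module_def by blast+

text \<open>The twisted operators satisfy the relations of \<open>A'\<close>, whose universal
  property then provides an action on the same additive group.\<close>

lemma twisted_module_ex:
  fixes A :: "('i, 'p::ab_group_add, 'k::comm_ring_1, 'a) gr_algebra" and A' :: "('i, 'p, 'k, 'b) gr_algebra"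
    and V :: "('a, 'v, 'p) wt_module"
  assumes A: "operator_algebra TYPE('b) TYPE('v) C A \<kappa> t H se sf"
    and A': "operator_algebra TYPE('a) TYPE('v) C A' \<kappa>' t' H' se' sf'"
    and tw: "twist C t H se sf t' H' se' sf' c d"
    and V: "weight_module C A \<kappa> V"
  shows "\<exists>V'. weight_module C A' \<kappa>' V' \<and> twisted_module A A' c d V V'"
proof -
  let ?\<rho> = "\<lambda>c x. scl A c \<odot>\<^bsub>V\<^esub> x" and ?E = "\<lambda>i x. eel A i \<odot>\<^bsub>V\<^esub> x" and ?F = "\<lambda>i x. fel A i \<odot>\<^bsub>V\<^esub> x"
  interpret q: quantum_rep V "wtsp V" ?\<rho> C t H se sf ?E ?F
    by (rule operator_algebra.module_rep[OF A V])
  obtain \<Phi> where \<Phi>: "\<Phi> \<in> ring_hom A' (end_ring V)"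
    "\<forall>c. \<forall>x\<in>carrier V. \<Phi> (scl A' c) x = scl A c \<odot>\<^bsub>V\<^esub> x"
    "\<forall>i. \<forall>x\<in>carrier V. \<Phi> (eel A' i) x = eel A i \<odot>\<^bsub>V\<^esub> (q.scaling (c i) x)"
    "\<forall>i. \<forall>x\<in>carrier V. \<Phi> (fel A' i) x = fel A i \<odot>\<^bsub>V\<^esub> (q.scaling (d i) x)"
    "\<forall>i \<mu>. \<forall>x\<in>wtsp V \<mu>. \<Phi> (Kel A' i) x = scl A (\<kappa>' i (crt C i \<mu>)) \<odot>\<^bsub>V\<^esub> x"
    "\<forall>\<beta> \<mu>. \<forall>a\<in>hcomp A' \<beta>. \<forall>x\<in>wtsp V \<mu>. \<Phi> a x \<in> wtsp V (\<mu> + \<beta>)"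
    using operator_algebra.rep_hom[OF A' quantum_rep_twist[OF q.quantum_rep_axioms tw]]
    by (elim bexE conjE) (rule that)
  define V' :: "('b, 'v, 'p) wt_module" where
    "V' = \<lparr>carrier = carrier V, monoid.mult = monoid.mult V, one = one V, zero = zero V,
     add = add V, module.smult = \<Phi>, wtsp = wtsp V\<rparr>"
  have s [simp]: "carrier V' = carrier V" "zero V' = zero V" "add V' = add V" "module.smult V' = \<Phi>" "wtsp V' = wtsp V"
    by (simp_all add: V'_def)
  have ab: "abelian_group V'"
    by (rule abelian_groupI) (auto simp: q.a_ac q.l_neg intro: bexI[of _ "\<ominus>\<^bsub>V\<^esub> _"])
  have er: "end_ring V' = end_ring V" by (simp add: end_ring_def add_end_def)
  have "left_module A' V'"
    by (rule left_module_of_end_hom[OF operator_algebra.ring_A[OF A'] ab]) (simp_all add: er \<Phi>(1))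
  moreover have "direct_sum_decomp V' (wtsp V')"
  proof -
    have "finsum V' g K = finsum V g K" for g :: "'p \<Rightarrow> 'v" and K
      by (rule finsum_cong_structure) simp_all
    then show ?thesis
      using q.decomp by (simp add: direct_sum_decomp_def subgroup_def m_inv_def)
  qed
  ultimately have "weight_module C A' \<kappa>' V'"
    using \<Phi>(2,5,6) by (simp add: weight_module_def q.W_carrier)
  moreover have "twisted_module A A' c d V V'"
    using \<Phi>(2-4) q.weight_operatorD(3)[OF q.E_op] q.weight_operatorD(3)[OF q.F_op]
    by (simp add: twisted_module_def q.W_carrier q.scaling_homogeneous)
  ultimately show ?thesis by blast
qed

context operator_algebra
begin

text \<open>Tailored to twisted modules, whose generators are known on weight vectors; additivity
  extends the commutation to all vectors, and \<open>hom_commutes\<close> to the whole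
  algebra.\<close>

lemma wt_homI_gens:
  fixes M N :: "('a, 'v, 'p) wt_module"
  assumes M: "weight_module C A \<kappa> M" and N: "weight_module C A \<kappa> N"
    and f: "f \<in> carrier M \<rightarrow>\<^sub>E carrier N"
      "\<And>x y. x \<in> carrier M \<Longrightarrow> y \<in> carrier M \<Longrightarrow> f (x \<oplus>\<^bsub>M\<^esub> y) = f x \<oplus>\<^bsub>N\<^esub> f y"
      "\<And>\<mu> x. x \<in> wtsp M \<mu> \<Longrightarrow> f x \<in> wtsp N \<mu>"
    and gens: "\<And>c x. x \<in> carrier M \<Longrightarrow> f (scl A c \<odot>\<^bsub>M\<^esub> x) = scl A c \<odot>\<^bsub>N\<^esub> f x"
      "\<And>i \<mu> x. x \<in> wtsp M \<mu> \<Longrightarrow> f (eel A i \<odot>\<^bsub>M\<^esub> x) = eel A i \<odot>\<^bsub>N\<^esub> f x"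
      "\<And>i \<mu> x. x \<in> wtsp M \<mu> \<Longrightarrow> f (fel A i \<odot>\<^bsub>M\<^esub> x) = fel A i \<odot>\<^bsub>N\<^esub> f x"
  shows "f \<in> wt_hom A M N"
proof -
  interpret M: left_module A M by (rule weight_moduleD[OF M])
  interpret N: left_module A N by (rule weight_moduleD[OF N])
  interpret W: weight_decomposition M "wtsp M" by (rule weight_moduleD(2)[OF M])
  have fc: "f x \<in> carrier N" if "x \<in> carrier M" for x using f(1) that by auto
  have ext: "f (g \<odot>\<^bsub>M\<^esub> x) = g \<odot>\<^bsub>N\<^esub> f x"
    if g: "g \<in> carrier A" "\<And>\<mu> x. x \<in> wtsp M \<mu> \<Longrightarrow> f (g \<odot>\<^bsub>M\<^esub> x) = g \<odot>\<^bsub>N\<^esub> f x" and x: "x \<in> carrier M" for g x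
    by (rule W.additive_eqI[where f = "\<lambda>x. f (g \<odot>\<^bsub>M\<^esub> x)" and g = "\<lambda>x. g \<odot>\<^bsub>N\<^esub> f x" and U = N])
      (use g x in \<open>simp_all add: M.smult_closed N.smult_closed M.smult_r_distr N.smult_r_distr fc f(2)\<close>)
  have f': "f \<in> carrier M \<rightarrow> carrier N" using f(1) by auto
  show ?thesis
    by (rule wt_homI[OF f(1,2) hom_commutes[OF M N f' f(2,3) gens(1)
      ext[OF gens_closed(2) gens(2)] ext[OF gens_closed(3) gens(3)]] f(3)])
qed

end

section \<open>Twisting as a functor\<close>

lemma twisted_module_hom:
  fixes A :: "('i, 'p::ab_group_add, 'k::comm_ring_1, 'a) gr_algebra" and A' :: "('i, 'p, 'k, 'b) gr_algebra"
    and M N :: "('a, 'v, 'p) wt_module"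
  assumes A: "operator_algebra TYPE('b) TYPE('v) C A \<kappa> t H se sf"
    and A': "operator_algebra TYPE('a) TYPE('v) C A' \<kappa>' t' H' se' sf'"
    and M: "weight_module C A \<kappa> M" "weight_module C A' \<kappa>' M'" "twisted_module A A' c d M M'"
    and N: "weight_module C A \<kappa> N" "weight_module C A' \<kappa>' N'" "twisted_module A A' c d N N'"
    and f: "f \<in> wt_hom A M N"
  shows "f \<in> wt_hom A' M' N'"
proof -
  note M' = twisted_moduleD[OF M(3)] and N' = twisted_moduleD[OF N(3)]
  interpret M: left_module A M by (rule weight_moduleD[OF M(1)])
  interpret W: weight_decomposition M "wtsp M" by (rule weight_moduleD(2)[OF M(1)])
  note fD = wt_homD[OF f] and cl = operator_algebra.gens_closed[OF A]
  show ?thesis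
  proof (rule operator_algebra.wt_homI_gens[OF A' M(2) N(2)])
    fix i \<mu> x assume "x \<in> wtsp M' \<mu>"
    then have x: "x \<in> wtsp M \<mu>" by (simp add: M')
    then have xc: "x \<in> carrier M" by (rule W.W_carrier)
    \<comment> \<open>\<open>f\<close> keeps the weight, so both sides carry the same factor
      \<open>c i \<mu>\<close>, and \<open>f\<close> commutes with this scalar.\<close>
    show "f (eel A' i \<odot>\<^bsub>M'\<^esub> x) = eel A' i \<odot>\<^bsub>N'\<^esub> f x"
      unfolding M'(6)[OF x] N'(6)[OF fD(4)[OF x]] by (simp add: fD(3) cl M.smult_closed xc)
    show "f (fel A' i \<odot>\<^bsub>M'\<^esub> x) = fel A' i \<odot>\<^bsub>N'\<^esub> f x"
      unfolding M'(7)[OF x] N'(7)[OF fD(4)[OF x]] by (simp add: fD(3) cl M.smult_closed xc)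
  qed (use fD(1) in \<open>simp_all add: M'(1-5) N'(1-5) fD(2-5) cl\<close>)
qed

text \<open>Scalars act in the same way on all the modules involved, so on weight vectors the two
  factors cancel and the generators act on \<open>V''\<close> as on \<open>V\<close>. The identity
  map is therefore an isomorphism.\<close>

lemma twisted_module_inverse_hom:
  fixes A :: "('i, 'p::ab_group_add, 'k::comm_ring_1, 'a) gr_algebra" and A' :: "('i, 'p, 'k, 'b) gr_algebra"
    and V V'' :: "('a, 'v, 'p) wt_module"
  assumes A: "operator_algebra TYPE('b) TYPE('v) C A \<kappa> t H se sf"
    and tw: "twisted_module A A' c d V V'" "twisted_module A' A (\<lambda>i \<mu>. uinv (c i \<mu>)) (\<lambda>i \<mu>. uinv (d i \<mu>)) V' V''"
    and cd: "\<And>i \<mu>. c i \<mu> dvd 1" "\<And>i \<mu>. d i \<mu> dvd 1"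
    and V: "weight_module C A \<kappa> V" "weight_module C A \<kappa> V''"
  shows "(\<lambda>x\<in>carrier V. x) \<in> wt_hom A V'' V \<inter> wt_hom A V V''"
proof -
  interpret q: quantum_rep V "wtsp V" "\<lambda>c x. scl A c \<odot>\<^bsub>V\<^esub> x" C t H se sf "\<lambda>i x. eel A i \<odot>\<^bsub>V\<^esub> x" "\<lambda>i x. fel A i \<odot>\<^bsub>V\<^esub> x"
    by (rule operator_algebra.module_rep[OF A V(1)])
  note t1 = twisted_moduleD[OF tw(1)] and t2 = twisted_moduleD[OF tw(2)]
  have base: "carrier V'' = carrier V" "add V'' = add V" "zero V'' = zero V" "wtsp V'' = wtsp V"
    by (simp_all add: t1(1-4) t2(1-4))
  have scl: "scl A a \<odot>\<^bsub>V''\<^esub> x = scl A a \<odot>\<^bsub>V\<^esub> x" if "x \<in> carrier V" for a x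
    using that by (simp add: t1(1,5) t2(5))
  have cancel: "scl A (uinv z) \<odot>\<^bsub>V\<^esub> (scl A z \<odot>\<^bsub>V\<^esub> x) = x" if "z dvd 1" "x \<in> carrier V" for z x
    using that q.\<rho>_mult[of x "uinv z" z] q.\<rho>_one[of x] by (simp add: uinv_left)
  have E: "eel A i \<odot>\<^bsub>V''\<^esub> x = eel A i \<odot>\<^bsub>V\<^esub> x" if x: "x \<in> wtsp V \<mu>" for x i \<mu>
  proof -
    have xc: "eel A i \<odot>\<^bsub>V\<^esub> x \<in> carrier V" using q.weight_operatorD(1)[OF q.E_op q.W_carrier[OF x]] .
    have xV': "x \<in> wtsp V' \<mu>" using x by (simp add: t1(4))
    show ?thesis
      unfolding t2(6)[OF xV'] t1(6)[OF x] t1(5)[OF q.\<rho>_closed[OF xc]] by (rule cancel[OF cd(1) xc])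
  qed
  have F: "fel A i \<odot>\<^bsub>V''\<^esub> x = fel A i \<odot>\<^bsub>V\<^esub> x" if x: "x \<in> wtsp V \<mu>" for x i \<mu>
  proof -
    have xc: "fel A i \<odot>\<^bsub>V\<^esub> x \<in> carrier V" using q.weight_operatorD(1)[OF q.F_op q.W_carrier[OF x]] .
    have xV': "x \<in> wtsp V' \<mu>" using x by (simp add: t1(4))
    show ?thesis
      unfolding t2(7)[OF xV'] t1(7)[OF x] t1(5)[OF q.\<rho>_closed[OF xc]] by (rule cancel[OF cd(2) xc])
  qed
  have cl: "scl A a \<odot>\<^bsub>V\<^esub> x \<in> carrier V" "eel A i \<odot>\<^bsub>V\<^esub> x \<in> carrier V" "fel A i \<odot>\<^bsub>V\<^esub> x \<in> carrier V"
    if "x \<in> carrier V" for a i x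
    using that q.\<rho>_closed q.weight_operatorD(1)[OF q.E_op] q.weight_operatorD(1)[OF q.F_op] by blast+
  show ?thesis
  proof
    show "(\<lambda>x\<in>carrier V. x) \<in> wt_hom A V'' V"
      by (rule operator_algebra.wt_homI_gens[OF A V(2,1)]) (auto simp: base scl E F q.W_carrier cl)
    show "(\<lambda>x\<in>carrier V. x) \<in> wt_hom A V V''"
      by (rule operator_algebra.wt_homI_gens[OF A V(1,2)]) (auto simp: base scl E F q.W_carrier cl)
  qed
qed

subsection \<open>Integrable modules\<close>

text \<open>Moving the scalings to the inside shows that the n-th power of \<open>T'\<close> is a
  scaling followed by \<open>T ^^ n\<close>, on all vectors and not only on homogeneous ones. The
  scaling can then be moved to the outside, so the same exponent kills x.\<close>

lemma (in weight_space_module) twisted_nilpotent: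
  assumes T: "weight_operator \<beta> T"
    and T': "\<And>\<mu> x. x \<in> W \<mu> \<Longrightarrow> T' x = \<rho> (c \<mu>) (T x)"
      "\<And>x. x \<in> carrier V \<Longrightarrow> T' x \<in> carrier V"
      "\<And>x y. x \<in> carrier V \<Longrightarrow> y \<in> carrier V \<Longrightarrow> T' (x \<oplus> y) = T' x \<oplus> T' y"
    and x: "x \<in> carrier V" "(T ^^ n) x = \<zero>"
  shows "(T' ^^ n) x = \<zero>"
proof -
  note TD = weight_operatorD[OF T] and Tn = weight_operator_funpow[OF T]
  have T'_eq: "T' y = T (scaling c y)" if "y \<in> carrier V" for y
    by (rule additive_eqI[where f = T' and g = "\<lambda>y. T (scaling c y)" and U = V])
      (use that in \<open>simp_all add: T' TD scaling_closed scaling_add scaling_homogeneous W_carrier\<close>)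
  have "\<exists>g. \<forall>y\<in>carrier V. (T' ^^ n) y = (T ^^ n) (scaling g y)"
  proof (induction n)
    case 0
    show ?case by (intro exI[of _ "\<lambda>_. 1"]) (simp add: scaling_one)
  next
    case (Suc n)
    then obtain g where g: "\<And>y. y \<in> carrier V \<Longrightarrow> (T' ^^ n) y = (T ^^ n) (scaling g y)" by blast
    let ?h = "\<lambda>\<mu>. c (\<mu> + (\<Sum>_<n. \<beta>))"
    have "(T' ^^ Suc n) y = (T ^^ Suc n) (scaling (\<lambda>\<mu>. ?h \<mu> * g \<mu>) y)" if y: "y \<in> carrier V" for y
    proof -
      have c: "scaling g y \<in> carrier V" using y by (rule scaling_closed)
      have "(T' ^^ Suc n) y = T (scaling c ((T ^^ n) (scaling g y)))"
        using y c by (simp add: g T'_eq weight_operatorD(1)[OF Tn])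
      also have "\<dots> = T ((T ^^ n) (scaling ?h (scaling g y)))"
        by (subst scaling_commute[OF Tn c]) simp_all
      finally show ?thesis using y by (simp add: scaling_mult)
    qed
    then show ?case by blast
  qed
  then obtain g where g: "(T' ^^ n) x = (T ^^ n) (scaling g x)" using x by blast
  have "scaling (\<lambda>\<mu>. g (\<mu> - (\<Sum>_<n. \<beta>))) ((T ^^ n) x) = (T ^^ n) (scaling g x)"
    by (rule scaling_commute[OF Tn x(1)]) simp
  then show ?thesis using g x(2) weight_operator_zero[OF weight_operator_scaling] by simp
qed

text \<open>Scalars, addition and weight spaces are shared, so dimensions and weights do not change;
  local nilpotency is the point that needs an argument.\<close>

lemma twisted_module_integrable:
  fixes A :: "('i, 'p::ab_group_add, rfun sqrtpi_ext, 'a) gr_algebra" and A' :: "('i, 'p, rfun sqrtpi_ext, 'b) gr_algebra"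
    and V :: "('a, 'v, 'p) wt_module"
  assumes A: "operator_algebra TYPE('b) TYPE('v) C A \<kappa> t H se sf"
    and A': "operator_algebra TYPE('a) TYPE('v) C A' \<kappa>' t' H' se' sf'"
    and V: "weight_module C A \<kappa> V" "weight_module C A' \<kappa>' V'" "twisted_module A A' c d V V'"
    and int: "integrable_O C A V"
  shows "integrable_O C A' V'"
proof -
  interpret q: quantum_rep V "wtsp V" "\<lambda>c x. scl A c \<odot>\<^bsub>V\<^esub> x" C t H se sf "\<lambda>i x. eel A i \<odot>\<^bsub>V\<^esub> x" "\<lambda>i x. fel A i \<odot>\<^bsub>V\<^esub> x"
    by (rule operator_algebra.module_rep[OF A V(1)])
  note t1 = twisted_moduleD[OF V(3)]
  note base = t1(1-4)
  interpret V': left_module A' V' by (rule weight_moduleD[OF V(2)])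
  note cl = operator_algebra.gens_closed[OF A']
  have fd: "fin_dim_wtsp A' V' \<mu>" if fdV: "fin_dim_wtsp A V \<mu>" for \<mu>
  proof -
    obtain K where K: "finite K" "K \<subseteq> wtsp V \<mu>"
      "\<forall>x \<in> wtsp V \<mu>. \<exists>c. x = (\<Oplus>\<^bsub>V\<^esub>b\<in>K. scl A (scalar_const (c b)) \<odot>\<^bsub>V\<^esub> b)"
      using fdV unfolding fin_dim_wtsp_def by blast
    have "(\<Oplus>\<^bsub>V'\<^esub>b\<in>K. scl A' (scalar_const (c b)) \<odot>\<^bsub>V'\<^esub> b) = (\<Oplus>\<^bsub>V\<^esub>b\<in>K. scl A (scalar_const (c b)) \<odot>\<^bsub>V\<^esub> b)" for c
    proof -
      have Kc: "b \<in> carrier V" if "b \<in> K" for b using K(2) that q.W_carrier by blast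
      have "finsum V' (\<lambda>b. scl A' (scalar_const (c b)) \<odot>\<^bsub>V'\<^esub> b) K =
          finsum V (\<lambda>b. scl A' (scalar_const (c b)) \<odot>\<^bsub>V'\<^esub> b) K"
        by (rule finsum_cong_structure) (simp_all add: base)
      also have "\<dots> = finsum V (\<lambda>b. scl A (scalar_const (c b)) \<odot>\<^bsub>V\<^esub> b) K"
        by (rule q.finsum_cong') (simp_all add: t1(5) Kc q.\<rho>_closed)
      finally show ?thesis .
    qed
    then have "\<forall>x \<in> wtsp V \<mu>. \<exists>c. x = (\<Oplus>\<^bsub>V'\<^esub>b\<in>K. scl A' (scalar_const (c b)) \<odot>\<^bsub>V'\<^esub> b)"
      using K(3) by simp
    then show ?thesis unfolding fin_dim_wtsp_def base using K(1,2) by blast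
  qed
  have nil: "((\<lambda>y. eel A' i \<odot>\<^bsub>V'\<^esub> y) ^^ n) x = \<zero>\<^bsub>V\<^esub>"
    if x: "x \<in> carrier V" "((\<lambda>y. eel A i \<odot>\<^bsub>V\<^esub> y) ^^ n) x = \<zero>\<^bsub>V\<^esub>" for i n x
    by (rule q.twisted_nilpotent[OF q.E_op, where T' = "\<lambda>y. eel A' i \<odot>\<^bsub>V'\<^esub> y" and c = "c i", OF t1(6)
      V'.smult_closed[OF cl(2), unfolded base] V'.smult_r_distr[OF cl(2), unfolded base] x])
  have nil': "((\<lambda>y. fel A' i \<odot>\<^bsub>V'\<^esub> y) ^^ n) x = \<zero>\<^bsub>V\<^esub>"
    if x: "x \<in> carrier V" "((\<lambda>y. fel A i \<odot>\<^bsub>V\<^esub> y) ^^ n) x = \<zero>\<^bsub>V\<^esub>" for i n x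
    by (rule q.twisted_nilpotent[OF q.F_op, where T' = "\<lambda>y. fel A' i \<odot>\<^bsub>V'\<^esub> y" and c = "d i", OF t1(7)
      V'.smult_closed[OF cl(3), unfolded base] V'.smult_r_distr[OF cl(3), unfolded base] x])
  show ?thesis
    unfolding integrable_O_def base
  proof (intro conjI allI ballI)
    show "fin_dim_wtsp A' V' \<mu>" for \<mu> using int fd unfolding integrable_O_def by blast
    show "\<exists>\<Lambda>. finite \<Lambda> \<and> (\<forall>\<mu>. wtsp V \<mu> \<noteq> {\<zero>\<^bsub>V\<^esub>} \<longrightarrow> (\<exists>\<nu>\<in>\<Lambda>. \<exists>\<beta>\<in>Qplus C. \<mu> = \<nu> - \<beta>))"
      using int unfolding integrable_O_def by (elim conjE)
    fix i x assume x: "x \<in> carrier V"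
    obtain n where "((\<lambda>y. eel A i \<odot>\<^bsub>V\<^esub> y) ^^ n) x = \<zero>\<^bsub>V\<^esub>" using int x unfolding integrable_O_def by blast
    from nil[OF x this] show "\<exists>n. ((\<lambda>y. eel A' i \<odot>\<^bsub>V'\<^esub> y) ^^ n) x = \<zero>\<^bsub>V\<^esub>" ..
    obtain n where "((\<lambda>y. fel A i \<odot>\<^bsub>V\<^esub> y) ^^ n) x = \<zero>\<^bsub>V\<^esub>" using int x unfolding integrable_O_def by blast
    from nil'[OF x this] show "\<exists>n. ((\<lambda>y. fel A' i \<odot>\<^bsub>V'\<^esub> y) ^^ n) x = \<zero>\<^bsub>V\<^esub>" ..
  qed
qed

theorem equivalent_cats_of_twist:
  fixes A :: "('i, 'p::ab_group_add, rfun sqrtpi_ext, 'a) gr_algebra" and A' :: "('i, 'p, rfun sqrtpi_ext, 'b) gr_algebra"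
  assumes A: "operator_algebra TYPE('b) TYPE('v) C A \<kappa> t H se sf"
    and A': "operator_algebra TYPE('a) TYPE('v) C A' \<kappa>' t' H' se' sf'"
    and tw: "twist C t H se sf t' H' se' sf' c d"
  shows "equivalent_cats (ModP C A \<kappa> :: (('a, 'v, 'p) wt_module, _) cat) (ModP C A' \<kappa>' :: (('b, 'v, 'p) wt_module, _) cat)"
    and "equivalent_cats (Oint C A \<kappa> :: (('a, 'v, 'p) wt_module, _) cat) (Oint C A' \<kappa>' :: (('b, 'v, 'p) wt_module, _) cat)"
proof -
  let ?c = "\<lambda>i \<mu>. uinv (c i \<mu>)" and ?d = "\<lambda>i \<mu>. uinv (d i \<mu>)"
  have u: "\<And>i \<mu>. c i \<mu> dvd 1" "\<And>i \<mu>. d i \<mu> dvd 1" using tw by (auto simp: twist_def)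
  have u': "\<And>i \<mu>. ?c i \<mu> dvd 1" "\<And>i \<mu>. ?d i \<mu> dvd 1" using u by (auto intro: uinv_unit)
  \<comment> \<open>A chosen twisted module; only its defining relation to \<open>V\<close> is used
    afterwards, so any choice would do.\<close>
  define Fo where "Fo V = (SOME V'. weight_module C A' \<kappa>' V' \<and> twisted_module A A' c d V V')"
    for V :: "('a, 'v, 'p) wt_module"
  define Go where "Go V = (SOME V'. weight_module C A \<kappa> V' \<and> twisted_module A' A ?c ?d V V')"
    for V :: "('b, 'v, 'p) wt_module"
  have Fo0: "weight_module C A' \<kappa>' (Fo V) \<and> twisted_module A A' c d V (Fo V)" if "weight_module C A \<kappa> V" for V
    unfolding Fo_def by (rule someI_ex) (rule twisted_module_ex[OF A A' tw that])
  have Go0: "weight_module C A \<kappa> (Go V) \<and> twisted_module A' A ?c ?d V (Go V)" if "weight_module C A' \<kappa>' V" for V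
    unfolding Go_def by (rule someI_ex) (rule twisted_module_ex[OF A' A twist_inverse[OF tw] that])
  note Fo = Fo0[THEN conjunct1] Fo0[THEN conjunct2] and Go = Go0[THEN conjunct1] Go0[THEN conjunct2]
  \<comment> \<open>Stated for arbitrary predicates that the functors respect: the trivial one gives
    all weight modules, integrability gives category O.\<close>
  have eq: "equivalent_cats (full_subcat (ModP C A \<kappa> :: (('a, 'v, 'p) wt_module, _) cat) P)
      (full_subcat (ModP C A' \<kappa>' :: (('b, 'v, 'p) wt_module, _) cat) P')"
    if P: "\<And>V. weight_module C A \<kappa> V \<Longrightarrow> P V \<Longrightarrow> P' (Fo V)" "\<And>V. weight_module C A' \<kappa>' V \<Longrightarrow> P' V \<Longrightarrow> P (Go V)"
    for P P'
  proof (rule equivalent_full_subcats_ModP[where Fo = Fo and Go = Go and P = P and P' = P', OF _ _ P])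
    fix V :: "('a, 'v, 'p) wt_module" assume V: "weight_module C A \<kappa> V"
    show "weight_module C A' \<kappa>' (Fo V) \<and> carrier (Fo V) = carrier V"
      using Fo[OF V] twisted_moduleD(1)[OF Fo(2)[OF V]] by simp
    show "(\<lambda>x\<in>carrier V. x) \<in> wt_hom A (Go (Fo V)) V \<inter> wt_hom A V (Go (Fo V))"
      by (rule twisted_module_inverse_hom[OF A Fo(2)[OF V] Go(2)[OF Fo(1)[OF V]] u V Go(1)[OF Fo(1)[OF V]]])
    fix W :: "('a, 'v, 'p) wt_module" and f assume W: "weight_module C A \<kappa> W" "f \<in> wt_hom A V W"
    show "f \<in> wt_hom A' (Fo V) (Fo W)"
      by (rule twisted_module_hom[OF A A' V Fo[OF V] W(1) Fo[OF W(1)] W(2)])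
  next
    fix V :: "('b, 'v, 'p) wt_module" assume V: "weight_module C A' \<kappa>' V"
    show "weight_module C A \<kappa> (Go V) \<and> carrier (Go V) = carrier V"
      using Go[OF V] twisted_moduleD(1)[OF Go(2)[OF V]] by simp
    \<comment> \<open>Inverting twice restores the original units, which makes the two directions
      formally symmetric.\<close>
    have "twisted_module A A' (\<lambda>i \<mu>. uinv (?c i \<mu>)) (\<lambda>i \<mu>. uinv (?d i \<mu>)) (Go V) (Fo (Go V))"
      using Fo(2)[OF Go(1)[OF V]] by (simp add: uinv_uinv u)
    then show "(\<lambda>x\<in>carrier V. x) \<in> wt_hom A' (Fo (Go V)) V \<inter> wt_hom A' V (Fo (Go V))"
      by (rule twisted_module_inverse_hom[OF A' Go(2)[OF V] _ u' V Fo(1)[OF Go(1)[OF V]]])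
    fix W :: "('b, 'v, 'p) wt_module" and f assume W: "weight_module C A' \<kappa>' W" "f \<in> wt_hom A' V W"
    show "f \<in> wt_hom A (Go V) (Go W)"
      by (rule twisted_module_hom[OF A' A V Go[OF V] W(1) Go[OF W(1)] W(2)])
  qed
  show "equivalent_cats (ModP C A \<kappa> :: (('a, 'v, 'p) wt_module, _) cat) (ModP C A' \<kappa>' :: (('b, 'v, 'p) wt_module, _) cat)"
    using eq[of "\<lambda>_. True" "\<lambda>_. True"] by (simp add: full_subcat_True)
  show "equivalent_cats (Oint C A \<kappa> :: (('a, 'v, 'p) wt_module, _) cat) (Oint C A' \<kappa>' :: (('b, 'v, 'p) wt_module, _) cat)"
    unfolding Oint_def
  proof (rule eq)
    fix V :: "('a, 'v, 'p) wt_module" assume V: "weight_module C A \<kappa> V" "integrable_O C A V"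
    show "integrable_O C A' (Fo V)" by (rule twisted_module_integrable[OF A A' V(1) Fo[OF V(1)] V(2)])
  next
    fix V :: "('b, 'v, 'p) wt_module" assume V: "weight_module C A' \<kappa>' V" "integrable_O C A' V"
    show "integrable_O C A (Go V)" by (rule twisted_module_integrable[OF A' A V(1) Go[OF V(1)] V(2)])
  qed
qed

section \<open>Scalars\<close>

text \<open>Products of monomials decide multiplicativity. This covers maps on coefficients, the
  inclusion of the group ring of order 2 into that of order 4, and the substitutions for the
  indeterminate.\<close>

lemma additive_mult_hom:
  fixes f :: "('n::monoid_add \<Rightarrow>\<^sub>0 'k::comm_ring_1) \<Rightarrow> 'e::comm_ring_1"
  assumes add: "\<And>x y. f (x + y) = f x + f y"
    and single: "\<And>k l a b. f (Poly_Mapping.single (k + l) (a * b)) = f (Poly_Mapping.single k a) * f (Poly_Mapping.single l b)"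
  shows "f (x * y) = f x * f y"
proof (induction x rule: poly_mapping_additive_induct)
  case (single k a)
  show ?case
    by (induction y rule: poly_mapping_additive_induct) (simp_all add: mult_single assms distrib_left)
qed (simp add: distrib_right add)

lemma lookup_map_zero: "f 0 = 0 \<Longrightarrow> Poly_Mapping.lookup (Poly_Mapping.map f p) k = f (Poly_Mapping.lookup p k)"
  by (simp add: map.rep_eq when_def)

lemma map_single_zero: "f 0 = 0 \<Longrightarrow> Poly_Mapping.map f (Poly_Mapping.single k a) = Poly_Mapping.single k (f a)"
  by (rule poly_mapping_eqI) (simp add: lookup_map_zero lookup_single when_def)

lemma map_hom_add:
  assumes "\<And>a b. f (a + b) = f a + f b" "f 0 = 0"
  shows "Poly_Mapping.map f (x + y) = Poly_Mapping.map f x + Poly_Mapping.map f y"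
  by (rule poly_mapping_eqI) (simp add: lookup_map_zero lookup_add assms)

lemma map_hom_mult:
  fixes x y :: "('n::comm_monoid_add \<Rightarrow>\<^sub>0 'k::comm_ring_1)"
  assumes "\<And>a b. f (a + b) = f a + f b" "f 0 = 0" "\<And>a b. f (a * b) = f a * (f b :: 'e::comm_ring_1)"
  shows "Poly_Mapping.map f (x * y) = Poly_Mapping.map f x * Poly_Mapping.map f y"
  by (rule additive_mult_hom) (simp_all add: map_hom_add map_single_zero mult_single assms)

lemma rfun_of_rat: "rfun_of_rat 0 = 0" "rfun_of_rat 1 = 1" "rfun_of_rat (a + b) = rfun_of_rat a + rfun_of_rat b"
  "rfun_of_rat (a * b) = rfun_of_rat a * rfun_of_rat b"
  by (simp_all add: rfun_of_rat_def Zero_fract_def One_fract_def one_pCons mult.commute)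

lemma rat_map_single: "rat_map (Poly_Mapping.single k a) = Poly_Mapping.single k (rfun_of_rat a)"
  by (rule map_single_zero) (rule rfun_of_rat)

lemma rat_map_hom: "rat_map (s + s') = rat_map s + rat_map s'" "rat_map (s * s') = rat_map s * rat_map s'" "rat_map 1 = 1"
proof -
  show "rat_map (s + s') = rat_map s + rat_map s'" by (rule map_hom_add) (simp_all add: rfun_of_rat)
  show "rat_map (s * s') = rat_map s * rat_map s'" by (rule map_hom_mult) (simp_all add: rfun_of_rat)
  show "rat_map 1 = 1" using rat_map_single[of 0 1] by (simp add: rfun_of_rat)
qed

lemma sqrtpi_power: "(sqrtpi :: 'k::comm_ring_1 sqrtpi_ext) ^ n = Poly_Mapping.single (of_nat n) 1"
  by (induction n) (simp_all add: sqrtpi_def mult_single)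

lemma scalar_const_unit:
  assumes "c \<noteq> (0 :: 'k::field)"
  shows "(scalar_const c :: 'n::comm_monoid_add \<Rightarrow>\<^sub>0 'k) dvd 1"
proof
  show "1 = scalar_const c * (scalar_const (inverse c) :: 'n \<Rightarrow>\<^sub>0 'k)"
    using assms by (simp add: mult_single)
qed

lemma scalar_const_power: "(scalar_const c :: 'n::comm_monoid_add \<Rightarrow>\<^sub>0 'k::comm_ring_1) ^ n = scalar_const (c ^ n)"
  by (induction n) (simp_all add: mult_single)

subsection \<open>Substitutions for the indeterminate\<close>

text \<open>The evaluation that occurs inside \<open>v_embed\<close>, with the point made a
  parameter so that the inverse substitution is covered as well.\<close>

definition eval_at :: "rfun sqrtpi_ext \<Rightarrow> rat poly \<Rightarrow> rfun sqrtpi_ext" where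
  "eval_at e a = poly (map_poly (\<lambda>c. scalar_const (rfun_of_rat c)) a) e"

lemma eval_at_pCons: "eval_at e (pCons c a) = scalar_const (rfun_of_rat c) + e * eval_at e a"
  by (simp add: eval_at_def map_poly_pCons rfun_of_rat)

lemma eval_at_zero: "eval_at e 0 = 0"
  by (simp add: eval_at_def)

lemma eval_at_one: "eval_at e 1 = 1"
  by (simp add: one_pCons eval_at_pCons eval_at_zero rfun_of_rat)

lemma eval_at_add: "eval_at e (a + b) = eval_at e a + eval_at e b"
proof (induction a arbitrary: b)
  case (pCons c a)
  obtain d b' where b: "b = pCons d b'" by (rule pCons_cases)
  show ?case unfolding b add_pCons eval_at_pCons pCons.IH rfun_of_rat single_add by (simp add: algebra_simps)
qed (simp add: eval_at_zero)

lemma eval_at_smult: "eval_at e (Polynomial.smult c a) = scalar_const (rfun_of_rat c) * eval_at e a"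
  by (induction a) (simp_all add: eval_at_zero eval_at_pCons rfun_of_rat mult_single[symmetric] algebra_simps
    flip: mult_single[of 0 _ 0, simplified])

lemma eval_at_mult: "eval_at e (a * b) = eval_at e a * eval_at e b"
  by (induction a) (simp_all add: eval_at_zero eval_at_pCons eval_at_add eval_at_smult rfun_of_rat algebra_simps)

lemma eval_at_pcompose: "eval_at e (pcompose a b) = eval_at (eval_at e b) a"
  by (induction a) (simp_all add: eval_at_zero eval_at_pCons pcompose_pCons eval_at_add eval_at_mult)

lemma eval_at_xvar: "eval_at (scalar_const xvar) a = scalar_const (Fraction_Field.Fract a 1)"
proof (induction a)
  case (pCons c a)
  have "Fraction_Field.Fract (pCons c a) 1 = rfun_of_rat c + xvar * Fraction_Field.Fract a 1"
    by (simp add: rfun_of_rat_def xvar_def)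
  then show ?case by (simp add: eval_at_pCons pCons.IH mult_single single_add)
qed (simp add: eval_at_zero flip: Zero_fract_def)

text \<open>The even and the odd part; multiplication by X exchanges their roles, which is the
  induction step.\<close>

lemma poly_parity_decomposition:
  "\<exists>s u :: rat poly. a = pcompose s [:0, 0, 1:] + [:0, 1:] * pcompose u [:0, 0, 1:]"
proof (induction a)
  case 0
  show ?case by (intro exI[of _ 0]) simp
next
  case (pCons c a)
  then obtain s u where a: "a = pcompose s [:0, 0, 1:] + [:0, 1:] * pcompose u [:0, 0, 1:]" by blast
  have "pCons c a = pcompose (pCons c u) [:0, 0, 1:] + [:0, 1:] * pcompose s [:0, 0, 1:]"
    by (simp add: a pcompose_pCons)
  then show ?case by blast
qed

text \<open>The product of a(X) and a(-X) is even, hence a polynomial in X^2, and it is nonzero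
  because there are no zero divisors.\<close>

lemma poly_square_multiple:
  assumes "a \<noteq> (0 :: rat poly)"
  shows "\<exists>b g. g \<noteq> 0 \<and> a * b = pcompose g [:0, 0, 1:]"
proof -
  obtain s u where a: "a = pcompose s [:0, 0, 1:] + [:0, 1:] * pcompose u [:0, 0, 1:]"
    using poly_parity_decomposition[of a] by blast
  let ?b = "pcompose a [:0, -1:]"
  have sq: "pcompose (pcompose y [:0, 0, 1:]) [:0, -1:] = pcompose y [:0, 0, 1::rat:]" for y
    by (simp add: pcompose_assoc[symmetric] pcompose_pCons)
  have b: "?b = pcompose s [:0, 0, 1:] - [:0, 1:] * pcompose u [:0, 0, 1:]"
    by (subst a) (simp add: pcompose_add pcompose_mult sq pcompose_pCons)
  have "a * ?b = (pcompose s [:0, 0, 1:]) ^ 2 - [:0, 0, 1:] * (pcompose u [:0, 0, 1:]) ^ 2"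
    unfolding b by (subst a) (simp add: power2_eq_square algebra_simps)
  also have "\<dots> = pcompose (s ^ 2 - [:0, 1:] * u ^ 2) [:0, 0, 1:]"
    by (simp add: pcompose_diff pcompose_mult power2_eq_square pcompose_pCons)
  finally have eq: "a * ?b = pcompose (s ^ 2 - [:0, 1:] * u ^ 2) [:0, 0, 1:]" .
  have "?b \<noteq> 0" using assms by (simp add: pcompose_eq_0_iff)
  then have "s ^ 2 - [:0, 1:] * u ^ 2 \<noteq> 0" using assms eq by (metis no_zero_divisors pcompose_0)
  then show ?thesis using eq by blast
qed

text \<open>A nonzero polynomial divides a nonzero polynomial in \<open>X\<^sup>4\<close>, whose value is a nonzero scalar.\<close>

lemma eval_at_unit:
  assumes e: "e ^ 4 = scalar_const (xvar ^ 4)" and "a \<noteq> 0"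
  shows "eval_at e a dvd 1"
proof -
  obtain b g where g: "g \<noteq> 0" "a * b = pcompose g [:0, 0, 1:]" using poly_square_multiple[OF \<open>a \<noteq> 0\<close>] by blast
  obtain b' h where h: "h \<noteq> 0" "g * b' = pcompose h [:0, 0, 1:]" using poly_square_multiple[OF g(1)] by blast
  have sq: "eval_at e [:0, 0, 1:] = e ^ 2" for e
    by (simp add: eval_at_pCons eval_at_zero rfun_of_rat power2_eq_square)
  have "eval_at e a * (eval_at e b * eval_at (e ^ 2) b') = eval_at (e ^ 2) (g * b')"
    by (simp add: eval_at_mult[symmetric] mult.assoc[symmetric] g(2) eval_at_pcompose sq)
  also have "\<dots> = eval_at (e ^ 4) h"
    by (simp add: h(2) eval_at_pcompose sq flip: power_mult)
  also have "e ^ 4 = (scalar_const xvar :: rfun sqrtpi_ext) ^ 4"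
    unfolding e by (simp add: scalar_const_power)
  also have "eval_at ((scalar_const xvar) ^ 4) h = eval_at (scalar_const xvar) (pcompose (pcompose h [:0, 0, 1:]) [:0, 0, 1:])"
    by (simp add: eval_at_pcompose sq flip: power_mult)
  also have "\<dots> = scalar_const (Fraction_Field.Fract (pcompose (pcompose h [:0, 0, 1:]) [:0, 0, 1:]) 1)"
    by (rule eval_at_xvar)
  also have "\<dots> dvd 1"
    using h(1) by (intro scalar_const_unit) (simp add: Zero_fract_def eq_fract pcompose_eq_0_iff)
  finally show ?thesis by (rule dvd_mult_left)
qed

text \<open>Substitution into a rational function. It behaves well only if denominators become
  units, which \<open>eval_at_unit\<close> guarantees when \<open>e ^ 4\<close> is the fourth power
  of q.\<close>

definition subst_at :: "rfun sqrtpi_ext \<Rightarrow> rfun \<Rightarrow> rfun sqrtpi_ext" where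
  "subst_at e f = eval_at e (fst (quot_of_fract f)) * uinv (eval_at e (snd (quot_of_fract f)))"

lemma v_embed_subst_at: "v_embed = subst_at v_elt"
  by (rule ext) (simp add: v_embed_def subst_at_def eval_at_def Let_def)

text \<open>The extension of the substitution that fixes \<surd>\<pi>; \<open>v_ident\<close> is the
  case \<open>e = v_elt\<close>.\<close>

definition subst_ext :: "rfun sqrtpi_ext \<Rightarrow> rfun sqrtpi_ext \<Rightarrow> rfun sqrtpi_ext" where
  "subst_ext e x = (\<Sum>k\<in>UNIV. subst_at e (Poly_Mapping.lookup x k) * Poly_Mapping.single k 1)"

lemma v_ident_subst_ext: "v_ident = subst_ext v_elt"
  by (rule ext) (simp add: v_ident_def subst_ext_def v_embed_subst_at)

context
  fixes e :: "rfun sqrtpi_ext"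
  assumes e: "e ^ 4 = scalar_const (xvar ^ 4)"
begin

text \<open>The definition reads off one particular fraction. Cross-multiplication, together with
  the invertibility of both denominators, frees the formula from that choice.\<close>

lemma subst_at_Fract:
  assumes "b \<noteq> 0"
  shows "subst_at e (Fraction_Field.Fract a b) = eval_at e a * uinv (eval_at e b)"
proof -
  let ?f = "Fraction_Field.Fract a b"
  let ?n = "fst (quot_of_fract ?f)" and ?d = "snd (quot_of_fract ?f)"
  have d: "?d \<noteq> 0" by (rule snd_quot_of_fract_nonzero)
  have "Fraction_Field.Fract ?n ?d = ?f" by (rule Fract_quot_of_fract)
  then have "?n * b = a * ?d" by (simp only: eq_fract(1)[OF d assms])
  then have eq: "eval_at e ?n * eval_at e b = eval_at e a * eval_at e ?d" by (simp flip: eval_at_mult)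
  note ud = eval_at_unit[OF e d] and ub = eval_at_unit[OF e assms]
  have "eval_at e ?n * uinv (eval_at e ?d) =
      (eval_at e ?n * eval_at e b) * uinv (eval_at e b) * uinv (eval_at e ?d)"
    using uinv_right[OF ub] by (simp add: mult.assoc)
  also have "\<dots> = eval_at e a * uinv (eval_at e b) * (eval_at e ?d * uinv (eval_at e ?d))"
    unfolding eq by (simp only: ac_simps)
  finally show ?thesis using uinv_right[OF ud] by (simp add: subst_at_def)
qed

lemma subst_at_mult: "subst_at e (f * g) = subst_at e f * subst_at e g"
proof -
  obtain a b c d where f: "f = Fraction_Field.Fract a b" "b \<noteq> 0" and g: "g = Fraction_Field.Fract c d" "d \<noteq> 0"
    by (metis Fract_cases)
  have bd: "b * d \<noteq> 0" using f g by simp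
  show ?thesis
    unfolding f(1) g(1) mult_fract subst_at_Fract[OF f(2)] subst_at_Fract[OF g(2)] subst_at_Fract[OF bd] eval_at_mult
      uinv_mult[OF eval_at_unit[OF e f(2)] eval_at_unit[OF e g(2)]]
    by (simp only: ac_simps)
qed

lemma subst_at_add: "subst_at e (f + g) = subst_at e f + subst_at e g"
proof -
  obtain a b c d where f: "f = Fraction_Field.Fract a b" "b \<noteq> 0" and g: "g = Fraction_Field.Fract c d" "d \<noteq> 0"
    by (metis Fract_cases)
  have bd: "b * d \<noteq> 0" using f g by simp
  note ub = eval_at_unit[OF e f(2)] and ud = eval_at_unit[OF e g(2)]
  have "subst_at e (f + g) = (eval_at e a * eval_at e d + eval_at e c * eval_at e b) * (uinv (eval_at e b) * uinv (eval_at e d))"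
    unfolding f(1) g(1) add_fract[OF f(2) g(2)] subst_at_Fract[OF bd] eval_at_mult eval_at_add uinv_mult[OF ub ud] ..
  also have "\<dots> = eval_at e a * uinv (eval_at e b) * (eval_at e d * uinv (eval_at e d)) +
      eval_at e c * uinv (eval_at e d) * (eval_at e b * uinv (eval_at e b))"
    by (simp only: ac_simps distrib_left distrib_right)
  finally show ?thesis
    unfolding f(1) g(1) subst_at_Fract[OF f(2)] subst_at_Fract[OF g(2)] by (simp add: uinv_right ub ud)
qed

lemma subst_at_rat: "subst_at e (rfun_of_rat c) = scalar_const (rfun_of_rat c)"
  by (subst rfun_of_rat_def) (simp add: subst_at_Fract eval_at_pCons eval_at_zero eval_at_one)

lemma subst_at_zero: "subst_at e 0 = 0" and subst_at_one: "subst_at e 1 = 1"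
  using subst_at_rat[of 0] subst_at_rat[of 1] by (simp_all add: rfun_of_rat)

lemma subst_at_xvar: "subst_at e xvar = e"
  by (subst xvar_def) (simp add: subst_at_Fract eval_at_pCons eval_at_zero eval_at_one rfun_of_rat)

lemma subst_at_inverse: "f \<noteq> 0 \<Longrightarrow> subst_at e f dvd 1 \<and> subst_at e (inverse f) = uinv (subst_at e f)"
proof -
  assume f: "f \<noteq> 0"
  have "subst_at e f * subst_at e (inverse f) = 1" using f by (simp add: subst_at_one flip: subst_at_mult)
  then show ?thesis by (metis dvd_triv_left uinv_eqI)
qed

lemma subst_ext_single: "subst_ext e (Poly_Mapping.single k c) = subst_at e c * Poly_Mapping.single k 1"
proof -
  have "subst_ext e (Poly_Mapping.single k c) =
      (\<Sum>j\<in>UNIV. if j = k then subst_at e c * Poly_Mapping.single k 1 else 0)"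
    unfolding subst_ext_def by (intro sum.cong) (auto simp: lookup_single when_def subst_at_zero)
  then show ?thesis by simp
qed

lemma subst_ext_add: "subst_ext e (x + y) = subst_ext e x + subst_ext e y"
  by (simp add: subst_ext_def lookup_add subst_at_add distrib_right sum.distrib)

lemma subst_ext_mult: "subst_ext e (x * y) = subst_ext e x * subst_ext e y"
proof (rule additive_mult_hom)
  fix k l :: 4 and a b
  have "Poly_Mapping.single (k + l) 1 = Poly_Mapping.single k (1::rfun) * Poly_Mapping.single l 1" by (simp add: mult_single)
  then show "subst_ext e (Poly_Mapping.single (k + l) (a * b)) =
      subst_ext e (Poly_Mapping.single k a) * subst_ext e (Poly_Mapping.single l b)"
    by (simp only: subst_ext_single subst_at_mult) (simp only: ac_simps)
qed (rule subst_ext_add)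

lemma subst_ext_rat_map: "subst_ext e (rat_map s) = rat_map s"
  by (induction s rule: poly_mapping_additive_induct)
    (simp_all add: rat_map_single rat_map_hom subst_ext_add subst_ext_single subst_at_rat mult_single)

end

text \<open>The composite is a ring homomorphism that fixes the rationals, \<surd>\<pi> and q, hence
  the identity. For a fraction, the value of its denominator is a unit and can be cancelled.\<close>

lemma subst_ext_inverse:
  assumes e: "e ^ 4 = scalar_const (xvar ^ 4)" and e': "e' ^ 4 = scalar_const (xvar ^ 4)"
    and inv: "subst_ext e e' = scalar_const xvar"
  shows "subst_ext e (subst_ext e' x) = x"
proof -
  have poly: "subst_ext e (subst_at e' (Fraction_Field.Fract a 1)) = scalar_const (Fraction_Field.Fract a 1)" for a
  proof (induction a)
    case 0
    then show ?case using subst_ext_rat_map[OF e, of 0] rat_map_single[of 0 0]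
      by (simp add: Zero_fract_def[symmetric] subst_at_zero[OF e'] rfun_of_rat)
  next
    case (pCons c a)
    have "Fraction_Field.Fract (pCons c a) 1 = rfun_of_rat c + xvar * Fraction_Field.Fract a 1"
      by (simp add: rfun_of_rat_def xvar_def)
    then show ?case
      using subst_ext_rat_map[OF e, of "scalar_const c"]
      by (simp add: subst_at_add[OF e'] subst_at_mult[OF e'] subst_at_rat[OF e'] subst_at_xvar[OF e']
        subst_ext_add[OF e] subst_ext_mult[OF e] inv pCons.IH rat_map_single mult_single single_add)
  qed
  have frac: "subst_ext e (subst_at e' f) = scalar_const f" for f
  proof -
    obtain a b where f: "f = Fraction_Field.Fract a b" "b \<noteq> 0" by (metis Fract_cases)
    let ?b = "Fraction_Field.Fract b 1" and ?a = "Fraction_Field.Fract a 1"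
    have fb: "f * ?b = ?a" using f by (simp add: eq_fract)
    have "subst_ext e (subst_at e' f) * scalar_const ?b = subst_ext e (subst_at e' (f * ?b))"
      by (simp add: subst_at_mult[OF e'] subst_ext_mult[OF e] poly)
    also have "\<dots> = scalar_const f * scalar_const ?b"
      unfolding fb poly by (simp only: mult_single fb) simp
    finally have "scalar_const ?b * subst_ext e (subst_at e' f) = scalar_const ?b * scalar_const f"
      by (simp only: mult.commute)
    moreover have "(scalar_const ?b :: rfun sqrtpi_ext) dvd 1"
      using f(2) by (intro scalar_const_unit) (simp add: Zero_fract_def eq_fract)
    ultimately show ?thesis by (rule unit_cancel_left[rotated])
  qed
  have one: "subst_ext e (Poly_Mapping.single k 1) = Poly_Mapping.single k 1" for k
    by (simp add: subst_ext_single[OF e] subst_at_one[OF e])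
  show ?thesis
    by (induction x rule: poly_mapping_additive_induct)
      (simp_all add: subst_ext_single[OF e'] subst_ext_mult[OF e] frac one mult_single subst_ext_add[OF e] subst_ext_add[OF e'])
qed

text \<open>The inverse of \<open>q \<mapsto> q \<surd>\<pi>\<close> is \<open>q \<mapsto> q \<surd>\<pi>\<^sup>-\<^sup>1 = q \<surd>\<pi>\<^sup>3\<close>.\<close>

definition w_elt :: "rfun sqrtpi_ext" where
  "w_elt = scalar_const xvar * sqrtpi ^ 3"

lemma v_elt_pow4: "v_elt ^ 4 = scalar_const (xvar ^ 4)"
  by (simp add: v_elt_def power_mult_distrib sqrtpi_pow4 scalar_const_power)

lemma w_elt_pow4: "w_elt ^ 4 = scalar_const (xvar ^ 4)"
proof -
  have "(sqrtpi :: rfun sqrtpi_ext) ^ 12 = 1" using power_mult[of "sqrtpi :: rfun sqrtpi_ext" 4 3] by (simp add: sqrtpi_pow4)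
  then show ?thesis by (simp add: w_elt_def power_mult_distrib scalar_const_power flip: power_mult)
qed

lemma v_w_inverse: "subst_ext v_elt (subst_ext w_elt x) = x" "subst_ext w_elt (subst_ext v_elt x) = x"
proof -
  have s: "sqrtpi * sqrtpi ^ 3 = (1 :: rfun sqrtpi_ext)" "sqrtpi ^ 3 * sqrtpi = (1 :: rfun sqrtpi_ext)"
    using sqrtpi_pow4 by (simp_all flip: power_Suc power_Suc2)
  have p: "subst_ext e (sqrtpi ^ n) = sqrtpi ^ n" if "e ^ 4 = scalar_const (xvar ^ 4)" for e n
    by (simp add: sqrtpi_power subst_ext_single[OF that] subst_at_one[OF that])
  have "subst_ext v_elt w_elt = scalar_const xvar"
    using p[OF v_elt_pow4, of 3] s
    by (simp add: w_elt_def subst_ext_mult[OF v_elt_pow4] subst_ext_single[OF v_elt_pow4] subst_at_xvar[OF v_elt_pow4])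
      (simp add: v_elt_def mult.assoc)
  then show "subst_ext v_elt (subst_ext w_elt x) = x" by (rule subst_ext_inverse[OF v_elt_pow4 w_elt_pow4])
  have "subst_ext w_elt v_elt = scalar_const xvar"
    using p[OF w_elt_pow4, of 1] s
    by (simp add: v_elt_def subst_ext_mult[OF w_elt_pow4] subst_ext_single[OF w_elt_pow4] subst_at_xvar[OF w_elt_pow4])
      (simp add: w_elt_def mult.assoc)
  then show "subst_ext w_elt (subst_ext v_elt x) = x" by (rule subst_ext_inverse[OF w_elt_pow4 v_elt_pow4])
qed

text \<open>The scalars of the extended algebra are defined with an abstract inverse; the explicit
  formula is what makes its coordinates visibly additive.\<close>

lemma the_inv_v_ident: "the_inv v_ident = subst_ext w_elt"
proof
  fix x
  have "inj v_ident" unfolding v_ident_subst_ext by (metis injI v_w_inverse(2))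
  then have "the_inv v_ident (v_ident (subst_ext w_elt x)) = subst_ext w_elt x" by (rule the_inv_f_f)
  then show "the_inv v_ident x = subst_ext w_elt x" by (simp add: v_ident_subst_ext v_w_inverse)
qed

section \<open>The three algebras\<close>

lemma (in quantum_presentation) operator_algebra_B:
  "operator_algebra TYPE('b) TYPE('v) C B \<kappa> t H se sf"
proof (rule operator_algebra.intro)
  show "ring B" by (rule ring_B)
  show "scl B c \<in> carrier B" "eel B i \<in> carrier B" "fel B i \<in> carrier B" for c i
    by (simp_all add: B_gens cl_closed)
next
  fix V :: "(('i gen list \<Rightarrow>\<^sub>0 'k) set, 'v, 'p) wt_module" assume "weight_module C B \<kappa> V"
  then interpret presented_module C \<kappa>K \<kappa>K' t h se sf \<kappa> H hc u w V by unfold_locales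
  show "quantum_rep V (wtsp V) (\<lambda>c x. scl B c \<odot>\<^bsub>V\<^esub> x) C t H se sf (\<lambda>i x. eel B i \<odot>\<^bsub>V\<^esub> x) (\<lambda>i x. fel B i \<odot>\<^bsub>V\<^esub> x)"
    by (rule quantum_rep_act)
next
  fix U :: "('b, 'v, 'p) wt_module" and W \<rho> E F assume "quantum_rep U W \<rho> C t H se sf E F"
  then interpret presentation_rep C \<kappa>K \<kappa>K' t h se sf \<kappa> H hc u w U W \<rho> E F
    by (intro presentation_rep.intro quantum_presentation_axioms)
  show "\<exists>\<Phi> \<in> ring_hom B (end_ring U).
        (\<forall>c. \<forall>x\<in>carrier U. \<Phi> (scl B c) x = \<rho> c x) \<and>
        (\<forall>i. \<forall>x\<in>carrier U. \<Phi> (eel B i) x = E i x) \<and>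
        (\<forall>i. \<forall>x\<in>carrier U. \<Phi> (fel B i) x = F i x) \<and>
        (\<forall>i \<mu>. \<forall>x\<in>W \<mu>. \<Phi> (Kel B i) x = \<rho> (\<kappa> i (crt C i \<mu>)) x) \<and>
        (\<forall>\<beta> \<mu>. \<forall>a\<in>hcomp B \<beta>. \<forall>x\<in>W \<mu>. \<Phi> a x \<in> W (\<mu> + \<beta>))"
    using presented_hom_ex by (elim bexE conjE) (rule bexI, intro conjI, assumption+)
qed (rule presented_hom_commutes; assumption)

lemma (in scalar_extension) operator_algebra_E:
  "operator_algebra TYPE('b) TYPE('v) C E (\<lambda>i n. \<iota> (\<kappa> i n)) (\<lambda>i j. \<iota> (t i j)) (\<lambda>i n. \<iota> (H i n))
    (\<lambda>i j k. \<iota> (se i j k)) (\<lambda>i j k. \<iota> (sf i j k))"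
proof (rule operator_algebra.intro)
  show "ring E" by (rule ring_E)
  show "scl E c \<in> carrier E" "eel E i \<in> carrier E" "fel E i \<in> carrier E" for c i
    by (simp_all add: scl_E_closed E_gens(1,2) tens_closed gens_B_closed)
qed (rule quantum_rep_extended extended_hom_ex, assumption, rule refl | rule extended_hom_ex, assumption |
  rule extended_hom_commutes, assumption, assumption, rule refl, assumption+)+

text \<open>\<open>uinv\<close> is a description that names an inverse at units only, so a
  homomorphism can be moved through it, and through \<open>zpow\<close>, at units.\<close>

lemma hom_units:
  fixes f :: "'k::comm_ring_1 \<Rightarrow> 'e::comm_ring_1"
  assumes "\<And>x y. f (x * y) = f x * f y" "f 1 = 1" "x dvd 1"
  shows "f x dvd 1" "f (uinv x) = uinv (f x)" "f (x ^ n) = f x ^ n" "f (zpow x m) = zpow (f x) m"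
proof -
  have e: "f x * f (uinv x) = 1" using assms uinv_right[OF assms(3)] by (metis assms(1))
  then show "f x dvd 1" by (metis dvd_triv_left)
  show u: "f (uinv x) = uinv (f x)" using uinv_eqI[OF e] by simp
  show p: "f (y ^ n) = f y ^ n" for y n by (induction n) (simp_all add: assms)
  show "f (zpow x m) = zpow (f x) m" by (simp add: zpow_def p u)
qed

lemma hom_prod:
  assumes "\<And>x y. f (x * y) = f x * f y" "f 1 = (1 :: 'e::comm_ring_1)"
  shows "f (prod g S) = (\<Prod>k\<in>S. f (g k :: 'k::comm_ring_1))"
  by (induction S rule: infinite_finite_induct) (simp_all add: assms)

subsection \<open>Units\<close>

lemma xvar_power: "xvar ^ n = Fraction_Field.Fract ([:0, 1:] ^ n) 1"
  by (induction n) (simp_all add: xvar_def One_fract_def)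

lemma xvar_nonzero: "xvar \<noteq> 0"
  by (simp add: xvar_def Zero_fract_def eq_fract)

lemma xvar_power_neq_one: "n > 0 \<Longrightarrow> xvar ^ n \<noteq> 1"
proof
  assume n: "n > 0" and "xvar ^ n = 1"
  then have "[:0, 1 :: rat:] ^ n = 1" by (simp add: xvar_power One_fract_def eq_fract)
  then have "degree ([:0, 1 :: rat:] ^ n) = 0" by simp
  then show False using n by (simp add: degree_power_eq)
qed

text \<open>Since \<open>(1 - y ^ k) (1 + y ^ k) = 1 - y ^ (2 k)\<close> is a nonzero element of \<open>\<rat>(q)\<close>.\<close>

lemma one_minus_unit:
  fixes y :: "'n::comm_monoid_add \<Rightarrow>\<^sub>0 rfun"
  assumes y: "y ^ 2 = scalar_const (xvar ^ (4 * d))" and d: "d > 0" "k > 0"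
  shows "1 - y ^ k dvd 1"
proof -
  have "(y ^ 2) ^ k = scalar_const (xvar ^ (4 * d * k))"
    unfolding y by (simp add: scalar_const_power power_mult)
  then have y2: "y ^ k * y ^ k = scalar_const (xvar ^ (4 * d * k))" by (simp flip: power_mult power_add add: mult_2)
  have "(1 - y ^ k) * (1 + y ^ k) = 1 - y ^ k * y ^ k" by (simp add: algebra_simps)
  also have "\<dots> = scalar_const (1 - xvar ^ (4 * d * k))" unfolding y2 by (simp add: single_diff)
  also have "\<dots> dvd 1" using xvar_power_neq_one[of "4 * d * k"] d by (intro scalar_const_unit) auto
  finally show ?thesis by (rule dvd_mult_left)
qed

lemma unit_of_pow4:
  fixes z :: "'n::comm_monoid_add \<Rightarrow>\<^sub>0 rfun"
  assumes z: "z ^ 4 = scalar_const (xvar ^ n)"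
  shows "z dvd 1"
proof -
  have "z ^ 4 dvd 1" unfolding z by (rule scalar_const_unit) (simp add: xvar_nonzero)
  then show ?thesis by (metis dvd_trans dvd_power zero_less_numeral)
qed

text \<open>Pulling out a power of the inverse of z leaves 1 - z^(2k), so that
  \<open>one_minus_unit\<close> makes the numerators and denominators of quantum integers
  invertible.\<close>

lemma power_diff_unit:
  fixes z :: "'n::comm_monoid_add \<Rightarrow>\<^sub>0 rfun"
  assumes z: "z ^ 4 = scalar_const (xvar ^ (4 * d))" and d: "d > 0" "k > 0"
  shows "z ^ k - zpow z (- int k) dvd 1"
proof -
  note u = unit_of_pow4[OF z]
  have y: "(z ^ 2) ^ 2 = scalar_const (xvar ^ (4 * d))" using z by (simp flip: power_mult)
  have "- (uinv z ^ k) * (1 - (z ^ 2) ^ k) = (uinv z * z) ^ k * z ^ k - uinv z ^ k"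
    unfolding power2_eq_square power_mult_distrib by (simp add: algebra_simps)
  then have eq: "z ^ k - zpow z (- int k) = - (uinv z ^ k) * (1 - (z ^ 2) ^ k)" by (simp add: uinv_left[OF u])
  show ?thesis unfolding eq
    by (intro unit_mult one_minus_unit[OF y d]) (simp add: unit_power uinv_unit u)
qed

subsection \<open>Comparison of quantum factorials\<close>

text \<open>The number n(n - 1)/2, written as the sum in which exponents accumulate in a quantum
  factorial.\<close>

definition triangle :: "nat \<Rightarrow> nat" where
  "triangle n = (\<Sum>l<n. l)"

lemma triangle_add: "triangle (k + l) = triangle k + triangle l + k * l"
  by (induction l) (simp_all add: triangle_def)

lemma triangle_double: "2 * triangle k = k * (k - 1)"
proof (induction k)
  case (Suc k) then show ?case by (cases k) (simp_all add: triangle_def algebra_simps)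
qed (simp add: triangle_def)

text \<open>The k-th quantum integers built from \<open>a\<close> and from \<open>b\<close> differ
  by \<open>e\<close> to the power k - 1, and these exponents add up to a triangular number.\<close>

lemma quantum_factorial_compare:
  fixes a b :: "nat \<Rightarrow> 'k::comm_ring_1"
  assumes a: "\<And>k. k > 0 \<Longrightarrow> a k = e ^ k * b k" and "e dvd 1" "b 1 dvd 1"
  shows "(\<Prod>k=1..n. a k * uinv (a 1)) = e ^ triangle n * (\<Prod>k=1..n. b k * uinv (b 1))"
proof (induction n)
  case (Suc n)
  have "a (Suc n) * uinv (a 1) = e ^ n * b (Suc n) * (e * uinv e) * uinv (b 1)"
    using assms(2,3) by (simp add: a uinv_mult ac_simps)
  then have "a (Suc n) * uinv (a 1) = e ^ n * (b (Suc n) * uinv (b 1))"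
    by (simp add: uinv_right[OF assms(2)] mult.assoc)
  then show ?case using Suc by (simp add: triangle_def power_add ac_simps)
qed (simp add: triangle_def)

subsection \<open>The algebra with \<open>\<surd>\<pi>\<close>\<close>

locale sqrt_superdatum = cartan_superdatum C for C :: "('i, 'p::ab_group_add) superdatum" +
  fixes r :: "'i \<Rightarrow> int sqrtpi_ext"
  assumes r_square: "r i ^ 2 = pi4 ^ par C i"
begin

abbreviation "q i \<equiv> scalar_const (q_sub C i) :: rfun sqrtpi_ext"
abbreviation "s i \<equiv> sqrt_sub r i"
abbreviation "p i \<equiv> p_sub C r i"
abbreviation "pis i \<equiv> pi4 ^ par C i :: rfun sqrtpi_ext"
abbreviation "\<rho> i j \<equiv> zpow (s i) (cm C i j)"

lemma pi4_square: "pi4 ^ 2 = (1 :: 'k::comm_ring_1 sqrtpi_ext)"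
  by (rule trans[OF _ sqrtpi_pow4]) (simp flip: power_mult)

lemma pi4_unit: "pi4 dvd (1 :: 'k::comm_ring_1 sqrtpi_ext)"
  by (rule dvdI[of _ _ pi4]) (simp only: pi4_square flip: power2_eq_square)

lemma q_unit: "q i dvd 1"
  by (rule scalar_const_unit) (simp add: q_sub_def xvar_nonzero)

lemma s_square: "s i ^ 2 = pis i"
proof -
  have m: "Poly_Mapping.map of_int (x * y) = (Poly_Mapping.map of_int x * Poly_Mapping.map of_int y :: rfun sqrtpi_ext)"
    for x y :: "int sqrtpi_ext"
    by (rule map_hom_mult) simp_all
  have "s i ^ 2 = Poly_Mapping.map of_int (r i ^ 2)" by (simp add: sqrt_sub_def power2_eq_square m)
  also have "r i ^ 2 = sqrtpi ^ (2 * par C i)" by (simp add: r_square power_mult)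
  also have "Poly_Mapping.map of_int (sqrtpi ^ (2 * par C i)) = (sqrtpi ^ (2 * par C i) :: rfun sqrtpi_ext)"
    by (simp only: sqrtpi_power map_single_zero of_int_0 of_int_1)
  finally show ?thesis by (simp add: power_mult)
qed

lemma pis_square: "pis i ^ 2 = 1"
  by (simp add: power_mult[symmetric] mult.commute[of _ 2]) (simp add: power_mult sqrtpi_pow4)

lemma pis_unit: "pis i dvd 1"
  by (rule unit_power[OF pi4_unit])

lemma s_pow4: "s i ^ 4 = 1"
  using power_mult[of "s i" 2 2] by (simp add: s_square pis_square)

lemma s_unit: "s i dvd 1"
  by (rule dvdI[of _ _ "s i ^ 3"]) (simp add: s_pow4 flip: power_Suc)

lemma p_unit: "p i dvd 1"
  unfolding p_sub_def by (rule unit_mult[OF q_unit s_unit])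

lemma p_pow4: "p i ^ 4 = scalar_const (xvar ^ (4 * dd C i))"
  by (simp add: p_sub_def power_mult_distrib s_pow4 scalar_const_power q_sub_def mult.commute flip: power_mult)

lemma p_square: "p i ^ 2 = q i ^ 2 * pis i"
  by (simp add: p_sub_def power_mult_distrib s_square)

text \<open>\<open>pis i\<close> differs from 1 only for odd i, and there the row i of the Cartan
  matrix is even.\<close>

lemma zpow_pis: "zpow (pis i) (cm C i j) = 1"
proof (cases "i \<in> odds C")
  case True
  then obtain b where "cm C i j = 2 * b" using odd_even by blast
  moreover have "zpow (pis i) 2 = 1" using zpow_of_nat[of "pis i" 2] pis_square[of i] by simp
  ultimately show ?thesis by (simp only: zpow_mult[OF pis_unit] zpow_one_left)
qed (simp add: par_def)

text \<open>The square is a power of \<open>pis i\<close> with exponent \<open>cm C i j\<close>,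
  hence 1. So the chosen square roots enter the relations through involutions, which can change
  sides of an equation freely.\<close>

lemma \<rho>_square: "\<rho> i j * \<rho> i j = 1"
proof -
  have "\<rho> i j * \<rho> i j = zpow (s i * s i) (cm C i j)" by (simp add: zpow_mult_distrib s_unit)
  also have "s i * s i = pis i" using s_square[of i] by (simp add: power2_eq_square)
  finally show ?thesis by (simp add: zpow_pis)
qed

abbreviation "H_sqrt \<equiv> \<lambda>i n. uinv (p i - zpow (p i) (- 1)) * (zpow (p i) n - zpow (p i) (- n))"
abbreviation "se_sqrt \<equiv> \<lambda>i j k. (- theta C r i j) ^ k *
        uinv (p_fact C r i (serre_len C i j - k)) * uinv (p_fact C r i k)"
abbreviation "sf_sqrt \<equiv> \<lambda>i j k. (- theta C r j i) ^ k *
        uinv (p_fact C r i (serre_len C i j - k)) * uinv (p_fact C r i k)"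

lemma operator_algebra_sqrt:
  "operator_algebra TYPE('b) TYPE('v) C (U_sqrt C r) (eig_sqrt C r) (\<lambda>i j. theta C r j i) H_sqrt se_sqrt sf_sqrt"
proof -
  interpret quantum_presentation C "\<lambda>i j. zpow (p i) (cm C i j)" "\<lambda>i j. zpow (p i) (- cm C i j)"
    "\<lambda>i j. theta C r j i" "\<lambda>i. let c = uinv (p i - zpow (p i) (- 1)) in mon c [gK i] - mon c [gKinv i]"
    se_sqrt sf_sqrt "eig_sqrt C r" H_sqrt "\<lambda>i. uinv (p i - zpow (p i) (- 1))" "\<lambda>i. [gK i]" "\<lambda>i. [gKinv i]"
    by unfold_locales (simp_all add: eig_sqrt_def K_value_def zpow_add p_unit Let_def)
  have "B = U_sqrt C r" unfolding B_def rels_def U_sqrt_def by (rule refl)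
  then show ?thesis using operator_algebra_B by simp
qed

subsection \<open>The algebra with \<open>\<pi>\<close>\<close>

lemma pi_ext_cases: "k = 0 \<or> k = (1 :: 2)"
proof -
  have "card {0, 1 :: 2} = card (UNIV :: 2 set)" by simp
  then have "{0, 1 :: 2} = UNIV" by (intro card_subset_eq) simp_all
  then show ?thesis by blast
qed

lemma pi_incl_single: "pi_incl (Poly_Mapping.single 0 a) = scalar_const a"
    "pi_incl (Poly_Mapping.single 1 a) = scalar_const a * pi4"
  by (simp_all add: pi_incl_def lookup_single)

lemma pi_incl_add: "pi_incl (x + y) = pi_incl x + pi_incl y"
  by (simp add: pi_incl_def lookup_add single_add algebra_simps)

lemma pi_incl_mult: "pi_incl (x * y) = pi_incl x * pi_incl y"
proof (rule additive_mult_hom)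
  fix k l :: 2 and a b :: 'a
  have two: "(1 :: 2) + 1 = 0" by simp
  have c: "scalar_const (a * b) = (scalar_const a * scalar_const b :: 'a sqrtpi_ext)" by (simp add: mult_single)
  have "scalar_const a * pi4 * (scalar_const b * pi4) = scalar_const a * scalar_const b * (pi4 ^ 2 :: 'a sqrtpi_ext)"
    unfolding power2_eq_square[of pi4] by (simp only: ac_simps)
  then have c': "scalar_const a * pi4 * (scalar_const b * pi4) = (scalar_const a * scalar_const b :: 'a sqrtpi_ext)"
    by (simp only: pi4_square mult_1_right)
  show "pi_incl (Poly_Mapping.single (k + l) (a * b)) =
      pi_incl (Poly_Mapping.single k a) * pi_incl (Poly_Mapping.single l b)"
    using pi_ext_cases[of k] pi_ext_cases[of l]
    by (elim disjE; hypsubst; simp only: pi_incl_single two add_0_left add_0_right c c'; simp only: ac_simps)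
qed (rule pi_incl_add)

lemma pi_incl_one: "pi_incl 1 = 1"
  using pi_incl_single(1)[of 1] by simp

lemma pi_incl_pi2: "pi_incl pi2 = pi4"
  using pi_incl_single(2)[of 1] by (simp add: pi2_def)

lemma pi_incl_map: "pi_incl (Poly_Mapping.map rfun_of_rat x) = rat_map (pi_incl x)"
proof (induction x rule: poly_mapping_additive_induct)
  case (single k a)
  have "(pi4 :: rat sqrtpi_ext) = Poly_Mapping.single 2 1" "(pi4 :: rfun sqrtpi_ext) = Poly_Mapping.single 2 1"
    by (simp_all add: sqrtpi_power)
  then show ?case using pi_ext_cases[of k]
    by (elim disjE) (simp_all add: map_single_zero rfun_of_rat pi_incl_single mult_single rat_map_single)
next
  case (add x y)
  then show ?case by (simp add: map_hom_add rfun_of_rat pi_incl_add rat_map_hom)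
qed

lemma sum_single_UNIV: "(\<Sum>k\<in>UNIV. Poly_Mapping.single k (Poly_Mapping.lookup x k)) = (x :: 'n::finite \<Rightarrow>\<^sub>0 'k::comm_monoid_add)"
  by (rule poly_mapping_eqI) (simp add: lookup_sum lookup_single when_def)

abbreviation "super_const i \<equiv> uinv (1 - q2 C i ^ 2 * pi2_sub C i)"
abbreviation "super_eig i n \<equiv> zpow (q2 C i ^ 2 * pi2_sub C i) n"
abbreviation "super_rel i j \<equiv> pi2 ^ (par C i * par C j) * zpow (q2 C i) (- cm C i j)"

lemma pi2_unit: "(pi2 :: rfun pi_ext) dvd 1"
  by (rule dvdI[of _ _ pi2]) (simp add: pi2_square flip: power2_eq_square)

lemma q2_unit: "q2 C i dvd 1" "pi2_sub C i dvd 1" "q2 C i ^ 2 * pi2_sub C i dvd 1"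
proof -
  show 1: "q2 C i dvd 1" by (rule scalar_const_unit) (simp add: q_sub_def xvar_nonzero)
  show 2: "pi2_sub C i dvd 1" unfolding pi2_sub_def by (rule unit_power[OF pi2_unit])
  show "q2 C i ^ 2 * pi2_sub C i dvd 1" by (rule unit_mult[OF unit_power[OF 1] 2])
qed

lemma pi_incl_q2: "pi_incl (q2 C i) = q i" "pi_incl (pi2_sub C i) = pis i"
  "pi_incl (q2 C i ^ 2 * pi2_sub C i) = p i ^ 2"
proof -
  note p = hom_units(3)[of pi_incl, OF pi_incl_mult pi_incl_one]
  show 1: "pi_incl (q2 C i) = q i" by (rule pi_incl_single)
  show 2: "pi_incl (pi2_sub C i) = pis i"
    unfolding pi2_sub_def by (subst p[OF pi2_unit]) (simp add: pi_incl_pi2)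
  show "pi_incl (q2 C i ^ 2 * pi2_sub C i) = p i ^ 2"
    unfolding pi_incl_mult 2 p[OF q2_unit(1)] 1 p_square ..
qed

end

context sqrt_superdatum
begin

lemma pi_incl_minus: "pi_incl (x - y) = pi_incl x - pi_incl y"
  using pi_incl_add[of "x - y" y] by simp

lemma pi_incl_uminus: "pi_incl (- x) = - pi_incl x"
  using pi_incl_minus[of 0 x] pi_incl_minus[of x x] by simp

text \<open>Bridges the two descriptions of K_i in the superalgebra: its eigenvalues are powers of
  q_i^2 \<pi>_i, whereas it conjugates the generators by powers of q_i alone.\<close>

lemma zpow_pi2_sub: "zpow (pi2_sub C i) (cm C i j) = 1"
proof (cases "i \<in> odds C")
  case True
  then obtain b where "cm C i j = 2 * b" using odd_even by blast
  moreover have "pi2_sub C i ^ 2 = 1" using True by (simp add: pi2_sub_def par_def pi2_square)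
  then have "zpow (pi2_sub C i) 2 = 1" using zpow_of_nat[of "pi2_sub C i" 2] by simp
  ultimately show ?thesis by (simp only: zpow_mult[OF q2_unit(2)] zpow_one_left)
qed (simp add: par_def pi2_sub_def)

lemma super_eig_cm: "super_eig i (cm C i j) = zpow (q2 C i) (2 * cm C i j)"
  "super_eig i (- cm C i j) = zpow (q2 C i) (- 2 * cm C i j)"
proof -
  have q: "zpow (q2 C i ^ 2) n = zpow (q2 C i) (2 * n)" for n
    using zpow_of_nat[of "q2 C i" 2] by (simp add: zpow_mult[OF q2_unit(1)])
  show 1: "super_eig i (cm C i j) = zpow (q2 C i) (2 * cm C i j)"
    by (simp add: zpow_mult_distrib unit_power q2_unit zpow_pi2_sub q)
  show "super_eig i (- cm C i j) = zpow (q2 C i) (- 2 * cm C i j)"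
    unfolding zpow_minus[OF q2_unit(3)] 1 zpow_minus[OF q2_unit(1), symmetric] by simp
qed

lemma operator_algebra_super:
  "operator_algebra TYPE('b) TYPE('v) C (U_super_ext C) (eig_super C) (\<lambda>i j. pi_incl (super_rel i j))
    (\<lambda>i n. pi_incl (super_const i * (1 - super_eig i n)))
    (\<lambda>i j k. pi_incl (super_serre C i j k)) (\<lambda>i j k. pi_incl (super_serre C i j k))"
proof -
  interpret quantum_presentation C "\<lambda>i j. zpow (q2 C i) (2 * cm C i j)" "\<lambda>i j. zpow (q2 C i) (- 2 * cm C i j)"
    "\<lambda>i j. super_rel i j" "\<lambda>i. let c = super_const i in mon c [] - mon c [gK i]"
    "super_serre C" "super_serre C" "\<lambda>i n. super_eig i n" "\<lambda>i n. super_const i * (1 - super_eig i n)"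
    "\<lambda>i. super_const i" "\<lambda>i. []" "\<lambda>i. [gK i]"
    by unfold_locales (simp_all only: super_eig_cm zpow_add[OF q2_unit(3)] zpow_zero Let_def, simp_all add: K_value_def)
  interpret pre_scalar_extension C "\<lambda>i j. zpow (q2 C i) (2 * cm C i j)" "\<lambda>i j. zpow (q2 C i) (- 2 * cm C i j)"
    "\<lambda>i j. super_rel i j" "\<lambda>i. let c = super_const i in mon c [] - mon c [gK i]"
    "super_serre C" "super_serre C" "\<lambda>i n. super_eig i n" "\<lambda>i n. super_const i * (1 - super_eig i n)"
    "\<lambda>i. super_const i" "\<lambda>i. []" "\<lambda>i. [gK i]" "pi_incl :: rat pi_ext \<Rightarrow> _" "Poly_Mapping.map rfun_of_rat"
    "\<lambda>x k. scalar_const (Poly_Mapping.lookup x k)" pi_incl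
  proof (rule pre_scalar_extension.intro[OF quantum_presentation_axioms], unfold_locales)
    show "(\<Sum>k\<in>UNIV. rat_map (Poly_Mapping.single k 1) * pi_incl (scalar_const (Poly_Mapping.lookup x k))) = x" for x
      by (simp add: rat_map_single rfun_of_rat pi_incl_single mult_single sum_single_UNIV)
  qed (simp_all add: pi_incl_add pi_incl_mult pi_incl_one pi_incl_map rat_map_hom lookup_add single_add)
  have U: "E = U_super_ext C" unfolding E_def U_super_ext_def B_def rels_def U_super_def by (rule refl)
  have scl_single: "scl E (Poly_Mapping.single j b) = tens (Poly_Mapping.single j 1) (scl B (scalar_const b))" for j b
    by (rule scl_E_single) (simp add: lookup_single when_def)
  have pi4: "(pi4 :: rfun sqrtpi_ext) = Poly_Mapping.single 2 1" by (simp add: sqrtpi_power)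
  have bal: "tens (Poly_Mapping.single j a) (scl B c) =
      tens (Poly_Mapping.single j 1) (scl B (scalar_const (rfun_of_rat a) * c))" for j a c
    using tens_scl_balanced[of "Poly_Mapping.single j 1" "scalar_const a" c]
    by (simp add: pi_incl_single mult_single map_single_zero rfun_of_rat)
  \<comment> \<open>Balancing over Q[\<pi>] trades (\<surd>\<pi>)^2 on the left for \<pi> on the
    right. The coordinates in \<open>scl\<close> never contain \<pi>, so a multiple of \<pi> in the
    second factor appears at the index j + 2.\<close>
  have bal2: "tens (Poly_Mapping.single (j + 2) 1) (scl B c) = tens (Poly_Mapping.single j 1) (scl B (pi2 * c))" for j c
    using tens_scl_balanced[of "Poly_Mapping.single j 1" pi2 c]
    by (simp add: pi_incl_single pi_incl_pi2 pi2_def sqrtpi_power mult_single map_single_zero rfun_of_rat)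
  interpret scalar_extension C "\<lambda>i j. zpow (q2 C i) (2 * cm C i j)" "\<lambda>i j. zpow (q2 C i) (- 2 * cm C i j)"
    "\<lambda>i j. super_rel i j" "\<lambda>i. let c = super_const i in mon c [] - mon c [gK i]"
    "super_serre C" "super_serre C" "\<lambda>i n. super_eig i n" "\<lambda>i n. super_const i * (1 - super_eig i n)"
    "\<lambda>i. super_const i" "\<lambda>i. []" "\<lambda>i. [gK i]" "pi_incl :: rat pi_ext \<Rightarrow> _" "Poly_Mapping.map rfun_of_rat"
    pi_incl "\<lambda>x k. scalar_const (Poly_Mapping.lookup x k)"
  proof (rule scalar_extension.intro[OF pre_scalar_extension_axioms], unfold_locales)
    fix s c
    show "scl E (rat_map s * pi_incl c) = tens s (scl B c)"
    proof (induction c rule: poly_mapping_additive_induct)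
      case (add c d)
      then show ?case
        unfolding pi_incl_add distrib_left scl_E_add scalar_homD(3)[OF scl_hom]
          tens_add_right[OF scl_B_closed scl_B_closed] by (rule arg_cong2)
    next
      case (single k b)
      show ?case
      proof (rule scl_E_reduce)
        fix j a
        consider "k = 0" | "k = 1" using pi_ext_cases[of k] by blast
        then show "scl E (rat_map (Poly_Mapping.single j a) * pi_incl (Poly_Mapping.single k b)) =
            tens (Poly_Mapping.single j a) (scl B (Poly_Mapping.single k b))"
        proof cases
          case 1
          have e: "rat_map (Poly_Mapping.single j a) * pi_incl (scalar_const b) = Poly_Mapping.single j (rfun_of_rat a * b)"
            by (simp add: rat_map_single pi_incl_single mult_single)
          have m: "scalar_const (rfun_of_rat a) * scalar_const b = (scalar_const (rfun_of_rat a * b) :: rfun pi_ext)"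
            by (simp add: mult_single)
          show ?thesis unfolding 1 e scl_single bal[of j a] m by (rule refl)
        next
          case 2
          have e: "rat_map (Poly_Mapping.single j a) * pi_incl (Poly_Mapping.single 1 b) =
              Poly_Mapping.single (j + 2) (rfun_of_rat a * b)"
            unfolding rat_map_single pi_incl_single pi4 mult_single by simp
          have m: "scalar_const (rfun_of_rat a) * Poly_Mapping.single 1 b = pi2 * (scalar_const (rfun_of_rat a * b) :: rfun pi_ext)"
            by (simp add: pi2_def mult_single)
          show ?thesis unfolding 2 e scl_single bal[of j a] bal2 m by (rule refl)
        qed
      qed
    qed
  qed
  have "(\<lambda>i n. pi_incl (super_eig i n)) = eig_super C"
    by (intro ext) (simp only: hom_units(4)[of pi_incl, OF pi_incl_mult pi_incl_one q2_unit(3)] pi_incl_q2(3)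
      eig_super_def p_square)
  then show ?thesis using operator_algebra_E unfolding U by simp
qed

subsection \<open>The algebra with parameter \<open>v\<close>\<close>

abbreviation "v i \<equiv> v_elt ^ dd C i"

lemma v_pow4: "v i ^ 4 = scalar_const (xvar ^ (4 * dd C i))"
proof -
  have "v i ^ 4 = (v_elt ^ 4) ^ dd C i" by (simp add: mult.commute flip: power_mult)
  then show ?thesis by (simp add: v_elt_pow4 scalar_const_power power_mult)
qed

lemma v_unit: "v i dvd 1"
  by (rule unit_of_pow4[OF v_pow4])

lemma v_elt_unit: "v_elt dvd 1"
  using unit_of_pow4[of v_elt 4] v_elt_pow4 by simp

lemma v_embed_hom: "v_embed (x + y) = v_embed x + v_embed y" "v_embed (x * y) = v_embed x * v_embed y" "v_embed 1 = 1"
  "v_embed xvar = v_elt" "v_embed (rfun_of_rat c) = scalar_const (rfun_of_rat c)"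
  by (simp_all add: v_embed_subst_at subst_at_add subst_at_mult subst_at_one subst_at_xvar subst_at_rat v_elt_pow4)

lemma v_embed_minus: "v_embed (x - y) = v_embed x - v_embed y"
  using v_embed_hom(1)[of "x - y" y] by simp

lemma v_embed_power: "v_embed (x ^ n) = v_embed x ^ n"
  by (induction n) (simp_all add: v_embed_hom)

lemma v_embed_inverse: "x \<noteq> 0 \<Longrightarrow> v_embed (inverse x) = uinv (v_embed x)"
  using subst_at_inverse[OF v_elt_pow4] by (simp add: v_embed_subst_at)

lemma v_embed_divide: "y \<noteq> 0 \<Longrightarrow> v_embed (x / y) = v_embed x * uinv (v_embed y)"
  by (simp add: divide_inverse v_embed_hom v_embed_inverse)

lemma v_embed_powi: "v_embed (xvar powi n) = zpow v_elt n"
  using v_embed_inverse[OF xvar_nonzero] by (simp add: power_int_def zpow_def v_embed_power v_embed_hom)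

lemma v_embed_q_sub: "v_embed (q_sub C i) = v i"
  by (simp add: q_sub_def v_embed_power v_embed_hom)

lemma q_sub_nonzero: "q_sub C i \<noteq> 0"
  by (simp add: q_sub_def xvar_nonzero)

lemma q_sub_diff_nonzero:
  assumes "k > 0"
  shows "q_sub C i ^ k - inverse (q_sub C i) ^ k \<noteq> 0"
proof
  assume "q_sub C i ^ k - inverse (q_sub C i) ^ k = 0"
  then have "q_sub C i ^ k * q_sub C i ^ k = inverse (q_sub C i) ^ k * q_sub C i ^ k" by simp
  also have "\<dots> = 1" using q_sub_nonzero by (simp flip: power_mult_distrib)
  finally have "xvar ^ (dd C i * (k + k)) = 1" by (simp add: q_sub_def power_mult flip: power_add)
  then show False using xvar_power_neq_one[of "dd C i * (k + k)"] dd_pos[of i] assms by simp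
qed

abbreviation "v_const i \<equiv> 1 / (q_sub C i - inverse (q_sub C i))"
abbreviation "v_eig i n \<equiv> xvar powi (int (dd C i) * n)"

lemma operator_algebra_v:
  "operator_algebra TYPE('b) TYPE('v) C (U_v_ext C) (eig_v C) (\<lambda>i j. v_embed 1)
    (\<lambda>i n. v_embed (v_const i * (v_eig i n - v_eig i (- n))))
    (\<lambda>i j k. v_embed (v_serre C i j k)) (\<lambda>i j k. v_embed (v_serre C i j k))"
proof -
  interpret quantum_presentation C "\<lambda>i j. xvar powi (int (dd C i) * cm C i j)" "\<lambda>i j. xvar powi (- int (dd C i) * cm C i j)"
    "\<lambda>i j. 1" "\<lambda>i. let c = v_const i in mon c [gK i] - mon c [gKinv i]"
    "v_serre C" "v_serre C" "\<lambda>i n. v_eig i n" "\<lambda>i n. v_const i * (v_eig i n - v_eig i (- n))"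
    "\<lambda>i. v_const i" "\<lambda>i. [gK i]" "\<lambda>i. [gKinv i]"
    by unfold_locales (simp_all add: K_value_def Let_def distrib_left power_int_add xvar_nonzero)
  interpret pre_scalar_extension C "\<lambda>i j. xvar powi (int (dd C i) * cm C i j)" "\<lambda>i j. xvar powi (- int (dd C i) * cm C i j)"
    "\<lambda>i j. 1" "\<lambda>i. let c = v_const i in mon c [gK i] - mon c [gKinv i]"
    "v_serre C" "v_serre C" "\<lambda>i n. v_eig i n" "\<lambda>i n. v_const i * (v_eig i n - v_eig i (- n))"
    "\<lambda>i. v_const i" "\<lambda>i. [gK i]" "\<lambda>i. [gKinv i]" "scalar_const :: rat \<Rightarrow> _" rfun_of_rat
    "\<lambda>x. Poly_Mapping.lookup (the_inv v_ident x)" v_embed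
  proof (rule pre_scalar_extension.intro[OF quantum_presentation_axioms], unfold_locales)
    show "(\<Sum>k\<in>UNIV. rat_map (Poly_Mapping.single k 1) * v_embed (Poly_Mapping.lookup (the_inv v_ident x) k)) = x" for x
      using v_w_inverse(1)[of x]
      by (simp add: rat_map_single rfun_of_rat the_inv_v_ident v_embed_subst_at subst_ext_def mult.commute)
  qed (simp_all add: v_embed_hom rat_map_hom rat_map_single the_inv_v_ident subst_ext_add w_elt_pow4 lookup_add)
  have U: "E = U_v_ext C" unfolding E_def U_v_ext_def B_def rels_def U_v_def by (rule refl)
  interpret scalar_extension C "\<lambda>i j. xvar powi (int (dd C i) * cm C i j)" "\<lambda>i j. xvar powi (- int (dd C i) * cm C i j)"
    "\<lambda>i j. 1" "\<lambda>i. let c = v_const i in mon c [gK i] - mon c [gKinv i]"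
    "v_serre C" "v_serre C" "\<lambda>i n. v_eig i n" "\<lambda>i n. v_const i * (v_eig i n - v_eig i (- n))"
    "\<lambda>i. v_const i" "\<lambda>i. [gK i]" "\<lambda>i. [gKinv i]" "scalar_const :: rat \<Rightarrow> _" rfun_of_rat
    v_embed "\<lambda>x. Poly_Mapping.lookup (the_inv v_ident x)"
  proof (rule scalar_extension.intro[OF pre_scalar_extension_axioms], unfold_locales)
    fix s c
    show "scl E (rat_map s * v_embed c) = tens s (scl B c)"
    proof (rule scl_E_reduce)
      fix j a
      \<comment> \<open>The product is the image of a monomial under \<open>v_ident\<close>, so its
        only coordinate is the one at j.\<close>
      have "rat_map (Poly_Mapping.single j a) * v_embed c = subst_ext v_elt (Poly_Mapping.single j (rfun_of_rat a * c))"
      proof -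
        have "Poly_Mapping.single j (rfun_of_rat a) = scalar_const (rfun_of_rat a) * Poly_Mapping.single j 1"
          by (simp add: mult_single)
        then show ?thesis
          unfolding subst_ext_single[OF v_elt_pow4] rat_map_single v_embed_subst_at[symmetric] v_embed_hom
          by (simp only: ac_simps)
      qed
      then have inv: "the_inv v_ident (rat_map (Poly_Mapping.single j a) * v_embed c) = Poly_Mapping.single j (rfun_of_rat a * c)"
        by (simp add: the_inv_v_ident v_w_inverse)
      have "scl E (rat_map (Poly_Mapping.single j a) * v_embed c) = tens (Poly_Mapping.single j 1) (scl B (rfun_of_rat a * c))"
        by (rule scl_E_single) (simp add: inv lookup_single when_def)
      also have "\<dots> = tens (Poly_Mapping.single j a) (scl B c)"
        using tens_scl_balanced[of "Poly_Mapping.single j 1" a c] by (simp add: mult_single)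
      finally show "scl E (rat_map (Poly_Mapping.single j a) * v_embed c) = tens (Poly_Mapping.single j a) (scl B c)" .
    qed
  qed
  have "(\<lambda>i n. v_embed (v_eig i n)) = eig_v C"
    by (intro ext) (simp add: eig_v_def v_embed_powi)
  then show ?thesis using operator_algebra_E unfolding U by simp
qed

end

section \<open>The twists relating the three algebras\<close>

text \<open>Trades the exponent m - k for k at the cost of a factor independent of k, which is the
  shape needed to compare Serre coefficients.\<close>

lemma involution_power_diff:
  fixes x :: "'k::comm_ring_1"
  assumes "x * x = 1" "k \<le> m"
  shows "x ^ (m - k) = x ^ m * x ^ k"
proof -
  have "x ^ m * x ^ k = x ^ (m - k) * (x * x) ^ k"
    using assms(2) by (simp add: power_mult_distrib flip: power_add mult.assoc)
  then show ?thesis by (simp add: assms(1))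
qed

text \<open>The inverse of z is its cube. This makes the exponent 1 - m, which is an off-diagonal
  Cartan entry when m is \<open>serre_len\<close>, a natural number.\<close>

lemma zpow_one_minus:
  assumes "z ^ 4 = (1 :: 'k::comm_ring_1)"
  shows "zpow z (1 - int m) = z ^ (1 + 3 * m)"
proof -
  have z3: "z * z ^ 3 = 1" using assms by (simp flip: power_Suc)
  then have "z dvd 1" by (intro dvdI[of _ _ "z ^ 3"]) simp
  then have "zpow z (1 - int m) = z * uinv z ^ m" using zpow_add[of z 1 "- int m"] by simp
  then show ?thesis by (simp add: uinv_eqI[OF z3] power_mult)
qed

text \<open>Both follow from \<open>triangle (k + l) = triangle k + triangle l + k l\<close> by comparing exponents modulo the
  relations for \<open>z\<close>.\<close>

lemma serre_exponent_pow4: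
  fixes z :: "'k::comm_ring_1"
  assumes z: "z ^ 4 = 1" and y: "z ^ (1 + 3 * m) * z ^ (1 + 3 * m) = 1" and k: "k \<le> m"
  shows "(z ^ 2) ^ triangle k * ((z ^ 3) ^ triangle (m - k) * (z ^ 3) ^ triangle k) =
    z ^ (3 * triangle m) * (z ^ (1 + 3 * m)) ^ k"
proof -
  obtain l where m: "m = k + l" using k le_Suc_ex by blast
  have dk: "2 * triangle k + k = k * k" using triangle_double[of k] by (cases k) (simp_all add: algebra_simps)
  let ?L = "2 * triangle k + (3 * triangle l + 3 * triangle k)" and ?R = "3 * triangle m + (1 + 3 * m) * k"
  \<comment> \<open>By \<open>y\<close> the added exponent on the left changes nothing; after it the
    two sides differ by a multiple of 4.\<close>
  have e: "?L + (1 + 3 * m + (1 + 3 * m)) * k = ?R + 4 * (k * k)"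
    using dk by (simp add: m triangle_add algebra_simps)
  have "z ^ ?L = z ^ ?L * (z ^ (1 + 3 * m) * z ^ (1 + 3 * m)) ^ k" by (simp only: y power_one mult_1_right)
  also have "\<dots> = z ^ (?L + (1 + 3 * m + (1 + 3 * m)) * k)" by (simp only: power_add[symmetric] power_mult[symmetric])
  also have "\<dots> = z ^ ?R * (z ^ 4) ^ (k * k)" unfolding e by (simp only: power_add power_mult)
  finally have "z ^ ?L = z ^ ?R" by (simp only: z power_one mult_1_right)
  then show ?thesis by (simp only: m diff_add_inverse power_add power_mult)
qed

lemma serre_exponent_pow2:
  fixes z :: "'k::comm_ring_1"
  assumes z: "z * z = 1" and k: "k \<le> m"
  shows "z ^ triangle (m - k) * z ^ triangle k = z ^ triangle m * (z ^ (1 + 3 * m)) ^ k"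
proof -
  obtain l where m: "m = k + l" using k le_Suc_ex by blast
  have dk: "2 * triangle k + k = k * k" using triangle_double[of k] by (cases k) (simp_all add: algebra_simps)
  let ?c = "2 * (k * l) + k + k * k + triangle k"
  \<comment> \<open>The exponents differ by the even number \<open>?c + ?c\<close>, which is enough
    for an involution.\<close>
  have e: "triangle m + (1 + 3 * m) * k = triangle l + triangle k + (?c + ?c)"
    using dk by (simp add: m triangle_add algebra_simps)
  have gen: "z ^ (a + (c + c)) = z ^ a * (z * z) ^ c" for a c by (simp only: power_add power_mult_distrib)
  have "z ^ (triangle m + (1 + 3 * m) * k) = z ^ (triangle l + triangle k) * (z * z) ^ ?c"
    unfolding e by (rule gen)
  then show ?thesis by (simp only: z power_one mult_1_right m diff_add_inverse power_add power_mult)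
qed

context sqrt_superdatum
begin

abbreviation "F i n \<equiv> p_fact C r i n"

lemma F_unit: "F i n dvd 1"
  unfolding p_fact_def using power_diff_unit[OF p_pow4 dd_pos, of 1 i]
  by (intro unit_prod unit_mult uinv_unit power_diff_unit[OF p_pow4 dd_pos]) auto

lemma theta_\<rho>: "i \<noteq> j \<Longrightarrow> theta C r i j = \<rho> j i" "theta C r i i = 1"
  by (simp_all add: theta_def)

lemma serre_len_cm: "i \<noteq> j \<Longrightarrow> cm C i j = 1 - int (serre_len C i j)"
  using cm_offdiag[of i j] by (simp add: serre_len_def)

text \<open>The twists from \<open>U_sqrt\<close> to the other two algebras have the same shape: all coefficients are
  involutions up to the factors \<open>w i j\<close>.\<close>

lemma twist_sqrt_ex:
  fixes x \<sigma> \<gamma> w t' :: "'i \<Rightarrow> 'i \<Rightarrow> rfun sqrtpi_ext"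
  assumes g: "\<And>i n. g i n dvd 1" "\<And>i j n. g i (n - cm C i j) = (\<gamma> i j * w i j) * g i n"
      "\<And>i n. g i n * H_sqrt i n = H' i n"
    and x: "\<And>i j. x i j * x i j = 1" "\<And>i j. x i j * x j i = 1" and \<gamma>: "\<And>i j. \<gamma> i j * \<gamma> i j = 1"
    and w: "\<And>i j. w i j = w j i" "\<And>i j. w i j dvd 1"
    and \<sigma>: "\<And>i j. i \<noteq> j \<Longrightarrow> x i j * \<sigma> i j = \<rho> j i" "\<And>i j. i \<noteq> j \<Longrightarrow> \<sigma> i j * \<gamma> j i * \<gamma> i j * x i j = \<rho> i j"
    and t': "\<And>i j. i \<noteq> j \<Longrightarrow> \<rho> i j * (\<gamma> j i * w j i) = t' i j * x i j" "\<And>i. \<gamma> i i * w i i = t' i i"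
    and s': "\<And>i j k. i \<noteq> j \<Longrightarrow> k \<le> serre_len C i j \<Longrightarrow> s' i j k =
      K i j * ((- 1) ^ k * \<sigma> i j ^ k * (uinv (F i (serre_len C i j - k)) * uinv (F i k)))"
    and K: "\<And>i j. i \<noteq> j \<Longrightarrow> K i j dvd 1"
  shows "\<exists>c d. twist C (\<lambda>i j. theta C r j i) H_sqrt se_sqrt sf_sqrt t' H' s' s' c d"
\<comment> \<open>\<open>twist_ex\<close> wants 1 on the diagonal, where the formula for
  \<open>x\<close> may give another involution. The commutation relation for i = j is therefore the
  separate hypothesis \<open>t'(2)\<close>.\<close>
proof (rule twist_ex[where x = "\<lambda>i j. if i = j then 1 else x i j", OF _ _ g])
  fix i j
  have xu: "x i j dvd 1" and \<gamma>u: "\<gamma> i j dvd 1" by (rule dvdI[OF x(1)[symmetric]], rule dvdI[OF \<gamma>[symmetric]])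
  show "(if i = i then 1 else x i i) = 1" by simp
  show "(if i = j then 1 else x i j) * (if j = i then 1 else x j i) = 1" by (simp add: x)
  show "theta C r j i * (\<gamma> j i * w j i) = t' i j * (if i = j then 1 else x i j)"
    using t'(1)[of i j] t'(2)[of i] by (cases "i = j") (simp_all add: theta_\<rho>)
  assume ij: "i \<noteq> j"
  let ?m = "serre_len C i j"
  show "\<exists>z. z dvd 1 \<and> (\<forall>k\<le>?m. s' i j k * (if i = j then 1 else x i j) ^ (?m - k) = z * se_sqrt i j k)"
  proof (intro exI[of _ "K i j * x i j ^ ?m"] conjI allI impI)
    show "K i j * x i j ^ ?m dvd 1" by (intro unit_mult unit_power K ij xu)
    fix k assume k: "k \<le> ?m"
    \<comment> \<open>Up to a constant in k, the involution contributes \<open>x i j ^ k\<close>;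
      joined with \<open>\<sigma> i j ^ k\<close> it gives the power of \<open>theta\<close> in the
      relations between the \<open>e\<close>.\<close>
    have "s' i j k * x i j ^ (?m - k) =
        K i j * x i j ^ ?m * (((- 1) * (x i j * \<sigma> i j)) ^ k * uinv (F i (?m - k)) * uinv (F i k))"
      unfolding s'[OF ij k] involution_power_diff[OF x(1) k] power_mult_distrib by (simp only: ac_simps)
    then show "s' i j k * (if i = j then 1 else x i j) ^ (?m - k) = K i j * x i j ^ ?m * se_sqrt i j k"
      using ij by (simp add: \<sigma>(1) theta_\<rho>(1))
  qed
  show "\<exists>z. z dvd 1 \<and> (\<forall>k\<le>?m. s' i j k * (\<gamma> j i * w j i) ^ k *
      (\<gamma> i j * w i j * (if i = j then 1 else x i j)) ^ (?m - k) = z * sf_sqrt i j k)"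
  proof (intro exI[of _ "K i j * w i j ^ ?m * (\<gamma> i j * x i j) ^ ?m"] conjI allI impI)
    show "K i j * w i j ^ ?m * (\<gamma> i j * x i j) ^ ?m dvd 1" by (intro unit_mult unit_power K ij xu \<gamma>u w)
    fix k assume k: "k \<le> ?m"
    have inv: "(\<gamma> i j * x i j) * (\<gamma> i j * x i j) = 1"
      using x(1)[of i j] \<gamma>[of i j] by (metis (no_types, lifting) mult.assoc mult.left_commute mult_1)
    \<comment> \<open>By symmetry the factors \<open>w\<close> have total exponent m in every term
      and leave the sum. The remaining involutions produce \<open>theta\<close> with i and j
      exchanged, as the relations between the \<open>f\<close> require.\<close>
    have wm: "w j i ^ k * w i j ^ (?m - k) = w i j ^ ?m" using k by (simp add: w(1)[of j i] flip: power_add)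
    have "s' i j k * (\<gamma> j i * w j i) ^ k * (\<gamma> i j * w i j * x i j) ^ (?m - k) =
        s' i j k * \<gamma> j i ^ k * (w j i ^ k * w i j ^ (?m - k)) * (\<gamma> i j * x i j) ^ (?m - k)"
      by (simp only: power_mult_distrib ac_simps)
    also have "\<dots> = K i j * w i j ^ ?m * (\<gamma> i j * x i j) ^ ?m *
        (((- 1) * (\<sigma> i j * \<gamma> j i * \<gamma> i j * x i j)) ^ k * uinv (F i (?m - k)) * uinv (F i k))"
      unfolding wm s'[OF ij k] involution_power_diff[OF inv k] by (simp only: power_mult_distrib ac_simps)
    finally show "s' i j k * (\<gamma> j i * w j i) ^ k * (\<gamma> i j * w i j * (if i = j then 1 else x i j)) ^ (?m - k) =
        K i j * w i j ^ ?m * (\<gamma> i j * x i j) ^ ?m * sf_sqrt i j k"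
      using ij by (simp add: \<sigma>(2) theta_\<rho>)
  qed
qed

lemma \<rho>_pow: "i \<noteq> j \<Longrightarrow> \<rho> i j = s i ^ (1 + 3 * serre_len C i j)"
  by (subst serre_len_cm, assumption) (rule zpow_one_minus[OF s_pow4])

text \<open>Both sides are powers of q with exponent - d_i a_ij = - d_j a_ji, by
  symmetrizability.\<close>

lemma q_zpow_symmetric: "zpow (q i) (- cm C i j) = zpow (q j) (- cm C j i)"
proof -
  let ?x = "scalar_const xvar :: rfun sqrtpi_ext"
  have u: "?x dvd 1" by (rule scalar_const_unit[OF xvar_nonzero])
  have q: "q i = zpow ?x (int (dd C i))" for i by (simp add: q_sub_def scalar_const_power)
  show ?thesis unfolding q zpow_mult[OF u, symmetric] by (simp add: symmetrizable)
qed

subsection \<open>The twist for the parameter \<open>\<pi>\<close>\<close>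

lemma super_diff_unit:
  assumes "k > 0"
  shows "(pi2_sub C i * q2 C i) ^ k - zpow (q2 C i) (- int k) dvd 1"
proof -
  let ?y = "q2 C i ^ 2 * pi2_sub C i"
  have "pi2_sub C i ^ 2 = 1" by (simp add: pi2_sub_def par_def pi2_square)
  then have y: "?y ^ 2 = scalar_const (xvar ^ (4 * dd C i))"
    by (simp add: power_mult_distrib scalar_const_power q_sub_def mult.commute flip: power_mult)
  have "- (uinv (q2 C i) ^ k) * (1 - ?y ^ k) = (uinv (q2 C i) * q2 C i) ^ k * (pi2_sub C i * q2 C i) ^ k - uinv (q2 C i) ^ k"
    unfolding power2_eq_square power_mult_distrib by (simp add: algebra_simps)
  then have eq: "(pi2_sub C i * q2 C i) ^ k - zpow (q2 C i) (- int k) = - (uinv (q2 C i) ^ k) * (1 - ?y ^ k)"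
    by (simp add: uinv_left[OF q2_unit(1)])
  show ?thesis unfolding eq
    by (intro unit_mult one_minus_unit[OF y dd_pos assms]) (simp add: unit_power uinv_unit q2_unit)
qed

lemma super_fact_unit: "super_fact C i n dvd 1"
  unfolding super_fact_def using super_diff_unit[of 1 i]
  by (intro unit_prod unit_mult uinv_unit super_diff_unit) auto

text \<open>Writing s_i for the chosen root of \<pi>_i, one has (\<pi>_i q_i)^k - q_i^(-k) = s_i^k
  (p_i^k - p_i^(-k)). The factorials thus differ by a triangular power of s_i.\<close>

lemma pi_incl_super_fact: "pi_incl (super_fact C i n) = s i ^ triangle n * F i n"
proof -
  let ?a = "\<lambda>k. (pis i * q i) ^ k - zpow (q i) (- int k)" and ?b = "\<lambda>k. p i ^ k - zpow (p i) (- int k)"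
  note u = hom_units[of pi_incl, OF pi_incl_mult pi_incl_one]
  have a: "pi_incl ((pi2_sub C i * q2 C i) ^ k - zpow (q2 C i) (- int k)) = ?a k" for k
    unfolding pi_incl_minus u(3)[OF unit_mult[OF q2_unit(2,1)]] pi_incl_mult pi_incl_q2 u(4)[OF q2_unit(1)] ..
  have a1: "pi_incl (uinv (pi2_sub C i * q2 C i - zpow (q2 C i) (- 1))) = uinv (?a 1)"
    using u(2)[OF super_diff_unit[of 1 i]] a[of 1] by simp
  have "pi_incl (super_fact C i n) = (\<Prod>k=1..n. ?a k * uinv (?a 1))"
    unfolding super_fact_def hom_prod[of pi_incl, OF pi_incl_mult pi_incl_one] pi_incl_mult[of "_ - _"] a a1 ..
  also have "\<dots> = s i ^ triangle n * (\<Prod>k=1..n. ?b k * uinv (?b 1))"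
  proof (rule quantum_factorial_compare[OF _ s_unit])
    fix k
    have "s i ^ k * (p i ^ k - zpow (p i) (- int k)) = (s i ^ 2 * q i) ^ k - (s i * uinv (s i)) ^ k * uinv (q i) ^ k"
      unfolding p_sub_def uinv_mult[OF q_unit s_unit] zpow_neg_nat power2_eq_square power_mult_distrib
      by (simp add: algebra_simps)
    then show "?a k = s i ^ k * ?b k" by (simp add: uinv_right s_unit s_square)
  qed (use power_diff_unit[OF p_pow4 dd_pos, of 1 i] in simp)
  finally show ?thesis by (simp add: p_fact_def)
qed

text \<open>The choice g_i(n) = p_i^(n-1) comes from (1 - p_i^(2n)) / (1 - p_i^2) = p_i^(n-1) (p_i^n
  - p_i^(-n)) / (p_i - p_i^(-1)). Its translation factor p_i^(-a_ij) splits into the involution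
  \<open>\<rho> i j\<close> and a power of q_i symmetric in i and j. The commutation relation for i
  \<noteq> j then determines \<open>x\<close>, and the comparison of factorials determines
  \<open>\<sigma>\<close>.\<close>

lemma twist_super_ex:
  "\<exists>c d. twist C (\<lambda>i j. theta C r j i) H_sqrt se_sqrt sf_sqrt (\<lambda>i j. pi_incl (super_rel i j))
    (\<lambda>i n. pi_incl (super_const i * (1 - super_eig i n)))
    (\<lambda>i j k. pi_incl (super_serre C i j k)) (\<lambda>i j k. pi_incl (super_serre C i j k)) c d"
proof -
  define e :: "'i \<Rightarrow> 'i \<Rightarrow> rfun sqrtpi_ext" where "e i j = pi4 ^ (par C i * par C j)" for i j
  let ?w = "\<lambda>i j. zpow (q i) (- cm C i j)"
  note u = hom_units[of pi_incl, OF pi_incl_mult pi_incl_one]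
  have e2: "e i j * e i j = 1" for i j
    using pi4_square[where 'k = rfun] by (simp add: e_def power2_eq_square flip: power_mult_distrib)
  have e_sym: "e j i = e i j" for i j by (simp add: e_def mult.commute)
  have pe: "pi_incl (pi2 ^ (par C i * par C j)) = e i j" for i j
    by (simp add: e_def u(3)[OF pi2_unit] pi_incl_pi2)
  have t': "pi_incl (super_rel i j) = e i j * ?w i j" for i j
    unfolding pi_incl_mult pe u(4)[OF q2_unit(1)] pi_incl_q2 ..
  have us: "uinv (s i) = s i ^ 3" for i by (rule uinv_eqI) (simp add: s_pow4 flip: power_Suc)
  have S: "uinv (pi_incl (super_fact C i n)) = (s i ^ 3) ^ triangle n * uinv (F i n)" for i n
    unfolding pi_incl_super_fact uinv_mult[OF unit_power[OF s_unit] F_unit] uinv_power[OF s_unit] us ..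
  have s': "pi_incl (super_serre C i j k) = s i ^ (3 * triangle (serre_len C i j)) *
      ((- 1) ^ k * (e i j * \<rho> i j) ^ k * (uinv (F i (serre_len C i j - k)) * uinv (F i k)))"
    if ij: "i \<noteq> j" and k: "k \<le> serre_len C i j" for i j k
  proof -
    let ?m = "serre_len C i j"
    have tri: "k * (k - 1) div 2 = triangle k" using triangle_double[of k] by simp
    have neg: "- (pi2 ^ (par C i * par C j)) dvd (1 :: rfun pi_ext)" using unit_power[OF pi2_unit] by simp
    have "pi_incl (super_serre C i j k) = (- e i j) ^ k * pis i ^ triangle k *
        ((s i ^ 3) ^ triangle (?m - k) * uinv (F i (?m - k))) * ((s i ^ 3) ^ triangle k * uinv (F i k))"
      unfolding super_serre_def pi_incl_mult tri u(3)[OF neg] u(3)[OF q2_unit(2)] pi_incl_q2 pi_incl_uminus pe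
        u(2)[OF super_fact_unit] S ..
    also have "pis i = s i ^ 2" by (simp only: s_square)
    also have "(- e i j) ^ k * (s i ^ 2) ^ triangle k *
        ((s i ^ 3) ^ triangle (?m - k) * uinv (F i (?m - k))) * ((s i ^ 3) ^ triangle k * uinv (F i k)) =
        (- e i j) ^ k * ((s i ^ 2) ^ triangle k * ((s i ^ 3) ^ triangle (?m - k) * (s i ^ 3) ^ triangle k)) *
        (uinv (F i (?m - k)) * uinv (F i k))" by (simp only: ac_simps)
    \<comment> \<open>The powers of s_i stem from the factor \<pi>_i^(k(k-1)/2) and from the two
      inverse factorials; together they are a constant times the k-th power of
      \<open>\<rho> i j\<close>.\<close>
    also have "(s i ^ 2) ^ triangle k * ((s i ^ 3) ^ triangle (?m - k) * (s i ^ 3) ^ triangle k) =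
        s i ^ (3 * triangle ?m) * \<rho> i j ^ k"
      using serre_exponent_pow4[OF s_pow4 _ k, of i] \<rho>_square[of i j] by (simp only: \<rho>_pow[OF ij])
    also have "- e i j = (- 1) * e i j" by simp
    finally show ?thesis by (simp only: power_mult_distrib ac_simps)
  qed
  have x2: "e i j * (\<rho> i j * \<rho> j i) * (e i j * (\<rho> i j * \<rho> j i)) = 1" for i j
  proof -
    have "e i j * (\<rho> i j * \<rho> j i) * (e i j * (\<rho> i j * \<rho> j i)) = e i j * e i j * (\<rho> i j * \<rho> i j) * (\<rho> j i * \<rho> j i)"
      by (simp only: ac_simps)
    then show ?thesis by (simp only: e2 \<rho>_square mult_1_left)
  qed
  have pm: "zpow (p i) (- cm C i j) = \<rho> i j * ?w i j" for i j
  proof -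
    have "zpow (s i) (- cm C i j) = \<rho> i j" using zpow_minus[OF s_unit] uinv_eqI[OF \<rho>_square] by simp
    then show ?thesis by (simp add: p_sub_def zpow_mult_distrib q_unit s_unit mult.commute)
  qed
  show ?thesis
  proof (rule twist_sqrt_ex[where g = "\<lambda>i n. zpow (p i) (n - 1)" and \<gamma> = \<rho> and w = ?w
        and x = "\<lambda>i j. e i j * (\<rho> i j * \<rho> j i)" and \<sigma> = "\<lambda>i j. e i j * \<rho> i j"
        and K = "\<lambda>i j. s i ^ (3 * triangle (serre_len C i j))", OF _ _ _ x2 _ \<rho>_square q_zpow_symmetric])
    fix i j n
    show "zpow (p i) (n - 1) dvd 1" by (rule zpow_unit[OF p_unit])
    show "zpow (p i) (n - cm C i j - 1) = \<rho> i j * ?w i j * zpow (p i) (n - 1)"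
      unfolding pm[symmetric] zpow_add[OF p_unit, symmetric] by (simp add: algebra_simps)
    show "zpow (p i) (n - 1) * H_sqrt i n = pi_incl (super_const i * (1 - super_eig i n))"
    proof -
      let ?P = "zpow (p i) n" and ?M = "zpow (p i) (- n)" and ?e = "uinv (p i)"
      have PM: "?P * ?M = 1" by (simp flip: zpow_add[OF p_unit])
      have eig: "pi_incl (super_eig i n) = ?P * ?P"
      proof -
        have "pi_incl (super_eig i n) = zpow (p i ^ 2) n" by (simp only: u(4)[OF q2_unit(3)] pi_incl_q2)
        also have "\<dots> = zpow (p i * p i) n" by (simp only: power2_eq_square)
        finally show ?thesis by (simp only: zpow_mult_distrib[OF p_unit p_unit])
      qed
      have D: "p i - ?e dvd 1" using power_diff_unit[OF p_pow4 dd_pos, of 1 i] by simp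
      have "1 - q2 C i ^ 2 * pi2_sub C i dvd 1"
      proof -
        have "pi2_sub C i ^ 2 = 1" by (simp add: pi2_sub_def par_def pi2_square)
        then have "(q2 C i ^ 2 * pi2_sub C i) ^ 2 = scalar_const (xvar ^ (4 * dd C i))"
          by (simp add: power_mult_distrib scalar_const_power q_sub_def mult.commute flip: power_mult)
        from one_minus_unit[OF this dd_pos, of 1] show ?thesis by simp
      qed
      then have c: "pi_incl (super_const i) = uinv (1 - p i ^ 2)"
        using u(2)[of "1 - q2 C i ^ 2 * pi2_sub C i"] by (simp only: pi_incl_minus pi_incl_one pi_incl_q2(3))
      \<comment> \<open>The two forms of the constant are related by 1 - p_i^2 = - p_i (p_i -
        p_i^(-1)).\<close>
      have "(1 - p i ^ 2) * (- (?e * uinv (p i - ?e))) = (p i * (p i - ?e)) * (?e * uinv (p i - ?e))"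
        using uinv_right[OF p_unit, of i] by (simp add: power2_eq_square algebra_simps)
      also have "\<dots> = (p i * ?e) * ((p i - ?e) * uinv (p i - ?e))" by (simp only: ac_simps)
      finally have c': "uinv (1 - p i ^ 2) = - (?e * uinv (p i - ?e))"
        by (intro uinv_eqI) (simp add: uinv_right p_unit D)
      have "zpow (p i) (n - 1) * H_sqrt i n = ?e * uinv (p i - ?e) * (?P * ?P - ?P * ?M)"
        unfolding zpow_pred[OF p_unit] by (simp add: algebra_simps)
      also have "\<dots> = - (?e * uinv (p i - ?e)) * (1 - ?P * ?P)" unfolding PM by (simp add: algebra_simps)
      finally show ?thesis by (simp only: pi_incl_mult pi_incl_minus pi_incl_one eig c c')
    qed
    show "e i j * (\<rho> i j * \<rho> j i) * (e j i * (\<rho> j i * \<rho> i j)) = 1"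
      using x2[of i j] by (simp only: e_sym mult.commute[of "\<rho> j i"])
    show "?w i j dvd 1" by (rule zpow_unit[OF q_unit])
    show "\<rho> i i * ?w i i = pi_incl (super_rel i i)"
    proof -
      \<comment> \<open>The diagonal Cartan entry is 2, so the root is squared; \<open>e i i\<close>
        is the same element because \<open>par C i\<close> equals its own square.\<close>
      have "\<rho> i i = pis i" using zpow_of_nat[of "s i" 2] by (simp add: cm_diag s_square)
      then show ?thesis unfolding t' by (simp add: e_def par_def)
    qed
    show "s i ^ (3 * triangle (serre_len C i j)) dvd 1" by (rule unit_power[OF s_unit])
    have *: "e i j * (\<rho> i j * \<rho> j i) * (e i j * \<rho> i j) = e i j * e i j * (\<rho> i j * \<rho> i j) * \<rho> j i"
      by (simp only: ac_simps)
    then show "e i j * (\<rho> i j * \<rho> j i) * (e i j * \<rho> i j) = \<rho> j i" by (simp only: e2 \<rho>_square mult_1_left)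
    have "e i j * \<rho> i j * \<rho> j i * \<rho> i j * (e i j * (\<rho> i j * \<rho> j i)) =
        e i j * e i j * (\<rho> i j * \<rho> i j) * (\<rho> j i * \<rho> j i) * \<rho> i j" by (simp only: ac_simps)
    then show "e i j * \<rho> i j * \<rho> j i * \<rho> i j * (e i j * (\<rho> i j * \<rho> j i)) = \<rho> i j" by (simp only: e2 \<rho>_square mult_1_left)
    have "e i j * ?w i j * (e i j * (\<rho> i j * \<rho> j i)) = e i j * e i j * (\<rho> i j * (\<rho> j i * ?w i j))" by (simp only: ac_simps)
    then show "\<rho> i j * (\<rho> j i * ?w j i) = pi_incl (super_rel i j) * (e i j * (\<rho> i j * \<rho> j i))"
      by (simp only: t' e2 mult_1_left q_zpow_symmetric[of j i])
  qed (rule s')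
qed

end

subsection \<open>The twist for the parameter \<open>v\<close>\<close>

lemma zpow_uinv: "x dvd 1 \<Longrightarrow> zpow (uinv x) n = zpow x (- n)"
  using zpow_mult[of x "- 1" n] by simp

locale parity_superdatum = sqrt_superdatum +
  assumes parity: "odd (dd C i) \<longleftrightarrow> i \<in> odds C"
begin

abbreviation "sqpi i \<equiv> (sqrtpi :: rfun sqrtpi_ext) ^ dd C i"

text \<open>Both factors come from square roots of \<pi>_i, the second by the parity condition. The
  ratio is an involution that measures how p_i deviates from the d_i-th power of v.\<close>

definition \<epsilon> :: "'a \<Rightarrow> rfun sqrtpi_ext" where
  "\<epsilon> i = s i * uinv (sqpi i)"

definition \<eta> :: "'a \<Rightarrow> 'a \<Rightarrow> rfun sqrtpi_ext" where
  "\<eta> i j = zpow (\<epsilon> i) (cm C i j)"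

lemma sqrtpi_unit: "(sqrtpi :: rfun sqrtpi_ext) dvd 1"
  by (rule dvdI[of _ _ "sqrtpi ^ 3"]) (simp add: sqrtpi_pow4 flip: power_Suc)

lemma sqpi_unit: "sqpi i dvd 1"
  by (rule unit_power[OF sqrtpi_unit])

text \<open>As \<pi> has order 2, its d_i-th power sees only the parity of d_i. This is the place
  where the parity condition enters.\<close>

lemma sqpi_square: "sqpi i * sqpi i = pis i"
proof -
  have "sqpi i * sqpi i = pi4 ^ dd C i" by (simp add: power2_eq_square power_mult_distrib)
  also have "\<dots> = pis i"
  proof (cases "odd (dd C i)")
    case True
    then obtain b where "dd C i = 2 * b + 1" by (rule oddE)
    then show ?thesis using True parity[of i] by (simp only: power_add power_mult[of pi4 2] pi4_square) (simp add: par_def)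
  next
    case False
    then obtain b where "dd C i = 2 * b" by (metis evenE)
    then show ?thesis using False parity[of i] by (simp only: power_mult[of pi4 2] pi4_square) (simp add: par_def)
  qed
  finally show ?thesis .
qed

lemma \<epsilon>_square: "\<epsilon> i * \<epsilon> i = 1"
proof -
  have "\<epsilon> i * \<epsilon> i = s i ^ 2 * uinv (sqpi i * sqpi i)"
    by (simp add: \<epsilon>_def uinv_mult sqpi_unit power2_eq_square ac_simps)
  then show ?thesis by (simp only: s_square sqpi_square uinv_right[OF pis_unit])
qed

lemma \<epsilon>_unit: "\<epsilon> i dvd 1"
  by (rule dvdI[OF \<epsilon>_square[symmetric]])

lemma uinv_\<epsilon>: "uinv (\<epsilon> i) = \<epsilon> i"
  by (rule uinv_eqI[OF \<epsilon>_square])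

lemma p_\<epsilon>_v: "p i = \<epsilon> i * v i"
proof -
  have "v i = q i * sqpi i" by (simp add: v_elt_def power_mult_distrib scalar_const_power q_sub_def)
  then have "\<epsilon> i * v i = q i * s i * (sqpi i * uinv (sqpi i))" by (simp only: \<epsilon>_def ac_simps)
  then show ?thesis by (simp add: uinv_right sqpi_unit p_sub_def)
qed

lemma \<eta>_square: "\<eta> i j * \<eta> i j = 1"
  by (simp add: \<eta>_def \<epsilon>_square flip: zpow_mult_distrib[OF \<epsilon>_unit \<epsilon>_unit])

lemma \<eta>_minus: "zpow (\<epsilon> i) (- cm C i j) = \<eta> i j"
  unfolding zpow_minus[OF \<epsilon>_unit] \<eta>_def[symmetric] by (rule uinv_eqI[OF \<eta>_square])

text \<open>The product of the chosen root with \<epsilon>_i is \<pi>_i (\<surd>\<pi>)^(-d_i).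
  Raised to a_ij, the factor \<pi>_i disappears, and the exponent - d_i a_ij that remains is
  symmetric.\<close>

lemma \<rho>_\<eta>_symmetric: "\<rho> i j * \<eta> i j = \<rho> j i * \<eta> j i"
proof -
  have "\<rho> i j * \<eta> i j = zpow sqrtpi (- (int (dd C i) * cm C i j))" for i j
  proof -
    have "s i * \<epsilon> i = s i ^ 2 * uinv (sqpi i)"
      unfolding \<epsilon>_def power2_eq_square by (simp only: ac_simps)
    then have "s i * \<epsilon> i = pis i * uinv (sqpi i)" by (simp only: s_square)
    then have "\<rho> i j * \<eta> i j = zpow (pis i * uinv (sqpi i)) (cm C i j)"
      by (simp only: \<eta>_def zpow_mult_distrib[OF s_unit \<epsilon>_unit, symmetric])
    also have "\<dots> = zpow (zpow sqrtpi (int (dd C i))) (- cm C i j)"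
      by (simp add: zpow_mult_distrib pis_unit uinv_unit sqpi_unit zpow_pis zpow_uinv)
    also have "\<dots> = zpow sqrtpi (int (dd C i) * - cm C i j)"
      by (simp only: zpow_mult[OF sqrtpi_unit])
    finally show ?thesis by (simp only: mult_minus_right)
  qed
  then show ?thesis by (simp only: symmetrizable[of i j])
qed

lemma \<epsilon>_pow4: "\<epsilon> i ^ 4 = 1"
  using power_mult[of "\<epsilon> i" 2 2] \<epsilon>_square[of i] by (simp add: power2_eq_square)

lemma \<eta>_pow: "i \<noteq> j \<Longrightarrow> \<eta> i j = \<epsilon> i ^ (1 + 3 * serre_len C i j)"
  unfolding \<eta>_def by (subst serre_len_cm, assumption) (rule zpow_one_minus[OF \<epsilon>_pow4])

text \<open>As \<epsilon>_i is its own inverse, both terms of p_i^k - p_i^(-k) are \<epsilon>_i^k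
  times the corresponding power of v^(d_i).\<close>

lemma v_embed_qfact: "v_embed (sym_qfact (q_sub C i) n) = \<epsilon> i ^ triangle n * F i n"
proof -
  let ?a = "\<lambda>k. v i ^ k - zpow (v i) (- int k)" and ?b = "\<lambda>k. p i ^ k - zpow (p i) (- int k)"
  have a: "v_embed (q_sub C i ^ k - inverse (q_sub C i) ^ k) = ?a k" for k
    by (simp add: v_embed_minus v_embed_power v_embed_inverse[OF q_sub_nonzero] v_embed_q_sub)
  have a1: "v_embed (x / (q_sub C i - inverse (q_sub C i))) = v_embed x * uinv (?a 1)" for x
    using v_embed_divide[of "q_sub C i - inverse (q_sub C i)" x] q_sub_diff_nonzero[of 1 i] a[of 1] by simp
  have "v_embed (sym_qfact (q_sub C i) n) = (\<Prod>k=1..n. ?a k * uinv (?a 1))"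
    unfolding sym_qfact_def hom_prod[of v_embed, OF v_embed_hom(2,3)] a1 a ..
  also have "\<dots> = \<epsilon> i ^ triangle n * (\<Prod>k=1..n. ?b k * uinv (?b 1))"
  proof (rule quantum_factorial_compare[OF _ \<epsilon>_unit])
    fix k
    have "\<epsilon> i ^ k * ?b k = (\<epsilon> i * \<epsilon> i) ^ k * v i ^ k - (\<epsilon> i * \<epsilon> i) ^ k * uinv (v i) ^ k"
      unfolding p_\<epsilon>_v zpow_neg_nat uinv_mult[OF \<epsilon>_unit v_unit] uinv_\<epsilon> power_mult_distrib by (simp add: algebra_simps)
    then show "?a k = \<epsilon> i ^ k * ?b k" by (simp add: \<epsilon>_square)
  qed (use power_diff_unit[OF p_pow4 dd_pos, of 1 i] in simp)
  finally show ?thesis by (simp add: p_fact_def)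
qed

lemma sym_qfact_nonzero: "sym_qfact (q_sub C i) n \<noteq> 0"
  unfolding sym_qfact_def using q_sub_diff_nonzero[of _ i] q_sub_diff_nonzero[of 1 i] by simp

text \<open>\<open>H\<close> and \<open>H'\<close> differ by the involution \<epsilon>_i^(n-1),
  which is taken as g_i(n); its translation factor is \<open>\<eta>\<close>, and \<open>w\<close> is
  1. The commutation relation for i \<noteq> j forces
  \<open>x i j = \<rho> i j * \<eta> j i\<close>, and \<open>\<rho>_\<eta>_symmetric\<close> is what
  makes opposite entries of \<open>x\<close> inverse to each other.\<close>

lemma twist_v_ex:
  "\<exists>c d. twist C (\<lambda>i j. theta C r j i) H_sqrt se_sqrt sf_sqrt (\<lambda>i j. v_embed 1)
    (\<lambda>i n. v_embed (v_const i * (v_eig i n - v_eig i (- n))))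
    (\<lambda>i j k. v_embed (v_serre C i j k)) (\<lambda>i j k. v_embed (v_serre C i j k)) c d"
proof -
  have U: "uinv (\<epsilon> i ^ n * F i l) = \<epsilon> i ^ n * uinv (F i l)" for i n l
    unfolding uinv_mult[OF unit_power[OF \<epsilon>_unit] F_unit] uinv_power[OF \<epsilon>_unit] uinv_\<epsilon> ..
  \<comment> \<open>A binomial has a numerator that the divided powers lack. It does not depend on
    k, so it goes into the constant together with the triangular powers of \<epsilon>_i.\<close>
  let ?K = "\<lambda>i j. \<epsilon> i ^ triangle (serre_len C i j) * F i (serre_len C i j) * \<epsilon> i ^ triangle (serre_len C i j)"
  have s': "v_embed (v_serre C i j k) = ?K i j *
      ((- 1) ^ k * \<eta> i j ^ k * (uinv (F i (serre_len C i j - k)) * uinv (F i k)))"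
    if ij: "i \<noteq> j" and k: "k \<le> serre_len C i j" for i j k
  proof -
    let ?m = "serre_len C i j"
    have m1: "v_embed ((- 1) ^ k) = (- 1) ^ k"
      using v_embed_minus[of 0 1] v_embed_minus[of 0 0] by (simp add: v_embed_power v_embed_hom)
    have u: "uinv (\<epsilon> i ^ triangle k * F i k * (\<epsilon> i ^ triangle (?m - k) * F i (?m - k))) =
        \<epsilon> i ^ triangle k * uinv (F i k) * (\<epsilon> i ^ triangle (?m - k) * uinv (F i (?m - k)))"
      by (subst uinv_mult) (intro unit_mult unit_power \<epsilon>_unit F_unit, intro unit_mult unit_power \<epsilon>_unit F_unit, simp only: U)
    have "v_embed (v_serre C i j k) = (- 1) ^ k * (\<epsilon> i ^ triangle ?m * F i ?m *
        (\<epsilon> i ^ triangle k * uinv (F i k) * (\<epsilon> i ^ triangle (?m - k) * uinv (F i (?m - k)))))"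
      unfolding v_serre_def sym_qbinom_def v_embed_hom(2) m1
      by (subst v_embed_divide) (simp add: sym_qfact_nonzero, simp only: v_embed_hom(2) v_embed_qfact u)
    also have "\<dots> = (- 1) ^ k * (\<epsilon> i ^ triangle ?m * F i ?m *
        ((\<epsilon> i ^ triangle (?m - k) * \<epsilon> i ^ triangle k) * (uinv (F i k) * uinv (F i (?m - k)))))"
      by (simp only: ac_simps)
    also have "\<epsilon> i ^ triangle (?m - k) * \<epsilon> i ^ triangle k = \<epsilon> i ^ triangle ?m * \<eta> i j ^ k"
      using serre_exponent_pow2[OF \<epsilon>_square k] by (simp only: \<eta>_pow[OF ij])
    finally show ?thesis by (simp only: ac_simps)
  qed
  show ?thesis
  proof (rule twist_sqrt_ex[where g = "\<lambda>i n. zpow (\<epsilon> i) (n - 1)" and \<gamma> = \<eta> and w = "\<lambda>i j. 1"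
        and x = "\<lambda>i j. \<rho> i j * \<eta> j i" and \<sigma> = \<eta> and K = ?K, OF _ _ _ _ _ \<eta>_square])
    fix i j n
    show "zpow (\<epsilon> i) (n - 1) dvd 1" by (rule zpow_unit[OF \<epsilon>_unit])
    show "zpow (\<epsilon> i) (n - cm C i j - 1) = \<eta> i j * 1 * zpow (\<epsilon> i) (n - 1)"
      unfolding \<eta>_minus[symmetric] mult_1_right zpow_add[OF \<epsilon>_unit, symmetric] by (simp add: algebra_simps)
    show "zpow (\<epsilon> i) (n - 1) * H_sqrt i n = v_embed (v_const i * (v_eig i n - v_eig i (- n)))"
    proof -
      let ?u = "uinv (v i - uinv (v i))" and ?E = "zpow (\<epsilon> i) n" and ?V = "zpow (v i) n - zpow (v i) (- n)"
      have Vu: "v i - uinv (v i) dvd 1" using power_diff_unit[OF v_pow4 dd_pos, of 1 i] by simp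
      have E2: "?E * ?E = 1" by (simp add: \<epsilon>_square flip: zpow_mult_distrib[OF \<epsilon>_unit \<epsilon>_unit])
      have Em: "zpow (\<epsilon> i) (- n) = ?E" unfolding zpow_minus[OF \<epsilon>_unit] by (rule uinv_eqI[OF E2])
      have "p i - zpow (p i) (- 1) = \<epsilon> i * (v i - uinv (v i))"
        unfolding p_\<epsilon>_v zpow_minus_one uinv_mult[OF \<epsilon>_unit v_unit] uinv_\<epsilon> by (simp add: algebra_simps)
      then have 1: "uinv (p i - zpow (p i) (- 1)) = \<epsilon> i * ?u" by (simp only: uinv_mult[OF \<epsilon>_unit Vu] uinv_\<epsilon>)
      have 2: "zpow (p i) n - zpow (p i) (- n) = ?E * ?V"
        unfolding p_\<epsilon>_v zpow_mult_distrib[OF \<epsilon>_unit v_unit] Em by (simp add: algebra_simps)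
      have "zpow (\<epsilon> i) (n - 1) * H_sqrt i n = (\<epsilon> i * \<epsilon> i) * (?E * ?E) * (?u * ?V)"
        unfolding 1 2 zpow_pred[OF \<epsilon>_unit] uinv_\<epsilon> by (simp only: ac_simps)
      then have L: "zpow (\<epsilon> i) (n - 1) * H_sqrt i n = ?u * ?V" by (simp only: \<epsilon>_square E2 mult_1_left)
      have eig: "v_embed (v_eig i m) = zpow (v i) m" for m
        unfolding v_embed_powi zpow_mult[OF v_elt_unit] zpow_of_nat ..
      have "v_embed (v_const i) = ?u"
        using v_embed_divide[of "q_sub C i - inverse (q_sub C i)" 1] q_sub_diff_nonzero[of 1 i]
        by (simp add: v_embed_hom v_embed_minus v_embed_q_sub v_embed_inverse[OF q_sub_nonzero])
      then show ?thesis unfolding L v_embed_hom(2) v_embed_minus eig by (simp only:)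
    qed
    show "\<rho> i j * \<eta> j i * (\<rho> i j * \<eta> j i) = 1"
    proof -
      have "\<rho> i j * \<eta> j i * (\<rho> i j * \<eta> j i) = (\<rho> i j * \<rho> i j) * (\<eta> j i * \<eta> j i)" by (simp only: ac_simps)
      then show ?thesis by (simp only: \<rho>_square \<eta>_square mult_1_left)
    qed
    show "\<rho> i j * \<eta> j i * (\<rho> j i * \<eta> i j) = 1"
    proof -
      have "\<rho> i j * \<eta> j i * (\<rho> j i * \<eta> i j) = (\<rho> i j * \<eta> i j) * (\<rho> j i * \<eta> j i)" by (simp only: ac_simps)
      also have "\<dots> = (\<rho> i j * \<eta> i j) * (\<rho> i j * \<eta> i j)" by (simp only: \<rho>_\<eta>_symmetric[of j i])
      also have "\<dots> = (\<rho> i j * \<rho> i j) * (\<eta> i j * \<eta> i j)" by (simp only: ac_simps)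
      finally show ?thesis by (simp only: \<rho>_square \<eta>_square mult_1_left)
    qed
    show "\<rho> i j * \<eta> j i * \<eta> i j = \<rho> j i"
    proof -
      have "\<rho> i j * \<eta> j i * \<eta> i j = (\<rho> i j * \<eta> i j) * \<eta> j i" by (simp only: ac_simps)
      also have "\<dots> = \<rho> j i * (\<eta> j i * \<eta> j i)" by (simp only: \<rho>_\<eta>_symmetric[of i j] mult.assoc)
      finally show ?thesis by (simp only: \<eta>_square mult_1_right)
    qed
    show "\<eta> i j * \<eta> j i * \<eta> i j * (\<rho> i j * \<eta> j i) = \<rho> i j"
    proof -
      have "\<eta> i j * \<eta> j i * \<eta> i j * (\<rho> i j * \<eta> j i) = (\<eta> i j * \<eta> i j) * (\<eta> j i * \<eta> j i) * \<rho> i j"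
        by (simp only: ac_simps)
      then show ?thesis by (simp only: \<eta>_square mult_1_left)
    qed
    show "\<rho> i j * (\<eta> j i * 1) = v_embed 1 * (\<rho> i j * \<eta> j i)" by (simp add: v_embed_hom)
    show "\<eta> i i * 1 = v_embed 1"
    proof -
      have "\<eta> i i = \<epsilon> i ^ 2" unfolding \<eta>_def cm_diag using zpow_of_nat[of "\<epsilon> i" 2] by simp
      then show ?thesis by (simp add: v_embed_hom \<epsilon>_square power2_eq_square)
    qed
    show "?K i j dvd 1" by (intro unit_mult unit_power \<epsilon>_unit F_unit)
  qed (simp_all add: s')
qed

end

theorem mainTheorem10:
  fixes C :: "('i, 'p::ab_group_add) superdatum"
    and r :: "'i \<Rightarrow> int sqrtpi_ext"
  assumes "cartan_superdatum C"
    and "\<forall>i. r i ^ 2 = pi4 ^ par C i"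
    and "\<forall>i. odd (dd C i) \<longleftrightarrow> i \<in> odds C"
  shows "equivalent_cats
           (ModP C (U_super_ext C) (eig_super C) :: ((_, 'v, 'p) wt_module, _) cat)
           (ModP C (U_sqrt C r) (eig_sqrt C r) :: ((_, 'v, 'p) wt_module, _) cat) \<and>
         equivalent_cats
           (ModP C (U_sqrt C r) (eig_sqrt C r) :: ((_, 'v, 'p) wt_module, _) cat)
           (ModP C (U_v_ext C) (eig_v C) :: ((_, 'v, 'p) wt_module, _) cat) \<and>
         equivalent_cats
           (Oint C (U_super_ext C) (eig_super C) :: ((_, 'v, 'p) wt_module, _) cat)
           (Oint C (U_sqrt C r) (eig_sqrt C r) :: ((_, 'v, 'p) wt_module, _) cat) \<and>
         equivalent_cats
           (Oint C (U_sqrt C r) (eig_sqrt C r) :: ((_, 'v, 'p) wt_module, _) cat)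
           (Oint C (U_v_ext C) (eig_v C) :: ((_, 'v, 'p) wt_module, _) cat)"
proof -
  interpret parity_superdatum C r
    using assms by (simp add: parity_superdatum_def parity_superdatum_axioms_def sqrt_superdatum_def sqrt_superdatum_axioms_def)
  obtain c d where super: "twist C (\<lambda>i j. theta C r j i) H_sqrt se_sqrt sf_sqrt (\<lambda>i j. pi_incl (super_rel i j))
    (\<lambda>i n. pi_incl (super_const i * (1 - super_eig i n)))
    (\<lambda>i j k. pi_incl (super_serre C i j k)) (\<lambda>i j k. pi_incl (super_serre C i j k)) c d"
    using twist_super_ex by blast
  obtain c' d' where v: "twist C (\<lambda>i j. theta C r j i) H_sqrt se_sqrt sf_sqrt (\<lambda>i j. v_embed 1)
    (\<lambda>i n. v_embed (v_const i * (v_eig i n - v_eig i (- n))))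
    (\<lambda>i j k. v_embed (v_serre C i j k)) (\<lambda>i j k. v_embed (v_serre C i j k)) c' d'"
    using twist_v_ex by blast
  \<comment> \<open>Both twists start at the algebra with \<surd>\<pi>; the equivalences from the
    superalgebra to it therefore use the inverse twist.\<close>
  show ?thesis
    by (intro conjI equivalent_cats_of_twist[OF operator_algebra_super operator_algebra_sqrt twist_inverse[OF super]]
      equivalent_cats_of_twist[OF operator_algebra_sqrt operator_algebra_v v])
qed

end
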